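(* Let $\mathbb{F}\in\{\mathbb{R},\mathbb{C}\}$, let $d\ge 1$, and let $\Sigma$ be a $d$-dimensional set of one of the following forms: either $\Sigma=\mathbb{R}\times\prod_{i=2}^{d}\Sigma_i$, where for each $i$ either $\Sigma_i=\mathbb{R}$ or $\Sigma_i=L_i\mathbb{T}$ for some $L_i>0$; or $\Sigma=\prod_{i=1}^{d}L_i\mathbb{T}$ with all $L_i>0$. Suppose $s\in\mathbb{R}$ satisfies $s>d/2$. Then the anisotropic space $X^s(\Sigma;\mathbb{F})$ is an algebra; that is, $fg\in X^s(\Sigma;\mathbb{F})$ for all $f,g\in X^s(\Sigma;\mathbb{F})$, and there is a constant $C>0$ such that $\|fg\|_{X^s}\le C\|f\|_{X^s}\|g\|_{X^s}$ for all such $f,g$.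
   Context: $L\mathbb{T}=\mathbb{R}/L\mathbb{Z}$. For a product $\Gamma=\prod_{i=1}^d\Gamma_i$ with each $\Gamma_i=\mathbb{R}$ or $\Gamma_i=L_i\mathbb{T}$, the dual group is $\hat\Gamma=\prod_{i=1}^d\hat\Gamma_i\subseteq\mathbb{R}^d$ with $\hat\Gamma_i=\mathbb{R}$ if $\Gamma_i=\mathbb{R}$ and $\hat\Gamma_i=L_i^{-1}\mathbb{Z}$ if $\Gamma_i=L_i\mathbb{T}$, equipped with the product of Lebesgue measures (on factors $\mathbb{R}$) and counting measures (on factors $L_i^{-1}\mathbb{Z}$). $\mathscr{S}'(\Gamma;\mathbb{C})$ denotes the tempered distributions on $\Gamma$ (dual of the Schwartz class of smooth functions on $\Gamma$ all of whose derivatives decay rapidly in the $\mathbb{R}$-variables), and $\hat f$ is the unitary Fourier transform, given on Schwartz functions by $\hat f(\xi)=\big(\prod_{i:\Gamma_i=L_i\mathbb{T}}L_i\big)^{-1/2}\int_\Gamma f(x)e^{-2\pi i\xi\cdot x}\,dx$ and extended by duality. Set $\langle\xi\rangle=(1+|\xi|^2)^{1/2}$, and $\mu(\xi)=\frac{|\xi_1|}{|\xi|}+|\xi|$ for $\xi\neq0$, $\mu(0)=1$. For $s\ge0$, $X^s(\Gamma;\mathbb{C})=\{f\in\mathscr{S}'(\Gamma;\mathbb{C}) : \hat f\in L^1_{\mathrm{loc}}(\hat\Gamma;\mathbb{C}),\ \|\mu\langle\cdot\rangle^{s-1}\hat f\|_{L^2(\hat\Gamma)}<\infty\}$, $X^s(\Gamma;\mathbb{R})=\{f\in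 X^s(\Gamma;\mathbb{C}) : f=\overline f\}$, with norm $\|f\|_{X^s}=\|\mu\langle\cdot\rangle^{s-1}\hat f\|_{L^2(\hat\Gamma)}$. *)

theory Defs
  imports "HOL-Analysis.Analysis"
begin

text \<open>
  A product group is described by the family of its factors, indexed by a finite type:
  \<open>Line\<close> is the real line and \<open>Circle l\<close> is the quotient of the reals by \<open>l\<close> times the integers
  (only used with \<open>l > 0\<close>).  Functions on the group are functions on \<open>real ^ 'n\<close> that are
  \<open>l\<close>-periodic in every \<open>Circle l\<close> variable, and integrals over the group are integrals over
  a fundamental domain.
\<close>

datatype factor = Line | Circle real

definition periodic :: "('n::finite \<Rightarrow> factor) \<Rightarrow> (real ^ 'n \<Rightarrow> complex) \<Rightarrow> bool" where
  "periodic \<Gamma> u \<longleftrightarrow> (\<forall>i l x. \<Gamma> i = Circle l \<longrightarrow> u (x + l *\<^sub>R axis i 1) = u x)"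

definition fundamental_domain :: "('n::finite \<Rightarrow> factor) \<Rightarrow> (real ^ 'n) set" where
  "fundamental_domain \<Gamma> = {x. \<forall>i l. \<Gamma> i = Circle l \<longrightarrow> 0 \<le> x $ i \<and> x $ i < l}"

definition line_part :: "('n::finite \<Rightarrow> factor) \<Rightarrow> real ^ 'n \<Rightarrow> real ^ 'n" where
  "line_part \<Gamma> x = (\<chi> i. if \<Gamma> i = Line then x $ i else 0)"

subsection \<open>Schwartz functions and tempered distributions\<close>

definition partial_deriv :: "'n::finite \<Rightarrow> (real ^ 'n \<Rightarrow> complex) \<Rightarrow> real ^ 'n \<Rightarrow> complex" where
  "partial_deriv i \<phi> x = vector_derivative (\<lambda>t. \<phi> (x + t *\<^sub>R axis i 1)) (at 0)"

definition partial_derivs :: "'n::finite list \<Rightarrow> (real ^ 'n \<Rightarrow> complex) \<Rightarrow> real ^ 'n \<Rightarrow> complex" where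
  "partial_derivs js \<phi> = foldr partial_deriv js \<phi>"

definition schwartz :: "('n::finite \<Rightarrow> factor) \<Rightarrow> (real ^ 'n \<Rightarrow> complex) set" where
  "schwartz \<Gamma> = {\<phi>. periodic \<Gamma> \<phi> \<and>
     (\<forall>js. partial_derivs js \<phi> differentiable_on UNIV) \<and>
     (\<forall>js k. bounded (range (\<lambda>x. (1 + norm (line_part \<Gamma> x)) ^ k * norm (partial_derivs js \<phi> x))))}"

definition schwartz_seminorm :: "('n::finite \<Rightarrow> factor) \<Rightarrow> nat \<Rightarrow> (real ^ 'n \<Rightarrow> complex) \<Rightarrow> real" where
  "schwartz_seminorm \<Gamma> N \<phi> = (SUP (js, x) \<in> {js. length js \<le> N} \<times> UNIV.
     (1 + norm (line_part \<Gamma> x)) ^ N * norm (partial_derivs js \<phi> x))"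

text \<open>
  Distributions are functionals with domain \<open>schwartz \<Gamma>\<close>; \<open>extensional\<close> makes their equality
  equality on that domain.
\<close>

type_synonym 'n distribution = "(real ^ 'n \<Rightarrow> complex) \<Rightarrow> complex"

definition tempered :: "('n::finite \<Rightarrow> factor) \<Rightarrow> 'n distribution set" where
  "tempered \<Gamma> = {f \<in> extensional (schwartz \<Gamma>).
     (\<forall>\<phi>\<in>schwartz \<Gamma>. \<forall>\<psi>\<in>schwartz \<Gamma>. f (\<lambda>x. \<phi> x + \<psi> x) = f \<phi> + f \<psi>) \<and>
     (\<forall>c. \<forall>\<phi>\<in>schwartz \<Gamma>. f (\<lambda>x. c * \<phi> x) = c * f \<phi>) \<and>
     (\<exists>C N. \<forall>\<phi>\<in>schwartz \<Gamma>. norm (f \<phi>) \<le> C * schwartz_seminorm \<Gamma> N \<phi>)}"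

definition conj_distribution :: "('n::finite \<Rightarrow> factor) \<Rightarrow> 'n distribution \<Rightarrow> 'n distribution" where
  "conj_distribution \<Gamma> f = (\<lambda>\<phi>\<in>schwartz \<Gamma>. cnj (f (\<lambda>x. cnj (\<phi> x))))"

text \<open>The distribution \<open>f\<close> is the function \<open>u\<close>.\<close>

definition represents :: "('n::finite \<Rightarrow> factor) \<Rightarrow> 'n distribution \<Rightarrow> (real ^ 'n \<Rightarrow> complex) \<Rightarrow> bool" where
  "represents \<Gamma> f u \<longleftrightarrow> u \<in> borel_measurable lborel \<and> periodic \<Gamma> u \<and>
     (\<forall>\<phi>\<in>schwartz \<Gamma>. set_integrable lborel (fundamental_domain \<Gamma>) (\<lambda>x. u x * \<phi> x)) \<and>
     f = (\<lambda>\<phi>\<in>schwartz \<Gamma>. LINT x:fundamental_domain \<Gamma>|lborel. u x * \<phi> x)"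

text \<open>
  The product of two distributions that are functions is their pointwise product.  The value
  of \<open>dist_mult\<close> is meaningful only if \<open>is_product\<close> has a unique solution.
\<close>

definition is_product ::
  "('n::finite \<Rightarrow> factor) \<Rightarrow> 'n distribution \<Rightarrow> 'n distribution \<Rightarrow> 'n distribution \<Rightarrow> bool" where
  "is_product \<Gamma> f g h \<longleftrightarrow>
     (\<exists>u v. represents \<Gamma> f u \<and> represents \<Gamma> g v \<and> represents \<Gamma> h (\<lambda>x. u x * v x))"

definition dist_mult ::
  "('n::finite \<Rightarrow> factor) \<Rightarrow> 'n distribution \<Rightarrow> 'n distribution \<Rightarrow> 'n distribution" where
  "dist_mult \<Gamma> f g = (THE h. is_product \<Gamma> f g h)"

subsection \<open>The dual group and the Fourier transform\<close>

definition dual_group :: "('n::finite \<Rightarrow> factor) \<Rightarrow> (real ^ 'n) set" where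
  "dual_group \<Gamma> = {\<xi>. \<forall>i l. \<Gamma> i = Circle l \<longrightarrow> l * \<xi> $ i \<in> \<int>}"

fun dual_factor_measure :: "factor \<Rightarrow> real measure" where
  "dual_factor_measure Line = lborel"
| "dual_factor_measure (Circle l) = count_space {t. l * t \<in> \<int>}"

definition dual_measure :: "('n::finite \<Rightarrow> factor) \<Rightarrow> (real ^ 'n) measure" where
  "dual_measure \<Gamma> = distr (PiM UNIV (\<lambda>i. dual_factor_measure (\<Gamma> i)))
     (restrict_space borel (dual_group \<Gamma>)) vec_lambda"

text \<open>
  Smooth functions of compact support on the dual group.  Only the values on \<open>dual_group \<Gamma>\<close>
  matter: near each of its points the dual group is an affine subspace spanned by the
  \<open>Line\<close> directions, and derivatives are taken within it and in those directions only.
\<close>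

definition dual_test_functions :: "('n::finite \<Rightarrow> factor) \<Rightarrow> (real ^ 'n \<Rightarrow> complex) set" where
  "dual_test_functions \<Gamma> = {\<phi>.
     (\<forall>js. (\<forall>i\<in>set js. \<Gamma> i = Line) \<longrightarrow> partial_derivs js \<phi> differentiable_on dual_group \<Gamma>) \<and>
     (\<exists>R. \<forall>\<xi>\<in>dual_group \<Gamma>. norm \<xi> > R \<longrightarrow> \<phi> \<xi> = 0)}"

definition fourier_const :: "('n::finite \<Rightarrow> factor) \<Rightarrow> real" where
  "fourier_const \<Gamma> = (\<Prod>i\<in>UNIV. case \<Gamma> i of Line \<Rightarrow> 1 | Circle l \<Rightarrow> l) powr (- 1 / 2)"

text \<open>
  The unitary transform on Schwartz functions is \<open>\<phi>\<close> times the kernel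
  \<open>fourier_const \<Gamma> * cis (- 2 * pi * (\<xi> \<bullet> x))\<close>, integrated over the group.  Its transpose is the
  integral of the same kernel over the dual group, and by Fubini the extension by duality
  pairs a distribution on the group with the transposed transform of the test function.
\<close>

definition dual_fourier_integral ::
  "('n::finite \<Rightarrow> factor) \<Rightarrow> (real ^ 'n \<Rightarrow> complex) \<Rightarrow> real ^ 'n \<Rightarrow> complex" where
  "dual_fourier_integral \<Gamma> \<phi> x =
     fourier_const \<Gamma> * (LINT \<xi>|dual_measure \<Gamma>. \<phi> \<xi> * cis (- 2 * pi * (\<xi> \<bullet> x)))"

definition fourier_transform :: "('n::finite \<Rightarrow> factor) \<Rightarrow> 'n distribution \<Rightarrow> 'n distribution" where
  "fourier_transform \<Gamma> f \<phi> = f (dual_fourier_integral \<Gamma> \<phi>)"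

definition dual_L1_loc :: "('n::finite \<Rightarrow> factor) \<Rightarrow> (real ^ 'n \<Rightarrow> complex) set" where
  "dual_L1_loc \<Gamma> = {h \<in> borel_measurable (dual_measure \<Gamma>).
     \<forall>K. compact K \<and> K \<subseteq> dual_group \<Gamma> \<longrightarrow> set_integrable (dual_measure \<Gamma>) K h}"

text \<open>The Fourier transform of \<open>f\<close> is the locally integrable function \<open>h\<close>.\<close>

definition fourier_represents ::
  "('n::finite \<Rightarrow> factor) \<Rightarrow> 'n distribution \<Rightarrow> (real ^ 'n \<Rightarrow> complex) \<Rightarrow> bool" where
  "fourier_represents \<Gamma> f h \<longleftrightarrow> h \<in> dual_L1_loc \<Gamma> \<and>
     (\<forall>\<phi>\<in>dual_test_functions \<Gamma>. fourier_transform \<Gamma> f \<phi> = (LINT \<xi>|dual_measure \<Gamma>. h \<xi> * \<phi> \<xi>))"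

text \<open>Such an \<open>h\<close> is unique almost everywhere, so the choice is immaterial.\<close>

definition fourier_fun :: "('n::finite \<Rightarrow> factor) \<Rightarrow> 'n distribution \<Rightarrow> real ^ 'n \<Rightarrow> complex" where
  "fourier_fun \<Gamma> f = (SOME h. fourier_represents \<Gamma> f h)"

subsection \<open>The anisotropic space\<close>

text \<open>The index \<open>e\<close> is that of the distinguished first coordinate.\<close>

definition anisotropic_weight :: "'n::finite \<Rightarrow> real ^ 'n \<Rightarrow> real" where
  "anisotropic_weight e \<xi> = (if \<xi> = 0 then 1 else \<bar>\<xi> $ e\<bar> / norm \<xi> + norm \<xi>)"

definition japanese_bracket :: "real ^ 'n::finite \<Rightarrow> real" where
  "japanese_bracket \<xi> = sqrt (1 + (norm \<xi>)\<^sup>2)"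

definition X_density ::
  "('n::finite \<Rightarrow> factor) \<Rightarrow> 'n \<Rightarrow> real \<Rightarrow> 'n distribution \<Rightarrow> real ^ 'n \<Rightarrow> real" where
  "X_density \<Gamma> e s f \<xi> =
     (norm (anisotropic_weight e \<xi> * japanese_bracket \<xi> powr (s - 1) * fourier_fun \<Gamma> f \<xi>))\<^sup>2"

definition X_complex :: "('n::finite \<Rightarrow> factor) \<Rightarrow> 'n \<Rightarrow> real \<Rightarrow> 'n distribution set" where
  "X_complex \<Gamma> e s = {f \<in> tempered \<Gamma>.
     (\<exists>h. fourier_represents \<Gamma> f h) \<and> integrable (dual_measure \<Gamma>) (X_density \<Gamma> e s f)}"

definition X_real :: "('n::finite \<Rightarrow> factor) \<Rightarrow> 'n \<Rightarrow> real \<Rightarrow> 'n distribution set" where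
  "X_real \<Gamma> e s = {f \<in> X_complex \<Gamma> e s. f = conj_distribution \<Gamma> f}"

definition X_norm :: "('n::finite \<Rightarrow> factor) \<Rightarrow> 'n \<Rightarrow> real \<Rightarrow> 'n distribution \<Rightarrow> real" where
  "X_norm \<Gamma> e s f = sqrt (LINT \<xi>|dual_measure \<Gamma>. X_density \<Gamma> e s f \<xi>)"

datatype scalars = Real_Scalars | Complex_Scalars

fun X_space :: "scalars \<Rightarrow> ('n::finite \<Rightarrow> factor) \<Rightarrow> 'n \<Rightarrow> real \<Rightarrow> 'n distribution set" where
  "X_space Real_Scalars \<Gamma> e s = X_real \<Gamma> e s"
| "X_space Complex_Scalars \<Gamma> e s = X_complex \<Gamma> e s"

end

theory Submission
  imports Defs "HOL-Probability.Probability"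
begin

text \<open>Write \<open>w\<close> for the weight \<open>\<mu> * bracket powr (s - 1)\<close>, so that the norm of \<open>f\<close> is the \<open>L\<^sup>2\<close> norm of \<open>w\<close>
  times the transform of \<open>f\<close>.  On the side of frequencies a product is a convolution, and
  everything follows from two properties of \<open>w\<close>.

  First, \<open>1 / w\<^sup>2\<close> is integrable (\<open>nn_integral_weight\<close>).  At infinity this is \<open>s > d / 2\<close>.  Near the
  origin \<open>w\<close> is as small as \<open>\<mu>\<close> if there is a second line \<open>j\<close>, but \<open>\<mu>\<^sup>2\<close> dominates both \<open>\<bar>\<xi> $ e\<bar>\<close> and
  \<open>\<bar>\<xi> $ j\<bar>\<^sup>2\<close>.  By Cauchy--Schwarz the transform of an element of the space is then integrable, so the
  element is a bounded function: the inverse transform of its transform.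

  Second, \<open>w (\<eta> + \<zeta>) \<le> w \<eta> * w \<zeta> * (k \<zeta> \<eta> + k \<eta> \<zeta>)\<close> with a kernel for which the integral of \<open>(k \<zeta> \<eta>)\<^sup>2\<close>
  over \<open>\<eta>\<close> is bounded uniformly in \<open>\<zeta>\<close> (\<open>weight_sum_kernel\<close>).  Where \<open>w\<close> is comparable to \<open>bracket powr s\<close>,
  a multiple of \<open>1 / w \<eta>\<close> will do.  The difficulty is near the origin: if \<open>\<eta>\<close> and \<open>\<zeta>\<close> nearly cancel,
  then \<open>\<bar>\<xi> $ e\<bar> / norm \<xi>\<close> can be near \<open>1\<close> at \<open>\<xi> = \<eta> + \<zeta>\<close> although it is small at \<open>\<eta>\<close> and \<open>\<zeta>\<close>.  This
  forces \<open>\<eta> $ j\<close> to be within about \<open>\<bar>\<zeta> $ e\<bar>\<close> of \<open>- \<zeta> $ j\<close>, a set of small measure, which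
  a product of two Poisson kernels quantifies (\<open>mu_sum_near_cancellation\<close>).  Testing a weighted
  convolution against a square-integrable function and applying Cauchy--Schwarz gives the bilinear
  estimate (\<open>weighted_convolution\<close>).

  The remaining work connects the definitions, which speak of tempered distributions, with this
  estimate.  A tempered distribution is determined by its transform, because the transforms of test
  functions are dense among Schwartz functions (\<open>transforms_dense\<close>); hence it is the inverse transform
  of its transform whenever the latter is integrable.  Functions on the group and on the dual group
  are determined almost everywhere by their integrals against Schwartz functions and test
  functions (\<open>group_uniqueness\<close>, \<open>dual_uniqueness\<close>), so neither the product nor the norm depends on
  the choices in their definitions.\<close>

section \<open>Products of one-dimensional measures\<close>

text \<open>Fubini in the coordinates, for measures on vectors that are products over the coordinates.\<close>

definition vec_measure :: "('n::finite => real measure) => (real ^ 'n) measure" where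
 "vec_measure M = distr (PiM UNIV M) borel vec_lambda"

locale coordinate_measures = product_sigma_finite M for M :: "'n::finite => real measure" +
 assumes ident_borel: "\<And>i. (\<lambda>t. t) \<in> borel_measurable (M i)"
begin

lemma borel_coordinate: "f \<in> borel_measurable borel ==> f \<in> borel_measurable (M i)"
 by (rule measurable_compose[OF ident_borel])

lemma vec_lambda_measurable: "vec_lambda \<in> measurable (PiM UNIV M) borel"
proof (subst borel_measurable_euclidean_space, rule ballI)
 fix b :: "real ^ 'n" assume "b \<in> Basis"
 then obtain i where b: "b = axis i 1" by (auto simp: Basis_vec_def)
 have "(\<lambda>x. x i) \<in> borel_measurable (PiM UNIV M)"
  using measurable_compose[OF measurable_component_singleton[of i UNIV M] ident_borel] by simp
 then show "(\<lambda>x. vec_lambda x \<bullet> b) \<in> borel_measurable (PiM UNIV M)"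
  by (simp add: b inner_axis)
qed

lemma sets_vec_measure [simp, measurable_cong]: "sets (vec_measure M) = sets borel"
 by (simp add: vec_measure_def)

lemma space_vec_measure [simp]: "space (vec_measure M) = UNIV"
 by (simp add: vec_measure_def)

lemma nn_integral_vec_measure:
 assumes [measurable]: "f \<in> borel_measurable borel"
 shows "(\<integral>\<^sup>+ x. f x \<partial>vec_measure M) = (\<integral>\<^sup>+ x. f (vec_lambda x) \<partial>PiM UNIV M)"
 unfolding vec_measure_def by (subst nn_integral_distr[OF vec_lambda_measurable]) auto

lemma nn_integral_vec_prod:
 assumes [measurable]: "\<And>i. f i \<in> borel_measurable borel"
 shows "(\<integral>\<^sup>+ x. (\<Prod>i\<in>UNIV. f i (x $ i)) \<partial>vec_measure M) = (\<Prod>i\<in>UNIV. \<integral>\<^sup>+ t. f i t \<partial>M i)"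
 by (subst nn_integral_vec_measure) (auto intro!: product_nn_integral_prod borel_coordinate)

lemma
 fixes f :: "'n => real => 'b::{real_normed_field,banach,second_countable_topology}"
 assumes [measurable]: "\<And>i. f i \<in> borel_measurable borel" and "\<And>i. integrable (M i) (f i)"
 shows integrable_vec_prod: "integrable (vec_measure M) (\<lambda>x. \<Prod>i\<in>UNIV. f i (x $ i))"
  and integral_vec_prod:
   "(\<integral>x. (\<Prod>i\<in>UNIV. f i (x $ i)) \<partial>vec_measure M) = (\<Prod>i\<in>UNIV. \<integral>t. f i t \<partial>M i)"
 unfolding vec_measure_def
 using product_integrable_prod[of UNIV f] product_integral_prod[of UNIV f] assms(2)
 by (simp_all add: integrable_distr_eq[OF vec_lambda_measurable] integral_distr[OF vec_lambda_measurable])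

lemma AE_vec_coordinate:
 assumes "AE t in M i. t \<notin> N" and [measurable]: "N \<in> sets borel"
 shows "AE x in vec_measure M. x $ i \<notin> N"
proof -
 let ?f = "\<lambda>k t. if k = i then indicator N t else (1::ennreal)"
 have "(\<integral>\<^sup>+ t. indicator N t \<partial>M i) = 0"
 proof -
  have "AE t in M i. indicator N t = (0::ennreal)"
   using assms(1) by eventually_elim simp
  then show ?thesis by (subst nn_integral_cong_AE[of _ "\<lambda>_. 0"]) auto
 qed
 then have z: "(\<Prod>k\<in>UNIV. \<integral>\<^sup>+ t. ?f k t \<partial>M k) = 0"
  by (intro prod_zero) (auto intro!: exI[of _ i])
 have "(\<integral>\<^sup>+ x. indicator {x. x $ i \<in> N} x \<partial>vec_measure M)
   = (\<integral>\<^sup>+ x. (\<Prod>k\<in>UNIV. ?f k (x $ k)) \<partial>vec_measure M)"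
  by (intro nn_integral_cong) (simp add: prod.If_cases indicator_def)
 also have "\<dots> = 0"
  by (subst nn_integral_vec_prod) (auto simp: z)
 finally have "emeasure (vec_measure M) {x. x $ i \<in> N} = 0"
  by (subst (asm) nn_integral_indicator) auto
 then show ?thesis
  by (subst AE_iff_measurable[of "{x. x $ i \<in> N}"]) auto
qed

lemma emeasure_bounded_finite:
 assumes fin: "\<And>i R. (\<integral>\<^sup>+ t. indicator {- R..R} t \<partial>M i) < \<infinity>" and "bounded B" "B \<in> sets borel"
 shows "emeasure (vec_measure M) B < \<infinity>"
proof -
 obtain R where R: "\<And>x. x \<in> B ==> norm x \<le> R"
  using \<open>bounded B\<close> bounded_iff by blast
 have "emeasure (vec_measure M) B = (\<integral>\<^sup>+ x. indicator B x \<partial>vec_measure M)"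
  using assms by simp
 also have "\<dots> \<le> (\<integral>\<^sup>+ x. (\<Prod>i\<in>UNIV. indicator {- R..R} (x $ i)) \<partial>vec_measure M)"
 proof (rule nn_integral_mono)
  fix x
  have "\<bar>x $ i\<bar> \<le> R" if "x \<in> B" for i
   using R[OF that] component_le_norm_cart[of x i] by linarith
  then have "\<forall>i. x $ i \<in> {- R..R}" if "x \<in> B"
   using that by (simp add: abs_le_iff minus_le_iff)
  then show "indicator B x \<le> (\<Prod>i\<in>UNIV. indicator {- R..R} (x $ i) :: ennreal)"
   by (cases "x \<in> B") auto
 qed
 also have "\<dots> = (\<Prod>i\<in>UNIV. \<integral>\<^sup>+ t. indicator {- R..R} t \<partial>M i)"
  by (rule nn_integral_vec_prod) auto
 also have "\<dots> < \<infinity>"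
  using fin by (auto simp: less_top[symmetric] ennreal_prod_eq_top less_imp_neq)
 finally show ?thesis .
qed

lemma vec_measure_translate:
 assumes tr: "\<And>i. (\<lambda>t. t + v $ i) \<in> measurable (M i) (M i)"
  and inv: "\<And>i. distr (M i) (M i) (\<lambda>t. t + v $ i) = M i"
 shows "distr (vec_measure M) borel (\<lambda>x. x + v) = vec_measure M"
proof -
 let ?T = "\<lambda>x i. x i + v $ i"
 have T[measurable]: "?T \<in> measurable (PiM UNIV M) (PiM UNIV M)"
  by (intro measurable_PiM_single') (auto intro!: measurable_compose[OF _ tr] simp: space_PiM
    dest: measurable_space[OF tr])
 have "distr (PiM UNIV M) (PiM UNIV M) ?T = PiM UNIV M"
 proof (rule PiM_eqI)
  fix A assume A: "\<And>i. i \<in> UNIV ==> A i \<in> sets (M i)"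
  have "emeasure (distr (PiM UNIV M) (PiM UNIV M) ?T) (Pi\<^sub>E UNIV A)
   = emeasure (PiM UNIV M) (Pi\<^sub>E UNIV (\<lambda>i. (\<lambda>t. t + v $ i) -` A i \<inter> space (M i)))"
   using A by (subst emeasure_distr) (auto intro!: arg_cong2[where f=emeasure] sets_PiM_I_finite simp: space_PiM PiE_iff)
  also have "\<dots> = (\<Prod>i\<in>UNIV. emeasure (M i) ((\<lambda>t. t + v $ i) -` A i \<inter> space (M i)))"
   using A by (intro emeasure_PiM) (auto intro!: measurable_sets[OF tr])
  also have "\<dots> = (\<Prod>i\<in>UNIV. emeasure (distr (M i) (M i) (\<lambda>t. t + v $ i)) (A i))"
   using A by (intro prod.cong refl) (simp add: emeasure_distr[OF tr])
  finally show "emeasure (distr (PiM UNIV M) (PiM UNIV M) ?T) (Pi\<^sub>E UNIV A) = (\<Prod>i\<in>UNIV. emeasure (M i) (A i))"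
   by (simp add: inv)
 qed auto
 note * = this
 have "distr (vec_measure M) borel (\<lambda>x. x + v) = distr (PiM UNIV M) borel (\<lambda>x. vec_lambda x + v)"
  unfolding vec_measure_def using vec_lambda_measurable by (subst distr_distr) (auto simp: comp_def)
 also have "\<dots> = distr (PiM UNIV M) borel (vec_lambda \<circ> ?T)"
  by (intro distr_cong) (auto simp: vec_eq_iff)
 also have "\<dots> = distr (distr (PiM UNIV M) (PiM UNIV M) ?T) borel vec_lambda"
  using vec_lambda_measurable by (subst distr_distr) auto
 finally show ?thesis by (simp add: * vec_measure_def)
qed

end

interpretation lborel_coords: coordinate_measures "\<lambda>i::'n::finite. lborel"
 by unfold_locales auto

lemma lborel_vec: "vec_measure (\<lambda>i::'n::finite. lborel) = lborel"
proof (rule lborel_eqI[symmetric])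
 fix l u :: "real ^ 'n" assume "\<And>b. b \<in> Basis ==> l \<bullet> b \<le> u \<bullet> b"
 then have le: "l $ i \<le> u $ i" for i
  by (metis axis_in_Basis_iff inner_axis real_inner_1_right insertCI Basis_real_def)
 have "emeasure (vec_measure (\<lambda>i::'n. lborel)) (box l u) = (\<integral>\<^sup>+ x. indicator (box l u) x \<partial>vec_measure (\<lambda>i. lborel))"
  by simp
 also have "\<dots> = (\<integral>\<^sup>+ x. (\<Prod>i\<in>UNIV. indicator {l $ i<..<u $ i} (x $ i)) \<partial>vec_measure (\<lambda>i::'n. lborel))"
  by (intro nn_integral_cong) (auto simp: mem_box_cart indicator_def intro!: prod_zero)
 also have "\<dots> = (\<Prod>i\<in>UNIV. ennreal (u $ i - l $ i))"
  by (subst lborel_coords.nn_integral_vec_prod) (auto simp: le)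
 also have "\<dots> = ennreal (\<Prod>b\<in>Basis. (u - l) \<bullet> b)"
  using le by (simp add: prod_ennreal Basis_vec_def prod.UNION_disjoint UNION_singleton_eq_range
   prod.reindex inj_on_def axis_eq_axis inner_axis)
 finally show "emeasure (vec_measure (\<lambda>i::'n. lborel)) (box l u) = ennreal (\<Prod>b\<in>Basis. (u - l) \<bullet> b)" .
qed simp

section \<open>The measure on the dual group\<close>

abbreviation dual_coords :: "('n::finite => factor) => 'n => real measure" where
 "dual_coords \<Gamma> i \<equiv> dual_factor_measure (\<Gamma> i)"

text \<open>The measure of the dual group, extended by zero to the Borel sets of the surrounding space: functions
 need no restriction, and measurability is Borel measurability.\<close>

definition dual_borel :: "('n::finite => factor) => (real ^ 'n) measure" where
 "dual_borel \<Gamma> = vec_measure (dual_coords \<Gamma>)"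

locale product_group =
 fixes \<Gamma> :: "'n::finite => factor"
 assumes period_pos: "\<And>i l. \<Gamma> i = Circle l ==> 0 < l"

lemma lattice_eq: "l > 0 ==> {t::real. l * t \<in> \<int>} = (\<lambda>n. of_int n / l) ` UNIV"
 by (auto simp: image_iff Ints_def field_simps)

sublocale product_group \<subseteq> dual: coordinate_measures "dual_coords \<Gamma>"
proof unfold_locales
 fix i
 show "\<exists>A. countable A \<and> A \<subseteq> sets (dual_coords \<Gamma> i) \<and> \<Union> A = space (dual_coords \<Gamma> i) \<and> (\<forall>a\<in>A. emeasure (dual_coords \<Gamma> i) a \<noteq> \<infinity>)"
 proof (cases "\<Gamma> i")
  case Line
  then show ?thesis
   using sigma_finite_measure.sigma_finite_countable[OF sigma_finite_lborel] by simp
 next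
  case (Circle l)
  have "countable {t::real. l * t \<in> \<int>}"
   using period_pos[OF Circle] by (simp add: lattice_eq)
  then show ?thesis
   using sigma_finite_measure.sigma_finite_countable[OF sigma_finite_measure_count_space_countable] Circle by simp
 qed
 show "(\<lambda>t. t) \<in> borel_measurable (dual_coords \<Gamma> i)"
  by (cases "\<Gamma> i") auto
qed

context product_group begin

lemma sets_dual_borel [simp, measurable_cong]: "sets (dual_borel \<Gamma>) = sets borel"
 by (simp add: dual_borel_def)

lemma space_dual_borel [simp]: "space (dual_borel \<Gamma>) = UNIV"
 by (simp add: dual_borel_def)

lemma closed_lattice: "closed {t::real. l * t \<in> \<int>}"
proof -
 have "{t. l * t \<in> \<int>} = (\<lambda>t. l * t) -` (\<int> :: real set)" by auto
 moreover have "closed ((\<lambda>t. l * t) -` (\<int> :: real set))"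
  by (intro continuous_closed_vimage closed_Ints) auto
 ultimately show ?thesis by simp
qed

lemma dual_group_closed: "closed (dual_group \<Gamma>)"
proof -
 have "dual_group \<Gamma> = (\<Inter>i. {\<xi>. \<forall>l. \<Gamma> i = Circle l \<longrightarrow> l * \<xi> $ i \<in> \<int>})"
  by (auto simp: dual_group_def)
 moreover have "closed {\<xi>::real^'n. \<forall>l. \<Gamma> i = Circle l \<longrightarrow> l * \<xi> $ i \<in> \<int>}" for i
 proof (cases "\<Gamma> i")
  case (Circle l)
  have "{\<xi>::real^'n. l * \<xi> $ i \<in> \<int>} = (\<lambda>\<xi>. \<xi> $ i) -` {t. l * t \<in> \<int>}" by auto
  moreover have "closed ((\<lambda>\<xi>::real^'n. \<xi> $ i) -` {t. l * t \<in> \<int>})"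
   by (intro continuous_closed_vimage closed_lattice) (auto intro!: continuous_intros)
  ultimately show ?thesis using Circle by simp
 qed simp
 ultimately show ?thesis by (auto intro!: closed_INT)
qed

lemma dual_group_borel [measurable]: "dual_group \<Gamma> \<in> sets borel"
 using dual_group_closed by (rule borel_closed)

lemma dual_group_add: "\<xi> \<in> dual_group \<Gamma> ==> \<eta> \<in> dual_group \<Gamma> ==> \<xi> + \<eta> \<in> dual_group \<Gamma>"
 by (auto simp: dual_group_def distrib_left)

lemma dual_group_diff: "\<xi> \<in> dual_group \<Gamma> ==> \<eta> \<in> dual_group \<Gamma> ==> \<xi> - \<eta> \<in> dual_group \<Gamma>"
 by (auto simp: dual_group_def right_diff_distrib)

lemma dual_group_zero: "0 \<in> dual_group \<Gamma>"
 by (auto simp: dual_group_def)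

lemma vec_lambda_in_dual_group:
 assumes "x \<in> space (PiM UNIV (dual_coords \<Gamma>))" shows "vec_lambda x \<in> dual_group \<Gamma>"
proof -
 have "x i \<in> space (dual_coords \<Gamma> i)" for i
  using assms by (auto simp: space_PiM)
 then show ?thesis
  unfolding dual_group_def by (auto, metis dual_factor_measure.simps(2) mem_Collect_eq space_count_space)
qed

lemma dual_measure_eq: "dual_measure \<Gamma> = restrict_space (dual_borel \<Gamma>) (dual_group \<Gamma>)"
proof (rule measure_eqI)
 show "sets (dual_measure \<Gamma>) = sets (restrict_space (dual_borel \<Gamma>) (dual_group \<Gamma>))"
  by (simp add: dual_measure_def sets_restrict_space)
 fix A assume "A \<in> sets (dual_measure \<Gamma>)"
 then have A: "A \<in> sets (restrict_space borel (dual_group \<Gamma>))"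
  by (simp add: dual_measure_def)
 then have A': "A \<in> sets borel" "A \<subseteq> dual_group \<Gamma>"
  by (auto simp: sets_restrict_space_iff)
 have m: "vec_lambda \<in> measurable (PiM UNIV (dual_coords \<Gamma>)) (restrict_space borel (dual_group \<Gamma>))"
  by (intro measurable_restrict_space2 dual.vec_lambda_measurable) (auto intro: vec_lambda_in_dual_group)
 show "emeasure (dual_measure \<Gamma>) A = emeasure (restrict_space (dual_borel \<Gamma>) (dual_group \<Gamma>)) A"
  using A A' m unfolding dual_measure_def
  by (simp add: emeasure_distr emeasure_restrict_space dual_borel_def vec_measure_def
    emeasure_distr[OF dual.vec_lambda_measurable])
qed

lemma AE_dual_group: "AE \<xi> in dual_borel \<Gamma>. \<xi> \<in> dual_group \<Gamma>"
proof -
 have m: "{x \<in> space (PiM UNIV (dual_coords \<Gamma>)). vec_lambda x \<notin> dual_group \<Gamma>} = {}"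
  using vec_lambda_in_dual_group by auto
 show ?thesis
  unfolding dual_borel_def vec_measure_def
  by (subst AE_distr_iff[OF dual.vec_lambda_measurable]) (auto intro!: AE_I2 vec_lambda_in_dual_group)
qed

text \<open>Each factor is translation invariant: the line, and the lattice under its own points.\<close>

lemma dual_translate:
 assumes v: "v \<in> dual_group \<Gamma>"
 shows "distr (dual_borel \<Gamma>) borel (\<lambda>\<xi>. \<xi> + v) = dual_borel \<Gamma>"
 unfolding dual_borel_def
proof (rule dual.vec_measure_translate)
 fix i
 have bij: "bij_betw (\<lambda>t. t + v $ i) {t. l * t \<in> \<int>} {t. l * t \<in> \<int>}" if "\<Gamma> i = Circle l" for l
 proof (rule bij_betw_byWitness[where f' = "\<lambda>t. t - v $ i"])
  have "l * v $ i \<in> \<int>" using v that by (auto simp: dual_group_def)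
  then show "(\<lambda>t. t + v $ i) ` {t. l * t \<in> \<int>} \<subseteq> {t. l * t \<in> \<int>}" "(\<lambda>t. t - v $ i) ` {t. l * t \<in> \<int>} \<subseteq> {t. l * t \<in> \<int>}"
   by (auto simp: distrib_left right_diff_distrib)
 qed auto
 show "(\<lambda>t. t + v $ i) \<in> measurable (dual_coords \<Gamma> i) (dual_coords \<Gamma> i)"
  using bij by (cases "\<Gamma> i") (auto simp: bij_betw_def)
 show "distr (dual_coords \<Gamma> i) (dual_coords \<Gamma> i) (\<lambda>t. t + v $ i) = dual_coords \<Gamma> i"
 proof (cases "\<Gamma> i")
  case Line
  then show ?thesis using lborel_distr_plus[of "v $ i"] by (simp add: add.commute cong: distr_cong)
 next
  case (Circle l)
  then show ?thesis using distr_bij_count_space[OF bij[OF Circle]] by simp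
 qed
qed

lemma lattice_bounded_finite:
 assumes "l > 0" shows "finite ({t::real. l * t \<in> \<int>} \<inter> {- R..R})"
proof -
 have "{t::real. l * t \<in> \<int>} \<inter> {- R..R} \<subseteq> (\<lambda>n. of_int n / l) ` {- \<lceil>R * l\<rceil>..\<lceil>R * l\<rceil>}"
 proof
  fix t :: real assume t: "t \<in> {t. l * t \<in> \<int>} \<inter> {- R..R}"
  then obtain n where n: "l * t = of_int n" by (auto simp: Ints_def)
  have "\<bar>l * t\<bar> \<le> R * l" using t assms by (auto simp: abs_mult abs_le_iff mult.commute)
  then have "\<bar>real_of_int n\<bar> \<le> R * l" by (simp add: n)
  then have "n \<in> {- \<lceil>R * l\<rceil>..\<lceil>R * l\<rceil>}" by (auto simp: abs_le_iff) linarith+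
  moreover have "t = of_int n / l" using n assms by (simp add: field_simps)
  ultimately show "t \<in> (\<lambda>n. of_int n / l) ` {- \<lceil>R * l\<rceil>..\<lceil>R * l\<rceil>}" by blast
 qed
 then show ?thesis by (rule finite_subset) auto
qed

lemma emeasure_dual_bounded:
 assumes "bounded B" "B \<in> sets borel" shows "emeasure (dual_borel \<Gamma>) B < \<infinity>"
 unfolding dual_borel_def
proof (rule dual.emeasure_bounded_finite[OF _ assms])
 fix i R
 show "(\<integral>\<^sup>+ t. indicator {- R..R} t \<partial>dual_coords \<Gamma> i) < \<infinity>"
 proof (cases "\<Gamma> i")
  case Line
  then show ?thesis by (simp add: emeasure_lborel_Icc_eq)
 next
  case (Circle l)
  have "(\<integral>\<^sup>+ t. indicator {- R..R} t \<partial>count_space {t. l * t \<in> \<int>})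
    = (\<Sum>t\<in>{t. l * t \<in> \<int>} \<inter> {- R..R}. 1)"
   using lattice_bounded_finite[OF period_pos[OF Circle], of R]
   by (subst nn_integral_count_space'[of "{t. l * t \<in> \<int>} \<inter> {- R..R}"]) (auto simp: indicator_def)
  then show ?thesis using Circle by (simp add: of_nat_less_top)
 qed
qed

lemma sigma_finite_dual: "sigma_finite_measure (dual_borel \<Gamma>)"
proof
 show "\<exists>A. countable A \<and> A \<subseteq> sets (dual_borel \<Gamma>) \<and> \<Union> A = space (dual_borel \<Gamma>) \<and> (\<forall>a\<in>A. emeasure (dual_borel \<Gamma>) a \<noteq> \<infinity>)"
 proof (intro exI conjI ballI)
  show "countable (range (\<lambda>n::nat. cball (0::real^'n) (real n)))" by auto
  show "\<Union> (range (\<lambda>n::nat. cball (0::real^'n) (real n))) = space (dual_borel \<Gamma>)"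
   by (auto simp: real_arch_simple)
  fix a assume "a \<in> range (\<lambda>n::nat. cball (0::real^'n) (real n))"
  then show "emeasure (dual_borel \<Gamma>) a \<noteq> \<infinity>"
   using emeasure_dual_bounded[of a] by auto
 qed auto
qed

lemma nn_integral_dual_translate:
 assumes "v \<in> dual_group \<Gamma>" and [measurable]: "f \<in> borel_measurable borel"
 shows "(\<integral>\<^sup>+ \<xi>. f (\<xi> + v) \<partial>dual_borel \<Gamma>) = (\<integral>\<^sup>+ \<xi>. f \<xi> \<partial>dual_borel \<Gamma>)"
 by (subst dual_translate[OF assms(1), symmetric], subst nn_integral_distr) auto

lemma integral_dual_translate:
 fixes f :: "real ^ 'n => complex"
 assumes "v \<in> dual_group \<Gamma>" and [measurable]: "f \<in> borel_measurable borel"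
 shows "(\<integral>\<xi>. f (\<xi> + v) \<partial>dual_borel \<Gamma>) = (\<integral>\<xi>. f \<xi> \<partial>dual_borel \<Gamma>)"
 by (subst dual_translate[OF assms(1), symmetric], subst integral_distr) auto

end

section \<open>Smoothness along coordinate directions\<close>

lemma has_derivative_imp_partial:
 fixes f :: "real ^ 'n::finite => complex"
 assumes f: "(f has_derivative D) (at (x + t *\<^sub>R axis i 1) within S)"
  and S: "\<And>u. x + u *\<^sub>R axis i 1 \<in> S"
 shows "((\<lambda>u. f (x + u *\<^sub>R axis i 1)) has_vector_derivative D (axis i 1)) (at t)"
proof -
 have "((\<lambda>u. x + u *\<^sub>R axis i 1) has_derivative (\<lambda>u. u *\<^sub>R axis i 1)) (at t)"
  by (auto intro!: derivative_eq_intros)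
 moreover have "(f has_derivative D) (at (x + t *\<^sub>R axis i 1) within range (\<lambda>u. x + u *\<^sub>R axis i 1))"
  using f by (rule has_derivative_subset) (auto simp: S)
 ultimately have "((\<lambda>u. f (x + u *\<^sub>R axis i 1)) has_derivative (\<lambda>u. D (u *\<^sub>R axis i 1))) (at t)"
  using diff_chain_within[of "\<lambda>u. x + u *\<^sub>R axis i 1" _ t UNIV f D] by (simp add: o_def)
 moreover have "D (u *\<^sub>R axis i 1) = u *\<^sub>R D (axis i 1)" for u
  using has_derivative_linear[OF f] by (simp add: linear_cmul)
 ultimately show ?thesis by (simp add: has_vector_derivative_def)
qed

lemma partial_deriv_eqI:
 "((\<lambda>u. f (x + u *\<^sub>R axis i 1)) has_vector_derivative d) (at 0) ==> partial_deriv i f x = d"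
 by (simp add: partial_deriv_def vector_derivative_at)

lemma partial_derivs_Nil [simp]: "partial_derivs [] f = f"
 by (simp add: partial_derivs_def)

lemma partial_derivs_Cons: "partial_derivs (j # js) f = partial_deriv j (partial_derivs js f)"
 by (simp add: partial_derivs_def)

lemma partial_derivs_snoc: "partial_derivs (js @ [j]) f = partial_derivs js (partial_deriv j f)"
 by (simp add: partial_derivs_def)

lemma differentiable_on_eq:
 "f differentiable_on S ==> (\<And>x. x \<in> S ==> f x = g x) ==> g differentiable_on S"
 unfolding differentiable_on_def by (metis differentiable_transform_within zero_less_one)

text \<open>
 The Schwartz functions and the test functions of the dual group are both smooth in the
 directions of a set \<open>I\<close> of coordinates, on a set \<open>S\<close> that is invariant under these directions
 (all of the space, respectively the dual group and its line coordinates).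
\<close>

locale directions =
 fixes I :: "'n::finite set" and S :: "(real ^ 'n) set"
 assumes shift: "x \<in> S ==> i \<in> I ==> x + t *\<^sub>R axis i 1 \<in> S"
begin

definition smooth :: "(real ^ 'n => complex) => bool" where
 "smooth f \<longleftrightarrow> (\<forall>js. set js \<subseteq> I \<longrightarrow> partial_derivs js f differentiable_on S)"

fun smooth_upto :: "nat => (real ^ 'n => complex) => bool" where
 "smooth_upto 0 f \<longleftrightarrow> f differentiable_on S"
| "smooth_upto (Suc n) f \<longleftrightarrow> f differentiable_on S \<and> (\<forall>i\<in>I. smooth_upto n (partial_deriv i f))"

text \<open>The recursion peels off the innermost derivative, which makes the product rule an induction on the
 order.\<close>

lemma smooth_iff_upto: "smooth f \<longleftrightarrow> (\<forall>n. smooth_upto n f)"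
proof
 assume *: "\<forall>n. smooth_upto n f"
 have "set js \<subseteq> I ==> smooth_upto (length js) g ==> partial_derivs js g differentiable_on S" for js g
  by (induction js arbitrary: g rule: rev_induct) (auto simp: partial_derivs_snoc)
 then show "smooth f" using * by (auto simp: smooth_def)
next
 assume *: "smooth f"
 have "smooth g ==> smooth_upto n g" for n g
 proof (induction n arbitrary: g)
  case 0
  then show ?case by (auto simp: smooth_def dest: spec[of _ "[]"])
 next
  case (Suc n)
  have "smooth (partial_deriv i g)" if "i \<in> I" for i
   unfolding smooth_def
  proof (intro allI impI)
   fix js assume "set js \<subseteq> I"
   then show "partial_derivs js (partial_deriv i g) differentiable_on S"
    using Suc.prems that unfolding smooth_def by (auto dest!: spec[of _ "js @ [i]"] simp: partial_derivs_snoc)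
  qed
  then show ?case using Suc by (auto simp: smooth_def dest: spec[of _ "[]"])
 qed
 then show "\<forall>n. smooth_upto n f" using * by blast
qed

lemma smooth_differentiable: "smooth f ==> f differentiable_on S"
 by (auto simp: smooth_def dest: spec[of _ "[]"])

lemma smooth_continuous: "smooth f ==> continuous_on S f"
 by (simp add: smooth_differentiable differentiable_imp_continuous_on)

lemma smooth_partial_deriv: "smooth f ==> i \<in> I ==> smooth (partial_deriv i f)"
 unfolding smooth_iff_upto using smooth_upto.simps(2) by blast

lemma partial_deriv_vector_derivative:
 assumes "f differentiable_on S" "x \<in> S" "i \<in> I"
 shows "((\<lambda>u. f (x + u *\<^sub>R axis i 1)) has_vector_derivative
  partial_deriv i f (x + t *\<^sub>R axis i 1)) (at t)"
proof -
 obtain D where D: "(f has_derivative D) (at (x + t *\<^sub>R axis i 1) within S)"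
  using assms shift unfolding differentiable_on_def differentiable_def by meson
 have "((\<lambda>u. f (x + t *\<^sub>R axis i 1 + u *\<^sub>R axis i 1)) has_vector_derivative D (axis i 1)) (at 0)"
  using has_derivative_imp_partial[of f D "x + t *\<^sub>R axis i 1" 0 i S] D shift assms by simp
 then have "partial_deriv i f (x + t *\<^sub>R axis i 1) = D (axis i 1)"
  by (rule partial_deriv_eqI)
 then show ?thesis
  using has_derivative_imp_partial[OF D] shift assms by simp
qed

lemma partial_deriv_vector_derivative_0:
 assumes "f differentiable_on S" "x \<in> S" "i \<in> I"
 shows "((\<lambda>u. f (x + u *\<^sub>R axis i 1)) has_vector_derivative partial_deriv i f x) (at 0)"
 using partial_deriv_vector_derivative[OF assms, of 0] by simp

lemma partial_deriv_cong:
 assumes "\<And>y. y \<in> S ==> f y = g y" "x \<in> S" "i \<in> I"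
 shows "partial_deriv i f x = partial_deriv i g x"
 unfolding partial_deriv_def using assms shift by simp

lemma smooth_upto_cong:
 "smooth_upto n f ==> (\<And>y. y \<in> S ==> f y = g y) ==> smooth_upto n g"
proof (induction n arbitrary: f g)
 case 0
 then show ?case using differentiable_on_eq by auto
next
 case (Suc n)
 have "smooth_upto n (partial_deriv i g)" if i: "i \<in> I" for i
 proof (rule Suc.IH[of "partial_deriv i f"])
  show "smooth_upto n (partial_deriv i f)" using Suc.prems(1) i by simp
  show "partial_deriv i f y = partial_deriv i g y" if "y \<in> S" for y
   by (rule partial_deriv_cong[OF Suc.prems(2) that i])
 qed
 moreover have "g differentiable_on S"
  using Suc.prems differentiable_on_eq[of f S g] by simp
 ultimately show ?case by simp
qed

text \<open>
 A class of functions is smooth if its members are differentiable and their derivatives are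
 again in the class.
\<close>

lemma smooth_coinduct:
 assumes "f \<in> C" and diff: "\<And>f. f \<in> C ==> f differentiable_on S"
  and step: "\<And>f i. f \<in> C ==> i \<in> I ==> \<exists>g\<in>C. \<forall>x\<in>S. partial_deriv i f x = g x"
 shows "smooth f"
proof -
 have "f \<in> C ==> smooth_upto n f" for f n
 proof (induction n arbitrary: f)
  case (Suc n)
  have "smooth_upto n (partial_deriv i f)" if i: "i \<in> I" for i
  proof -
   obtain g where g: "g \<in> C" "\<forall>x\<in>S. partial_deriv i f x = g x"
    using step[OF Suc.prems i] by blast
   show ?thesis by (rule smooth_upto_cong[OF Suc.IH[OF g(1)]]) (simp add: g(2))
  qed
  then show ?case using Suc diff by auto
 qed (simp add: diff)
 then show ?thesis using assms(1) by (simp add: smooth_iff_upto)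
qed

lemma partial_deriv_add:
 assumes "f differentiable_on S" "g differentiable_on S" "x \<in> S" "i \<in> I"
 shows "partial_deriv i (\<lambda>y. f y + g y) x = partial_deriv i f x + partial_deriv i g x"
 by (intro partial_deriv_eqI has_vector_derivative_add partial_deriv_vector_derivative_0 assms)

lemma partial_deriv_mult:
 assumes "f differentiable_on S" "g differentiable_on S" "x \<in> S" "i \<in> I"
 shows "partial_deriv i (\<lambda>y. f y * g y) x = f x * partial_deriv i g x + partial_deriv i f x * g x"
proof (intro partial_deriv_eqI)
 have "((\<lambda>u. f (x + u *\<^sub>R axis i 1) * g (x + u *\<^sub>R axis i 1)) has_vector_derivative
  f (x + 0 *\<^sub>R axis i 1) * partial_deriv i g x + partial_deriv i f x * g (x + 0 *\<^sub>R axis i 1)) (at 0)"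
  by (intro has_vector_derivative_mult partial_deriv_vector_derivative_0 assms)
 then show "((\<lambda>u. f (x + u *\<^sub>R axis i 1) * g (x + u *\<^sub>R axis i 1)) has_vector_derivative
  f x * partial_deriv i g x + partial_deriv i f x * g x) (at 0)" by simp
qed

lemma smooth_upto_SucD: "smooth_upto (Suc n) f ==> smooth_upto n f"
 by (induction n arbitrary: f) auto

lemma smooth_upto_add: "smooth_upto n f ==> smooth_upto n g ==> smooth_upto n (\<lambda>y. f y + g y)"
proof (induction n arbitrary: f g)
 case 0
 then show ?case by (auto intro!: differentiable_on_add)
next
 case (Suc n)
 have "smooth_upto n (partial_deriv i (\<lambda>y. f y + g y))" if "i \<in> I" for i
  by (rule smooth_upto_cong[OF Suc.IH[of "partial_deriv i f" "partial_deriv i g"]])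
   (use Suc.prems that in \<open>auto simp: partial_deriv_add\<close>)
 then show ?case using Suc.prems by (auto intro!: differentiable_on_add)
qed

lemma smooth_upto_mult: "smooth_upto n f ==> smooth_upto n g ==> smooth_upto n (\<lambda>y. f y * g y)"
proof (induction n arbitrary: f g)
 case 0
 then show ?case by (auto intro!: differentiable_on_mult)
next
 case (Suc n)
 have "smooth_upto n (partial_deriv i (\<lambda>y. f y * g y))" if i: "i \<in> I" for i
 proof -
  have "smooth_upto n f" "smooth_upto n g" "smooth_upto n (partial_deriv i f)" "smooth_upto n (partial_deriv i g)"
   using smooth_upto_SucD[OF Suc.prems(1)] smooth_upto_SucD[OF Suc.prems(2)] Suc.prems i by simp_all
  then have "smooth_upto n (\<lambda>y. f y * partial_deriv i g y)" "smooth_upto n (\<lambda>y. partial_deriv i f y * g y)"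
   by (rule_tac [!] Suc.IH)
  from smooth_upto_add[OF this] show ?thesis
   by (rule smooth_upto_cong) (use Suc.prems i in \<open>auto simp: partial_deriv_mult\<close>)
 qed
 then show ?case using Suc.prems by (auto intro!: differentiable_on_mult)
qed

lemma smooth_mult: "smooth f ==> smooth g ==> smooth (\<lambda>y. f y * g y)"
 and smooth_add: "smooth f ==> smooth g ==> smooth (\<lambda>y. f y + g y)"
 by (auto simp: smooth_iff_upto smooth_upto_mult smooth_upto_add)

lemma smooth_const: "smooth (\<lambda>_. c)"
proof (rule smooth_coinduct[of _ "range (\<lambda>c _. c)"])
 fix f :: "real ^ 'n => complex" and i
 assume "f \<in> range (\<lambda>c _. c)"
 then have "\<forall>x\<in>S. partial_deriv i f x = (\<lambda>_. 0) x"
  by (auto simp: partial_deriv_def)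
 then show "\<exists>g\<in>range (\<lambda>c _. c). \<forall>x\<in>S. partial_deriv i f x = g x"
  by (intro bexI[of _ "\<lambda>_. 0"]) simp_all
qed auto

lemma smooth_coordinate: "smooth (\<lambda>y. complex_of_real (y $ j))"
proof (rule smooth_coinduct[of _ "insert (\<lambda>y. complex_of_real (y $ j)) (range (\<lambda>c _. c))"])
 fix f :: "real ^ 'n => complex" and i
 assume f: "f \<in> insert (\<lambda>y. complex_of_real (y $ j)) (range (\<lambda>c _. c))"
 have "partial_deriv i (\<lambda>y. complex_of_real (y $ j)) x = (if i = j then 1 else 0)" for x
 proof (rule partial_deriv_eqI)
  have "((\<lambda>u. complex_of_real (x $ j + u * (if i = j then 1 else 0))) has_vector_derivative
    (if i = j then 1 else 0)) (at 0)"
   by (cases "i = j") (auto intro!: derivative_eq_intros)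
  then show "((\<lambda>u. complex_of_real ((x + u *\<^sub>R axis i 1) $ j)) has_vector_derivative
    (if i = j then 1 else 0)) (at 0)"
   by (cases "i = j") (simp_all add: axis_def)
 qed
 moreover have "partial_deriv i (\<lambda>_. c) x = 0" for x c
  by (auto simp: partial_deriv_def)
 ultimately show "\<exists>g\<in>insert (\<lambda>y. complex_of_real (y $ j)) (range (\<lambda>c _. c)). \<forall>x\<in>S. partial_deriv i f x = g x"
  using f by fastforce
next
 fix f assume "f \<in> insert (\<lambda>y. complex_of_real (y $ j)) (range (\<lambda>c _. c))"
 moreover have "(\<lambda>y::real^'n. complex_of_real (y $ j)) differentiable_on S"
  unfolding differentiable_on_def
  by (auto intro!: bounded_linear_imp_differentiable bounded_linear_compose[OF bounded_linear_of_real] bounded_linear_vec_nth)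
 ultimately show "f differentiable_on S" by auto
qed auto

lemma partial_derivs_add:
 assumes "smooth f" "smooth g" "set js \<subseteq> I" "x \<in> S"
 shows "partial_derivs js (\<lambda>y. f y + g y) x = partial_derivs js f x + partial_derivs js g x"
 using assms(3,4)
proof (induction js arbitrary: x)
 case (Cons j js)
 have "partial_deriv j (partial_derivs js (\<lambda>y. f y + g y)) x
   = partial_deriv j (\<lambda>y. partial_derivs js f y + partial_derivs js g y) x"
  using Cons by (intro partial_deriv_cong) auto
 also have "\<dots> = partial_deriv j (partial_derivs js f) x + partial_deriv j (partial_derivs js g) x"
  using Cons.prems assms by (intro partial_deriv_add) (auto simp: smooth_def)
 finally show ?case by (simp add: partial_derivs_Cons)
qed simp

lemma partial_derivs_cmult:
 assumes "smooth f" "set js \<subseteq> I" "x \<in> S"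
 shows "partial_derivs js (\<lambda>y. c * f y) x = c * partial_derivs js f x"
 using assms(2,3)
proof (induction js arbitrary: x)
 case (Cons j js)
 have "partial_deriv j (partial_derivs js (\<lambda>y. c * f y)) x
   = partial_deriv j (\<lambda>y. c * partial_derivs js f y) x"
  using Cons by (intro partial_deriv_cong) auto
 also have "\<dots> = c * partial_deriv j (partial_derivs js f) x"
  using Cons.prems assms
  by (intro partial_deriv_eqI has_vector_derivative_mult_right partial_deriv_vector_derivative_0) (auto simp: smooth_def)
 finally show ?case by (simp add: partial_derivs_Cons)
qed simp

text \<open>
 The mean value inequality along a path parallel to the axes; the path stays within the distance
 \<open>\<Sum>i\<in>J. \<bar>v $ i\<bar>\<close> of its starting point.
\<close>

lemma increment_one:
 assumes f: "f differentiable_on S" and "x \<in> S" "i \<in> I"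
  and B: "\<And>u. \<bar>u\<bar> \<le> \<bar>t\<bar> ==> norm (partial_deriv i f (x + u *\<^sub>R axis i 1)) \<le> B"
 shows "norm (f (x + t *\<^sub>R axis i 1) - f x) \<le> B * \<bar>t\<bar>"
proof -
 have "norm (f (x + t *\<^sub>R axis i 1) - f (x + 0 *\<^sub>R axis i 1)) \<le> B * norm (t - 0)"
 proof (rule differentiable_bound[of "{- \<bar>t\<bar>..\<bar>t\<bar>}" "\<lambda>u. f (x + u *\<^sub>R axis i 1)"
    "\<lambda>u h. h *\<^sub>R partial_deriv i f (x + u *\<^sub>R axis i 1)"])
  fix u assume u: "u \<in> {- \<bar>t\<bar>..\<bar>t\<bar>}"
  show "((\<lambda>u. f (x + u *\<^sub>R axis i 1)) has_derivative (\<lambda>h. h *\<^sub>R partial_deriv i f (x + u *\<^sub>R axis i 1)))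
    (at u within {- \<bar>t\<bar>..\<bar>t\<bar>})"
   using partial_deriv_vector_derivative[OF f assms(2,3), of u]
   by (auto simp: has_vector_derivative_def intro: has_derivative_at_withinI)
  show "onorm (\<lambda>h. h *\<^sub>R partial_deriv i f (x + u *\<^sub>R axis i 1)) \<le> B"
   using B[of u] u by (intro onorm_le) (auto simp: mult.commute[of B] intro!: mult_left_mono)
 qed auto
 then show ?thesis by simp
qed

lemma increment_bound:
 fixes v :: "real ^ 'n"
 assumes f: "f differentiable_on S" and x: "x \<in> S" and J: "J \<subseteq> I"
  and B: "\<And>i y. i \<in> J ==> y \<in> S ==> norm (y - x) \<le> (\<Sum>i\<in>J. \<bar>v $ i\<bar>) ==> norm (partial_deriv i f y) \<le> B"
 shows "norm (f (x + (\<Sum>i\<in>J. v $ i *\<^sub>R axis i 1)) - f x) \<le> B * (\<Sum>i\<in>J. \<bar>v $ i\<bar>)"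
proof -
 have *: "x + (\<Sum>i\<in>K. v $ i *\<^sub>R axis i 1) \<in> S \<and>
   norm (f (x + (\<Sum>i\<in>K. v $ i *\<^sub>R axis i 1)) - f x) \<le> B * (\<Sum>i\<in>K. \<bar>v $ i\<bar>)" if "K \<subseteq> J" for K
  using finite_subset[OF that finite] that
 proof (induction K rule: finite_induct)
  case (insert k K)
  let ?y = "x + (\<Sum>i\<in>K. v $ i *\<^sub>R axis i 1)"
  have y: "?y \<in> S" using insert by auto
  have k: "k \<in> J" "k \<in> I" using insert J by auto
  have "norm (f (?y + v $ k *\<^sub>R axis k 1) - f ?y) \<le> B * \<bar>v $ k\<bar>"
  proof (rule increment_one[OF f y k(2)])
   fix u assume u: "\<bar>u\<bar> \<le> \<bar>v $ k\<bar>"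
   have "norm (?y + u *\<^sub>R axis k 1 - x) \<le> (\<Sum>i\<in>K. \<bar>v $ i\<bar>) + \<bar>u\<bar>"
    using norm_triangle_ineq[of "\<Sum>i\<in>K. v $ i *\<^sub>R axis i 1" "u *\<^sub>R axis k (1::real)"]
     norm_sum[of "\<lambda>i. v $ i *\<^sub>R axis i (1::real)" K] by (simp add: algebra_simps norm_axis_1)
   also have "\<dots> \<le> (\<Sum>i\<in>insert k K. \<bar>v $ i\<bar>)" using insert u by simp
   also have "\<dots> \<le> (\<Sum>i\<in>J. \<bar>v $ i\<bar>)"
    using insert.prems by (intro sum_mono2) auto
   finally show "norm (partial_deriv k f (?y + u *\<^sub>R axis k 1)) \<le> B"
    using k y by (intro B shift) auto
  qed
  moreover have "norm (f ?y - f x) \<le> B * (\<Sum>i\<in>K. \<bar>v $ i\<bar>)" using insert by auto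
  moreover have "x + (\<Sum>i\<in>insert k K. v $ i *\<^sub>R axis i 1) = ?y + v $ k *\<^sub>R axis k 1"
   using insert by (simp add: algebra_simps)
  moreover have "norm (f (?y + v $ k *\<^sub>R axis k 1) - f x)
    \<le> norm (f (?y + v $ k *\<^sub>R axis k 1) - f ?y) + norm (f ?y - f x)"
   by (rule order_trans[OF eq_refl norm_triangle_ineq]) simp
  moreover have "?y + v $ k *\<^sub>R axis k 1 \<in> S" using y k by (rule_tac shift)
  ultimately show ?case using insert by (simp add: algebra_simps)
 qed (simp add: x)
 show ?thesis using *[of J] by simp
qed

end

lemma directions_UNIV: "directions UNIV UNIV"
 by unfold_locales auto

section \<open>Fourier integrals\<close>

definition fourier_integral :: "(real ^ 'n::finite) measure => real => (real ^ 'n => complex) => real ^ 'n => complex" where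
 "fourier_integral M a p x = (\<integral>\<xi>. p \<xi> * cis (a * (\<xi> \<bullet> x)) \<partial>M)"

text \<open>Measurable functions of rapid decay in the mean, which may be multiplied by polynomials before they are integrated.\<close>

definition moments :: "(real ^ 'n::finite) measure => (real ^ 'n => complex) => bool" where
 "moments M p \<longleftrightarrow> p \<in> borel_measurable borel \<and> (\<forall>k. integrable M (\<lambda>\<xi>. norm \<xi> ^ k * norm (p \<xi>)))"

lemma cis_borel [measurable]: "cis \<in> borel_measurable borel"
 by (intro borel_measurable_continuous_onI continuous_intros)

lemma cis_sum: "finite A ==> cis (\<Sum>i\<in>A. f i) = (\<Prod>i\<in>A. cis (f i))"
 by (induction A rule: finite_induct) (auto simp: cis_mult[symmetric])

text \<open>The remainder that justifies differentiation under the integral sign.\<close>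

lemma cis_taylor: "norm (cis h - 1 - \<i> * of_real h) \<le> h\<^sup>2 / 2"
 using iexp_approx1[of h 1] by (simp add: cis_conv_exp power2_eq_square algebra_simps)

lemma norm_integral_le:
 fixes f :: "'a => complex"
 assumes g: "integrable M g" and le: "\<And>x. norm (f x) \<le> g x"
 shows "norm (\<integral>x. f x \<partial>M) \<le> (\<integral>x. g x \<partial>M)"
proof (cases "integrable M f")
 case True
 then show ?thesis
  by (intro order_trans[OF integral_norm_bound] integral_mono) (auto simp: g le)
next
 case False
 have "0 \<le> g x" for x using le[of x] norm_ge_zero[of "f x"] by linarith
 then show ?thesis by (simp add: not_integrable_integral_eq[OF False])
qed

locale borel_measure =
 fixes M :: "(real ^ 'n::finite) measure"
 assumes sets_borel [simp, measurable_cong]: "sets M = sets borel"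
begin

lemma momentsD:
 assumes "moments M p"
 shows "p \<in> borel_measurable borel" "integrable M (\<lambda>\<xi>. norm \<xi> ^ k * norm (p \<xi>))" "integrable M p"
proof -
 show m [measurable]: "p \<in> borel_measurable borel" and "integrable M (\<lambda>\<xi>. norm \<xi> ^ k * norm (p \<xi>))"
  using assms by (auto simp: moments_def)
 have "integrable M (\<lambda>\<xi>. norm \<xi> ^ 0 * norm (p \<xi>))"
  using assms unfolding moments_def by blast
 then show "integrable M p" by (simp add: integrable_norm_iff)
qed

lemma integrable_cis:
 assumes "integrable M p"
 shows "integrable M (\<lambda>\<xi>. p \<xi> * cis (a * (\<xi> \<bullet> x)))"
proof (rule Bochner_Integration.integrable_bound[OF assms])
 show "(\<lambda>\<xi>. p \<xi> * cis (a * (\<xi> \<bullet> x))) \<in> borel_measurable M"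
  using borel_measurable_integrable[OF assms] by measurable
qed (simp add: norm_mult)

lemma fourier_integral_bound:
 assumes "integrable M p"
 shows "norm (fourier_integral M a p x) \<le> (\<integral>\<xi>. norm (p \<xi>) \<partial>M)"
 unfolding fourier_integral_def
 by (rule order_trans[OF integral_norm_bound]) (simp add: norm_mult)

lemma moments_mult_coordinate:
 assumes "moments M p" shows "moments M (\<lambda>\<xi>. c * of_real (\<xi> $ j) * p \<xi>)"
 unfolding moments_def
proof (intro conjI allI)
 note [measurable] = momentsD(1)[OF assms]
 show "(\<lambda>\<xi>. c * of_real (\<xi> $ j) * p \<xi>) \<in> borel_measurable borel" by measurable
 fix k
 show "integrable M (\<lambda>\<xi>. norm \<xi> ^ k * norm (c * of_real (\<xi> $ j) * p \<xi>))"
 proof (rule Bochner_Integration.integrable_bound)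
  show "integrable M (\<lambda>\<xi>. norm c * (norm \<xi> ^ Suc k * norm (p \<xi>)))"
   by (intro integrable_mult_right momentsD(2)[OF assms])
  have "norm c * \<bar>\<xi> $ j\<bar> * norm \<xi> ^ k * norm (p \<xi>) \<le> norm c * norm \<xi> * norm \<xi> ^ k * norm (p \<xi>)" for \<xi>
   by (intro mult_right_mono mult_left_mono component_le_norm_cart) auto
  then show "AE \<xi> in M. norm (norm \<xi> ^ k * norm (c * of_real (\<xi> $ j) * p \<xi>))
    \<le> norm (norm c * (norm \<xi> ^ Suc k * norm (p \<xi>)))"
   by (auto simp: norm_mult mult_ac)
 qed measurable
qed

lemma fourier_integral_has_derivative:
 assumes "moments M p"
 shows "(fourier_integral M a p has_derivative
  (\<lambda>y. \<integral>\<xi>. p \<xi> * cis (a * (\<xi> \<bullet> x)) * (\<i> * of_real (a * (\<xi> \<bullet> y))) \<partial>M)) (at x)"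
proof -
 note [measurable] = momentsD(1)[OF assms]
 let ?d = "\<lambda>y \<xi>. p \<xi> * cis (a * (\<xi> \<bullet> x)) * (\<i> * of_real (a * (\<xi> \<bullet> y)))"
 let ?D = "\<lambda>y. \<integral>\<xi>. ?d y \<xi> \<partial>M"
 have inner_bound: "\<bar>a * (\<xi> \<bullet> y)\<bar> \<le> \<bar>a\<bar> * norm \<xi> * norm y" for \<xi> y :: "real ^ 'n"
  using Cauchy_Schwarz_ineq2[of \<xi> y] by (simp add: abs_mult mult.assoc mult_left_mono)
 have int: "integrable M (?d y)" for y
 proof (rule Bochner_Integration.integrable_bound)
  show "integrable M (\<lambda>\<xi>. (\<bar>a\<bar> * norm y) * (norm \<xi> ^ 1 * norm (p \<xi>)))"
   by (intro integrable_mult_right momentsD(2)[OF assms])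
  have "norm (p \<xi>) * \<bar>a * (\<xi> \<bullet> y)\<bar> \<le> norm (p \<xi>) * (\<bar>a\<bar> * norm \<xi> * norm y)" for \<xi>
   by (intro mult_left_mono inner_bound) auto
  then show "AE \<xi> in M. norm (?d y \<xi>) \<le> norm ((\<bar>a\<bar> * norm y) * (norm \<xi> ^ 1 * norm (p \<xi>)))"
   by (auto simp: norm_mult abs_mult mult_ac)
 qed measurable
 have D_bound: "norm (?D y) \<le> norm y * (\<bar>a\<bar> * (\<integral>\<xi>. norm \<xi> ^ 1 * norm (p \<xi>) \<partial>M))" for y
 proof -
  have "norm (?D y) \<le> (\<integral>\<xi>. (\<bar>a\<bar> * norm y) * (norm \<xi> ^ 1 * norm (p \<xi>)) \<partial>M)"
  proof (rule norm_integral_le)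
   show "integrable M (\<lambda>\<xi>. (\<bar>a\<bar> * norm y) * (norm \<xi> ^ 1 * norm (p \<xi>)))"
    by (intro integrable_mult_right momentsD(2)[OF assms])
   show "norm (?d y \<xi>) \<le> (\<bar>a\<bar> * norm y) * (norm \<xi> ^ 1 * norm (p \<xi>))" for \<xi>
    using mult_left_mono[OF inner_bound[of \<xi> y], of "norm (p \<xi>)"] by (simp add: norm_mult abs_mult mult_ac)
  qed
  also have "\<dots> = norm y * (\<bar>a\<bar> * (\<integral>\<xi>. norm \<xi> ^ 1 * norm (p \<xi>) \<partial>M))"
   by (subst integral_mult_right_zero) (simp only: mult_ac)
  finally show ?thesis .
 qed
 have lin: "bounded_linear ?D"
 proof (rule bounded_linear_intro[OF _ _ D_bound])
  show "?D (y + z) = ?D y + ?D z" for y z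
   using int by (subst Bochner_Integration.integral_add[symmetric]) (auto simp: inner_add_right algebra_simps)
  show "?D (r *\<^sub>R y) = r *\<^sub>R ?D y" for r y
  proof -
   have "?d (r *\<^sub>R y) = (\<lambda>\<xi>. r *\<^sub>R ?d y \<xi>)"
    by (simp add: fun_eq_iff scaleR_conv_of_real[where 'a = complex] mult_ac)
   then show ?thesis by (simp only: integral_scaleR_right)
  qed
 qed
 have rem: "norm (fourier_integral M a p y - fourier_integral M a p x - ?D (y - x)) / norm (y - x)
   \<le> a\<^sup>2 * (\<integral>\<xi>. norm \<xi> ^ 2 * norm (p \<xi>) \<partial>M) * norm (y - x)" for y
 proof -
  have "fourier_integral M a p y - fourier_integral M a p x - ?D (y - x)
   = (\<integral>\<xi>. p \<xi> * cis (a * (\<xi> \<bullet> y)) - p \<xi> * cis (a * (\<xi> \<bullet> x)) - ?d (y - x) \<xi> \<partial>M)"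
   unfolding fourier_integral_def
   using integrable_cis[OF momentsD(3)[OF assms], of a y] integrable_cis[OF momentsD(3)[OF assms], of a x]
    int[of "y - x"]
   by (simp only: Bochner_Integration.integral_diff Bochner_Integration.integrable_diff)
  also have "norm \<dots> \<le> (\<integral>\<xi>. (a\<^sup>2 * (norm (y - x))\<^sup>2) * (norm \<xi> ^ 2 * norm (p \<xi>)) \<partial>M)"
  proof (rule norm_integral_le)
   show "integrable M (\<lambda>\<xi>. (a\<^sup>2 * (norm (y - x))\<^sup>2) * (norm \<xi> ^ 2 * norm (p \<xi>)))"
    by (intro integrable_mult_right momentsD(2)[OF assms])
   fix \<xi>
   let ?h = "a * (\<xi> \<bullet> (y - x))"
   have "cis (a * (\<xi> \<bullet> y)) = cis (a * (\<xi> \<bullet> x)) * cis ?h"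
    by (simp add: cis_mult inner_diff_right algebra_simps)
   then have "p \<xi> * cis (a * (\<xi> \<bullet> y)) - p \<xi> * cis (a * (\<xi> \<bullet> x)) - ?d (y - x) \<xi>
     = p \<xi> * cis (a * (\<xi> \<bullet> x)) * (cis ?h - 1 - \<i> * of_real ?h)"
    by (simp only: algebra_simps mult_1_left mult_1_right)
   then have "norm (p \<xi> * cis (a * (\<xi> \<bullet> y)) - p \<xi> * cis (a * (\<xi> \<bullet> x)) - ?d (y - x) \<xi>)
     = norm (p \<xi>) * norm (cis ?h - 1 - \<i> * of_real ?h)"
    by (simp only: norm_mult norm_cis mult_1_right)
   also have "\<dots> \<le> norm (p \<xi>) * (?h\<^sup>2 / 2)"
    by (intro mult_left_mono cis_taylor) auto
   also have "\<dots> \<le> norm (p \<xi>) * (\<bar>a\<bar> * norm \<xi> * norm (y - x))\<^sup>2"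
   proof (rule mult_left_mono)
    have "?h\<^sup>2 \<le> (\<bar>a\<bar> * norm \<xi> * norm (y - x))\<^sup>2"
     using power_mono[OF inner_bound[of \<xi> "y - x"], of 2] by simp
    then show "?h\<^sup>2 / 2 \<le> (\<bar>a\<bar> * norm \<xi> * norm (y - x))\<^sup>2"
     using zero_le_power2[of ?h] by linarith
   qed auto
   finally show "norm (p \<xi> * cis (a * (\<xi> \<bullet> y)) - p \<xi> * cis (a * (\<xi> \<bullet> x)) - ?d (y - x) \<xi>)
     \<le> (a\<^sup>2 * (norm (y - x))\<^sup>2) * (norm \<xi> ^ 2 * norm (p \<xi>))"
    by (simp add: power_mult_distrib mult_ac)
  qed
  also have "\<dots> = (a\<^sup>2 * (\<integral>\<xi>. norm \<xi> ^ 2 * norm (p \<xi>) \<partial>M) * norm (y - x)) * norm (y - x)"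
   by (subst integral_mult_right_zero) (simp only: power2_eq_square mult_ac)
  finally have "norm (fourier_integral M a p y - fourier_integral M a p x - ?D (y - x))
   \<le> (a\<^sup>2 * (\<integral>\<xi>. norm \<xi> ^ 2 * norm (p \<xi>) \<partial>M) * norm (y - x)) * norm (y - x)" .
  then show ?thesis
   by (cases "y = x") (auto simp: divide_le_eq)
 qed
 show ?thesis
 proof (rule has_derivativeI_sandwich[of 1])
  show "((\<lambda>y. a\<^sup>2 * (\<integral>\<xi>. norm \<xi> ^ 2 * norm (p \<xi>) \<partial>M) * norm (y - x)) \<longlongrightarrow> 0) (at x)"
   by (auto intro!: tendsto_eq_intros)
 qed (use lin rem in auto)
qed

lemma partial_deriv_fourier_integral:
 assumes "moments M p"
 shows "partial_deriv j (fourier_integral M a p) = fourier_integral M a (\<lambda>\<xi>. (\<i> * of_real a) * of_real (\<xi> $ j) * p \<xi>)"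
proof
 fix x
 have "partial_deriv j (fourier_integral M a p) x
   = (\<integral>\<xi>. p \<xi> * cis (a * (\<xi> \<bullet> x)) * (\<i> * of_real (a * (\<xi> \<bullet> axis j 1))) \<partial>M)"
  using has_derivative_imp_partial[where x = x and t = 0 and i = j and S = UNIV,
    OF _ UNIV_I] fourier_integral_has_derivative[OF assms, of a x]
  by (intro partial_deriv_eqI) auto
 then show "partial_deriv j (fourier_integral M a p) x = fourier_integral M a (\<lambda>\<xi>. (\<i> * of_real a) * of_real (\<xi> $ j) * p \<xi>) x"
  by (simp add: fourier_integral_def inner_axis mult_ac)
qed

lemma partial_derivs_fourier_integral:
 assumes "moments M p"
 shows "\<exists>q. moments M q \<and> partial_derivs js (fourier_integral M a p) = fourier_integral M a q"
proof (induction js)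
 case Nil
 then show ?case using assms by auto
next
 case (Cons j js)
 then show ?case
  using partial_deriv_fourier_integral moments_mult_coordinate unfolding partial_derivs_Cons by metis
qed

text \<open>A derivative of a transform is the transform of a function that again has all moments.\<close>

lemma smooth_fourier_integral:
 assumes "moments M p" shows "directions.smooth UNIV UNIV (fourier_integral M a p)"
 unfolding directions.smooth_def[OF directions_UNIV]
proof (intro allI impI)
 fix js :: "'n list"
 obtain q where q: "moments M q" "partial_derivs js (fourier_integral M a p) = fourier_integral M a q"
  using partial_derivs_fourier_integral[OF assms] by blast
 have "fourier_integral M a q differentiable at x" for x
  using fourier_integral_has_derivative[OF q(1)] unfolding differentiable_def by blast
 then show "partial_derivs js (fourier_integral M a p) differentiable_on UNIV"
  by (simp add: q differentiable_on_def)
qed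

end

text \<open>
 All interchanges of integrals over the group and over the dual group are of the following form,
 with the unimodular kernel \<open>k\<close> a character.
\<close>

lemma fubini_kernel:
 fixes u :: "'a => complex" and v :: "'b => complex" and k :: "'a => 'b => complex"
 assumes "sigma_finite_measure M" "sigma_finite_measure N"
  and u: "integrable M u" and v: "integrable N v"
  and k [measurable]: "(\<lambda>(x, y). k x y) \<in> borel_measurable (M \<Otimes>\<^sub>M N)"
  and bound: "\<And>x y. norm (k x y) \<le> 1"
 shows "(\<integral>x. u x * (\<integral>y. v y * k x y \<partial>N) \<partial>M) = (\<integral>y. v y * (\<integral>x. u x * k x y \<partial>M) \<partial>N)"
proof -
 interpret pair_sigma_finite M N using assms by (simp add: pair_sigma_finite_def)
 note [measurable] = borel_measurable_integrable[OF u] borel_measurable_integrable[OF v]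
 have b: "norm (u x * v y * k x y) \<le> norm (u x) * norm (v y)" for x y
  using mult_left_mono[OF bound[of x y], of "norm (u x) * norm (v y)"] by (simp add: norm_mult)
 have "integrable (M \<Otimes>\<^sub>M N) (\<lambda>(x, y). norm (u x) * norm (v y))"
  using u v by (intro Fubini_integrable) auto
 then have int: "integrable (M \<Otimes>\<^sub>M N) (\<lambda>(x, y). u x * v y * k x y)"
  by (rule Bochner_Integration.integrable_bound) (use b in \<open>auto intro!: AE_I2\<close>)
 have "(\<integral>x. u x * (\<integral>y. v y * k x y \<partial>N) \<partial>M) = (\<integral>x. (\<integral>y. u x * v y * k x y \<partial>N) \<partial>M)"
  by (simp add: mult.assoc)
 also have "\<dots> = (\<integral>y. (\<integral>x. u x * v y * k x y \<partial>M) \<partial>N)"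
  using Fubini_integral[OF int] by simp
 also have "\<dots> = (\<integral>y. v y * (\<integral>x. u x * k x y \<partial>M) \<partial>N)"
  by (simp add: mult_ac flip: integral_mult_right_zero)
 finally show ?thesis .
qed

section \<open>Schwartz functions\<close>

interpretation everywhere: directions UNIV UNIV
 by (rule directions_UNIV)

lemma schwartz_iff:
 "\<phi> \<in> schwartz \<Gamma> \<longleftrightarrow> periodic \<Gamma> \<phi> \<and> everywhere.smooth \<phi> \<and>
  (\<forall>js k. \<exists>B. \<forall>x. (1 + norm (line_part \<Gamma> x)) ^ k * norm (partial_derivs js \<phi> x) \<le> B)"
proof -
 have "bounded (range (\<lambda>x. (1 + norm (line_part \<Gamma> x)) ^ k * norm (partial_derivs js \<phi> x))) \<longleftrightarrow>
  (\<exists>B. \<forall>x. (1 + norm (line_part \<Gamma> x)) ^ k * norm (partial_derivs js \<phi> x) \<le> B)" for k js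
  by (auto simp: bounded_iff abs_mult)
 then show ?thesis by (auto simp: schwartz_def everywhere.smooth_def)
qed

context
 fixes \<Gamma> :: "'n::finite => factor"
begin

lemma schwartz_smooth: "\<phi> \<in> schwartz \<Gamma> ==> everywhere.smooth \<phi>"
 by (simp add: schwartz_iff)

lemma schwartz_periodic: "\<phi> \<in> schwartz \<Gamma> ==> periodic \<Gamma> \<phi>"
 by (simp add: schwartz_iff)

lemma schwartz_measurable: "\<phi> \<in> schwartz \<Gamma> ==> \<phi> \<in> borel_measurable borel"
 using everywhere.smooth_continuous[OF schwartz_smooth]
 by (intro borel_measurable_continuous_onI) auto

lemma schwartz_bound:
 assumes "\<phi> \<in> schwartz \<Gamma>"
 obtains B where "B > 0" "\<And>x. (1 + norm (line_part \<Gamma> x)) ^ k * norm (partial_derivs js \<phi> x) \<le> B"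
proof -
 obtain B where B: "\<And>x. (1 + norm (line_part \<Gamma> x)) ^ k * norm (partial_derivs js \<phi> x) \<le> B"
  using assms unfolding schwartz_iff by blast
 have "(1 + norm (line_part \<Gamma> x)) ^ k * norm (partial_derivs js \<phi> x) \<le> max B 1" for x
  using B[of x] by linarith
 then show ?thesis using that[of "max B 1"] by auto
qed

lemma periodic_partial_deriv:
 assumes "periodic \<Gamma> \<phi>" shows "periodic \<Gamma> (partial_deriv j \<phi>)"
 unfolding periodic_def
proof (intro allI impI)
 fix i l x assume "\<Gamma> i = Circle l"
 then have "\<phi> (x + t *\<^sub>R axis j 1 + l *\<^sub>R axis i 1) = \<phi> (x + t *\<^sub>R axis j 1)" for t
  using assms by (simp add: periodic_def)
 then have "\<phi> (x + l *\<^sub>R axis i 1 + t *\<^sub>R axis j 1) = \<phi> (x + t *\<^sub>R axis j 1)" for t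
  by (simp only: add.assoc add.commute[of "l *\<^sub>R axis i 1"])
 then show "partial_deriv j \<phi> (x + l *\<^sub>R axis i 1) = partial_deriv j \<phi> x"
  by (simp add: partial_deriv_def)
qed

lemma schwartz_partial_deriv:
 assumes "\<phi> \<in> schwartz \<Gamma>" shows "partial_deriv j \<phi> \<in> schwartz \<Gamma>"
 using assms
 by (auto simp: schwartz_iff periodic_partial_deriv everywhere.smooth_partial_deriv
   simp flip: partial_derivs_snoc)

lemma schwartz_partial_derivs: "\<phi> \<in> schwartz \<Gamma> ==> partial_derivs js \<phi> \<in> schwartz \<Gamma>"
 by (induction js) (auto simp: partial_derivs_Cons schwartz_partial_deriv)

lemma schwartz_cmult:
 assumes "\<phi> \<in> schwartz \<Gamma>" shows "(\<lambda>x. c * \<phi> x) \<in> schwartz \<Gamma>"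
proof -
 have "\<exists>B. \<forall>x. (1 + norm (line_part \<Gamma> x)) ^ k * norm (partial_derivs js (\<lambda>x. c * \<phi> x) x) \<le> B" for js k
 proof -
  obtain B where B: "\<And>x. (1 + norm (line_part \<Gamma> x)) ^ k * norm (partial_derivs js \<phi> x) \<le> B"
   using schwartz_bound[OF assms] by blast
  have "(1 + norm (line_part \<Gamma> x)) ^ k * norm (partial_derivs js (\<lambda>x. c * \<phi> x) x) \<le> norm c * B" for x
   using mult_left_mono[OF B[of x], of "norm c"] schwartz_smooth[OF assms]
   by (simp add: everywhere.partial_derivs_cmult norm_mult mult_ac)
  then show ?thesis by blast
 qed
 then show ?thesis
  using assms everywhere.smooth_mult[OF everywhere.smooth_const schwartz_smooth[OF assms]]
  by (auto simp: schwartz_iff periodic_def)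
qed

lemma schwartz_add:
 assumes "\<phi> \<in> schwartz \<Gamma>" "\<psi> \<in> schwartz \<Gamma>" shows "(\<lambda>x. \<phi> x + \<psi> x) \<in> schwartz \<Gamma>"
proof -
 have "\<exists>B. \<forall>x. (1 + norm (line_part \<Gamma> x)) ^ k * norm (partial_derivs js (\<lambda>x. \<phi> x + \<psi> x) x) \<le> B" for js k
 proof -
  obtain B where B: "\<And>x. (1 + norm (line_part \<Gamma> x)) ^ k * norm (partial_derivs js \<phi> x) \<le> B"
   using schwartz_bound[OF assms(1)] by blast
  obtain B' where B': "\<And>x. (1 + norm (line_part \<Gamma> x)) ^ k * norm (partial_derivs js \<psi> x) \<le> B'"
   using schwartz_bound[OF assms(2)] by blast
  have "(1 + norm (line_part \<Gamma> x)) ^ k * norm (partial_derivs js (\<lambda>x. \<phi> x + \<psi> x) x) \<le> B + B'" for x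
  proof -
   have "(1 + norm (line_part \<Gamma> x)) ^ k * norm (partial_derivs js (\<lambda>x. \<phi> x + \<psi> x) x)
    \<le> (1 + norm (line_part \<Gamma> x)) ^ k * (norm (partial_derivs js \<phi> x) + norm (partial_derivs js \<psi> x))"
    using assms by (intro mult_left_mono) (auto simp: everywhere.partial_derivs_add schwartz_smooth norm_triangle_ineq)
   then show ?thesis using B[of x] B'[of x] by (simp add: distrib_left)
  qed
  then show ?thesis by blast
 qed
 then show ?thesis
  using assms everywhere.smooth_add[of \<phi> \<psi>] by (auto simp: schwartz_iff periodic_def)
qed

lemma schwartz_diff:
 assumes "\<phi> \<in> schwartz \<Gamma>" "\<psi> \<in> schwartz \<Gamma>" shows "(\<lambda>x. \<phi> x - \<psi> x) \<in> schwartz \<Gamma>"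
 using schwartz_add[OF assms(1) schwartz_cmult[OF assms(2), of "-1"]] by simp

lemma partial_derivs_cnj:
 assumes "everywhere.smooth \<phi>"
 shows "partial_derivs js (\<lambda>x. cnj (\<phi> x)) = (\<lambda>x. cnj (partial_derivs js \<phi> x))"
proof (induction js)
 case (Cons j js)
 have "partial_deriv j (\<lambda>x. cnj (partial_derivs js \<phi> x)) x = cnj (partial_deriv j (partial_derivs js \<phi>) x)" for x
  using assms
  by (intro partial_deriv_eqI has_vector_derivative_cnj everywhere.partial_deriv_vector_derivative_0)
   (auto simp: everywhere.smooth_def)
 then show ?case by (simp add: partial_derivs_Cons Cons)
qed simp

lemma schwartz_cnj:
 assumes "\<phi> \<in> schwartz \<Gamma>" shows "(\<lambda>x. cnj (\<phi> x)) \<in> schwartz \<Gamma>"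
proof -
 have "everywhere.smooth (\<lambda>x. cnj (\<phi> x))"
  using schwartz_smooth[OF assms] partial_derivs_cnj[OF schwartz_smooth[OF assms]]
  by (simp add: everywhere.smooth_def differentiable_on_def differentiable_cnj_iff)
 then show ?thesis
  using assms partial_derivs_cnj[OF schwartz_smooth[OF assms]] by (auto simp: schwartz_iff periodic_def)
qed

lemma finite_short_lists: "finite {js :: 'n list. length js \<le> N}"
 using finite_lists_length_le[of "UNIV :: 'n set" N] by simp

text \<open>Only finitely many derivatives enter a seminorm, and each of them decays rapidly, so the supremum is
 over a bounded set.\<close>

lemma schwartz_seminorm_upper:
 assumes "\<phi> \<in> schwartz \<Gamma>" "length js \<le> N"
 shows "(1 + norm (line_part \<Gamma> x)) ^ N * norm (partial_derivs js \<phi> x) \<le> schwartz_seminorm \<Gamma> N \<phi>"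
proof -
 have "\<forall>js. \<exists>B. \<forall>x. (1 + norm (line_part \<Gamma> x)) ^ N * norm (partial_derivs js \<phi> x) \<le> B"
  using assms unfolding schwartz_iff by blast
 then obtain B where B: "\<And>js x. (1 + norm (line_part \<Gamma> x)) ^ N * norm (partial_derivs js \<phi> x) \<le> B js"
  by metis
 have "bdd_above ((\<lambda>(js, x). (1 + norm (line_part \<Gamma> x)) ^ N * norm (partial_derivs js \<phi> x)) `
   ({js. length js \<le> N} \<times> UNIV))"
 proof (rule bdd_aboveI2)
  fix z :: "'n list \<times> (real ^ 'n)" assume z: "z \<in> {js. length js \<le> N} \<times> UNIV"
  show "(case z of (js, x) => (1 + norm (line_part \<Gamma> x)) ^ N * norm (partial_derivs js \<phi> x))
    \<le> Max (B ` {js. length js \<le> N})"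
   using B[of "snd z" "fst z"] Max_ge[of "B ` {js. length js \<le> N}" "B (fst z)"] z finite_short_lists[of N]
   by (auto simp: case_prod_beta intro: order_trans)
 qed
 then show ?thesis
  unfolding schwartz_seminorm_def using assms(2) by (intro cSUP_upper2[where x = "(js, x)"]) auto
qed

lemma schwartz_seminorm_least:
 assumes "\<And>js x. length js \<le> N ==> (1 + norm (line_part \<Gamma> x)) ^ N * norm (partial_derivs js \<phi> x) \<le> \<epsilon>"
 shows "schwartz_seminorm \<Gamma> N \<phi> \<le> \<epsilon>"
 unfolding schwartz_seminorm_def
proof (rule cSUP_least)
 show "{js. length js \<le> N} \<times> (UNIV :: (real ^ 'n) set) \<noteq> {}" by (auto intro: exI[of _ "[]"])
qed (use assms in auto)

end

section \<open>Integrals over the group\<close>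

lemma integrable_inverse_1_plus_square_UNIV: "integrable lborel (\<lambda>t::real. inverse (1 + t\<^sup>2))"
 using integrable_inverse_1_plus_square by (simp add: set_integrable_def)

interpretation lborel_vec: borel_measure "lborel :: (real ^ 'n::finite) measure"
 by unfold_locales simp

context
 fixes \<Gamma> :: "'n::finite => factor"
begin

definition group_weight :: "real ^ 'n => real" where
 "group_weight x = (\<Prod>i\<in>UNIV. case \<Gamma> i of Line => inverse (1 + (x $ i)\<^sup>2) | Circle l => indicator {0..<l} (x $ i))"

lemma indicator_fundamental_domain:
 "indicator (fundamental_domain \<Gamma>) x
  = (\<Prod>i\<in>UNIV. case \<Gamma> i of Line => 1 | Circle l => (indicator {0..<l} (x $ i) :: real))"
proof (cases "x \<in> fundamental_domain \<Gamma>")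
 case True
 then show ?thesis by (auto simp: fundamental_domain_def intro!: prod.neutral split: factor.split)
next
 case False
 then obtain i l where "\<Gamma> i = Circle l" "x $ i \<notin> {0..<l}"
  by (auto simp: fundamental_domain_def not_le)
 then show ?thesis using False by (auto intro!: prod_zero exI[of _ i])
qed

lemma fundamental_domain_borel [measurable]: "fundamental_domain \<Gamma> \<in> sets borel"
proof -
 have "fundamental_domain \<Gamma> = {x. (\<Prod>i\<in>UNIV. case \<Gamma> i of Line => 1 | Circle l => indicator {0..<l} (x $ i)) = (1::real)}"
  by (simp flip: indicator_fundamental_domain) (simp add: indicator_def)
 moreover have "(\<lambda>x::real^'n. \<Prod>i\<in>UNIV. case \<Gamma> i of Line => 1 | Circle l => (indicator {0..<l} (x $ i) :: real)) \<in> borel_measurable borel"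
 proof (rule borel_measurable_prod)
  fix i show "(\<lambda>x::real^'n. case \<Gamma> i of Line => 1 | Circle l => (indicator {0..<l} (x $ i) :: real)) \<in> borel_measurable borel"
   by (cases "\<Gamma> i") simp_all
 qed
 ultimately show ?thesis by simp
qed

lemma line_part_component: "\<Gamma> i = Line ==> \<bar>x $ i\<bar> \<le> norm (line_part \<Gamma> x)"
 using component_le_norm_cart[of "line_part \<Gamma> x" i] by (simp add: line_part_def)

lemma group_weight_nonneg: "0 \<le> group_weight x"
 unfolding group_weight_def by (intro prod_nonneg ballI) (auto split: factor.split)

lemma indicator_le_group_weight:
 "indicator (fundamental_domain \<Gamma>) x \<le> (1 + norm (line_part \<Gamma> x)) ^ (2 * CARD('n)) * group_weight x"
proof -
 let ?r = "1 + norm (line_part \<Gamma> x)"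
 have "indicator (fundamental_domain \<Gamma>) x
   \<le> (\<Prod>i\<in>UNIV. ?r\<^sup>2 * (case \<Gamma> i of Line => inverse (1 + (x $ i)\<^sup>2) | Circle l => indicator {0..<l} (x $ i)))"
  unfolding indicator_fundamental_domain
 proof (rule prod_mono, safe)
  fix i
  show "0 \<le> (case \<Gamma> i of Line => 1 | Circle l => (indicator {0..<l} (x $ i) :: real))"
   by (auto split: factor.split)
  show "(case \<Gamma> i of Line => 1 | Circle l => indicator {0..<l} (x $ i))
   \<le> ?r\<^sup>2 * (case \<Gamma> i of Line => inverse (1 + (x $ i)\<^sup>2) | Circle l => indicator {0..<l} (x $ i))"
  proof (cases "\<Gamma> i")
   case Line
   have "(1 + \<bar>x $ i\<bar>)\<^sup>2 \<le> ?r\<^sup>2"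
    using line_part_component[OF Line, of x] by (intro power_mono) auto
   moreover have "1 + (x $ i)\<^sup>2 \<le> (1 + \<bar>x $ i\<bar>)\<^sup>2" by (simp add: power2_sum)
   ultimately have "1 + (x $ i)\<^sup>2 \<le> ?r\<^sup>2" by linarith
   moreover have "1 + (x $ i)\<^sup>2 > 0" by (simp add: add_pos_nonneg)
   ultimately show ?thesis using Line by (simp add: field_simps)
  next
   case (Circle l)
   have "1 \<le> ?r\<^sup>2" by simp
   then show ?thesis using Circle by (simp add: indicator_def)
  qed
 qed
 also have "\<dots> = ?r ^ (2 * CARD('n)) * group_weight x"
  by (simp add: prod.distrib group_weight_def power_mult)
 finally show ?thesis .
qed

lemma integrable_group_weight: "integrable lborel group_weight"
proof -
 let ?f = "\<lambda>i t. case \<Gamma> i of Line => inverse (1 + t\<^sup>2) | Circle l => (indicator {0..<l} t :: real)"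
 have "integrable (vec_measure (\<lambda>i::'n. lborel)) (\<lambda>x. \<Prod>i\<in>UNIV. ?f i (x $ i))"
 proof (rule lborel_coords.integrable_vec_prod)
  fix i
  show "?f i \<in> borel_measurable borel" by (cases "\<Gamma> i") auto
  show "integrable lborel (?f i)"
  proof (cases "\<Gamma> i")
   case (Circle l)
   have "emeasure lborel {0..<l} < \<infinity>" by (cases "0 \<le> l") auto
   then show ?thesis using Circle by (auto intro!: integrable_real_indicator)
  qed (simp add: integrable_inverse_1_plus_square_UNIV)
 qed
 then show ?thesis by (simp add: lborel_vec group_weight_def[abs_def])
qed

lemma
 fixes f :: "real ^ 'n => complex"
 assumes [measurable]: "f \<in> borel_measurable borel"
  and B: "\<And>x. (1 + norm (line_part \<Gamma> x)) ^ (2 * CARD('n)) * norm (f x) \<le> B"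
 shows integrable_decay: "integrable lborel (\<lambda>x. indicator (fundamental_domain \<Gamma>) x *\<^sub>R f x)"
  and integral_decay: "(LBINT x. norm (indicator (fundamental_domain \<Gamma>) x *\<^sub>R f x)) \<le> B * (LBINT x. group_weight x)"
proof -
 have le: "norm (indicator (fundamental_domain \<Gamma>) x *\<^sub>R f x) \<le> B * group_weight x" for x
 proof -
  have "norm (indicator (fundamental_domain \<Gamma>) x *\<^sub>R f x)
    \<le> ((1 + norm (line_part \<Gamma> x)) ^ (2 * CARD('n)) * group_weight x) * norm (f x)"
   using indicator_le_group_weight[of x] by (simp add: mult_right_mono)
  also have "\<dots> \<le> B * group_weight x"
   using mult_right_mono[OF B[of x] group_weight_nonneg[of x]] by (simp only: mult_ac)
  finally show ?thesis .
 qed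
 have i: "integrable lborel (\<lambda>x. B * group_weight x)"
  by (intro integrable_mult_right integrable_group_weight)
 show 1: "integrable lborel (\<lambda>x. indicator (fundamental_domain \<Gamma>) x *\<^sub>R f x)"
  by (rule Bochner_Integration.integrable_bound[OF i]) (use le in \<open>auto intro!: AE_I2 intro: order_trans[OF _ abs_ge_self]\<close>)
 have "(LBINT x. norm (indicator (fundamental_domain \<Gamma>) x *\<^sub>R f x)) \<le> (LBINT x. B * group_weight x)"
  by (intro integral_mono integrable_norm 1 i le)
 then show "(LBINT x. norm (indicator (fundamental_domain \<Gamma>) x *\<^sub>R f x)) \<le> B * (LBINT x. group_weight x)"
  by simp
qed

lemma integrable_schwartz:
 assumes "\<phi> \<in> schwartz \<Gamma>"
 shows "integrable lborel (\<lambda>x. indicator (fundamental_domain \<Gamma>) x *\<^sub>R \<phi> x)"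
proof -
 obtain B where "\<And>x. (1 + norm (line_part \<Gamma> x)) ^ (2 * CARD('n)) * norm (partial_derivs [] \<phi> x) \<le> B"
  using schwartz_bound[OF assms] by blast
 then show ?thesis by (intro integrable_decay schwartz_measurable[OF assms]) auto
qed

lemma fundamental_domain_norm:
 obtains K where "K \<ge> 1" "\<And>x. x \<in> fundamental_domain \<Gamma> ==> norm x \<le> K * (1 + norm (line_part \<Gamma> x))"
proof -
 let ?l = "\<lambda>i. case \<Gamma> i of Line => 0 | Circle l => \<bar>l\<bar>"
 let ?K = "1 + real CARD('n) + (\<Sum>i\<in>UNIV. ?l i)"
 have l: "?l i \<ge> 0" for i by (auto split: factor.split)
 have s: "0 \<le> (\<Sum>i\<in>UNIV. ?l i)" by (intro sum_nonneg l)
 have "norm x \<le> ?K * (1 + norm (line_part \<Gamma> x))" if x: "x \<in> fundamental_domain \<Gamma>" for x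
 proof -
  have "\<bar>x $ i\<bar> \<le> norm (line_part \<Gamma> x) + ?l i" for i
  proof (cases "\<Gamma> i")
   case (Circle l)
   then have "0 \<le> x $ i" "x $ i < l" using x by (auto simp: fundamental_domain_def)
   then have "\<bar>x $ i\<bar> \<le> \<bar>l\<bar>" by linarith
   then show ?thesis using Circle by (simp add: add_increasing)
  qed (simp add: line_part_component)
  then have "norm x \<le> (\<Sum>i\<in>UNIV. norm (line_part \<Gamma> x) + ?l i)"
   by (intro order_trans[OF norm_le_l1_cart] sum_mono)
  also have "\<dots> = real CARD('n) * norm (line_part \<Gamma> x) + (\<Sum>i\<in>UNIV. ?l i)"
   by (simp add: sum.distrib)
  also have "\<dots> \<le> ?K * (1 + norm (line_part \<Gamma> x))"
   using s by (simp add: algebra_simps)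
  finally show ?thesis .
 qed
 then show ?thesis using s that[of ?K] by auto
qed

lemma moments_schwartz:
 assumes "\<phi> \<in> schwartz \<Gamma>"
 shows "moments lborel (\<lambda>x. indicator (fundamental_domain \<Gamma>) x *\<^sub>R \<phi> x)"
 unfolding moments_def
proof (intro conjI allI)
 note [measurable] = schwartz_measurable[OF assms]
 show "(\<lambda>x. indicator (fundamental_domain \<Gamma>) x *\<^sub>R \<phi> x) \<in> borel_measurable borel" by measurable
 fix k
 obtain K where K: "K \<ge> 1" "\<And>x. x \<in> fundamental_domain \<Gamma> ==> norm x \<le> K * (1 + norm (line_part \<Gamma> x))"
  using fundamental_domain_norm by blast
 obtain B where B: "\<And>x. (1 + norm (line_part \<Gamma> x)) ^ (2 * CARD('n) + k) * norm (partial_derivs [] \<phi> x) \<le> B"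
  using schwartz_bound[OF assms] by blast
 let ?f = "\<lambda>x. (1 + norm (line_part \<Gamma> x)) ^ k * norm (\<phi> x)"
 have [measurable]: "(\<lambda>x. line_part \<Gamma> x) \<in> borel_measurable borel"
 proof (intro borel_measurable_continuous_onI)
  have "continuous_on UNIV (\<lambda>x::real^'n. if \<Gamma> i = Line then x $ i else 0)" for i
   by (cases "\<Gamma> i = Line") (auto intro!: continuous_intros)
  then show "continuous_on UNIV (\<lambda>x. line_part \<Gamma> x)"
   unfolding line_part_def by (intro continuous_on_vec_lambda)
 qed
 have i: "integrable lborel (\<lambda>x. indicator (fundamental_domain \<Gamma>) x *\<^sub>R complex_of_real (?f x))"
  by (rule integrable_decay[where B = B], measurable)
   (use B in \<open>simp add: power_add mult_ac norm_mult norm_power abs_mult flip: of_real_add of_real_power of_real_mult\<close>)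
 have i': "integrable lborel (\<lambda>x. K ^ k * norm (indicator (fundamental_domain \<Gamma>) x *\<^sub>R complex_of_real (?f x)))"
  by (intro integrable_mult_right integrable_norm i)
 show "integrable lborel (\<lambda>x. norm x ^ k * norm (indicator (fundamental_domain \<Gamma>) x *\<^sub>R \<phi> x))"
 proof (rule Bochner_Integration.integrable_bound[OF i'])
  have "norm x ^ k * norm (\<phi> x) \<le> K ^ k * ?f x" if "x \<in> fundamental_domain \<Gamma>" for x
   using mult_right_mono[OF power_mono[OF K(2)[OF that] norm_ge_zero, of k], of "norm (\<phi> x)"]
   by (simp add: power_mult_distrib mult_ac)
  then show "AE x in lborel. norm (norm x ^ k * norm (indicator (fundamental_domain \<Gamma>) x *\<^sub>R \<phi> x))
    \<le> norm (K ^ k * norm (indicator (fundamental_domain \<Gamma>) x *\<^sub>R complex_of_real (?f x)))"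
   using K(1) by (intro AE_I2) (auto simp: indicator_def norm_mult norm_power abs_mult
     simp del: of_real_mult of_real_power of_real_add)
 qed measurable
qed

end

section \<open>Test functions on the dual group and their transforms\<close>

lemma difference_quotient_LIMSEQ:
 fixes f :: "real => complex"
 assumes "(f has_vector_derivative d) (at 0)"
 shows "(\<lambda>n. (f (1 / Suc n) - f 0) * of_real (Suc n)) \<longlonglongrightarrow> d"
proof -
 have "(\<lambda>h. norm (f (0 + h) - f 0 - h *\<^sub>R d) / norm h) \<midarrow>0\<rightarrow> 0"
  using assms unfolding has_vector_derivative_def has_derivative_at by blast
 moreover have "filterlim (\<lambda>n. 1 / real (Suc n)) (at 0) sequentially"
  using LIMSEQ_Suc[OF lim_1_over_n] by (auto simp: filterlim_at)
 ultimately have "(\<lambda>n. norm (f (0 + 1 / Suc n) - f 0 - (1 / Suc n) *\<^sub>R d) / norm (1 / Suc n)) \<longlonglongrightarrow> 0"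
  by (rule filterlim_compose)
 moreover have "norm (f (0 + 1 / Suc n) - f 0 - (1 / Suc n) *\<^sub>R d) / norm (1 / Suc n)
   = norm ((f (1 / Suc n) - f 0) * of_real (Suc n) - d)" for n
 proof -
  have "(f (1 / Suc n) - f 0) * of_real (Suc n) - d
    = (f (0 + 1 / Suc n) - f 0 - (1 / Suc n) *\<^sub>R d) * of_real (Suc n)"
   by (simp add: algebra_simps scaleR_conv_of_real del: of_nat_Suc)
  then show ?thesis by (simp add: norm_mult del: of_nat_Suc)
 qed
 ultimately have "(\<lambda>n. norm ((f (1 / Suc n) - f 0) * of_real (Suc n) - d)) \<longlonglongrightarrow> 0"
  by (simp only:)
 from tendsto_norm_zero_cancel[OF this] show ?thesis by (rule LIM_zero_cancel)
qed

context product_group begin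

abbreviation (input) S :: "(real ^ 'n) set" where "S \<equiv> dual_group \<Gamma>"
abbreviation (input) FD :: "(real ^ 'n) set" where "FD \<equiv> fundamental_domain \<Gamma>"
abbreviation (input) tests :: "(real ^ 'n => complex) set" where "tests \<equiv> dual_test_functions \<Gamma>"
abbreviation (input) lines :: "'n set" where "lines \<equiv> {i. \<Gamma> i = Line}"
abbreviation (input) m :: "(real ^ 'n) measure" where "m \<equiv> dual_borel \<Gamma>"

sublocale dual_borel: borel_measure "dual_borel \<Gamma>"
 by unfold_locales (rule sets_dual_borel)

sublocale along: directions "{i. \<Gamma> i = Line}" "dual_group \<Gamma>"
proof
 fix x i t assume "x \<in> S" "i \<in> lines"
 then show "x + t *\<^sub>R axis i 1 \<in> S"
  unfolding dual_group_def by (auto simp: axis_def)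
qed

lemma dual_test_iff: "\<psi> \<in> tests \<longleftrightarrow>
  along.smooth \<psi> \<and> (\<exists>R. \<forall>\<xi>\<in>S. norm \<xi> > R \<longrightarrow> \<psi> \<xi> = 0)"
 by (auto simp: dual_test_functions_def along.smooth_def subset_iff)

text \<open>Functions on the dual group are arbitrary elsewhere; extended by zero they can be integrated and
 tested for measurability on the whole space.\<close>

definition zero_ext :: "(real ^ 'n => complex) => real ^ 'n => complex" where
 "zero_ext \<psi> \<xi> = indicator (dual_group \<Gamma>) \<xi> *\<^sub>R \<psi> \<xi>"

lemma integral_dual_measure:
 fixes f :: "real ^ 'n => complex"
 shows "(\<integral>\<xi>. f \<xi> \<partial>dual_measure \<Gamma>) = (\<integral>\<xi>. zero_ext f \<xi> \<partial>m)"
 by (simp add: dual_measure_eq integral_restrict_space zero_ext_def)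

text \<open>The dual measure is the restriction of \<open>dual_borel \<Gamma>\<close> to the dual group.\<close>

lemma integrable_dual_measure:
 fixes f :: "real ^ 'n => complex"
 shows "integrable (dual_measure \<Gamma>) f \<longleftrightarrow> integrable m (zero_ext f)"
 by (simp add: dual_measure_eq integrable_restrict_space zero_ext_def[abs_def])

lemma borel_measurable_dual_measure:
 fixes f :: "real ^ 'n => complex"
 shows "f \<in> borel_measurable (dual_measure \<Gamma>) \<longleftrightarrow> zero_ext f \<in> borel_measurable borel"
 by (simp add: dual_measure_eq borel_measurable_restrict_space_iff zero_ext_def[abs_def] cong: measurable_cong_sets)

lemma dual_fourier_integral_eq:
 "dual_fourier_integral \<Gamma> \<psi> x = fourier_const \<Gamma> * fourier_integral m (- 2 * pi) (zero_ext \<psi>) x"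
 unfolding dual_fourier_integral_def integral_dual_measure fourier_integral_def
 by (simp add: zero_ext_def[abs_def])

lemma test_bounded:
 assumes "\<psi> \<in> tests"
 obtains B R where "B > 0" "R > 0" "\<And>\<xi>. \<xi> \<in> S ==> norm (\<psi> \<xi>) \<le> B" "\<And>\<xi>. \<xi> \<in> S ==> norm \<xi> > R ==> \<psi> \<xi> = 0"
proof -
 obtain R where R: "\<And>\<xi>. \<xi> \<in> S ==> norm \<xi> > R ==> \<psi> \<xi> = 0"
  using assms unfolding dual_test_iff by blast
 have "compact (\<psi> ` (S \<inter> cball 0 R))"
  using along.smooth_continuous[of \<psi>] assms dual_group_closed
  by (intro compact_continuous_image closed_Int_compact) (auto simp: dual_test_iff intro: continuous_on_subset)
 then obtain B where "\<forall>z\<in>\<psi> ` (S \<inter> cball 0 R). norm z \<le> B"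
  using compact_imp_bounded[of "\<psi> ` (S \<inter> cball 0 R)"] unfolding bounded_iff by blast
 then have B: "\<And>\<xi>. \<xi> \<in> S ==> norm \<xi> \<le> R ==> norm (\<psi> \<xi>) \<le> B"
  by simp
 have "norm (\<psi> \<xi>) \<le> max B 1" if "\<xi> \<in> S" for \<xi>
  using B[OF that] R[OF that] by (cases "norm \<xi> \<le> R") auto
 then show ?thesis using R that[of "max B 1" "max R 1"] by auto
qed

lemma zero_ext_measurable:
 assumes "continuous_on S \<psi>" shows "zero_ext \<psi> \<in> borel_measurable borel"
 unfolding zero_ext_def[abs_def]
 using borel_measurable_continuous_on_indicator[OF dual_group_borel assms] by simp

lemma integrable_bounded_support:
 fixes f :: "real ^ 'n => complex"
 assumes [measurable]: "f \<in> borel_measurable borel"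
  and "\<And>\<xi>. norm (f \<xi>) \<le> B" "\<And>\<xi>. norm \<xi> > R ==> f \<xi> = 0"
 shows "integrable m f"
proof (rule Bochner_Integration.integrable_bound)
 show "integrable m (\<lambda>\<xi>. B * indicator (cball 0 R) \<xi>)"
  using emeasure_dual_bounded[of "cball 0 R"] by (intro integrable_mult_right integrable_real_indicator) auto
 have "0 \<le> B" using assms(2) norm_ge_zero order_trans by blast
 then show "AE \<xi> in m. norm (f \<xi>) \<le> norm (B * indicator (cball 0 R) \<xi>)"
  using assms(2,3) by (intro AE_I2) (auto simp: indicator_def not_le)
qed measurable

lemma moments_test:
 assumes "\<psi> \<in> tests" shows "moments m (zero_ext \<psi>)"
 unfolding moments_def
proof (intro conjI allI)
 show [measurable]: "zero_ext \<psi> \<in> borel_measurable borel"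
  using assms by (intro zero_ext_measurable along.smooth_continuous) (simp add: dual_test_iff)
 fix k
 obtain B R where BR: "B > 0" "R > 0" "\<And>\<xi>. \<xi> \<in> S ==> norm (\<psi> \<xi>) \<le> B" "\<And>\<xi>. \<xi> \<in> S ==> norm \<xi> > R ==> \<psi> \<xi> = 0"
  using test_bounded[OF assms] by blast
 have "integrable m (\<lambda>\<xi>. of_real (norm \<xi> ^ k) * zero_ext \<psi> \<xi>)"
 proof (rule integrable_bounded_support)
  fix \<xi> :: "real ^ 'n"
  show "norm (of_real (norm \<xi> ^ k) * zero_ext \<psi> \<xi>) \<le> R ^ k * B"
   using BR by (cases "\<xi> \<in> S"; cases "norm \<xi> \<le> R")
    (auto simp: zero_ext_def norm_mult norm_power intro!: mult_mono power_mono)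
  show "of_real (norm \<xi> ^ k) * zero_ext \<psi> \<xi> = 0" if "norm \<xi> > R"
   using BR that by (auto simp: zero_ext_def indicator_def)
 qed measurable
 from integrable_norm[OF this] show "integrable m (\<lambda>\<xi>. norm \<xi> ^ k * norm (zero_ext \<psi> \<xi>))"
  by (simp add: norm_mult norm_power)
qed

lemma test_mult:
 assumes "along.smooth \<theta>" "\<psi> \<in> tests"
 shows "(\<lambda>\<xi>. \<theta> \<xi> * \<psi> \<xi>) \<in> tests"
 using assms along.smooth_mult[of \<theta> \<psi>] unfolding dual_test_iff by fastforce

lemma test_coordinate:
 assumes "\<psi> \<in> tests"
 shows "(\<lambda>\<xi>. c * of_real (\<xi> $ j) * \<psi> \<xi>) \<in> tests"
 by (intro test_mult assms along.smooth_mult along.smooth_const along.smooth_coordinate)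

lemma test_partial_deriv:
 assumes "\<psi> \<in> tests" and j: "\<Gamma> j = Line"
 shows "partial_deriv j \<psi> \<in> tests"
proof -
 obtain R where R: "\<And>\<xi>. \<xi> \<in> S ==> norm \<xi> > R ==> \<psi> \<xi> = 0"
  using assms unfolding dual_test_iff by blast
 have "partial_deriv j \<psi> \<xi> = 0" if \<xi>: "\<xi> \<in> S" "norm \<xi> > R + 1" for \<xi>
 proof (rule partial_deriv_eqI)
  have "norm \<xi> \<le> norm (\<xi> + u *\<^sub>R axis j 1) + \<bar>u\<bar>" for u
   using norm_triangle_ineq4[of "\<xi> + u *\<^sub>R axis j 1" "u *\<^sub>R axis j 1"] by (simp add: norm_axis_1)
  then have "\<psi> (\<xi> + u *\<^sub>R axis j 1) = 0" if "\<bar>u\<bar> < 1" for u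
   using that \<xi> j by (intro R along.shift) (auto, smt (verit, best))
  then show "((\<lambda>u. \<psi> (\<xi> + u *\<^sub>R axis j 1)) has_vector_derivative 0) (at 0)"
   by (intro has_vector_derivative_transform_within[OF has_vector_derivative_const, of 1]) (auto simp: dist_real_def)
 qed
 then show ?thesis
  using assms along.smooth_partial_deriv[of \<psi> j] unfolding dual_test_iff by blast
qed

text \<open>
 The measure is invariant under translations in the direction of a line.  Hence the difference
 quotients of \<open>\<psi>\<close> have the transform of \<open>\<psi>\<close> times difference quotients of a character.
\<close>

lemma fourier_integral_deriv:
 assumes \<psi>: "\<psi> \<in> tests" and j: "\<Gamma> j = Line"
 shows "fourier_integral m a (zero_ext (partial_deriv j \<psi>)) x
  = - \<i> * of_real (a * x $ j) * fourier_integral m a (zero_ext \<psi>) x"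
proof -
 let ?F = "fourier_integral m a (zero_ext \<psi>) x"
 let ?v = "\<lambda>n. (1 / Suc n) *\<^sub>R axis j (1::real)"
 let ?q = "\<lambda>n \<xi>. (zero_ext \<psi> (\<xi> + ?v n) - zero_ext \<psi> \<xi>) * of_real (Suc n)"
 note psi = moments_test[OF \<psi>]
 note [measurable] = dual_borel.momentsD(1)[OF psi] dual_borel.momentsD(1)[OF moments_test[OF test_partial_deriv[OF \<psi> j]]]
 have v: "?v n \<in> S" for n
  using along.shift[OF dual_group_zero, of j "1 / Suc n"] j by simp
 have vS: "\<xi> + ?v n \<in> S \<longleftrightarrow> \<xi> \<in> S" for \<xi> n
 proof
  show "\<xi> \<in> S" if "\<xi> + ?v n \<in> S" using dual_group_diff[OF that v[of n]] by simp
  show "\<xi> + ?v n \<in> S" if "\<xi> \<in> S" using dual_group_add[OF that v[of n]] .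
 qed
 have shifted: "(\<integral>\<xi>. zero_ext \<psi> (\<xi> + ?v n) * cis (a * (\<xi> \<bullet> x)) \<partial>m) = cis (- (a * x $ j) * (1 / Suc n)) * ?F" for n
 proof -
  have cis_shift: "cis (a * (\<xi> \<bullet> x)) = cis (- (a * x $ j) * (1 / Suc n)) * cis (a * ((\<xi> + ?v n) \<bullet> x))" for \<xi>
   by (simp add: cis_mult inner_add_left inner_axis' algebra_simps del: of_nat_Suc)
  have "(\<integral>\<xi>. zero_ext \<psi> (\<xi> + ?v n) * cis (a * (\<xi> \<bullet> x)) \<partial>m)
   = (\<integral>\<xi>. cis (- (a * x $ j) * (1 / Suc n)) * (zero_ext \<psi> (\<xi> + ?v n) * cis (a * ((\<xi> + ?v n) \<bullet> x))) \<partial>m)"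
   by (intro Bochner_Integration.integral_cong refl, subst cis_shift) (simp only: mult_ac)
  also have "\<dots> = cis (- (a * x $ j) * (1 / Suc n)) * (\<integral>\<xi>. zero_ext \<psi> (\<xi> + ?v n) * cis (a * ((\<xi> + ?v n) \<bullet> x)) \<partial>m)"
   by (rule integral_mult_right_zero)
  also have "(\<integral>\<xi>. zero_ext \<psi> (\<xi> + ?v n) * cis (a * ((\<xi> + ?v n) \<bullet> x)) \<partial>m) = ?F"
   unfolding fourier_integral_def by (rule integral_dual_translate[OF v]) measurable
  finally show ?thesis .
 qed
 have int_shifted: "integrable m (\<lambda>\<xi>. zero_ext \<psi> (\<xi> + ?v n))" for n
 proof -
  have "integrable (distr m borel (\<lambda>\<xi>. \<xi> + ?v n)) (zero_ext \<psi>)"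
   using dual_borel.momentsD(3)[OF psi] by (simp only: dual_translate[OF v])
  then show ?thesis by (subst (asm) integrable_distr_eq) auto
 qed
 have quot: "(\<integral>\<xi>. ?q n \<xi> * cis (a * (\<xi> \<bullet> x)) \<partial>m) = (cis (- (a * x $ j) * (1 / Suc n)) - 1) * of_real (Suc n) * ?F" for n
 proof -
  have "(\<integral>\<xi>. ?q n \<xi> * cis (a * (\<xi> \<bullet> x)) \<partial>m)
   = (\<integral>\<xi>. of_real (Suc n) * (zero_ext \<psi> (\<xi> + ?v n) * cis (a * (\<xi> \<bullet> x)) - zero_ext \<psi> \<xi> * cis (a * (\<xi> \<bullet> x))) \<partial>m)"
   by (simp only: algebra_simps)
  also have "\<dots> = of_real (Suc n) * ((\<integral>\<xi>. zero_ext \<psi> (\<xi> + ?v n) * cis (a * (\<xi> \<bullet> x)) \<partial>m) - ?F)"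
   unfolding fourier_integral_def
   by (subst integral_mult_right_zero, subst Bochner_Integration.integral_diff)
    (intro dual_borel.integrable_cis int_shifted dual_borel.momentsD(3)[OF psi] refl)+
  also have "\<dots> = (cis (- (a * x $ j) * (1 / Suc n)) - 1) * of_real (Suc n) * ?F"
   unfolding shifted by (simp only: algebra_simps mult_1_left mult_1_right)
  finally show ?thesis .
 qed
 obtain B R where BR: "B > 0" "R > 0" "\<And>\<xi>. \<xi> \<in> S ==> norm (partial_deriv j \<psi> \<xi>) \<le> B"
   "\<And>\<xi>. \<xi> \<in> S ==> norm \<xi> > R ==> partial_deriv j \<psi> \<xi> = 0"
  using test_bounded[OF test_partial_deriv[OF \<psi> j]] by blast
 obtain B' R' where "B' > 0" and R': "R' > 0" and "\<And>\<xi>. \<xi> \<in> S ==> norm (\<psi> \<xi>) \<le> B'"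
   and R'_zero: "\<And>\<xi>. \<xi> \<in> S ==> norm \<xi> > R' ==> \<psi> \<xi> = 0"
  using test_bounded[OF \<psi>] by blast
 have diff: "\<psi> differentiable_on S" using \<psi> by (simp add: dual_test_iff along.smooth_differentiable)
 have "(\<lambda>n. \<integral>\<xi>. ?q n \<xi> * cis (a * (\<xi> \<bullet> x)) \<partial>m) \<longlonglongrightarrow> fourier_integral m a (zero_ext (partial_deriv j \<psi>)) x"
  unfolding fourier_integral_def
 proof (rule integral_dominated_convergence[where w = "\<lambda>\<xi>. B * indicator (cball 0 (R' + 1)) \<xi>"])
  show "integrable m (\<lambda>\<xi>. B * indicator (cball 0 (R' + 1)) \<xi>)"
   using emeasure_dual_bounded[of "cball 0 (R' + 1)"] by (intro integrable_mult_right integrable_real_indicator) auto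
  show "AE \<xi> in m. (\<lambda>n. ?q n \<xi> * cis (a * (\<xi> \<bullet> x))) \<longlonglongrightarrow> zero_ext (partial_deriv j \<psi>) \<xi> * cis (a * (\<xi> \<bullet> x))"
  proof (rule AE_I2)
   fix \<xi>
   show "(\<lambda>n. ?q n \<xi> * cis (a * (\<xi> \<bullet> x))) \<longlonglongrightarrow> zero_ext (partial_deriv j \<psi>) \<xi> * cis (a * (\<xi> \<bullet> x))"
   proof (cases "\<xi> \<in> S")
    case True
    have "(\<lambda>n. (\<psi> (\<xi> + (1 / Suc n) *\<^sub>R axis j 1) - \<psi> (\<xi> + 0 *\<^sub>R axis j 1)) * of_real (Suc n)) \<longlonglongrightarrow> partial_deriv j \<psi> \<xi>"
     using along.partial_deriv_vector_derivative_0[OF diff True] j by (intro difference_quotient_LIMSEQ) auto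
    then have "(\<lambda>n. ?q n \<xi>) \<longlonglongrightarrow> zero_ext (partial_deriv j \<psi>) \<xi>"
     using True vS[of \<xi>] by (simp add: zero_ext_def del: of_nat_Suc)
    then show ?thesis by (intro tendsto_mult_right)
   next
    case False
    then show ?thesis using vS[of \<xi>] by (simp add: zero_ext_def)
   qed
  qed
  fix n
  show "AE \<xi> in m. norm (?q n \<xi> * cis (a * (\<xi> \<bullet> x))) \<le> B * indicator (cball 0 (R' + 1)) \<xi>"
  proof (rule AE_I2)
   fix \<xi>
   show "norm (?q n \<xi> * cis (a * (\<xi> \<bullet> x))) \<le> B * indicator (cball 0 (R' + 1)) \<xi>"
   proof (cases "\<xi> \<in> S")
    case S: True
    show ?thesis
    proof (cases "norm \<xi> \<le> R' + 1")
     case True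
     have "norm (\<psi> (\<xi> + ?v n) - \<psi> \<xi>) \<le> B * \<bar>1 / Suc n\<bar>"
      using S j BR(3) by (intro along.increment_one diff) (auto intro: along.shift)
     then have "norm (\<psi> (\<xi> + ?v n) - \<psi> \<xi>) * real (Suc n) \<le> B"
      by (simp add: field_simps del: of_nat_Suc)
     moreover have "?q n \<xi> = (\<psi> (\<xi> + ?v n) - \<psi> \<xi>) * of_real (Suc n)"
      using S vS[of \<xi> n] by (simp add: zero_ext_def)
     ultimately show ?thesis
      using True by (simp only: norm_mult norm_cis norm_of_real abs_of_nat) simp
    next
     case False
     have "1 / real (Suc n) \<le> 1" by simp
     moreover have "norm \<xi> \<le> norm (\<xi> + ?v n) + 1 / real (Suc n)"
      using norm_triangle_ineq4[of "\<xi> + ?v n" "?v n"] by (simp add: norm_axis_1 del: of_nat_Suc)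
     ultimately have "norm (\<xi> + ?v n) > R'" using False by linarith
     then show ?thesis using R'_zero[of \<xi>] R'_zero[of "\<xi> + ?v n"] S False vS[of \<xi> n]
      by (simp add: zero_ext_def del: of_nat_Suc)
    qed
   next
    case False
    then show ?thesis using vS[of \<xi>] BR by (simp add: zero_ext_def)
   qed
  qed
 qed measurable
 moreover have "(\<lambda>n. (cis (- (a * x $ j) * (1 / Suc n)) - 1) * of_real (Suc n) * ?F) \<longlonglongrightarrow> - \<i> * of_real (a * x $ j) * ?F"
 proof (rule tendsto_mult_right)
  have "((\<lambda>t. cis (- (a * x $ j) * t)) has_vector_derivative - \<i> * of_real (a * x $ j)) (at 0)"
   using exp_scaleR_has_vector_derivative_right[of "- \<i> * of_real (a * x $ j)" 0 UNIV]
   by (simp add: cis_conv_exp scaleR_conv_of_real mult_ac)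
  from difference_quotient_LIMSEQ[OF this]
  show "(\<lambda>n. (cis (- (a * x $ j) * (1 / Suc n)) - 1) * of_real (Suc n)) \<longlonglongrightarrow> - \<i> * of_real (a * x $ j)"
   by (simp del: of_nat_Suc)
 qed
 ultimately show ?thesis unfolding quot by (rule LIMSEQ_unique)
qed

text \<open>Each factor \<open>\<bar>x $ j\<bar>\<close> is traded for a derivative of \<open>\<psi>\<close>.\<close>

lemma fourier_integral_decay:
 assumes "\<psi> \<in> tests" and a: "a \<noteq> 0"
 shows "\<exists>B. \<forall>x. (1 + (\<Sum>j\<in>lines. \<bar>x $ j\<bar>)) ^ k * norm (fourier_integral m a (zero_ext \<psi>) x) \<le> B"
 using assms(1)
proof (induction k arbitrary: \<psi>)
 case 0
 then show ?case
  using dual_borel.fourier_integral_bound[OF dual_borel.momentsD(3)[OF moments_test]] by auto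
next
 case (Suc k)
 let ?F = "\<lambda>\<psi> x. norm (fourier_integral m a (zero_ext \<psi>) x)"
 let ?s = "\<lambda>x::real^'n. 1 + (\<Sum>j\<in>lines. \<bar>x $ j\<bar>)"
 obtain B0 where B0: "\<And>x. ?s x ^ k * ?F \<psi> x \<le> B0" using Suc by blast
 have "\<forall>j. \<exists>B. j \<in> lines \<longrightarrow> (\<forall>x. ?s x ^ k * ?F (partial_deriv j \<psi>) x \<le> B)"
  using Suc test_partial_deriv by blast
 then obtain B where B: "\<And>j x. j \<in> lines ==> ?s x ^ k * ?F (partial_deriv j \<psi>) x \<le> B j" by metis
 have "?s x ^ Suc k * ?F \<psi> x \<le> B0 + (\<Sum>j\<in>lines. B j / \<bar>a\<bar>)" for x
 proof -
  have "\<bar>x $ j\<bar> * ?F \<psi> x = ?F (partial_deriv j \<psi>) x / \<bar>a\<bar>" if "j \<in> lines" for j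
   using fourier_integral_deriv[OF Suc.prems, of j a x] that a by (simp add: norm_mult abs_mult)
  then have "(\<Sum>j\<in>lines. ?s x ^ k * (?F (partial_deriv j \<psi>) x / \<bar>a\<bar>)) = (\<Sum>j\<in>lines. ?s x ^ k * (\<bar>x $ j\<bar> * ?F \<psi> x))"
   by (intro sum.cong refl) simp
  then have "?s x ^ Suc k * ?F \<psi> x = ?s x ^ k * ?F \<psi> x + (\<Sum>j\<in>lines. ?s x ^ k * (?F (partial_deriv j \<psi>) x / \<bar>a\<bar>))"
   by (simp add: algebra_simps sum_distrib_left sum_distrib_right)
  also have "\<dots> \<le> B0 + (\<Sum>j\<in>lines. B j / \<bar>a\<bar>)"
   using B0 B a by (intro add_mono sum_mono) (auto simp: divide_right_mono)
  finally show ?thesis .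
 qed
 then show ?case by blast
qed

lemma partial_derivs_test_integral:
 assumes "\<psi> \<in> tests"
 shows "\<exists>\<psi>'\<in>tests. partial_derivs js (fourier_integral m a (zero_ext \<psi>)) = fourier_integral m a (zero_ext \<psi>')"
proof (induction js)
 case (Cons j js)
 then obtain \<psi>' where \<psi>': "\<psi>' \<in> tests"
  and eq: "partial_derivs js (fourier_integral m a (zero_ext \<psi>)) = fourier_integral m a (zero_ext \<psi>')" by blast
 have "(\<lambda>\<xi>. (\<i> * of_real a) * of_real (\<xi> $ j) * zero_ext \<psi>' \<xi>) = zero_ext (\<lambda>\<xi>. (\<i> * of_real a) * of_real (\<xi> $ j) * \<psi>' \<xi>)"
  by (simp add: zero_ext_def fun_eq_iff)
 then show ?case
  using test_coordinate[OF \<psi>', of "\<i> * of_real a" j] unfolding partial_derivs_Cons eq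
  by (auto simp: dual_borel.partial_deriv_fourier_integral[OF moments_test[OF \<psi>']])
qed (use assms in auto)

lemma line_part_le_sum: "norm (line_part \<Gamma> x) \<le> (\<Sum>j\<in>lines. \<bar>x $ j\<bar>)"
proof -
 have "norm (line_part \<Gamma> x) \<le> (\<Sum>i\<in>UNIV. \<bar>line_part \<Gamma> x $ i\<bar>)" by (rule norm_le_l1_cart)
 also have "\<dots> = (\<Sum>j\<in>lines. \<bar>x $ j\<bar>)"
  by (rule sum.mono_neutral_cong_right) (auto simp: line_part_def)
 finally show ?thesis .
qed

lemma character_periodic:
 assumes "\<Gamma> i = Circle l" "\<xi> \<in> S"
 shows "cis (2 * pi * (\<xi> \<bullet> (x + l *\<^sub>R axis i 1))) = cis (2 * pi * (\<xi> \<bullet> x))"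
proof -
 have "l * \<xi> $ i \<in> \<int>" using assms by (simp add: dual_group_def)
 then obtain k :: int where k: "l * \<xi> $ i = of_int k" by (elim Ints_cases)
 have "2 * pi * (\<xi> \<bullet> (x + l *\<^sub>R axis i 1)) = 2 * pi * (\<xi> \<bullet> x) + 2 * pi * of_int k"
  by (simp add: inner_add_right inner_axis k[symmetric] algebra_simps)
 then have "cis (2 * pi * (\<xi> \<bullet> (x + l *\<^sub>R axis i 1))) = cis (2 * pi * (\<xi> \<bullet> x)) * cis (2 * pi * of_int k)"
  by (simp only: cis_mult)
 then show ?thesis by (simp only: cis_multiple_2pi[OF Ints_of_int] mult_1_right)
qed

lemma cis_minus: "cis (- t) = cnj (cis t)"
 by (simp add: cis_cnj)

text \<open>Frequencies in the lattice of a circle give characters with the period of the circle.\<close>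

lemma fourier_integral_periodic:
 assumes "a = 2 * pi \<or> a = - 2 * pi"
 shows "periodic \<Gamma> (fourier_integral m a (zero_ext f))"
 unfolding periodic_def fourier_integral_def
proof (intro allI impI)
 fix i l x assume i: "\<Gamma> i = Circle l"
 have "cis (a * (\<xi> \<bullet> (x + l *\<^sub>R axis i 1))) = cis (a * (\<xi> \<bullet> x))" if "\<xi> \<in> S" for \<xi>
  using character_periodic[OF i that, of x] assms by (auto simp: cis_minus)
 then have "zero_ext f \<xi> * cis (a * (\<xi> \<bullet> (x + l *\<^sub>R axis i 1))) = zero_ext f \<xi> * cis (a * (\<xi> \<bullet> x))" for \<xi>
  by (cases "\<xi> \<in> S") (simp_all add: zero_ext_def)
 then show "(\<integral>\<xi>. zero_ext f \<xi> * cis (a * (\<xi> \<bullet> (x + l *\<^sub>R axis i 1))) \<partial>m) = (\<integral>\<xi>. zero_ext f \<xi> * cis (a * (\<xi> \<bullet> x)) \<partial>m)"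
  by (simp only:)
qed

lemma test_integral_schwartz:
 assumes "\<psi> \<in> tests" "a = 2 * pi \<or> a = - 2 * pi"
 shows "fourier_integral m a (zero_ext \<psi>) \<in> schwartz \<Gamma>"
 unfolding schwartz_iff
proof (intro conjI allI)
 show "periodic \<Gamma> (fourier_integral m a (zero_ext \<psi>))"
  by (rule fourier_integral_periodic[OF assms(2)])
 show "everywhere.smooth (fourier_integral m a (zero_ext \<psi>))"
  by (rule dual_borel.smooth_fourier_integral[OF moments_test[OF assms(1)]])
 fix js k
 obtain \<psi>' where \<psi>': "\<psi>' \<in> tests"
  and eq: "partial_derivs js (fourier_integral m a (zero_ext \<psi>)) = fourier_integral m a (zero_ext \<psi>')"
  using partial_derivs_test_integral[OF assms(1)] by blast
 have "a \<noteq> 0" using assms(2) by auto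
 then obtain B where B: "\<And>x. (1 + (\<Sum>j\<in>lines. \<bar>x $ j\<bar>)) ^ k * norm (fourier_integral m a (zero_ext \<psi>') x) \<le> B"
  using fourier_integral_decay[OF \<psi>'] by blast
 have "(1 + norm (line_part \<Gamma> x)) ^ k * norm (fourier_integral m a (zero_ext \<psi>') x) \<le> B" for x
  using line_part_le_sum[of x] by (intro order_trans[OF mult_right_mono B[of x]] power_mono) auto
 then show "\<exists>B. \<forall>x. (1 + norm (line_part \<Gamma> x)) ^ k * norm (partial_derivs js (fourier_integral m a (zero_ext \<psi>)) x) \<le> B"
  by (auto simp: eq)
qed

lemma dual_fourier_integral_schwartz:
 assumes "\<psi> \<in> tests" shows "dual_fourier_integral \<Gamma> \<psi> \<in> schwartz \<Gamma>"
 using schwartz_cmult[OF test_integral_schwartz[OF assms], of "- 2 * pi" "fourier_const \<Gamma>"]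
 by (simp add: dual_fourier_integral_eq[abs_def])

end

section \<open>Fourier inversion on the dual group\<close>

text \<open>The characteristic function of the normal distribution.\<close>

lemma gaussian_fourier:
 assumes "\<epsilon> > 0"
 shows "(LBINT t. of_real (exp (- (\<epsilon> * t)\<^sup>2 / 2)) * cis (2 * pi * (\<tau> * t))) = of_real (normal_density 0 (\<epsilon> / (2 * pi)) \<tau>)"
proof -
 let ?s = "2 * pi * \<tau> / \<epsilon>"
 have "of_real (exp (- ?s\<^sup>2 / 2)) = char std_normal_distribution ?s"
  by (simp add: char_std_normal_distribution)
 also have "\<dots> = (LBINT x. of_real (std_normal_density x) * cis (?s * x))"
  unfolding char_def by (subst integral_density) (auto simp: cis_conv_exp scaleR_conv_of_real)
 also have "\<dots> = \<bar>\<epsilon>\<bar> *\<^sub>R (LBINT t. of_real (std_normal_density (0 + \<epsilon> * t)) * cis (?s * (0 + \<epsilon> * t)))"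
  using assms by (intro lborel_integral_real_affine) simp
 also have "(\<lambda>t. of_real (std_normal_density (0 + \<epsilon> * t)) * cis (?s * (0 + \<epsilon> * t)))
   = (\<lambda>t. of_real (1 / sqrt (2 * pi)) * (of_real (exp (- (\<epsilon> * t)\<^sup>2 / 2)) * cis (2 * pi * (\<tau> * t))))"
  using assms by (simp add: std_normal_density_def fun_eq_iff mult_ac)
 finally have "of_real (exp (- ?s\<^sup>2 / 2)) = of_real (\<epsilon> / sqrt (2 * pi)) *
   (LBINT t. of_real (exp (- (\<epsilon> * t)\<^sup>2 / 2)) * cis (2 * pi * (\<tau> * t)))"
  using assms by (simp add: scaleR_conv_of_real)
 moreover have "normal_density 0 (\<epsilon> / (2 * pi)) \<tau> = exp (- ?s\<^sup>2 / 2) * (sqrt (2 * pi) / \<epsilon>)"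
 proof -
  have "sqrt (2 * pi * (\<epsilon> / (2 * pi))\<^sup>2) = \<epsilon> / sqrt (2 * pi)"
   using assms by (intro real_sqrt_unique) (auto simp: power_divide field_simps power2_eq_square)
  moreover have "- (\<tau> - 0)\<^sup>2 / (2 * (\<epsilon> / (2 * pi))\<^sup>2) = - ?s\<^sup>2 / 2"
   using assms by (simp add: field_simps power2_eq_square)
  ultimately show ?thesis by (simp add: normal_density_def)
 qed
 ultimately have "of_real (normal_density 0 (\<epsilon> / (2 * pi)) \<tau>) = of_real (\<epsilon> / sqrt (2 * pi)) *
   (LBINT t. of_real (exp (- (\<epsilon> * t)\<^sup>2 / 2)) * cis (2 * pi * (\<tau> * t))) * of_real (sqrt (2 * pi) / \<epsilon>)"
  by (simp only: of_real_mult)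
 also have "\<dots> = of_real (\<epsilon> / sqrt (2 * pi) * (sqrt (2 * pi) / \<epsilon>)) *
   (LBINT t. of_real (exp (- (\<epsilon> * t)\<^sup>2 / 2)) * cis (2 * pi * (\<tau> * t)))"
  by (simp only: of_real_mult mult_ac)
 finally show ?thesis using assms by simp
qed

lemma integrable_gaussian:
 assumes "\<epsilon> > 0" shows "integrable lborel (\<lambda>t::real. exp (- (\<epsilon> * t)\<^sup>2 / 2))"
proof -
 have "integrable lborel (\<lambda>t. sqrt (2 * pi * (1 / \<epsilon>)\<^sup>2) * normal_density 0 (1 / \<epsilon>) t)"
  using assms by (intro integrable_mult_right integrable_normal_density) auto
 moreover have "sqrt (2 * pi * (1 / \<epsilon>)\<^sup>2) * normal_density 0 (1 / \<epsilon>) t = exp (- (\<epsilon> * t)\<^sup>2 / 2)" for t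
  using assms by (simp add: normal_density_def power_mult_distrib power_divide field_simps)
 ultimately show ?thesis by simp
qed

lemma circle_orthogonality:
 assumes l: "0 < l" and k: "l * \<tau> \<in> \<int>"
 shows "(LBINT t. of_real (indicator {0..<l} t) * cis (2 * pi * (\<tau> * t))) = (if \<tau> = 0 then of_real l else 0)"
proof -
 have AE: "AE t in lborel. of_real (indicator {0..<l} t) * cis (2 * pi * (\<tau> * t)) = indicator {0..l} t *\<^sub>R cis (2 * pi * (\<tau> * t))"
  using AE_lborel_singleton[of l] by eventually_elim (auto simp: indicator_def)
 have "(LBINT t. of_real (indicator {0..<l} t) * cis (2 * pi * (\<tau> * t)))
  = (LBINT t. indicator {0..l} t *\<^sub>R cis (2 * pi * (\<tau> * t)))"
  by (intro integral_cong_AE AE) measurable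
 also have "\<dots> = (if \<tau> = 0 then of_real l else 0)"
 proof (cases "\<tau> = 0")
  case True
  then show ?thesis using l by (simp add: lebesgue_integral_const scaleR_conv_of_real)
 next
  case False
  let ?c = "\<i> * of_real (2 * pi * \<tau>)"
  have c: "?c \<noteq> 0" using False by simp
  have d: "((\<lambda>t. inverse ?c * cis (2 * pi * (\<tau> * t))) has_vector_derivative cis (2 * pi * (\<tau> * t))) (at t within {0..l})" for t
  proof -
   have "((\<lambda>t. exp (t *\<^sub>R ?c)) has_vector_derivative exp (t *\<^sub>R ?c) * ?c) (at t within {0..l})"
    by (rule exp_scaleR_has_vector_derivative_right)
   then have "((\<lambda>t. inverse ?c * exp (t *\<^sub>R ?c)) has_vector_derivative inverse ?c * (exp (t *\<^sub>R ?c) * ?c)) (at t within {0..l})"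
    by (rule has_vector_derivative_mult_right)
   moreover have "exp (t *\<^sub>R ?c) = cis (2 * pi * (\<tau> * t))" for t
    by (simp add: cis_conv_exp scaleR_conv_of_real mult_ac)
   moreover have "inverse ?c * (z * ?c) = z" for z
   proof -
    have "inverse ?c * (z * ?c) = (inverse ?c * ?c) * z" by (simp only: mult_ac)
    then show ?thesis by (simp only: left_inverse[OF c] mult_1_left)
   qed
   ultimately show ?thesis by (simp only:)
  qed
  have "has_bochner_integral lborel (\<lambda>t. indicator {0..l} t *\<^sub>R cis (2 * pi * (\<tau> * t)))
   (inverse ?c * cis (2 * pi * (\<tau> * l)) - inverse ?c * cis (2 * pi * (\<tau> * 0)))"
   using l d by (intro has_bochner_integral_FTC_Icc) (auto intro!: continuous_intros)
  moreover have "cis (2 * pi * (\<tau> * l)) = 1"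
   using cis_multiple_2pi[OF k] by (simp add: mult_ac)
  ultimately show ?thesis using False by (simp add: has_bochner_integral_integral_eq)
 qed
 finally show ?thesis .
qed

context product_group begin

lemma fourier_const_pos: "fourier_const \<Gamma> > 0"
 unfolding fourier_const_def using period_pos
 by (intro powr_gt_zero[THEN iffD2]) (auto simp: prod_zero_iff less_imp_neq[symmetric] split: factor.splits)

lemma fourier_const_sq: "(fourier_const \<Gamma>)\<^sup>2 = (\<Prod>i\<in>UNIV. inverse (case \<Gamma> i of Line => 1 | Circle l => l))"
proof -
 let ?P = "\<Prod>i\<in>UNIV. case \<Gamma> i of Line => 1 | Circle l => l"
 have P: "?P > 0" using period_pos by (intro prod_pos) (auto split: factor.splits)
 have "(fourier_const \<Gamma>)\<^sup>2 = ?P powr (- 1)"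
  by (simp add: fourier_const_def power2_eq_square flip: powr_add)
 also have "\<dots> = inverse ?P" using P by (simp add: powr_minus)
 finally show ?thesis by (simp add: o_def flip: prod_inversef)
qed

definition gauss_cutoff :: "real => real ^ 'n => complex" where
 "gauss_cutoff \<epsilon> x = (\<Prod>i\<in>UNIV. of_real (case \<Gamma> i of Line => exp (- (\<epsilon> * x $ i)\<^sup>2 / 2) | Circle l => indicator {0..<l} (x $ i)))"

text \<open>The transform of \<open>gauss_cutoff\<close>, up to a constant: a probability density on the dual group.\<close>

definition gauss_kernel :: "real => real ^ 'n => real" where
 "gauss_kernel \<epsilon> \<eta> = (\<Prod>i\<in>UNIV. case \<Gamma> i of Line => normal_density 0 (\<epsilon> / (2 * pi)) (\<eta> $ i) | Circle l => indicator {0} (\<eta> $ i))"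

lemma gauss_kernel_nonneg: "0 \<le> gauss_kernel \<epsilon> \<eta>"
 unfolding gauss_kernel_def by (intro prod_nonneg) (auto split: factor.split)

lemma integrable_gauss_factor:
 assumes "\<epsilon> > 0"
 shows "integrable lborel (\<lambda>t. case \<Gamma> i of Line => exp (- (\<epsilon> * t)\<^sup>2 / 2) | Circle l => indicator {0..<l} t)"
proof (cases "\<Gamma> i")
 case (Circle l)
 have "emeasure lborel {0..<l} < \<infinity>" using period_pos[OF Circle] by simp
 then show ?thesis using Circle by (auto intro!: integrable_real_indicator)
qed (use integrable_gaussian[OF assms] in simp)

lemma integrable_gauss_cutoff:
 assumes "\<epsilon> > 0" shows "integrable lborel (gauss_cutoff \<epsilon>)"
proof -
 have "integrable (vec_measure (\<lambda>i::'n. lborel)) (\<lambda>x. \<Prod>i\<in>UNIV. complex_of_real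
   (case \<Gamma> i of Line => exp (- (\<epsilon> * x $ i)\<^sup>2 / 2) | Circle l => indicator {0..<l} (x $ i)))"
 proof (rule lborel_coords.integrable_vec_prod)
  fix i
  show "integrable lborel (\<lambda>t. complex_of_real (case \<Gamma> i of Line => exp (- (\<epsilon> * t)\<^sup>2 / 2) | Circle l => indicator {0..<l} t))"
   by (intro integrable_of_real integrable_gauss_factor assms)
  show "(\<lambda>t. complex_of_real (case \<Gamma> i of Line => exp (- (\<epsilon> * t)\<^sup>2 / 2) | Circle l => indicator {0..<l} t)) \<in> borel_measurable borel"
   by (cases "\<Gamma> i") simp_all
 qed
 then show ?thesis by (simp add: lborel_vec gauss_cutoff_def[abs_def])
qed

lemma gauss_cutoff_fourier:
 assumes "\<epsilon> > 0" and \<tau>: "\<tau> \<in> S"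
 shows "(LBINT x. gauss_cutoff \<epsilon> x * cis (2 * pi * (\<tau> \<bullet> x)))
  = of_real (gauss_kernel \<epsilon> \<tau>) / of_real ((fourier_const \<Gamma>)\<^sup>2)"
proof -
 let ?g = "\<lambda>i t. case \<Gamma> i of Line => exp (- (\<epsilon> * t)\<^sup>2 / 2) | Circle l => indicator {0..<l} t"
 let ?f = "\<lambda>i t. complex_of_real (?g i t) * cis (2 * pi * (\<tau> $ i * t))"
 let ?J = "\<lambda>i. case \<Gamma> i of Line => normal_density 0 (\<epsilon> / (2 * pi)) (\<tau> $ i) | Circle l => indicator {0} (\<tau> $ i)"
 let ?l = "\<lambda>i. case \<Gamma> i of Line => 1 | Circle l => l"
 have meas: "?g i \<in> borel_measurable borel" for i by (cases "\<Gamma> i") simp_all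
 have "(LBINT x. gauss_cutoff \<epsilon> x * cis (2 * pi * (\<tau> \<bullet> x))) = (\<integral>x. (\<Prod>i\<in>UNIV. ?f i (x $ i)) \<partial>vec_measure (\<lambda>i::'n. lborel))"
  by (simp add: lborel_vec gauss_cutoff_def inner_vec_def sum_distrib_left cis_sum prod.distrib)
 also have "\<dots> = (\<Prod>i\<in>UNIV. \<integral>t. ?f i t \<partial>lborel)"
 proof (rule lborel_coords.integral_vec_prod)
  fix i
  show "?f i \<in> borel_measurable borel" using meas[of i] by measurable
  show "integrable lborel (?f i)"
  proof (rule Bochner_Integration.integrable_bound[OF integrable_gauss_factor[OF assms(1), of i]])
   show "?f i \<in> borel_measurable lborel" using meas[of i] by measurable
  qed (simp add: norm_mult)
 qed
 also have "\<dots> = (\<Prod>i\<in>UNIV. complex_of_real (?J i * ?l i))"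
 proof (intro prod.cong refl)
  fix i
  show "(LBINT t. ?f i t) = complex_of_real (?J i * ?l i)"
  proof (cases "\<Gamma> i")
   case Line
   then show ?thesis using gaussian_fourier[OF assms(1), of "\<tau> $ i"] by simp
  next
   case (Circle l)
   have "l * \<tau> $ i \<in> \<int>" using \<tau> Circle by (simp add: dual_group_def)
   then show ?thesis using circle_orthogonality[OF period_pos[OF Circle]] Circle by simp
  qed
 qed
 also have "\<dots> = of_real (gauss_kernel \<epsilon> \<tau>) * of_real (\<Prod>i\<in>UNIV. ?l i)"
  by (simp add: gauss_kernel_def prod.distrib)
 also have "(\<Prod>i\<in>UNIV. ?l i) = 1 / (fourier_const \<Gamma>)\<^sup>2"
  by (simp add: fourier_const_sq divide_inverse o_def flip: prod_inversef)
 finally show ?thesis by simp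
qed

lemma
 assumes "\<epsilon> > 0" and \<xi>: "\<xi> \<in> S"
 shows integrable_gauss_kernel: "integrable m (\<lambda>\<eta>. gauss_kernel \<epsilon> (\<xi> - \<eta>))"
  and integral_gauss_kernel: "(\<integral>\<eta>. gauss_kernel \<epsilon> (\<xi> - \<eta>) \<partial>m) = 1"
  and integrable_gauss_kernel_moment: "\<Gamma> j = Line ==> integrable m (\<lambda>\<eta>. \<bar>\<eta> $ j - \<xi> $ j\<bar> * gauss_kernel \<epsilon> (\<xi> - \<eta>))"
  and integral_gauss_kernel_moment: "\<Gamma> j = Line ==> (\<integral>\<eta>. \<bar>\<eta> $ j - \<xi> $ j\<bar> * gauss_kernel \<epsilon> (\<xi> - \<eta>) \<partial>m) \<le> \<epsilon>"
proof -
 let ?\<sigma> = "\<epsilon> / (2 * pi)"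
 have \<sigma>: "?\<sigma> > 0" using assms by simp
 let ?J = "\<lambda>i t. case \<Gamma> i of Line => normal_density (\<xi> $ i) ?\<sigma> t | Circle l => indicator {\<xi> $ i} t"
 have eq: "gauss_kernel \<epsilon> (\<xi> - \<eta>) = (\<Prod>i\<in>UNIV. ?J i (\<eta> $ i))" for \<eta>
  unfolding gauss_kernel_def
  by (intro prod.cong refl) (auto simp: normal_density_def indicator_def power2_commute split: factor.split)
 have meas: "?J i \<in> borel_measurable borel" for i by (cases "\<Gamma> i") simp_all
 have int: "integrable (dual_coords \<Gamma> i) (?J i) \<and> (\<integral>t. ?J i t \<partial>dual_coords \<Gamma> i) = 1" for i
 proof (cases "\<Gamma> i")
  case Line
  then show ?thesis using \<sigma> by (simp add: integrable_normal_density integral_normal_density)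
 next
  case (Circle l)
  have "\<xi> $ i \<in> {t. l * t \<in> \<int>}" using \<xi> Circle by (simp add: dual_group_def)
  then have "has_bochner_integral (count_space {t. l * t \<in> \<int>}) (indicator {\<xi> $ i}) (measure (count_space {t. l * t \<in> \<int>}) {\<xi> $ i})"
   by (intro has_bochner_integral_real_indicator) auto
  moreover have "measure (count_space {t. l * t \<in> \<int>}) {\<xi> $ i} = 1"
   using \<open>\<xi> $ i \<in> {t. l * t \<in> \<int>}\<close> by (simp add: measure_count_space)
  ultimately show ?thesis using Circle by (simp add: has_bochner_integral_iff)
 qed
 show "integrable m (\<lambda>\<eta>. gauss_kernel \<epsilon> (\<xi> - \<eta>))" "(\<integral>\<eta>. gauss_kernel \<epsilon> (\<xi> - \<eta>) \<partial>m) = 1"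
  unfolding eq dual_borel_def
  using dual.integrable_vec_prod[of ?J] dual.integral_vec_prod[of ?J] meas int by simp_all
 assume j: "\<Gamma> j = Line"
 let ?K = "\<lambda>i t. if i = j then \<bar>t - \<xi> $ j\<bar> * ?J j t else ?J i t"
 have eqK: "\<bar>\<eta> $ j - \<xi> $ j\<bar> * gauss_kernel \<epsilon> (\<xi> - \<eta>) = (\<Prod>i\<in>UNIV. ?K i (\<eta> $ i))" for \<eta>
  unfolding eq by (subst (1 2) prod.remove[of UNIV j]) (auto simp: mult.assoc intro!: prod.cong)
 have measK: "?K i \<in> borel_measurable borel" for i using meas[of i] meas[of j] by (cases "i = j") simp_all
 have intK: "integrable (dual_coords \<Gamma> i) (?K i)" for i
  using int[of i] integrable_normal_moment_abs[OF \<sigma>, of "\<xi> $ j" 1] j by (cases "i = j") (auto simp: mult.commute)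
 have val: "(\<integral>t. ?K i t \<partial>dual_coords \<Gamma> i) = (if i = j then ?\<sigma> * sqrt (2 / pi) else 1)" for i
  using int[of i] integral_normal_moment_abs_odd[OF \<sigma>, of "\<xi> $ j" 0] j by (cases "i = j") (auto simp: mult.commute)
 show "integrable m (\<lambda>\<eta>. \<bar>\<eta> $ j - \<xi> $ j\<bar> * gauss_kernel \<epsilon> (\<xi> - \<eta>))"
  unfolding eqK dual_borel_def using dual.integrable_vec_prod[of ?K] measK intK by simp
 have "(\<integral>\<eta>. \<bar>\<eta> $ j - \<xi> $ j\<bar> * gauss_kernel \<epsilon> (\<xi> - \<eta>) \<partial>m) = (\<Prod>i\<in>UNIV. if i = j then ?\<sigma> * sqrt (2 / pi) else 1)"
  unfolding eqK dual_borel_def using dual.integral_vec_prod[of ?K] measK intK by (simp only: val)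
 also have "\<dots> = \<epsilon> / (2 * pi) * sqrt (2 / pi)" by simp
 also have "\<dots> \<le> \<epsilon> * 1"
 proof -
  have "sqrt (2 / pi) \<le> 1" using pi_gt3 by simp
  moreover have "\<epsilon> / (2 * pi) \<le> \<epsilon>" using assms pi_gt3 by (simp add: field_simps)
  ultimately show ?thesis using assms by (intro mult_mono) auto
 qed
 finally show "(\<integral>\<eta>. \<bar>\<eta> $ j - \<xi> $ j\<bar> * gauss_kernel \<epsilon> (\<xi> - \<eta>) \<partial>m) \<le> \<epsilon>" by simp
qed

text \<open>The kernel sits on the affine subspace through \<open>\<xi>\<close> in the directions of the lines.  There \<open>\<psi>\<close> is Lipschitz, and the first
 moment of the kernel is at most \<open>\<epsilon>\<close> in each direction.\<close>

lemma gauss_kernel_approximates: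
 assumes \<psi>: "\<psi> \<in> tests" and \<xi>: "\<xi> \<in> S"
 obtains C where "\<And>\<epsilon>. \<epsilon> > 0 ==> norm ((\<integral>\<eta>. zero_ext \<psi> \<eta> * of_real (gauss_kernel \<epsilon> (\<xi> - \<eta>)) \<partial>m) - \<psi> \<xi>) \<le> C * \<epsilon>"
proof -
 note psi = moments_test[OF \<psi>]
 note [measurable] = dual_borel.momentsD(1)[OF psi]
 have diff: "\<psi> differentiable_on S" using \<psi> by (simp add: dual_test_iff along.smooth_differentiable)
 have "\<forall>j\<in>lines. \<exists>B. \<forall>\<eta>\<in>S. norm (partial_deriv j \<psi> \<eta>) \<le> B"
 proof
  fix j assume "j \<in> lines"
  then show "\<exists>B. \<forall>\<eta>\<in>S. norm (partial_deriv j \<psi> \<eta>) \<le> B"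
   using test_bounded[OF test_partial_deriv[OF \<psi>], of j] by (metis mem_Collect_eq)
 qed
 then obtain b where b: "\<And>j \<eta>. j \<in> lines ==> \<eta> \<in> S ==> norm (partial_deriv j \<psi> \<eta>) \<le> b j"
  by metis
 define B where "B = (\<Sum>j\<in>lines. \<bar>b j\<bar>)"
 have B: "norm (partial_deriv j \<psi> \<eta>) \<le> B" if "j \<in> lines" "\<eta> \<in> S" for j \<eta>
  using b[OF that] member_le_sum[of j lines "\<lambda>j. \<bar>b j\<bar>"] that unfolding B_def by auto
 have B0: "B \<ge> 0" unfolding B_def by (intro sum_nonneg) auto
 have lip: "norm (zero_ext \<psi> \<eta> - \<psi> \<xi>) * gauss_kernel \<epsilon> (\<xi> - \<eta>)
   \<le> B * (\<Sum>j\<in>lines. \<bar>\<eta> $ j - \<xi> $ j\<bar> * gauss_kernel \<epsilon> (\<xi> - \<eta>))" for \<eta> \<epsilon>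
 proof (cases "\<forall>i. \<Gamma> i \<noteq> Line \<longrightarrow> \<eta> $ i = \<xi> $ i")
  case True
  let ?v = "\<eta> - \<xi>"
  have eta: "\<eta> = \<xi> + (\<Sum>i\<in>lines. ?v $ i *\<^sub>R axis i 1)"
   using True by (auto simp: vec_eq_iff sum_component axis_def if_distrib cong: if_cong)
  have "\<eta> \<in> S" using True \<xi> by (auto simp: dual_group_def)
  moreover have "norm (\<psi> (\<xi> + (\<Sum>i\<in>lines. ?v $ i *\<^sub>R axis i 1)) - \<psi> \<xi>) \<le> B * (\<Sum>i\<in>lines. \<bar>?v $ i\<bar>)"
   by (rule along.increment_bound[OF diff \<xi>]) (auto intro: B)
  ultimately have "norm (zero_ext \<psi> \<eta> - \<psi> \<xi>) \<le> B * (\<Sum>j\<in>lines. \<bar>\<eta> $ j - \<xi> $ j\<bar>)"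
   unfolding eta[symmetric] by (simp add: zero_ext_def)
  from mult_right_mono[OF this gauss_kernel_nonneg[of \<epsilon> "\<xi> - \<eta>"]]
  show ?thesis by (simp only: sum_distrib_right mult.assoc)
 next
  case False
  then obtain i where i: "\<Gamma> i \<noteq> Line" "\<eta> $ i \<noteq> \<xi> $ i" by blast
  then have "gauss_kernel \<epsilon> (\<xi> - \<eta>) = 0"
   unfolding gauss_kernel_def by (intro prod_zero) (auto intro!: bexI[of _ i] split: factor.split)
  then show ?thesis by simp
 qed
 have "norm ((\<integral>\<eta>. zero_ext \<psi> \<eta> * of_real (gauss_kernel \<epsilon> (\<xi> - \<eta>)) \<partial>m) - \<psi> \<xi>) \<le> (B * real (card lines)) * \<epsilon>"
  if \<epsilon>: "\<epsilon> > 0" for \<epsilon>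
 proof -
  let ?G = "\<lambda>\<eta>. gauss_kernel \<epsilon> (\<xi> - \<eta>)"
  have iG: "integrable m (\<lambda>\<eta>. complex_of_real (?G \<eta>))"
   using integrable_gauss_kernel[OF \<epsilon> \<xi>] by (rule integrable_of_real)
  obtain C R where C: "C > 0" "R > 0" "\<And>\<eta>. \<eta> \<in> S ==> norm (\<psi> \<eta>) \<le> C" "\<And>\<eta>. \<eta> \<in> S ==> norm \<eta> > R ==> \<psi> \<eta> = 0"
   using test_bounded[OF \<psi>] by blast
  have ipG: "integrable m (\<lambda>\<eta>. zero_ext \<psi> \<eta> * complex_of_real (?G \<eta>))"
  proof (rule Bochner_Integration.integrable_bound)
   show "integrable m (\<lambda>\<eta>. C * ?G \<eta>)" by (intro integrable_mult_right integrable_gauss_kernel \<epsilon> \<xi>)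
   show "AE \<eta> in m. norm (zero_ext \<psi> \<eta> * complex_of_real (?G \<eta>)) \<le> norm (C * ?G \<eta>)"
    using C(1,3) by (intro AE_I2) (auto simp: zero_ext_def norm_mult abs_mult indicator_def intro!: mult_right_mono)
   show "(\<lambda>\<eta>. zero_ext \<psi> \<eta> * complex_of_real (?G \<eta>)) \<in> borel_measurable m"
    using borel_measurable_integrable[OF iG] by measurable
  qed
  have "(\<integral>\<eta>. zero_ext \<psi> \<eta> * of_real (?G \<eta>) \<partial>m) - \<psi> \<xi>
    = (\<integral>\<eta>. zero_ext \<psi> \<eta> * of_real (?G \<eta>) \<partial>m) - (\<integral>\<eta>. \<psi> \<xi> * of_real (?G \<eta>) \<partial>m)"
   using integral_gauss_kernel[OF \<epsilon> \<xi>] by simp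
  also have "\<dots> = (\<integral>\<eta>. zero_ext \<psi> \<eta> * of_real (?G \<eta>) - \<psi> \<xi> * of_real (?G \<eta>) \<partial>m)"
   using ipG iG by (simp add: Bochner_Integration.integral_diff)
  also have "norm \<dots> \<le> (\<integral>\<eta>. B * (\<Sum>j\<in>lines. \<bar>\<eta> $ j - \<xi> $ j\<bar> * ?G \<eta>) \<partial>m)"
  proof (rule norm_integral_le)
   show "integrable m (\<lambda>\<eta>. B * (\<Sum>j\<in>lines. \<bar>\<eta> $ j - \<xi> $ j\<bar> * ?G \<eta>))"
    by (intro integrable_mult_right Bochner_Integration.integrable_sum integrable_gauss_kernel_moment \<epsilon> \<xi>) auto
   fix \<eta>
   have "zero_ext \<psi> \<eta> * of_real (?G \<eta>) - \<psi> \<xi> * of_real (?G \<eta>) = (zero_ext \<psi> \<eta> - \<psi> \<xi>) * of_real (?G \<eta>)"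
    by (simp add: left_diff_distrib)
   then show "norm (zero_ext \<psi> \<eta> * of_real (?G \<eta>) - \<psi> \<xi> * of_real (?G \<eta>)) \<le> B * (\<Sum>j\<in>lines. \<bar>\<eta> $ j - \<xi> $ j\<bar> * ?G \<eta>)"
    using lip[of \<eta> \<epsilon>] gauss_kernel_nonneg[of \<epsilon> "\<xi> - \<eta>"] by (simp add: norm_mult)
  qed
  also have "\<dots> = B * (\<Sum>j\<in>lines. \<integral>\<eta>. \<bar>\<eta> $ j - \<xi> $ j\<bar> * ?G \<eta> \<partial>m)"
   by (subst integral_mult_right_zero, subst Bochner_Integration.integral_sum)
    (auto intro!: integrable_gauss_kernel_moment \<epsilon> \<xi>)
  also have "\<dots> \<le> B * (\<Sum>j\<in>lines. \<epsilon>)"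
   by (intro mult_left_mono sum_mono integral_gauss_kernel_moment \<epsilon> \<xi> B0) auto
  finally show ?thesis by (simp add: mult_ac)
 qed
 then show ?thesis using that by blast
qed

text \<open>
 Fourier inversion for test functions.  A Gaussian cut-off in the line variables makes the double
 integral absolutely convergent; its transform is an approximate identity on the dual group (a
 Gaussian in the line variables and, by orthogonality of the characters, a point mass in the
 circle variables).
\<close>

theorem dual_fourier_inversion:
 assumes \<psi>: "\<psi> \<in> tests" and \<xi>: "\<xi> \<in> S"
 shows "fourier_const \<Gamma> * (LBINT x. indicator (FD) x *\<^sub>R (dual_fourier_integral \<Gamma> \<psi> x * cis (2 * pi * (\<xi> \<bullet> x)))) = \<psi> \<xi>"
proof -
 let ?c = "fourier_const \<Gamma>"
 let ?p = "zero_ext \<psi>"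
 let ?F = "fourier_integral m (- 2 * pi) ?p"
 let ?D = "FD"
 let ?e = "\<lambda>n. 1 / real (Suc n)"
 note psi = moments_test[OF \<psi>]
 note [measurable] = dual_borel.momentsD(1)[OF psi]
 have F: "?F \<in> schwartz \<Gamma>" by (rule test_integral_schwartz[OF \<psi>]) simp
 have [measurable]: "?F \<in> borel_measurable borel" by (rule schwartz_measurable[OF F])
 have reg: "(LBINT x. gauss_cutoff (?e n) x * cis (2 * pi * (\<xi> \<bullet> x)) * ?F x)
   = (\<integral>\<eta>. ?p \<eta> * of_real (gauss_kernel (?e n) (\<xi> - \<eta>)) \<partial>m) / of_real (?c\<^sup>2)" for n
 proof -
  have "integrable lborel (\<lambda>x. gauss_cutoff (?e n) x * cis (2 * pi * (\<xi> \<bullet> x)))"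
   using lborel_vec.integrable_cis[OF integrable_gauss_cutoff[of "?e n"], of "2 * pi" \<xi>] by (simp add: inner_commute)
  then have "(LBINT x. gauss_cutoff (?e n) x * cis (2 * pi * (\<xi> \<bullet> x)) * ?F x)
   = (\<integral>\<eta>. ?p \<eta> * (LBINT x. gauss_cutoff (?e n) x * cis (2 * pi * (\<xi> \<bullet> x)) * cis (- 2 * pi * (\<eta> \<bullet> x))) \<partial>m)"
   unfolding fourier_integral_def
   by (intro fubini_kernel sigma_finite_dual sigma_finite_lborel dual_borel.momentsD(3)[OF psi]) auto
  also have "\<dots> = (\<integral>\<eta>. ?p \<eta> * of_real (gauss_kernel (?e n) (\<xi> - \<eta>)) / of_real (?c\<^sup>2) \<partial>m)"
  proof (intro Bochner_Integration.integral_cong refl)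
   fix \<eta>
   show "?p \<eta> * (LBINT x. gauss_cutoff (?e n) x * cis (2 * pi * (\<xi> \<bullet> x)) * cis (- 2 * pi * (\<eta> \<bullet> x)))
    = ?p \<eta> * of_real (gauss_kernel (?e n) (\<xi> - \<eta>)) / of_real (?c\<^sup>2)"
   proof (cases "\<eta> \<in> S")
    case True
    have "cis (2 * pi * (\<xi> \<bullet> x)) * cis (- 2 * pi * (\<eta> \<bullet> x)) = cis (2 * pi * ((\<xi> - \<eta>) \<bullet> x))" for x
     by (simp add: cis_mult inner_diff_left right_diff_distrib)
    then show ?thesis
     using gauss_cutoff_fourier[of "?e n" "\<xi> - \<eta>"] dual_group_diff[OF \<xi> True] by (simp add: mult.assoc del: of_nat_Suc)
   qed (simp add: zero_ext_def)
  qed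
  finally show ?thesis by simp
 qed
 obtain C where C: "\<And>\<epsilon>. \<epsilon> > 0 ==> norm ((\<integral>\<eta>. ?p \<eta> * of_real (gauss_kernel \<epsilon> (\<xi> - \<eta>)) \<partial>m) - \<psi> \<xi>) \<le> C * \<epsilon>"
  using gauss_kernel_approximates[OF \<psi> \<xi>] by blast
 have "(\<lambda>n. \<integral>\<eta>. ?p \<eta> * of_real (gauss_kernel (?e n) (\<xi> - \<eta>)) \<partial>m) \<longlonglongrightarrow> \<psi> \<xi>"
 proof (rule LIM_zero_cancel, rule Lim_null_comparison[of _ "\<lambda>n. C * ?e n"])
  show "\<forall>\<^sub>F n in sequentially. norm ((\<integral>\<eta>. ?p \<eta> * of_real (gauss_kernel (?e n) (\<xi> - \<eta>)) \<partial>m) - \<psi> \<xi>) \<le> C * ?e n"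
   by (intro always_eventually allI C) simp
  show "(\<lambda>n. C * ?e n) \<longlonglongrightarrow> 0"
   using tendsto_mult_left[OF LIMSEQ_Suc[OF lim_1_over_n], of C] by simp
 qed
 from tendsto_divide[OF this tendsto_const[of "of_real (?c\<^sup>2)"]]
 have lim1: "(\<lambda>n. \<integral>x. gauss_cutoff (?e n) x * cis (2 * pi * (\<xi> \<bullet> x)) * ?F x \<partial>lborel) \<longlonglongrightarrow> \<psi> \<xi> / of_real (?c\<^sup>2)"
  unfolding reg using fourier_const_pos by simp
 have lim2: "(\<lambda>n. \<integral>x. gauss_cutoff (?e n) x * cis (2 * pi * (\<xi> \<bullet> x)) * ?F x \<partial>lborel)
   \<longlonglongrightarrow> (LBINT x. indicator ?D x *\<^sub>R (?F x * cis (2 * pi * (\<xi> \<bullet> x))))"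
 proof (rule integral_dominated_convergence[where w = "\<lambda>x. norm (indicator ?D x *\<^sub>R ?F x)"])
  show "integrable lborel (\<lambda>x. norm (indicator ?D x *\<^sub>R ?F x))"
   by (intro integrable_norm integrable_schwartz F)
  have [measurable]: "gauss_cutoff (?e n) \<in> borel_measurable lborel" for n
   by (rule borel_measurable_integrable[OF integrable_gauss_cutoff]) simp
  show "(\<lambda>x. gauss_cutoff (?e n) x * cis (2 * pi * (\<xi> \<bullet> x)) * ?F x) \<in> borel_measurable lborel" for n by measurable
  have D: "of_real (indicator ?D x) = (\<Prod>i\<in>UNIV. complex_of_real (case \<Gamma> i of Line => 1 | Circle l => indicator {0..<l} (x $ i)))" for x
   unfolding indicator_fundamental_domain by simp
  have "(\<lambda>n. gauss_cutoff (?e n) x) \<longlonglongrightarrow> of_real (indicator ?D x)" for x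
   unfolding D gauss_cutoff_def
  proof (intro tendsto_prod tendsto_of_real)
   fix i
   have "(\<lambda>n. - (?e n * x $ i)\<^sup>2 / 2) \<longlonglongrightarrow> - (0 * x $ i)\<^sup>2 / 2"
    using LIMSEQ_Suc[OF lim_1_over_n] by (intro tendsto_intros) auto
   from tendsto_exp[OF this]
   show "(\<lambda>n. case \<Gamma> i of Line => exp (- (?e n * x $ i)\<^sup>2 / 2) | Circle l => indicator {0..<l} (x $ i))
    \<longlonglongrightarrow> (case \<Gamma> i of Line => 1 | Circle l => indicator {0..<l} (x $ i))"
    by (cases "\<Gamma> i") (auto simp del: of_nat_Suc)
  qed
  then have "(\<lambda>n. gauss_cutoff (?e n) x * cis (2 * pi * (\<xi> \<bullet> x)) * ?F x) \<longlonglongrightarrow> of_real (indicator ?D x) * cis (2 * pi * (\<xi> \<bullet> x)) * ?F x" for x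
   by (intro tendsto_mult_right)
  then show "AE x in lborel. (\<lambda>n. gauss_cutoff (?e n) x * cis (2 * pi * (\<xi> \<bullet> x)) * ?F x)
    \<longlonglongrightarrow> indicator ?D x *\<^sub>R (?F x * cis (2 * pi * (\<xi> \<bullet> x)))"
   by (intro AE_I2) (simp add: scaleR_conv_of_real mult_ac)
  have "norm (gauss_cutoff (?e n) x) \<le> indicator ?D x" for n x
   unfolding indicator_fundamental_domain gauss_cutoff_def prod_norm[symmetric]
   by (intro prod_mono) (auto split: factor.split)
  then show "AE x in lborel. norm (gauss_cutoff (?e n) x * cis (2 * pi * (\<xi> \<bullet> x)) * ?F x) \<le> norm (indicator ?D x *\<^sub>R ?F x)" for n
   by (intro AE_I2) (auto simp: norm_mult intro!: mult_right_mono)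
 qed measurable
 have "(LBINT x. indicator ?D x *\<^sub>R (?F x * cis (2 * pi * (\<xi> \<bullet> x)))) = \<psi> \<xi> / of_real (?c\<^sup>2)"
  by (rule LIMSEQ_unique[OF lim2 lim1])
 moreover have "(LBINT x. indicator ?D x *\<^sub>R (dual_fourier_integral \<Gamma> \<psi> x * cis (2 * pi * (\<xi> \<bullet> x))))
   = of_real ?c * (LBINT x. indicator ?D x *\<^sub>R (?F x * cis (2 * pi * (\<xi> \<bullet> x))))"
  unfolding dual_fourier_integral_eq by (subst integral_mult_right_zero[symmetric]) (simp add: mult_ac)
 ultimately show ?thesis using fourier_const_pos by (simp add: power2_eq_square)
qed

text \<open>The function on the group whose Fourier transform is the integrable function \<open>k\<close>.\<close>

definition inverse_fourier :: "(real ^ 'n => complex) => real ^ 'n => complex" where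
 "inverse_fourier k x = fourier_const \<Gamma> * fourier_integral m (2 * pi) k x"

text \<open>Fubini moves the transform from \<open>k\<close> to the test function, where inversion undoes it.\<close>

lemma inverse_fourier_pairing:
 assumes k: "integrable m k" and \<psi>: "\<psi> \<in> tests"
 shows "(LBINT x. indicator (FD) x *\<^sub>R (inverse_fourier k x * dual_fourier_integral \<Gamma> \<psi> x))
  = (\<integral>\<xi>. k \<xi> * zero_ext \<psi> \<xi> \<partial>m)"
proof -
 let ?u = "\<lambda>x. of_real (fourier_const \<Gamma>) * (indicator (FD) x *\<^sub>R dual_fourier_integral \<Gamma> \<psi> x)"
 have u: "integrable lborel ?u"
  by (intro integrable_mult_right integrable_schwartz dual_fourier_integral_schwartz \<psi>)
 have "(LBINT x. indicator (FD) x *\<^sub>R (inverse_fourier k x * dual_fourier_integral \<Gamma> \<psi> x))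
   = (\<integral>x. ?u x * (\<integral>\<xi>. k \<xi> * cis (2 * pi * (\<xi> \<bullet> x)) \<partial>m) \<partial>lborel)"
  by (simp add: inverse_fourier_def fourier_integral_def mult_ac)
 also have "\<dots> = (\<integral>\<xi>. k \<xi> * (LBINT x. ?u x * cis (2 * pi * (\<xi> \<bullet> x))) \<partial>m)"
  by (intro fubini_kernel sigma_finite_dual sigma_finite_lborel u k) auto
 also have "\<dots> = (\<integral>\<xi>. k \<xi> * zero_ext \<psi> \<xi> \<partial>m)"
 proof (rule integral_cong_AE)
  have "(LBINT x. ?u x * cis (2 * pi * (\<xi> \<bullet> x))) = \<psi> \<xi>" if "\<xi> \<in> S" for \<xi>
   using dual_fourier_inversion[OF \<psi> that] by (simp add: mult.assoc flip: integral_mult_right_zero)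
  then have *: "k \<xi> * (LBINT x. ?u x * cis (2 * pi * (\<xi> \<bullet> x))) = k \<xi> * zero_ext \<psi> \<xi>" if "\<xi> \<in> S" for \<xi>
   using that by (simp add: zero_ext_def)
  show "AE \<xi> in m. k \<xi> * (LBINT x. ?u x * cis (2 * pi * (\<xi> \<bullet> x))) = k \<xi> * zero_ext \<psi> \<xi>"
   using AE_dual_group by eventually_elim (rule *)
  note [measurable] = dual_borel.momentsD(1)[OF moments_test[OF \<psi>]] borel_measurable_integrable[OF k]
   borel_measurable_integrable[OF u]
  interpret sigma_finite_measure "lborel :: (real ^ 'n) measure" by (rule sigma_finite_lborel)
  show "(\<lambda>\<xi>. k \<xi> * (LBINT x. ?u x * cis (2 * pi * (\<xi> \<bullet> x)))) \<in> borel_measurable m" by measurable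
  show "(\<lambda>\<xi>. k \<xi> * zero_ext \<psi> \<xi>) \<in> borel_measurable m" by measurable
 qed
 finally show ?thesis .
qed

end

section \<open>Smooth functions of one variable\<close>

fun real_diffs :: "nat => (real => real) => bool" where
 "real_diffs 0 f \<longleftrightarrow> True"
| "real_diffs (Suc n) f \<longleftrightarrow> (\<exists>f'. (\<forall>x. (f has_real_derivative f' x) (at x)) \<and> real_diffs n f')"

definition smooth_real :: "(real => real) => bool" where
 "smooth_real f \<longleftrightarrow> (\<forall>n. real_diffs n f)"

lemma real_diffs_SucD: "real_diffs (Suc n) f ==> real_diffs n f"
 by (induction n arbitrary: f) auto

lemma smooth_real_deriv:
 assumes "smooth_real f"
 shows "(f has_real_derivative deriv f x) (at x)" "smooth_real (deriv f)"
proof -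
 have "real_diffs (Suc n) f" for n using assms unfolding smooth_real_def by blast
 then obtain f' where f': "\<And>n x. (f has_real_derivative f' n x) (at x)" "\<And>n. real_diffs n (f' n)"
  unfolding real_diffs.simps by metis
 have "f' n = deriv f" for n using DERIV_imp_deriv[OF f'(1)] by auto
 then show "(f has_real_derivative deriv f x) (at x)" "smooth_real (deriv f)"
  using f' by (auto simp: smooth_real_def)
qed

text \<open>The one-variable form of \<open>smooth_coinduct\<close>.\<close>

lemma smooth_real_coinduct:
 assumes "f \<in> C" and step: "\<And>f. f \<in> C ==> \<exists>f'\<in>C. \<forall>x. (f has_real_derivative f' x) (at x)"
 shows "smooth_real f"
proof -
 have "f \<in> C ==> real_diffs n f" for n f
 proof (induction n arbitrary: f)
  case (Suc n)
  obtain f' where "f' \<in> C" "\<forall>x. (f has_real_derivative f' x) (at x)" using step[OF Suc.prems] by blast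
  then show ?case using Suc.IH by auto
 qed simp
 then show ?thesis using assms(1) by (simp add: smooth_real_def)
qed

lemma smooth_real_const: "smooth_real (\<lambda>_. c)"
proof (rule smooth_real_coinduct[of _ "range (\<lambda>c _. c)"])
 fix f :: "real => real" assume "f \<in> range (\<lambda>c _. c)"
 then have "\<forall>x. (f has_real_derivative (\<lambda>_. 0) x) (at x)" by auto
 then show "\<exists>f'\<in>range (\<lambda>c _. c). \<forall>x. (f has_real_derivative f' x) (at x)"
  by (intro bexI[of _ "\<lambda>_. 0"]) simp_all
qed auto

lemma real_diffs_add: "real_diffs n f ==> real_diffs n g ==> real_diffs n (\<lambda>x. f x + g x)"
proof (induction n arbitrary: f g)
 case (Suc n)
 obtain f' g' where "\<forall>x. (f has_real_derivative f' x) (at x)" "real_diffs n f'"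
  "\<forall>x. (g has_real_derivative g' x) (at x)" "real_diffs n g'"
  using Suc.prems by auto
 then have "\<forall>x. ((\<lambda>x. f x + g x) has_real_derivative f' x + g' x) (at x)" "real_diffs n (\<lambda>x. f' x + g' x)"
  using Suc.IH by (auto intro!: DERIV_add)
 then show ?case unfolding real_diffs.simps by (intro exI[of _ "\<lambda>x. f' x + g' x"] conjI)
qed simp

lemma real_diffs_mult: "real_diffs n f ==> real_diffs n g ==> real_diffs n (\<lambda>x. f x * g x)"
proof (induction n arbitrary: f g)
 case (Suc n)
 obtain f' g' where d: "\<forall>x. (f has_real_derivative f' x) (at x)" "real_diffs n f'"
  "\<forall>x. (g has_real_derivative g' x) (at x)" "real_diffs n g'"
  using Suc.prems by auto
 have "\<forall>x. ((\<lambda>x. f x * g x) has_real_derivative f' x * g x + g' x * f x) (at x)"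
  using d by (auto intro!: DERIV_mult)
 moreover have "real_diffs n (\<lambda>x. f' x * g x + g' x * f x)"
  using d Suc.IH real_diffs_SucD[OF Suc.prems(1)] real_diffs_SucD[OF Suc.prems(2)]
  by (intro real_diffs_add) simp_all
 ultimately show ?case unfolding real_diffs.simps by (intro exI[of _ "\<lambda>x. f' x * g x + g' x * f x"] conjI)
qed simp

lemma real_diffs_compose: "real_diffs n f ==> real_diffs n g ==> real_diffs n (\<lambda>x. f (g x))"
proof (induction n arbitrary: f)
 case (Suc n)
 obtain f' g' where d: "\<forall>x. (f has_real_derivative f' x) (at x)" "real_diffs n f'"
  "\<forall>x. (g has_real_derivative g' x) (at x)" "real_diffs n g'"
  using Suc.prems by auto
 have "\<forall>x. ((\<lambda>x. f (g x)) has_real_derivative f' (g x) * g' x) (at x)"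
 proof
  fix x show "((\<lambda>x. f (g x)) has_real_derivative f' (g x) * g' x) (at x)"
   by (rule DERIV_chain2) (use d in simp_all)
 qed
 moreover have "real_diffs n (\<lambda>x. f' (g x) * g' x)"
  by (rule real_diffs_mult[OF Suc.IH[OF d(2) real_diffs_SucD[OF Suc.prems(2)]] d(4)])
 ultimately show ?case unfolding real_diffs.simps by (intro exI[of _ "\<lambda>x. f' (g x) * g' x"] conjI)
qed simp

lemma smooth_real_add: "smooth_real f ==> smooth_real g ==> smooth_real (\<lambda>x. f x + g x)"
 and smooth_real_mult: "smooth_real f ==> smooth_real g ==> smooth_real (\<lambda>x. f x * g x)"
 and smooth_real_compose: "smooth_real f ==> smooth_real g ==> smooth_real (\<lambda>x. f (g x))"
 by (auto simp: smooth_real_def real_diffs_add real_diffs_mult real_diffs_compose)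

lemma smooth_real_ident: "smooth_real (\<lambda>x. x)"
 unfolding smooth_real_def
proof
 fix n show "real_diffs n (\<lambda>x. x)"
 proof (cases n)
  case (Suc k)
  have "real_diffs k (\<lambda>_. 1)" using smooth_real_const by (simp add: smooth_real_def)
  then show ?thesis unfolding Suc real_diffs.simps by (intro exI[of _ "\<lambda>_. 1"] conjI) auto
 qed simp
qed

lemma smooth_real_affine: "smooth_real (\<lambda>x. a * x + b)"
 by (intro smooth_real_add smooth_real_mult smooth_real_const smooth_real_ident)

lemma smooth_real_sum: "finite A ==> (\<And>i. i \<in> A ==> smooth_real (f i)) ==> smooth_real (\<lambda>x. \<Sum>i\<in>A. f i x)"
 by (induction A rule: finite_induct) (auto intro!: smooth_real_add smooth_real_const)

lemma smooth_real_sin: "smooth_real sin"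
proof (rule smooth_real_coinduct[of _ "{sin, cos, \<lambda>x. - sin x, \<lambda>x. - cos x}"])
 fix f :: "real => real" assume f: "f \<in> {sin, cos, \<lambda>x. - sin x, \<lambda>x. - cos x}"
 have "\<forall>x. (sin has_real_derivative cos x) (at x)" "\<forall>x. (cos has_real_derivative (- sin x)) (at x)"
  "\<forall>x. ((\<lambda>x. - sin x) has_real_derivative (- cos x)) (at x)" "\<forall>x. ((\<lambda>x. - cos x) has_real_derivative sin x) (at x)" for x :: real
  by (auto intro!: derivative_eq_intros)
 then show "\<exists>f'\<in>{sin, cos, \<lambda>x. - sin x, \<lambda>x. - cos x}. \<forall>x. (f has_real_derivative f' x) (at x)"
  using f by (elim insertE emptyE) simp_all
qed simp

lemma smooth_real_continuous: "smooth_real f ==> continuous_on UNIV f"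
 using smooth_real_deriv(1) by (auto intro!: continuous_at_imp_continuous_on DERIV_isCont)

text \<open>The standard smooth function that vanishes on a half-line.\<close>

definition flat_exp :: "real => real" where
 "flat_exp x = (if x > 0 then exp (- (1 / x)) else 0)"

lemma poly_exp_decay: "((\<lambda>y. poly p y * exp (- y)) \<longlongrightarrow> 0) (at_top :: real filter)"
proof -
 have "((\<lambda>y. \<Sum>i\<le>degree p. coeff p i * (y ^ i / exp y)) \<longlongrightarrow> (\<Sum>i\<le>degree p. coeff p i * 0)) at_top"
  by (intro tendsto_intros tendsto_power_div_exp_0)
 then show ?thesis
  by (simp add: poly_altdef sum_distrib_right exp_minus divide_inverse mult.assoc)
qed

text \<open>
 With \<open>y = 1 / x\<close>, the derivative of \<open>p y * exp (- y)\<close> is \<open>y\<^sup>2 * (p y - p' y) * exp (- y)\<close>,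
 which is of the same form; and \<open>p y * exp (- y)\<close> tends to zero faster than any power of \<open>x\<close>.
\<close>

lemma smooth_flat: "smooth_real flat_exp"
proof -
 define G where "G = (\<lambda>(p::real poly) x. if x > 0 then poly p (1 / x) * exp (- (1 / x)) else 0)"
 have "\<forall>x. (G p has_real_derivative G ([:0, 0, 1:] * (p - pderiv p)) x) (at x)" for p
 proof
  fix x :: real
  let ?q = "[:0, 0, 1:] * (p - pderiv p)"
  consider "x > 0" | "x < 0" | "x = 0" by linarith
  then show "(G p has_real_derivative G ?q x) (at x)"
  proof cases
   case 1
   have "((\<lambda>x. poly p (1 / x) * exp (- (1 / x))) has_real_derivative
     (poly (pderiv p) (1 / x) * (- (1 / x\<^sup>2))) * exp (- (1 / x)) + exp (- (1 / x)) * (1 / x\<^sup>2) * poly p (1 / x)) (at x)"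
    using 1 by (auto intro!: derivative_eq_intros DERIV_chain2[OF poly_DERIV] simp: field_simps power2_eq_square)
   moreover have "(poly (pderiv p) (1 / x) * (- (1 / x\<^sup>2))) * exp (- (1 / x)) + exp (- (1 / x)) * (1 / x\<^sup>2) * poly p (1 / x) = G ?q x"
    using 1 by (simp add: G_def field_simps power2_eq_square)
   ultimately have "((\<lambda>x. poly p (1 / x) * exp (- (1 / x))) has_real_derivative G ?q x) (at x)" by simp
   then show ?thesis
    by (rule has_field_derivative_transform_within_open[of _ _ _ "{0<..}"]) (use 1 in \<open>auto simp: G_def\<close>)
  next
   case 2
   have "((\<lambda>_. 0) has_real_derivative 0) (at x)" by simp
   then have "(G p has_real_derivative 0) (at x)"
    by (rule has_field_derivative_transform_within_open[of _ _ _ "{..<0}"]) (use 2 in \<open>auto simp: G_def\<close>)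
   then show ?thesis using 2 by (simp add: G_def)
  next
   case 3
   have "((\<lambda>h. G p h / h) \<longlongrightarrow> 0) (at_right 0)"
   proof -
    have "((\<lambda>h. poly ([:0, 1:] * p) (inverse h) * exp (- inverse h)) \<longlongrightarrow> 0) (at_right 0)"
     by (rule filterlim_compose[OF poly_exp_decay filterlim_inverse_at_top_right])
    moreover have "\<forall>\<^sub>F h in at_right 0. poly ([:0, 1:] * p) (inverse h) * exp (- inverse h) = G p h / h"
     by (intro eventually_at_rightI[of 0 1]) (auto simp: G_def field_simps)
    ultimately show ?thesis by (rule Lim_transform_eventually)
   qed
   moreover have "((\<lambda>h. G p h / h) \<longlongrightarrow> 0) (at_left 0)"
   proof -
    have "\<forall>\<^sub>F h in at_left 0. 0 = G p h / h"
     by (intro eventually_at_leftI[of "-1"]) (auto simp: G_def)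
    then show ?thesis by (rule Lim_transform_eventually[OF tendsto_const])
   qed
   ultimately have "((\<lambda>h. G p h / h) \<longlongrightarrow> 0) (at 0)" by (simp add: filterlim_split_at)
   moreover have "G q 0 = 0" for q by (simp add: G_def)
   ultimately show ?thesis using 3 by (simp add: DERIV_def)
  qed
 qed
 then have "smooth_real (G p)" for p
  by (intro smooth_real_coinduct[of _ "range G"]) auto
 then have "smooth_real (G 1)" .
 moreover have "flat_exp = G 1" by (auto simp: G_def flat_exp_def fun_eq_iff)
 ultimately show ?thesis by (simp only:)
qed

lemma flat_nonneg: "0 \<le> flat_exp x" and flat_le_1: "flat_exp x \<le> 1" and flat_zero: "x \<le> 0 ==> flat_exp x = 0"
 by (auto simp: flat_exp_def)

lemma flat_limit: "(\<lambda>n. flat_exp (real n * x)) \<longlonglongrightarrow> indicator {0<..} x"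
proof (cases "x > 0")
 case True
 have "(\<lambda>n. exp (- ((1 / x) * (1 / real n)))) \<longlonglongrightarrow> exp (- ((1 / x) * 0))"
  by (intro tendsto_intros lim_1_over_n)
 moreover have "\<forall>\<^sub>F n in sequentially. exp (- ((1 / x) * (1 / real n))) = flat_exp (real n * x)"
  using eventually_gt_at_top[of 0] by eventually_elim (use True in \<open>simp add: flat_exp_def mult.commute\<close>)
 ultimately show ?thesis using True by (simp add: Lim_transform_eventually)
next
 case False
 then have "flat_exp (real n * x) = 0" for n by (intro flat_zero) (simp add: mult_nonneg_nonpos)
 then show ?thesis using False by simp
qed

text \<open>A bump supported in \<open>{-1..1}\<close> with value \<open>1\<close> at the origin.\<close>

definition bump :: "real => real" where
 "bump x = exp 2 * (flat_exp (1 * x + 1) * flat_exp ((- 1) * x + 1))"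

lemma smooth_bump: "smooth_real bump"
 unfolding bump_def[abs_def]
 by (intro smooth_real_mult smooth_real_const smooth_real_compose[OF smooth_flat smooth_real_affine])

lemma bump_0: "bump 0 = 1"
 by (simp add: bump_def flat_exp_def flip: exp_add)

lemma bump_outside: "\<bar>x\<bar> \<ge> 1 ==> bump x = 0"
 by (cases "x \<ge> 0") (auto simp: bump_def flat_zero)

section \<open>Products of smooth functions of one variable\<close>

lemma smooth_one_coordinate:
 assumes "smooth_real f" shows "everywhere.smooth (\<lambda>x. complex_of_real (f (x $ i)))"
proof (rule everywhere.smooth_coinduct[of _ "{\<lambda>x. complex_of_real (f (x $ i)) | f. smooth_real f}"])
 fix F j assume "F \<in> {\<lambda>x. complex_of_real (f (x $ i)) | f. smooth_real f}"
 then obtain f where F: "F = (\<lambda>x. complex_of_real (f (x $ i)))" and f: "smooth_real f" by blast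
 have hd: "(F has_derivative (\<lambda>h. complex_of_real (deriv f (x $ i) * h $ i))) (at x)" for x
 proof -
  have "(f has_derivative (\<lambda>h. deriv f (x $ i) * h)) (at (x $ i))"
   using smooth_real_deriv(1)[OF f] by (simp add: has_field_derivative_def)
  moreover have "((\<lambda>x. x $ i) has_derivative (\<lambda>h. h $ i)) (at x)"
   by (intro bounded_linear_imp_has_derivative bounded_linear_vec_nth)
  ultimately have "((\<lambda>x. f (x $ i)) has_derivative (\<lambda>h. deriv f (x $ i) * h $ i)) (at x)"
   using has_derivative_compose by blast
  then show ?thesis unfolding F by (rule has_derivative_of_real)
 qed
 then show "F differentiable_on UNIV" by (auto simp: differentiable_on_def differentiable_def)
 let ?f' = "if j = i then deriv f else (\<lambda>_. 0)"
 have "partial_deriv j F x = complex_of_real (?f' (x $ i))" for x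
 proof -
  have "((\<lambda>u. F (x + u *\<^sub>R axis j 1)) has_vector_derivative complex_of_real (deriv f (x $ i) * axis j 1 $ i)) (at 0)"
   by (rule has_derivative_imp_partial[where S = UNIV]) (use hd[of x] in simp_all)
  from partial_deriv_eqI[OF this] show ?thesis by (simp add: axis_def)
 qed
 moreover have "smooth_real ?f'" using smooth_real_deriv(2)[OF f] smooth_real_const by simp
 ultimately show "\<exists>g\<in>{\<lambda>x. complex_of_real (f (x $ i)) | f. smooth_real f}. \<forall>x\<in>UNIV. partial_deriv j F x = g x"
  by (intro bexI[of _ "\<lambda>x. complex_of_real (?f' (x $ i))"]) blast+
qed (use assms in blast)

definition prod_fun :: "('n::finite => real => real) => real ^ 'n => complex" where
 "prod_fun f x = (\<Prod>i\<in>UNIV. complex_of_real (f i (x $ i)))"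

lemma smooth_prod_fun:
 assumes "\<And>i. smooth_real (f i)" shows "everywhere.smooth (prod_fun f)"
proof -
 have "everywhere.smooth (\<lambda>x. \<Prod>i\<in>A. complex_of_real (f i (x $ i)))" if "finite A" for A
  using that by (induction A rule: finite_induct)
   (auto intro!: everywhere.smooth_mult smooth_one_coordinate everywhere.smooth_const assms)
 then show ?thesis by (simp add: prod_fun_def[abs_def])
qed

lemma partial_deriv_prod_fun:
 assumes "\<And>i. smooth_real (f i)"
 shows "partial_deriv j (prod_fun f) = prod_fun (f(j := deriv (f j)))"
proof
 fix x :: "real ^ 'a"
 let ?P = "\<Prod>i\<in>UNIV - {j}. complex_of_real (f i (x $ i))"
 have split: "prod_fun g y = complex_of_real (g j (y $ j)) * (\<Prod>i\<in>UNIV - {j}. complex_of_real (g i (y $ i)))" for g y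
  unfolding prod_fun_def by (rule prod.remove) auto
 have "prod_fun f (x + u *\<^sub>R axis j 1) = complex_of_real (f j (x $ j + u)) * ?P" for u
  unfolding split by (intro arg_cong2[where f = "(*)"] prod.cong) (auto simp: axis_def)
 moreover have "((\<lambda>u. complex_of_real (f j (x $ j + u)) * ?P) has_vector_derivative complex_of_real (deriv (f j) (x $ j)) * ?P) (at 0)"
 proof -
  have *: "((\<lambda>u. f j (x $ j + u)) has_real_derivative deriv (f j) (x $ j)) (at 0)"
   using smooth_real_deriv(1)[OF assms[of j], of "x $ j"]
    DERIV_shift[of "f j" "deriv (f j) (x $ j)" 0 "x $ j"] by (simp add: add.commute[of "x $ j"])
  then have **: "((\<lambda>u. f j (x $ j + u)) has_vector_derivative deriv (f j) (x $ j)) (at 0)"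
   by (simp add: has_real_derivative_iff_has_vector_derivative)
  show ?thesis by (rule has_vector_derivative_mult_left, rule has_vector_derivative_of_real) (use * ** in simp)
 qed
 ultimately have "partial_deriv j (prod_fun f) x = complex_of_real (deriv (f j) (x $ j)) * ?P"
  by (intro partial_deriv_eqI) simp
 also have "\<dots> = prod_fun (f(j := deriv (f j))) x"
  unfolding split by (auto intro!: prod.cong)
 finally show "partial_deriv j (prod_fun f) x = prod_fun (f(j := deriv (f j))) x" .
qed

definition vanishing_outside :: "real => (real => real) => bool" where
 "vanishing_outside R f \<longleftrightarrow> (\<forall>t. \<bar>t\<bar> \<ge> R \<longrightarrow> f t = 0)"

lemma vanishing_outside_mono: "vanishing_outside R f ==> R \<le> R' ==> vanishing_outside R' f"
 by (auto simp: vanishing_outside_def)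

lemma vanishing_outside_deriv:
 assumes "smooth_real f" "vanishing_outside R f" shows "vanishing_outside R (deriv f)"
 unfolding vanishing_outside_def
proof (intro allI impI)
 have open_part: "deriv f t = 0" if "\<bar>t\<bar> > R" for t
 proof -
  have op: "open {t::real. R < \<bar>t\<bar>}" by (intro open_Collect_less continuous_intros)
  have mem: "t \<in> {t::real. R < \<bar>t\<bar>}" using that by simp
  have "0 = f u" if "u \<in> {t::real. R < \<bar>t\<bar>}" for u
   using that assms(2) by (simp add: vanishing_outside_def)
  then have "(f has_real_derivative 0) (at t)"
   by (rule has_field_derivative_transform_within_open[OF DERIV_const op mem])
  then show ?thesis by (rule DERIV_imp_deriv)
 qed
 fix t assume t: "\<bar>t\<bar> \<ge> R"
 define s where "s n = t + (if t \<ge> 0 then 1 else -1) * (1 / real (Suc n))" for n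
 have "s \<longlonglongrightarrow> t + (if t \<ge> 0 then 1 else -1) * 0"
  unfolding s_def by (intro tendsto_intros LIMSEQ_Suc[OF lim_1_over_n])
 then have "(\<lambda>n. deriv f (s n)) \<longlonglongrightarrow> deriv f t"
  using smooth_real_continuous[OF smooth_real_deriv(2)[OF assms(1)]]
  by (auto simp: continuous_on_eq_continuous_at isCont_tendsto_compose)
 moreover have "deriv f (s n) = 0" for n
 proof (rule open_part)
  have "1 / real (Suc n) > 0" by simp
  then show "\<bar>s n\<bar> > R"
   using t by (cases "t \<ge> 0"; simp only: s_def if_True if_False; linarith)
 qed
 ultimately show "deriv f t = 0" by (simp add: LIMSEQ_const_iff)
qed

lemma vanishing_outside_bounded:
 assumes "smooth_real f" "vanishing_outside R f" shows "\<exists>B. \<forall>t. \<bar>f t\<bar> \<le> B"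
proof -
 have "compact (f ` {- \<bar>R\<bar>..\<bar>R\<bar>})"
  using smooth_real_continuous[OF assms(1)] by (intro compact_continuous_image) (auto intro: continuous_on_subset)
 then obtain B where B: "\<forall>y\<in>f ` {- \<bar>R\<bar>..\<bar>R\<bar>}. norm y \<le> B"
  using compact_imp_bounded bounded_iff by metis
 have "\<bar>f t\<bar> \<le> max B 0" for t
 proof (cases "\<bar>t\<bar> \<le> \<bar>R\<bar>")
  case True
  then have "\<bar>f t\<bar> \<le> B" using B by (auto simp: abs_le_iff)
  then show ?thesis by simp
 next
  case False
  then have "f t = 0" using assms(2) by (auto simp: vanishing_outside_def)
  then show ?thesis by simp
 qed
 then show ?thesis by blast
qed

definition periodic_real :: "real => (real => real) => bool" where
 "periodic_real l f \<longleftrightarrow> (\<forall>t. f (t + l) = f t)"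

lemma periodic_real_deriv:
 assumes "smooth_real f" "periodic_real l f" shows "periodic_real l (deriv f)"
 unfolding periodic_real_def
proof
 fix t
 have "((\<lambda>t. f (t + l)) has_real_derivative deriv f (t + l)) (at t)"
  using smooth_real_deriv(1)[OF assms(1), of "t + l"] by (simp add: DERIV_shift)
 then have "(f has_real_derivative deriv f (t + l)) (at t)"
  using assms(2) by (simp add: periodic_real_def)
 then show "deriv f (t + l) = deriv f t" by (simp add: DERIV_imp_deriv)
qed

lemma periodic_real_bounded:
 assumes "smooth_real f" "periodic_real l f" "l > 0" shows "\<exists>B. \<forall>t. \<bar>f t\<bar> \<le> B"
proof -
 have "compact (f ` {0..l})"
  using smooth_real_continuous[OF assms(1)] by (intro compact_continuous_image) (auto intro: continuous_on_subset)
 then obtain B where B: "\<forall>y\<in>f ` {0..l}. norm y \<le> B"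
  using compact_imp_bounded bounded_iff by metis
 have shift_nat: "f (t + real n * l) = f t" for n t
 proof (induction n)
  case (Suc n)
  have "f (t + real (Suc n) * l) = f ((t + real n * l) + l)" by (simp add: algebra_simps)
  then show ?case using assms(2) Suc by (simp add: periodic_real_def)
 qed simp
 have shift: "f (t + of_int k * l) = f t" for k t
 proof (cases "k \<ge> 0")
  case True
  then show ?thesis using shift_nat[of t "nat k"] by simp
 next
  case False
  then show ?thesis using shift_nat[of "t + of_int k * l" "nat (- k)"] by simp
 qed
 have "\<bar>f t\<bar> \<le> B" for t
 proof -
  let ?s = "t + of_int (- \<lfloor>t / l\<rfloor>) * l"
  have "?s \<in> {0..l}"
   using floor_divide_lower[OF assms(3), of t] floor_divide_upper[OF assms(3), of t] by (simp add: algebra_simps)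
  then have "norm (f ?s) \<le> B" using B by blast
  then show ?thesis using shift[of t "- \<lfloor>t / l\<rfloor>"] by simp
 qed
 then show ?thesis by blast
qed

text \<open>A class of factors that is closed under derivatives and whose products are Schwartz functions on the
 group.\<close>

definition admissible_factors :: "('n::finite => factor) => real => ('n => real => real) => bool" where
 "admissible_factors \<Gamma> R f \<longleftrightarrow> (\<forall>i. smooth_real (f i) \<and>
  (case \<Gamma> i of Line => vanishing_outside R (f i) | Circle l => periodic_real l (f i)))"

context product_group begin

lemma partial_derivs_prod_fun:
 assumes "admissible_factors \<Gamma> R f"
 shows "\<exists>g. admissible_factors \<Gamma> R g \<and> partial_derivs js (prod_fun f) = prod_fun g"
proof (induction js)
 case (Cons j js)
 then obtain g where g: "admissible_factors \<Gamma> R g" "partial_derivs js (prod_fun f) = prod_fun g" by blast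
 have sm: "smooth_real (g i)" for i using g(1) by (simp add: admissible_factors_def)
 have "admissible_factors \<Gamma> R (g(j := deriv (g j)))"
  unfolding admissible_factors_def
 proof
  fix i
  have "case \<Gamma> i of Line => vanishing_outside R (deriv (g i)) | Circle l => periodic_real l (deriv (g i))"
   using g(1)[unfolded admissible_factors_def, rule_format, of i]
   by (cases "\<Gamma> i") (auto intro: vanishing_outside_deriv periodic_real_deriv)
  then show "smooth_real ((g(j := deriv (g j))) i) \<and>
   (case \<Gamma> i of Line => vanishing_outside R ((g(j := deriv (g j))) i) | Circle l => periodic_real l ((g(j := deriv (g j))) i))"
   using g(1)[unfolded admissible_factors_def, rule_format, of i] smooth_real_deriv(2)[OF sm]
   by (cases "i = j"; cases "\<Gamma> i") auto
 qed
 then show ?case using partial_deriv_prod_fun[of g j] sm g(2) by (auto simp: partial_derivs_Cons)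
qed (use assms in auto)

lemma admissible_prod_bound:
 assumes f: "admissible_factors \<Gamma> R f"
 shows "\<exists>B. \<forall>x. (1 + norm (line_part \<Gamma> x)) ^ k * norm (prod_fun f x) \<le> B"
proof -
 have "\<forall>i. \<exists>B. \<forall>t. \<bar>f i t\<bar> \<le> B"
 proof
  fix i show "\<exists>B. \<forall>t. \<bar>f i t\<bar> \<le> B"
   using f[unfolded admissible_factors_def, rule_format, of i] period_pos[of i]
   by (cases "\<Gamma> i") (auto intro: vanishing_outside_bounded periodic_real_bounded)
 qed
 then obtain b where b: "\<And>i t. \<bar>f i t\<bar> \<le> b i" by metis
 have b0: "0 \<le> b i" for i using b[of i 0] by (meson abs_ge_zero order_trans)
 let ?R = "1 + (\<Sum>j\<in>lines. \<bar>R\<bar>)"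
 have "(1 + norm (line_part \<Gamma> x)) ^ k * norm (prod_fun f x) \<le> ?R ^ k * (\<Prod>i\<in>UNIV. b i)" for x
 proof (cases "\<forall>i. \<Gamma> i = Line \<longrightarrow> \<bar>x $ i\<bar> < R")
  case True
  have "(\<Sum>j\<in>lines. \<bar>x $ j\<bar>) \<le> (\<Sum>j\<in>lines. \<bar>R\<bar>)"
   using True by (intro sum_mono) force
  then have "1 + norm (line_part \<Gamma> x) \<le> ?R" using line_part_le_sum[of x] by linarith
  moreover have "norm (prod_fun f x) \<le> (\<Prod>i\<in>UNIV. b i)"
   unfolding prod_fun_def prod_norm[symmetric] using b by (intro prod_mono) auto
  ultimately show ?thesis by (intro mult_mono power_mono) (auto intro!: add_nonneg_nonneg sum_nonneg)
 next
  case False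
  then obtain i where i: "\<Gamma> i = Line" "\<bar>x $ i\<bar> \<ge> R" by (auto simp: not_less)
  then have "f i (x $ i) = 0"
   using f[unfolded admissible_factors_def, rule_format, of i] by (auto simp: vanishing_outside_def)
  then have "prod_fun f x = 0" unfolding prod_fun_def by (intro prod_zero) auto
  then show ?thesis using b0 by (auto intro!: mult_nonneg_nonneg prod_nonneg zero_le_power add_nonneg_nonneg sum_nonneg)
 qed
 then show ?thesis by blast
qed

lemma prod_fun_schwartz:
 assumes f: "admissible_factors \<Gamma> R f" shows "prod_fun f \<in> schwartz \<Gamma>"
 unfolding schwartz_iff
proof (intro conjI allI)
 show "everywhere.smooth (prod_fun f)"
  using f by (intro smooth_prod_fun) (simp add: admissible_factors_def)
 show "periodic \<Gamma> (prod_fun f)"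
  unfolding periodic_def prod_fun_def
 proof (intro allI impI prod.cong refl)
  fix i l x j assume i: "\<Gamma> i = Circle l"
  then have "f i (x $ i + l) = f i (x $ i)"
   using f[unfolded admissible_factors_def, rule_format, of i] by (simp add: periodic_real_def)
  then show "complex_of_real (f j ((x + l *\<^sub>R axis i 1) $ j)) = complex_of_real (f j (x $ j))"
   by (cases "j = i") (auto simp: axis_def)
 qed
 fix js k
 show "\<exists>B. \<forall>x. (1 + norm (line_part \<Gamma> x)) ^ k * norm (partial_derivs js (prod_fun f) x) \<le> B"
  using partial_derivs_prod_fun[OF f, of js] admissible_prod_bound by auto
qed

lemma smooth_everywhere_along: "everywhere.smooth f ==> along.smooth f"
 unfolding everywhere.smooth_def along.smooth_def by (auto intro: differentiable_on_subset)

lemma prod_fun_test: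
 assumes "\<And>i. smooth_real (f i)" "\<And>i. vanishing_outside R (f i)"
 shows "prod_fun f \<in> tests"
 unfolding dual_test_iff
proof (intro conjI exI ballI impI)
 show "along.smooth (prod_fun f)" by (intro smooth_everywhere_along smooth_prod_fun assms)
 fix \<xi> :: "real ^ 'n" assume \<xi>: "norm \<xi> > real CARD('n) * \<bar>R\<bar>"
 have "\<not> (\<forall>i. \<bar>\<xi> $ i\<bar> < R)"
 proof
  assume *: "\<forall>i. \<bar>\<xi> $ i\<bar> < R"
  have "(\<Sum>i\<in>UNIV. \<bar>\<xi> $ i\<bar>) \<le> (\<Sum>i\<in>(UNIV::'n set). \<bar>R\<bar>)"
  proof (rule sum_mono)
   fix i show "\<bar>\<xi> $ i\<bar> \<le> \<bar>R\<bar>" using *[rule_format, of i] by linarith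
  qed
  then show False using \<xi> norm_le_l1_cart[of \<xi>] by simp
 qed
 then obtain i where "\<bar>\<xi> $ i\<bar> \<ge> R" by (auto simp: not_less)
 then have "f i (\<xi> $ i) = 0" using assms(2)[of i] by (simp add: vanishing_outside_def)
 then show "prod_fun f \<xi> = 0" unfolding prod_fun_def by (intro prod_zero) auto
qed

end

section \<open>Functions determined by their integrals against smooth functions\<close>

text \<open>The positive and the negative part of \<open>w\<close> are densities of two finite measures that agree on boxes,
 which generate the Borel sets.\<close>

lemma AE_zero_of_box_integrals_real:
 fixes w :: "'a::euclidean_space => real"
 assumes sets: "sets M = sets borel" and w: "integrable M w"
  and zero: "\<And>a b. (\<integral>x. indicator (box a b) x * w x \<partial>M) = 0"
 shows "AE x in M. w x = 0"
proof -
 note [simp, measurable_cong] = sets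
 have [simp]: "space M = UNIV" using sets_eq_imp_space_eq[OF sets] by simp
 note [measurable] = borel_measurable_integrable[OF w]
 define f g where "f = (\<lambda>x. ennreal (w x))" and "g = (\<lambda>x. ennreal (- w x))"
 have [measurable]: "f \<in> borel_measurable M" "g \<in> borel_measurable M" by (auto simp: f_def g_def)
 have fin: "(\<integral>\<^sup>+x. f x \<partial>M) < \<infinity>" "(\<integral>\<^sup>+x. g x \<partial>M) < \<infinity>"
  using w real_integrable_def[of M w] by (auto simp: f_def g_def less_top)
 have box_eq: "emeasure (density M f) (box a b) = emeasure (density M g) (box a b)" for a b
 proof -
  let ?w = "\<lambda>x. indicator (box a b) x * w x"
  have i: "integrable M ?w"
   using integrable_mult_indicator[OF _ w, of "box a b"] by simp
  have "(\<integral>\<^sup>+x. ennreal (?w x) \<partial>M) < top" "(\<integral>\<^sup>+x. ennreal (- ?w x) \<partial>M) < top"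
   using i real_integrable_def[of M ?w] by (auto simp: less_top)
  moreover have "enn2real (\<integral>\<^sup>+x. ennreal (?w x) \<partial>M) = enn2real (\<integral>\<^sup>+x. ennreal (- ?w x) \<partial>M)"
   using real_lebesgue_integral_def[OF i] zero[of a b] by simp
  ultimately have "(\<integral>\<^sup>+x. ennreal (?w x) \<partial>M) = (\<integral>\<^sup>+x. ennreal (- ?w x) \<partial>M)"
   by (metis (no_types) ennreal_enn2real)
  moreover have "(\<integral>\<^sup>+x. ennreal (?w x) \<partial>M) = (\<integral>\<^sup>+x. f x * indicator (box a b) x \<partial>M)"
   by (intro nn_integral_cong) (auto simp: f_def indicator_def)
  moreover have "(\<integral>\<^sup>+x. ennreal (- ?w x) \<partial>M) = (\<integral>\<^sup>+x. g x * indicator (box a b) x \<partial>M)"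
   by (intro nn_integral_cong) (auto simp: g_def indicator_def)
  ultimately show ?thesis by (simp add: emeasure_density)
 qed
 have "density M f = density M g"
 proof (rule measure_eqI_generator_eq)
  let ?E = "range (\<lambda>(a, b). box a b::'a set)"
  show "Int_stable ?E" by (auto simp: Int_stable_def box_Int_box)
  show "?E \<subseteq> Pow UNIV" "sets (density M f) = sigma_sets UNIV ?E" "sets (density M g) = sigma_sets UNIV ?E"
   by (simp_all add: borel_eq_box sets)
  let ?A = "\<lambda>n::nat. box (- (real n *\<^sub>R One)) (real n *\<^sub>R One) :: 'a set"
  show "range ?A \<subseteq> ?E" "(\<Union>i. ?A i) = UNIV" unfolding UN_box_eq_UNIV by auto
  show "emeasure (density M f) (?A i) \<noteq> \<infinity>" for i
  proof -
   have "emeasure (density M f) (?A i) \<le> emeasure (density M f) UNIV" by (intro emeasure_mono) auto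
   also have "\<dots> < \<infinity>" using fin by (simp add: emeasure_density)
   finally show ?thesis by simp
  qed
  show "emeasure (density M f) X = emeasure (density M g) X" if "X \<in> ?E" for X
   using that box_eq by auto
 qed
 then have "AE x in M. f x = g x"
  using fin by (subst (asm) finite_density_unique) auto
 then show ?thesis
 proof eventually_elim
  case (elim x)
  then show ?case
   by (cases "w x \<ge> 0") (auto simp: f_def g_def ennreal_neg ennreal_eq_0_iff dest: sym)
 qed
qed

lemma AE_zero_of_box_integrals:
 fixes w :: "'a::euclidean_space => complex"
 assumes sets: "sets M = sets borel"
  and int: "\<And>a b. integrable M (\<lambda>x. indicator (box a b) x *\<^sub>R w x)"
  and zero: "\<And>a b. (\<integral>x. indicator (box a b) x *\<^sub>R w x \<partial>M) = 0"
 shows "AE x in M. w x = 0"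
proof -
 let ?A = "\<lambda>n::nat. box (- (real n *\<^sub>R One)) (real n *\<^sub>R One) :: 'a set"
 have *: "AE x in M. indicator (?A n) x *\<^sub>R w x = 0" for n
 proof -
  let ?v = "\<lambda>x. indicator (?A n) x *\<^sub>R w x"
  have sub: "\<exists>c d. box a b \<inter> ?A n = box c d" for a b by (auto simp: box_Int_box)
  have z: "(\<integral>x. indicator (box a b) x *\<^sub>R ?v x \<partial>M) = 0" and i: "integrable M (\<lambda>x. indicator (box a b) x *\<^sub>R ?v x)" for a b
  proof -
   obtain c d where "box a b \<inter> ?A n = box c d" using sub by blast
   then have "indicator (box a b) x *\<^sub>R ?v x = indicator (box c d) x *\<^sub>R w x" for x
    by (metis indicator_inter_arith scaleR_scaleR)
   then show "(\<integral>x. indicator (box a b) x *\<^sub>R ?v x \<partial>M) = 0" "integrable M (\<lambda>x. indicator (box a b) x *\<^sub>R ?v x)"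
    using int[of c d] zero[of c d] by (simp_all only:)
  qed
  have "AE x in M. Re (?v x) = 0"
  proof (rule AE_zero_of_box_integrals_real[OF sets])
   show "integrable M (\<lambda>x. Re (?v x))" using int by (rule integrable_Re)
   show "(\<integral>x. indicator (box a b) x * Re (?v x) \<partial>M) = 0" for a b
    using integral_Re[OF i[of a b]] z[of a b] by (simp add: mult.assoc)
  qed
  moreover have "AE x in M. Im (?v x) = 0"
  proof (rule AE_zero_of_box_integrals_real[OF sets])
   show "integrable M (\<lambda>x. Im (?v x))" using int by (rule integrable_Im)
   show "(\<integral>x. indicator (box a b) x * Im (?v x) \<partial>M) = 0" for a b
    using integral_Im[OF i[of a b]] z[of a b] by (simp add: mult.assoc)
  qed
  ultimately show ?thesis by eventually_elim (simp add: complex_eq_iff)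
 qed
 have "AE x in M. \<forall>n. indicator (?A n) x *\<^sub>R w x = 0" unfolding AE_all_countable by (rule allI) (rule *)
 then show ?thesis
 proof eventually_elim
  case (elim x)
  have "x \<in> (\<Union>n. ?A n)" unfolding UN_box_eq_UNIV by simp
  then obtain n where "x \<in> ?A n" by blast
  then show ?case using elim[rule_format, of n] by simp
 qed
qed

lemma indicator_box: "indicator (box a b) x = (\<Prod>i\<in>UNIV. indicator {a $ i<..<b $ i} (x $ i) :: real)"
 for x :: "real ^ 'n::finite"
proof (cases "x \<in> box a b")
 case False
 then obtain i where "x $ i \<notin> {a $ i<..<b $ i}" by (auto simp: mem_box_cart)
 then show ?thesis using False by (auto intro!: prod_zero[symmetric] bexI[of _ i] simp: indicator_def)
qed (auto simp: mem_box_cart)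

definition interval_bump :: "nat => real => real => real => real" where
 "interval_bump n a b t = flat_exp (real n * (t - a)) * flat_exp (real n * (b - t))"

lemma smooth_interval_bump: "smooth_real (interval_bump n a b)"
proof -
 have "interval_bump n a b = (\<lambda>t. flat_exp (real n * t + (- real n * a)) * flat_exp ((- real n) * t + real n * b))"
  by (simp add: interval_bump_def fun_eq_iff algebra_simps)
 then show ?thesis
  by (simp only:) (intro smooth_real_mult smooth_real_compose[OF smooth_flat smooth_real_affine])
qed

lemma interval_bump_vanishing: "vanishing_outside (1 + \<bar>a\<bar> + \<bar>b\<bar>) (interval_bump n a b)"
 unfolding vanishing_outside_def
proof (intro allI impI)
 fix t assume "1 + \<bar>a\<bar> + \<bar>b\<bar> \<le> \<bar>t\<bar>"
 then have "t - a \<le> 0 \<or> b - t \<le> 0" by linarith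
 then show "interval_bump n a b t = 0"
  unfolding interval_bump_def using flat_zero[of "real n * (t - a)"] flat_zero[of "real n * (b - t)"]
  by (auto simp: mult_nonneg_nonpos)
qed

lemma interval_bump_limit: "(\<lambda>n. interval_bump n a b t) \<longlonglongrightarrow> indicator {a<..<b} t"
proof -
 have "(\<lambda>n. interval_bump n a b t) \<longlonglongrightarrow> indicator {0<..} (t - a) * indicator {0<..} (b - t)"
  unfolding interval_bump_def by (intro tendsto_mult flat_limit)
 moreover have "indicator {0<..} (t - a) * indicator {0<..} (b - t) = (indicator {a<..<b} t :: real)"
  by (auto simp: indicator_def)
 ultimately show ?thesis by simp
qed

lemma interval_bump_bounds: "0 \<le> interval_bump n a b t" "interval_bump n a b t \<le> indicator {a..b} t"
proof -
 show "0 \<le> interval_bump n a b t" by (simp add: interval_bump_def flat_nonneg)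
 show "interval_bump n a b t \<le> indicator {a..b} t"
 proof (cases "t \<in> {a..b}")
  case True
  then show ?thesis unfolding interval_bump_def using flat_le_1 flat_nonneg by (simp add: mult_le_one)
 next
  case False
  then have "t - a \<le> 0 \<or> b - t \<le> 0" by auto
  then show ?thesis
   unfolding interval_bump_def using flat_zero[of "real n * (t - a)"] flat_zero[of "real n * (b - t)"]
   by (auto simp: mult_nonneg_nonpos)
 qed
qed

context product_group begin

lemma zero_ext_mult: "zero_ext f \<xi> * zero_ext g \<xi> = zero_ext (\<lambda>\<xi>. f \<xi> * g \<xi>) \<xi>"
 by (auto simp: zero_ext_def indicator_def)

lemma dual_L1_loc_integrable:
 assumes h: "h \<in> dual_L1_loc \<Gamma>"
 shows "integrable m (\<lambda>\<xi>. indicator (cball 0 R) \<xi> *\<^sub>R zero_ext h \<xi>)"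
proof -
 have "compact (cball 0 R \<inter> S)" using dual_group_closed by (intro compact_Int_closed) auto
 then have "set_integrable (dual_measure \<Gamma>) (cball 0 R \<inter> S) h"
  using h unfolding dual_L1_loc_def by blast
 then have "integrable m (zero_ext (\<lambda>\<xi>. indicator (cball 0 R \<inter> S) \<xi> *\<^sub>R h \<xi>))"
  unfolding set_integrable_def integrable_dual_measure .
 moreover have "zero_ext (\<lambda>\<xi>. indicator (cball 0 R \<inter> S) \<xi> *\<^sub>R h \<xi>) = (\<lambda>\<xi>. indicator (cball 0 R) \<xi> *\<^sub>R zero_ext h \<xi>)"
  by (auto simp: zero_ext_def indicator_def fun_eq_iff)
 ultimately show ?thesis by simp
qed

lemma dual_L1_loc_test_integrable:
 assumes h: "h \<in> dual_L1_loc \<Gamma>" and \<psi>: "\<psi> \<in> tests"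
 shows "integrable m (\<lambda>\<xi>. zero_ext h \<xi> * zero_ext \<psi> \<xi>)"
proof -
 obtain B R where B: "B > 0" "R > 0" "\<And>\<xi>. \<xi> \<in> S ==> norm (\<psi> \<xi>) \<le> B" "\<And>\<xi>. \<xi> \<in> S ==> norm \<xi> > R ==> \<psi> \<xi> = 0"
  using test_bounded[OF \<psi>] by blast
 have [measurable]: "zero_ext h \<in> borel_measurable borel" "zero_ext \<psi> \<in> borel_measurable borel"
  using h moments_test[OF \<psi>] by (auto simp: dual_L1_loc_def borel_measurable_dual_measure moments_def)
 show ?thesis
 proof (rule Bochner_Integration.integrable_bound)
  show "integrable m (\<lambda>\<xi>. B * norm (indicator (cball 0 R) \<xi> *\<^sub>R zero_ext h \<xi>))"
   by (intro integrable_mult_right integrable_norm dual_L1_loc_integrable h)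
  have "norm (zero_ext h \<xi> * zero_ext \<psi> \<xi>) \<le> B * norm (indicator (cball 0 R) \<xi> *\<^sub>R zero_ext h \<xi>)" for \<xi>
  proof (cases "\<xi> \<in> S \<and> norm \<xi> \<le> R")
   case True
   then show ?thesis using B(3)[of \<xi>] by (simp add: zero_ext_def norm_mult mult.commute[of B] mult_left_mono)
  next
   case False
   then show ?thesis using B(4)[of \<xi>] B(1) by (auto simp: zero_ext_def indicator_def)
  qed
  then show "AE \<xi> in m. norm (zero_ext h \<xi> * zero_ext \<psi> \<xi>) \<le> norm (B * norm (indicator (cball 0 R) \<xi> *\<^sub>R zero_ext h \<xi>))"
   by (intro AE_I2) (use order_trans abs_ge_self in \<open>simp, blast\<close>)
 qed measurable
qed

text \<open>Products of interval bumps are test functions.  They converge boundedly, and within a fixed bounded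
 set, to the indicators of boxes.\<close>

lemma dual_uniqueness:
 assumes h: "h \<in> dual_L1_loc \<Gamma>" and h': "h' \<in> dual_L1_loc \<Gamma>"
  and eq: "\<And>\<psi>. \<psi> \<in> tests ==> (\<integral>\<xi>. h \<xi> * \<psi> \<xi> \<partial>dual_measure \<Gamma>) = (\<integral>\<xi>. h' \<xi> * \<psi> \<xi> \<partial>dual_measure \<Gamma>)"
 shows "AE \<xi> in m. zero_ext h \<xi> = zero_ext h' \<xi>"
proof -
 define w where "w = (\<lambda>\<xi>. zero_ext h \<xi> - zero_ext h' \<xi>)"
 have [measurable]: "zero_ext h \<in> borel_measurable borel" "zero_ext h' \<in> borel_measurable borel"
  using h h' by (auto simp: dual_L1_loc_def borel_measurable_dual_measure)
 have [measurable]: "w \<in> borel_measurable borel" unfolding w_def by measurable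
 have int: "integrable m (\<lambda>\<xi>. indicator (cball 0 R) \<xi> *\<^sub>R w \<xi>)" for R
  using Bochner_Integration.integrable_diff[OF dual_L1_loc_integrable[OF h, of R] dual_L1_loc_integrable[OF h', of R]]
  by (simp add: w_def scaleR_diff_right)
 have test: "(\<integral>\<xi>. w \<xi> * \<psi> \<xi> \<partial>m) = 0" if \<psi>: "\<psi> \<in> tests" for \<psi>
 proof -
  have "(\<integral>\<xi>. zero_ext h \<xi> * zero_ext \<psi> \<xi> \<partial>m) = (\<integral>\<xi>. zero_ext h' \<xi> * zero_ext \<psi> \<xi> \<partial>m)"
   using eq[OF \<psi>] unfolding integral_dual_measure zero_ext_mult by (simp add: zero_ext_def[abs_def])
  then have "(\<integral>\<xi>. zero_ext h \<xi> * zero_ext \<psi> \<xi> - zero_ext h' \<xi> * zero_ext \<psi> \<xi> \<partial>m) = 0"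
   using dual_L1_loc_test_integrable[OF h \<psi>] dual_L1_loc_test_integrable[OF h' \<psi>]
   by (simp add: Bochner_Integration.integral_diff)
  moreover have "zero_ext h \<xi> * zero_ext \<psi> \<xi> - zero_ext h' \<xi> * zero_ext \<psi> \<xi> = w \<xi> * \<psi> \<xi>" for \<xi>
   by (auto simp: w_def zero_ext_def indicator_def algebra_simps)
  ultimately show ?thesis by simp
 qed
 have "AE \<xi> in m. w \<xi> = 0"
 proof (rule AE_zero_of_box_integrals[OF sets_dual_borel])
  fix a b :: "real ^ 'n"
  obtain R where R: "cbox a b \<subseteq> cball 0 R"
   using bounded_subset_ballD[OF bounded_cbox[of a b], of 0] ball_subset_cball by (metis order_trans)
  show "integrable m (\<lambda>\<xi>. indicator (box a b) \<xi> *\<^sub>R w \<xi>)"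
  proof (rule Bochner_Integration.integrable_bound[OF int[of R]])
   have "box a b \<subseteq> cball 0 R" using R box_subset_cbox[of a b] by blast
   then show "AE \<xi> in m. norm (indicator (box a b) \<xi> *\<^sub>R w \<xi>) \<le> norm (indicator (cball 0 R) \<xi> *\<^sub>R w \<xi>)"
    by (intro AE_I2) (auto simp: indicator_def)
  qed measurable
  let ?f = "\<lambda>n. prod_fun (\<lambda>i. interval_bump n (a $ i) (b $ i))"
  have f: "?f n \<in> tests" for n
  proof (rule prod_fun_test)
   fix i
   show "vanishing_outside (1 + (\<Sum>i\<in>UNIV. \<bar>a $ i\<bar> + \<bar>b $ i\<bar>)) (interval_bump n (a $ i) (b $ i))"
    using member_le_sum[of i UNIV "\<lambda>i. \<bar>a $ i\<bar> + \<bar>b $ i\<bar>"]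
    by (intro vanishing_outside_mono[OF interval_bump_vanishing]) auto
  qed (rule smooth_interval_bump)
  have [measurable]: "?f n \<in> borel_measurable borel" for n
   using everywhere.smooth_continuous[OF smooth_prod_fun[OF smooth_interval_bump]]
   by (rule borel_measurable_continuous_onI)
  have lim: "(\<lambda>n. ?f n \<xi>) \<longlonglongrightarrow> of_real (indicator (box a b) \<xi>)" for \<xi>
   unfolding prod_fun_def indicator_box of_real_prod by (intro tendsto_prod tendsto_of_real interval_bump_limit)
  have bound: "norm (?f n \<xi>) \<le> indicator (cball 0 R) \<xi>" for n \<xi>
  proof -
   have "norm (?f n \<xi>) \<le> (\<Prod>i\<in>UNIV. indicator {a $ i..b $ i} (\<xi> $ i))"
    unfolding prod_fun_def prod_norm[symmetric]
    by (intro prod_mono) (simp add: interval_bump_bounds)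
   also have "\<dots> \<le> indicator (cball 0 R) \<xi>"
   proof (cases "\<xi> \<in> cbox a b")
    case True
    then have "\<xi> \<in> cball 0 R" using R by blast
    then show ?thesis using True by (simp add: mem_box_cart)
   next
    case False
    then obtain i where "\<xi> $ i \<notin> {a $ i..b $ i}" by (auto simp: mem_box_cart)
    then have "(\<Prod>i\<in>UNIV. indicator {a $ i..b $ i} (\<xi> $ i)) = (0::real)"
     by (intro prod_zero) (auto simp: indicator_def)
    then show ?thesis by (simp only: indicator_pos_le)
   qed
   finally show ?thesis .
  qed
  have "(\<lambda>n. \<integral>\<xi>. w \<xi> * ?f n \<xi> \<partial>m) \<longlonglongrightarrow> (\<integral>\<xi>. indicator (box a b) \<xi> *\<^sub>R w \<xi> \<partial>m)"
  proof (rule integral_dominated_convergence[where w = "\<lambda>\<xi>. norm (indicator (cball 0 R) \<xi> *\<^sub>R w \<xi>)"])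
   show "integrable m (\<lambda>\<xi>. norm (indicator (cball 0 R) \<xi> *\<^sub>R w \<xi>))" by (intro integrable_norm int)
   show "AE \<xi> in m. (\<lambda>n. w \<xi> * ?f n \<xi>) \<longlonglongrightarrow> indicator (box a b) \<xi> *\<^sub>R w \<xi>"
    using tendsto_mult_left[OF lim] by (intro AE_I2) (simp add: scaleR_conv_of_real mult.commute)
   show "AE \<xi> in m. norm (w \<xi> * ?f n \<xi>) \<le> norm (indicator (cball 0 R) \<xi> *\<^sub>R w \<xi>)" for n
    using mult_left_mono[OF bound norm_ge_zero] by (intro AE_I2) (simp add: norm_mult mult.commute)
  qed measurable
  then show "(\<integral>\<xi>. indicator (box a b) \<xi> *\<^sub>R w \<xi> \<partial>m) = 0"
   unfolding test[OF f] by (simp add: LIMSEQ_const_iff)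
 qed
 then show ?thesis by eventually_elim (simp add: w_def)
qed

text \<open>
 On a circle of length \<open>l\<close>, the product of sines is periodic, and for \<open>t\<close> in \<open>{0..<l}\<close> it is
 positive exactly on the interval \<open>{a<..<b}\<close>.
\<close>

definition circle_bump :: "nat => real => real => real => real => real" where
 "circle_bump n l a b t = flat_exp (real n * (sin (pi / l * (t - a)) * sin (pi / l * (b - t))))"

lemma smooth_circle_bump: "smooth_real (circle_bump n l a b)"
proof -
 have "circle_bump n l a b = (\<lambda>t. flat_exp (real n * (sin (pi / l * t + (- (pi / l * a))) * sin ((- (pi / l)) * t + pi / l * b))))"
  by (simp add: circle_bump_def fun_eq_iff algebra_simps diff_divide_distrib)
 then show ?thesis
  by (simp only:) (intro smooth_real_compose[OF smooth_flat] smooth_real_mult smooth_real_const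
    smooth_real_compose[OF smooth_real_sin smooth_real_affine])
qed

lemma circle_bump_periodic: "l > 0 ==> periodic_real l (circle_bump n l a b)"
 unfolding periodic_real_def circle_bump_def
proof
 fix t assume l: "l > 0"
 have "pi / l * (t + l - a) = pi / l * (t - a) + pi" "pi / l * (b - (t + l)) = pi / l * (b - t) - pi"
  using l by (auto simp: field_simps)
 then show "flat_exp (real n * (sin (pi / l * (t + l - a)) * sin (pi / l * (b - (t + l)))))
   = flat_exp (real n * (sin (pi / l * (t - a)) * sin (pi / l * (b - t))))"
  by simp
qed

lemma circle_bump_limit:
 assumes "l > 0" "0 \<le> a" "a < b" "b \<le> l" "0 \<le> t" "t < l"
 shows "(\<lambda>n. circle_bump n l a b t) \<longlonglongrightarrow> indicator {a<..<b} t"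
proof -
 have pos: "sin (pi / l * x) > 0" if "0 < x" "x < l" for x
  using that assms(1) by (intro sin_gt_zero) (auto simp: field_simps)
 have nonneg: "sin (pi / l * x) \<ge> 0" if "0 \<le> x" "x \<le> l" for x
  using that assms(1) mult_left_mono[of x l pi] by (intro sin_ge_zero) (auto simp: field_simps)
 have neg: "sin (pi / l * x) \<le> 0" if "- l \<le> x" "x \<le> 0" for x
 proof -
  have "sin (pi / l * (- x)) \<ge> 0"
   using that assms(1) mult_left_mono[of "- x" l pi] mult_nonneg_nonpos[of pi x]
   by (intro sin_ge_zero) (auto simp: field_simps)
  then show ?thesis by simp
 qed
 let ?s = "sin (pi / l * (t - a)) * sin (pi / l * (b - t))"
 have "indicator {0<..} ?s = (indicator {a<..<b} t :: real)"
 proof -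
  consider "t \<le> a" | "b \<le> t" | "a < t" "t < b" by linarith
  then show ?thesis
  proof cases
   case 1
   then have "?s \<le> 0" using neg[of "t - a"] nonneg[of "b - t"] assms by (intro mult_nonpos_nonneg) auto
   then show ?thesis using 1 by simp
  next
   case 2
   then have "?s \<le> 0" using nonneg[of "t - a"] neg[of "b - t"] assms by (intro mult_nonneg_nonpos) auto
   then show ?thesis using 2 by simp
  next
   case 3
   then have "?s > 0" using pos[of "t - a"] pos[of "b - t"] assms by (intro mult_pos_pos) auto
   then show ?thesis using 3 by simp
  qed
 qed
 then show ?thesis using flat_limit[of ?s] by (simp add: circle_bump_def)
qed

text \<open>On the group, products of interval bumps in the lines and of periodic bumps in the circles take
 the place of test functions.\<close>

lemma group_uniqueness:
 assumes [measurable]: "w \<in> borel_measurable borel"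
  and int: "\<And>\<phi>. \<phi> \<in> schwartz \<Gamma> ==> integrable lborel (\<lambda>x. indicator (FD) x *\<^sub>R (w x * \<phi> x))"
  and zero: "\<And>\<phi>. \<phi> \<in> schwartz \<Gamma> ==> (LBINT x. indicator (FD) x *\<^sub>R (w x * \<phi> x)) = 0"
 shows "AE x in lborel. x \<in> FD \<longrightarrow> w x = 0"
proof -
 let ?D = "FD"
 define v where "v = (\<lambda>x. indicator ?D x *\<^sub>R w x)"
 have [measurable]: "v \<in> borel_measurable borel" unfolding v_def by measurable
 have "AE x in lborel. v x = 0"
 proof (rule AE_zero_of_box_integrals)
  fix a b :: "real ^ 'n"
  let ?Rsum = "\<Sum>i\<in>UNIV. \<bar>a $ i\<bar> + \<bar>b $ i\<bar>"
  let ?R = "3 + ?Rsum"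
  have R: "\<bar>a $ i\<bar> + \<bar>b $ i\<bar> \<le> ?Rsum" for i
   using member_le_sum[of i UNIV "\<lambda>i. \<bar>a $ i\<bar> + \<bar>b $ i\<bar>"] by auto
  \<comment> \<open>a fixed Schwartz function that is at least one on the box\<close>
  let ?\<theta>f = "\<lambda>i t. case \<Gamma> i of Line => exp 2 * interval_bump 1 (a $ i - 1) (b $ i + 1) t | Circle l => 1"
  let ?\<theta> = "prod_fun ?\<theta>f"
  have "admissible_factors \<Gamma> ?R ?\<theta>f"
   unfolding admissible_factors_def
  proof
   fix i
   have "vanishing_outside ?R (interval_bump 1 (a $ i - 1) (b $ i + 1))"
    using R[of i] by (intro vanishing_outside_mono[OF interval_bump_vanishing]) linarith
   then show "smooth_real (?\<theta>f i) \<and> (case \<Gamma> i of Line => vanishing_outside ?R (?\<theta>f i) | Circle l => periodic_real l (?\<theta>f i))"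
    by (cases "\<Gamma> i") (auto simp: vanishing_outside_def periodic_real_def intro!: smooth_real_mult smooth_real_const smooth_interval_bump)
  qed
  then have \<theta>: "?\<theta> \<in> schwartz \<Gamma>" by (rule prod_fun_schwartz)
  have \<theta>_int: "integrable lborel (\<lambda>x. norm (v x * ?\<theta> x))"
   using integrable_norm[OF int[OF \<theta>]] by (simp add: v_def)
  have \<theta>_fac: "1 \<le> ?\<theta>f i t" if "t \<in> {a $ i..b $ i}" for i t
  proof (cases "\<Gamma> i")
   case Line
   have "flat_exp x \<ge> exp (-1)" if "x \<ge> 1" for x using that by (simp add: flat_exp_def field_simps)
   then have "interval_bump 1 (a $ i - 1) (b $ i + 1) t \<ge> exp (-1) * exp (-1)"
    unfolding interval_bump_def using that by (intro mult_mono) (auto simp: flat_nonneg)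
   then have "exp 2 * interval_bump 1 (a $ i - 1) (b $ i + 1) t \<ge> exp 2 * (exp (-1) * exp (-1))"
    by (intro mult_left_mono) auto
   then show ?thesis using Line by (simp flip: exp_add)
  qed simp
  have \<theta>_pos: "0 \<le> ?\<theta>f i t" for i t
   using interval_bump_bounds(1) by (auto split: factor.split)
  have [measurable]: "?\<theta> \<in> borel_measurable borel" by (rule schwartz_measurable[OF \<theta>])
  have box_\<theta>: "indicator (box a b) x \<le> norm (?\<theta> x)" for x
  proof (cases "x \<in> box a b")
   case True
   have "1 \<le> (\<Prod>i\<in>UNIV. ?\<theta>f i (x $ i))"
    using True by (intro prod_ge_1 \<theta>_fac) (auto simp: mem_box_cart less_imp_le)
   also have "\<dots> = norm (?\<theta> x)"
    unfolding prod_fun_def prod_norm[symmetric] using \<theta>_pos by (intro prod.cong) auto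
   finally show ?thesis using True by simp
  qed simp
  show "integrable lborel (\<lambda>x. indicator (box a b) x *\<^sub>R v x)"
  proof (rule Bochner_Integration.integrable_bound[OF \<theta>_int])
   show "AE x in lborel. norm (indicator (box a b) x *\<^sub>R v x) \<le> norm (norm (v x * ?\<theta> x))"
    using mult_left_mono[OF box_\<theta> norm_ge_zero] by (intro AE_I2) (simp add: norm_mult mult.commute)
  qed measurable
  let ?a = "\<lambda>i. max (a $ i) 0"
  show "(LBINT x. indicator (box a b) x *\<^sub>R v x) = 0"
  proof (cases "\<exists>i l. \<Gamma> i = Circle l \<and> min (b $ i) l \<le> ?a i")
   case True
   then obtain i l where i: "\<Gamma> i = Circle l" "min (b $ i) l \<le> ?a i" by blast
   have "indicator (box a b) x *\<^sub>R v x = 0" for x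
   proof (cases "x \<in> box a b \<and> x \<in> ?D")
    case True
    then have "a $ i < x $ i" "x $ i < b $ i" "0 \<le> x $ i" "x $ i < l"
     using i by (auto simp: mem_box_cart fundamental_domain_def)
    then have False using i(2) by linarith
    then show ?thesis ..
   qed (auto simp: v_def indicator_def)
   then show ?thesis by (simp only: Bochner_Integration.integral_zero)
  next
   case False
   let ?f = "\<lambda>n i t. case \<Gamma> i of Line => interval_bump n (a $ i) (b $ i) t | Circle l => circle_bump n l (?a i) (min (b $ i) l) t"
   have "admissible_factors \<Gamma> ?R (?f n)" for n
    unfolding admissible_factors_def
   proof
    fix i
    have "vanishing_outside ?R (interval_bump n (a $ i) (b $ i))"
     using R[of i] by (intro vanishing_outside_mono[OF interval_bump_vanishing]) linarith
    then show "smooth_real (?f n i) \<and> (case \<Gamma> i of Line => vanishing_outside ?R (?f n i) | Circle l => periodic_real l (?f n i))"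
     using smooth_interval_bump smooth_circle_bump circle_bump_periodic period_pos by (cases "\<Gamma> i") auto
   qed
   then have f: "prod_fun (?f n) \<in> schwartz \<Gamma>" for n by (rule prod_fun_schwartz)
   have [measurable]: "prod_fun (?f n) \<in> borel_measurable borel" for n by (rule schwartz_measurable[OF f])
   have "AE x in vec_measure (\<lambda>i::'n. lborel). x $ i \<notin> {0}" for i
    by (rule lborel_coords.AE_vec_coordinate) (auto intro: AE_lborel_singleton)
   then have ne: "AE x in (lborel :: (real ^ 'n) measure). \<forall>i. x $ i \<noteq> 0"
    unfolding AE_all_countable lborel_vec by simp
   have "(\<lambda>n. \<integral>x. v x * prod_fun (?f n) x \<partial>lborel) \<longlonglongrightarrow> (LBINT x. indicator (box a b) x *\<^sub>R v x)"
   proof (rule integral_dominated_convergence[OF _ _ \<theta>_int])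
    show "AE x in lborel. (\<lambda>n. v x * prod_fun (?f n) x) \<longlonglongrightarrow> indicator (box a b) x *\<^sub>R v x"
     using ne
    proof eventually_elim
     case (elim x)
     show ?case
     proof (cases "x \<in> ?D")
      case True
      have "(\<lambda>n. ?f n i (x $ i)) \<longlonglongrightarrow> indicator {a $ i<..<b $ i} (x $ i)" for i
      proof (cases "\<Gamma> i")
       case Line
       then show ?thesis by (simp add: interval_bump_limit)
      next
       case (Circle l)
       have x: "0 \<le> x $ i" "x $ i < l" using True Circle by (auto simp: fundamental_domain_def)
       have "(\<lambda>n. circle_bump n l (?a i) (min (b $ i) l) (x $ i)) \<longlonglongrightarrow> indicator {?a i<..<min (b $ i) l} (x $ i)"
        using False Circle x period_pos[OF Circle] by (intro circle_bump_limit) (auto simp: not_le)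
       moreover have "indicator {?a i<..<min (b $ i) l} (x $ i) = (indicator {a $ i<..<b $ i} (x $ i) :: real)"
        using x elim[rule_format, of i] by (auto simp: indicator_def)
       ultimately show ?thesis using Circle by simp
      qed
      then have "(\<lambda>n. prod_fun (?f n) x) \<longlonglongrightarrow> of_real (indicator (box a b) x)"
       unfolding prod_fun_def indicator_box of_real_prod by (intro tendsto_prod tendsto_of_real)
      from tendsto_mult_left[OF this, of "v x"] show ?thesis by (simp add: scaleR_conv_of_real mult.commute)
     qed (simp add: v_def)
    qed
    have fle: "norm (prod_fun (?f n) x) \<le> norm (?\<theta> x)" for n x
     unfolding prod_fun_def prod_norm[symmetric]
    proof (intro prod_mono conjI)
     fix i
     have "\<bar>?f n i (x $ i)\<bar> \<le> ?\<theta>f i (x $ i)"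
     proof (cases "\<Gamma> i")
      case Line
      have "interval_bump n (a $ i) (b $ i) (x $ i) \<le> indicator {a $ i..b $ i} (x $ i)"
       by (rule interval_bump_bounds)
      also have "\<dots> \<le> ?\<theta>f i (x $ i)" using \<theta>_fac[of "x $ i" i] \<theta>_pos[of i "x $ i"] by (auto simp: indicator_def)
      finally show ?thesis using Line interval_bump_bounds(1) by simp
     next
      case (Circle l)
      then show ?thesis by (simp add: circle_bump_def flat_nonneg flat_le_1)
     qed
     from order_trans[OF this abs_ge_self]
     show "norm (complex_of_real (?f n i (x $ i))) \<le> norm (complex_of_real (?\<theta>f i (x $ i)))"
      by (simp only: norm_of_real)
    qed simp
    show "AE x in lborel. norm (v x * prod_fun (?f n) x) \<le> norm (v x * ?\<theta> x)" for n
     using mult_left_mono[OF fle norm_ge_zero] by (intro AE_I2) (simp add: norm_mult)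
   qed measurable
   moreover have "(LBINT x. v x * prod_fun (?f n) x) = 0" for n
    using zero[OF f[of n]] by (simp add: v_def)
   ultimately show ?thesis by (simp add: LIMSEQ_const_iff)
  qed
 qed simp
 then show ?thesis by eventually_elim (auto simp: v_def)
qed

end

section \<open>Translation invariance of integrals of periodic functions\<close>

lemma lborel_translate:
 fixes f :: "'a::euclidean_space => complex"
 assumes [measurable]: "f \<in> borel_measurable borel"
 shows "(LBINT x. f (x + v)) = (LBINT x. f x)"
  and "integrable lborel (\<lambda>x. f (x + v)) \<longleftrightarrow> integrable lborel f"
proof -
 have d: "distr lborel borel (\<lambda>x. x + v) = (lborel :: 'a measure)"
  using lborel_distr_plus[of v] by (simp only: add.commute[of _ v])
 show "(LBINT x. f (x + v)) = (LBINT x. f x)"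
  by (subst (2) d[symmetric]) (simp add: integral_distr)
 show "integrable lborel (\<lambda>x. f (x + v)) \<longleftrightarrow> integrable lborel f"
  by (subst (2) d[symmetric]) (simp add: integrable_distr_eq)
qed

context product_group begin

lemma periodic_multiple:
 assumes "periodic \<Gamma> f" "\<Gamma> i = Circle l"
 shows "f (x + (of_int k * l) *\<^sub>R axis i 1) = f x"
proof -
 have nat: "f (x + (real n * l) *\<^sub>R axis i 1) = f x" for n x
 proof (induction n)
  case (Suc n)
  have "x + (real (Suc n) * l) *\<^sub>R axis i 1 = (x + (real n * l) *\<^sub>R axis i 1) + l *\<^sub>R axis i 1"
   by (simp add: algebra_simps)
  then show ?case using Suc assms by (simp only: periodic_def)
 qed simp
 show ?thesis
 proof (cases "k \<ge> 0")
  case True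
  then show ?thesis using nat[of x "nat k"] by simp
 next
  case False
  then show ?thesis using nat[of "x + (of_int k * l) *\<^sub>R axis i 1" "nat (- k)"] by simp
 qed
qed

lemma periodic_translate: "periodic \<Gamma> f ==> periodic \<Gamma> (\<lambda>x. f (x + v))"
 unfolding periodic_def by (metis (no_types, lifting) add.assoc add.commute)

text \<open>
 The fundamental domain, translated by \<open>t\<close> along a circle, is cut at the endpoint of the circle,
 and the piece that sticks out is moved back by one period.
\<close>

lemma fundamental_domain_shift:
 assumes per: "periodic \<Gamma> f" and [measurable]: "f \<in> borel_measurable borel"
  and int: "integrable lborel (\<lambda>x. indicator (FD) x *\<^sub>R f x)"
 shows "integrable lborel (\<lambda>x. indicator (FD) x *\<^sub>R f (x + t *\<^sub>R axis j 1))
  \<and> (LBINT x. indicator (FD) x *\<^sub>R f (x + t *\<^sub>R axis j 1))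
   = (LBINT x. indicator (FD) x *\<^sub>R f x)"
proof -
 let ?D = "FD"
 have coord [measurable]: "(\<lambda>x::real^'n. x $ j) \<in> borel_measurable borel"
  by (intro borel_measurable_continuous_onI continuous_intros)
 show ?thesis
 proof (cases "\<Gamma> j")
  case Line
  have D: "x + t *\<^sub>R axis j 1 \<in> ?D \<longleftrightarrow> x \<in> ?D" for x
   using Line by (auto simp: fundamental_domain_def axis_def) (metis add.right_neutral factor.distinct(1) mult_zero_right)+
  then have "(\<lambda>x. indicator ?D x *\<^sub>R f (x + t *\<^sub>R axis j 1)) = (\<lambda>x. (\<lambda>y. indicator ?D y *\<^sub>R f y) (x + t *\<^sub>R axis j 1))"
   by (simp add: indicator_def)
  then show ?thesis
   using lborel_translate[of "\<lambda>y. indicator ?D y *\<^sub>R f y" "t *\<^sub>R axis j 1"] int by simp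
 next
  case (Circle l)
  note l = period_pos[OF Circle]
  define s where "s = t + of_int (- \<lfloor>t / l\<rfloor>) * l"
  have s: "0 \<le> s" "s < l"
   using floor_divide_lower[OF l, of t] floor_divide_upper[OF l, of t] by (auto simp: s_def algebra_simps)
  have fs: "f (x + t *\<^sub>R axis j 1) = f (x + s *\<^sub>R axis j 1)" for x
   using periodic_multiple[OF per Circle, of "x + t *\<^sub>R axis j 1" "- \<lfloor>t / l\<rfloor>"]
   by (simp add: s_def algebra_simps)
  define low where "low = (\<lambda>x. indicator {x. x $ j < s} x *\<^sub>R (indicator ?D x *\<^sub>R f x))"
  define high where "high = (\<lambda>x. indicator {x. s \<le> x $ j} x *\<^sub>R (indicator ?D x *\<^sub>R f x))"
  have [measurable]: "low \<in> borel_measurable borel" "high \<in> borel_measurable borel"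
   unfolding low_def high_def by measurable
  have i: "integrable lborel low" "integrable lborel high"
   unfolding low_def high_def by (intro integrable_mult_indicator int, measurable)+
  have D_iff: "x \<in> ?D \<longleftrightarrow> 0 \<le> x $ j \<and> x $ j < l \<and> (\<forall>k m. k \<noteq> j \<longrightarrow> \<Gamma> k = Circle m \<longrightarrow> 0 \<le> x $ k \<and> x $ k < m)" for x
   using Circle unfolding fundamental_domain_def mem_Collect_eq by (metis factor.inject)
  have ax: "(axis j (1::real) :: real ^ 'n) $ k = (if k = j then 1 else 0)" for k by (simp add: axis_def)
  have eq: "indicator ?D x *\<^sub>R f (x + s *\<^sub>R axis j 1) = high (x + s *\<^sub>R axis j 1) + low (x + (s - l) *\<^sub>R axis j 1)" for x
  proof -
   have fl: "f (x + (s - l) *\<^sub>R axis j 1) = f (x + s *\<^sub>R axis j 1)"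
    using periodic_multiple[OF per Circle, of "x + s *\<^sub>R axis j 1" "-1"] by (simp add: algebra_simps)
   have 1: "x + s *\<^sub>R axis j 1 \<in> ?D \<and> s \<le> (x + s *\<^sub>R axis j 1) $ j \<longleftrightarrow> x \<in> ?D \<and> x $ j < l - s"
    using s l unfolding D_iff by (auto simp: ax)
   have 2: "x + (s - l) *\<^sub>R axis j 1 \<in> ?D \<and> (x + (s - l) *\<^sub>R axis j 1) $ j < s \<longleftrightarrow> x \<in> ?D \<and> \<not> x $ j < l - s"
    using s l unfolding D_iff by (auto simp: ax)
   have "high (x + s *\<^sub>R axis j 1) = (if x \<in> ?D \<and> x $ j < l - s then f (x + s *\<^sub>R axis j 1) else 0)"
    using 1 by (auto simp: high_def indicator_def)
   moreover have "low (x + (s - l) *\<^sub>R axis j 1) = (if x \<in> ?D \<and> \<not> x $ j < l - s then f (x + s *\<^sub>R axis j 1) else 0)"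
    using 2 fl by (auto simp: low_def indicator_def)
   ultimately show ?thesis by (auto simp: indicator_def)
  qed
  have it: "integrable lborel (\<lambda>x. high (x + s *\<^sub>R axis j 1))" "integrable lborel (\<lambda>x. low (x + (s - l) *\<^sub>R axis j 1))"
   using i lborel_translate(2)[of high "s *\<^sub>R axis j 1"] lborel_translate(2)[of low "(s - l) *\<^sub>R axis j 1"] by simp_all
  have "(LBINT x. indicator ?D x *\<^sub>R f (x + s *\<^sub>R axis j 1))
    = (LBINT x. high (x + s *\<^sub>R axis j 1)) + (LBINT x. low (x + (s - l) *\<^sub>R axis j 1))"
   unfolding eq by (rule Bochner_Integration.integral_add[OF it])
  also have "\<dots> = (LBINT x. high x) + (LBINT x. low x)"
   using lborel_translate(1)[of high "s *\<^sub>R axis j 1"] lborel_translate(1)[of low "(s - l) *\<^sub>R axis j 1"] by simp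
  also have "\<dots> = (LBINT x. high x + low x)"
   using i by (simp add: Bochner_Integration.integral_add)
  also have "(\<lambda>x. high x + low x) = (\<lambda>x. indicator ?D x *\<^sub>R f x)"
   by (auto simp: high_def low_def indicator_def fun_eq_iff)
  finally have "(LBINT x. indicator ?D x *\<^sub>R f (x + s *\<^sub>R axis j 1)) = (LBINT x. indicator ?D x *\<^sub>R f x)" .
  moreover have "integrable lborel (\<lambda>x. indicator ?D x *\<^sub>R f (x + s *\<^sub>R axis j 1))"
   unfolding eq by (rule Bochner_Integration.integrable_add[OF it])
  ultimately show ?thesis unfolding fs by blast
 qed
qed

lemma fundamental_domain_translate:
 fixes v :: "real ^ 'n"
 assumes per: "periodic \<Gamma> f" and f: "f \<in> borel_measurable borel"
  and int: "integrable lborel (\<lambda>x. indicator (FD) x *\<^sub>R f x)"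
 shows "(LBINT x. indicator (FD) x *\<^sub>R f (x + v))
   = (LBINT x. indicator (FD) x *\<^sub>R f x)"
proof -
 let ?g = "\<lambda>A x. f (x + (\<Sum>j\<in>A. v $ j *\<^sub>R axis j 1))"
 have "integrable lborel (\<lambda>x. indicator (FD) x *\<^sub>R ?g A x)
  \<and> (LBINT x. indicator (FD) x *\<^sub>R ?g A x)
   = (LBINT x. indicator (FD) x *\<^sub>R f x)" if "finite A" for A
  using that
 proof (induction A rule: finite_induct)
  case (insert j A)
  have g: "?g (insert j A) x = ?g A (x + v $ j *\<^sub>R axis j 1)" for x
   using insert by (simp add: add.assoc)
  have "?g A \<in> borel_measurable borel" by (rule measurable_compose[OF _ f]) measurable
  then show ?case
   using fundamental_domain_shift[OF periodic_translate[OF per], of "\<Sum>j\<in>A. v $ j *\<^sub>R axis j 1" "v $ j" j] insert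
   unfolding g by simp
 qed (simp add: int)
 from this[of UNIV] have "(LBINT x. indicator (FD) x *\<^sub>R ?g UNIV x)
   = (LBINT x. indicator (FD) x *\<^sub>R f x)" by simp
 moreover have "(\<Sum>j\<in>UNIV. v $ j *\<^sub>R axis j 1) = v"
  by (auto simp: vec_eq_iff sum_component axis_def if_distrib cong: if_cong)
 ultimately show ?thesis by simp
qed

end

section \<open>One-dimensional kernels\<close>

lemma x_cos_le_sin:
 assumes "0 \<le> x" "x \<le> pi" shows "x * cos x \<le> sin x"
proof -
 have "sin 0 - 0 * cos 0 \<le> sin x - x * cos x"
 proof (rule DERIV_nonneg_imp_nondecreasing[OF assms(1)])
  fix t assume t: "0 \<le> t" "t \<le> x"
  have "((\<lambda>t. sin t - t * cos t) has_real_derivative t * sin t) (at t)"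
   by (auto intro!: derivative_eq_intros)
  moreover have "t * sin t \<ge> 0" using t assms by (intro mult_nonneg_nonneg sin_ge_zero) auto
  ultimately show "\<exists>y. ((\<lambda>t. sin t - t * cos t) has_real_derivative y) (at t) \<and> 0 \<le> y" by blast
 qed
 then show ?thesis by simp
qed

lemma half_le_sin:
 assumes "0 \<le> x" "x \<le> pi / 2" shows "x / 2 \<le> sin x"
proof -
 have c: "0 \<le> cos (x / 2)" using assms by (intro cos_ge_zero) auto
 have "1 / 2 \<le> (cos (x / 2))\<^sup>2"
 proof -
  have "cos x \<ge> 0" using assms by (intro cos_ge_zero) auto
  moreover have "cos x = 2 * (cos (x / 2))\<^sup>2 - 1" using cos_double_cos[of "x / 2"] by simp
  ultimately show ?thesis by simp
 qed
 then have "x * (1 / 2) \<le> x * (cos (x / 2))\<^sup>2" using assms by (intro mult_left_mono) auto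
 also have "\<dots> = 2 * ((x / 2 * cos (x / 2)) * cos (x / 2))" by (simp add: power2_eq_square)
 also have "\<dots> \<le> 2 * (sin (x / 2) * cos (x / 2))"
  using x_cos_le_sin[of "x / 2"] c assms by (intro mult_left_mono mult_right_mono) auto
 also have "\<dots> = sin x" using sin_double[of "x / 2"] by simp
 finally show ?thesis by simp
qed

text \<open>The transform of the bump, hence a kernel of rapid decay and integral one.\<close>

definition line_kernel :: "real => complex" where
 "line_kernel z = (LBINT t. complex_of_real (bump t) * cis (2 * pi * (t * z)))"

lemma integrable_bump: "integrable lborel (\<lambda>t. complex_of_real (bump t))"
proof -
 obtain B where B: "\<And>t. \<bar>bump t\<bar> \<le> B"
  using vanishing_outside_bounded[OF smooth_bump, of 1] bump_outside by (auto simp: vanishing_outside_def)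
 have [measurable]: "bump \<in> borel_measurable borel"
  by (rule borel_measurable_continuous_onI[OF smooth_real_continuous[OF smooth_bump]])
 show ?thesis
 proof (rule Bochner_Integration.integrable_bound)
  show "integrable lborel (\<lambda>t. B * indicator {-1..1::real} t)"
   by (intro integrable_mult_right integrable_real_indicator) auto
  show "AE t in lborel. norm (complex_of_real (bump t)) \<le> norm (B * indicator {-1..1} t)"
   using B bump_outside by (intro AE_I2) (auto simp: indicator_def intro: order_trans[OF B abs_ge_self])
 qed measurable
qed

text \<open>The decay of the kernel is the case of one line of the decay of transforms of test functions.\<close>

lemma line_kernel_decay: "\<exists>B. \<forall>z. (1 + \<bar>z\<bar>) ^ k * norm (line_kernel z) \<le> B"
proof -
 interpret L: product_group "\<lambda>_::unit. Line" by unfold_locales simp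
 let ?\<psi> = "prod_fun (\<lambda>_::unit. bump)"
 have \<psi>: "?\<psi> \<in> dual_test_functions (\<lambda>_. Line)"
  by (rule L.prod_fun_test[OF smooth_bump, of 1]) (use bump_outside in \<open>auto simp: vanishing_outside_def\<close>)
 have "L.zero_ext ?\<psi> = ?\<psi>" by (simp add: L.zero_ext_def fun_eq_iff dual_group_def)
 then obtain B where B: "\<And>x. (1 + norm (line_part (\<lambda>_. Line) x)) ^ k *
   norm (fourier_integral (dual_borel (\<lambda>_::unit. Line)) (2 * pi) ?\<psi> x) \<le> B"
  using schwartz_bound[OF L.test_integral_schwartz[OF \<psi>, of "2 * pi"], where js = "[]" and k = k] by auto
 have "fourier_integral (dual_borel (\<lambda>_::unit. Line)) (2 * pi) ?\<psi> x = line_kernel (x $ ())" for x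
 proof -
  have "(\<integral>\<xi>. (\<Prod>i\<in>(UNIV::unit set). complex_of_real (bump (\<xi> $ i)) * cis (2 * pi * (\<xi> $ i * x $ ()))) \<partial>vec_measure (\<lambda>_. dual_factor_measure Line))
   = (\<Prod>i\<in>(UNIV::unit set). \<integral>t. complex_of_real (bump t) * cis (2 * pi * (t * x $ ())) \<partial>dual_factor_measure Line)"
  proof (rule L.dual.integral_vec_prod)
   have [measurable]: "bump \<in> borel_measurable borel"
    by (rule borel_measurable_continuous_onI[OF smooth_real_continuous[OF smooth_bump]])
   show "(\<lambda>t. complex_of_real (bump t) * cis (2 * pi * (t * x $ ()))) \<in> borel_measurable borel" by measurable
   then show "integrable (dual_factor_measure Line) (\<lambda>t. complex_of_real (bump t) * cis (2 * pi * (t * x $ ())))"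
    by (simp, intro Bochner_Integration.integrable_bound[OF integrable_bump]) (auto simp: norm_mult)
  qed
  then show ?thesis
   by (simp add: fourier_integral_def dual_borel_def line_kernel_def prod_fun_def UNIV_unit inner_vec_def)
 qed
 moreover have "norm (line_part (\<lambda>_. Line) (\<chi> i::unit. z)) = \<bar>z\<bar>" for z
  by (simp add: line_part_def norm_vec_def L2_set_def UNIV_unit)
 ultimately have "(1 + \<bar>z\<bar>) ^ k * norm (line_kernel z) \<le> B" for z
  using B[of "\<chi> i. z"] by simp
 then show ?thesis by blast
qed

lemma line_kernel_borel [measurable]: "line_kernel \<in> borel_measurable borel"
proof -
 interpret sigma_finite_measure "lborel :: real measure" by (rule sigma_finite_lborel)
 have [measurable]: "bump \<in> borel_measurable borel"
  by (rule borel_measurable_continuous_onI[OF smooth_real_continuous[OF smooth_bump]])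
 show ?thesis unfolding line_kernel_def[abs_def] by measurable
qed

lemma integrable_line_kernel_moment: "integrable lborel (\<lambda>z. (1 + \<bar>z\<bar>) ^ k * norm (line_kernel z))"
proof -
 obtain B where B: "\<And>z. (1 + \<bar>z\<bar>) ^ (k + 2) * norm (line_kernel z) \<le> B" using line_kernel_decay by blast
 show ?thesis
 proof (rule Bochner_Integration.integrable_bound)
  show "integrable lborel (\<lambda>z::real. B * inverse (1 + z\<^sup>2))"
   by (intro integrable_mult_right integrable_inverse_1_plus_square_UNIV)
  show "AE z in lborel. norm ((1 + \<bar>z\<bar>) ^ k * norm (line_kernel z)) \<le> norm (B * inverse (1 + z\<^sup>2))"
  proof (rule AE_I2)
   fix z :: real
   let ?a = "(1 + \<bar>z\<bar>) ^ k * norm (line_kernel z)"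
   have p: "1 + z\<^sup>2 > 0" by (simp add: add_pos_nonneg)
   have "1 + z\<^sup>2 \<le> (1 + \<bar>z\<bar>)\<^sup>2" by (simp add: power2_sum)
   then have "?a * (1 + z\<^sup>2) \<le> ?a * (1 + \<bar>z\<bar>)\<^sup>2" by (intro mult_left_mono) auto
   also have "\<dots> \<le> B" using B[of z] by (simp add: power_add power2_eq_square mult_ac)
   finally have "?a \<le> B * inverse (1 + z\<^sup>2)" using p by (simp add: field_simps)
   then show "norm ?a \<le> norm (B * inverse (1 + z\<^sup>2))" by simp
  qed
 qed measurable
qed

text \<open>Nonnegative, with finitely many frequencies and with integral one over a period.\<close>

definition fejer_kernel :: "real => nat => real => real" where
 "fejer_kernel l r z = (norm (\<Sum>k<r. cis (2 * pi * (real k / l * z))))\<^sup>2 / (l * real r)"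

lemma fejer_kernel_expand:
 "complex_of_real (fejer_kernel l r z) = (\<Sum>j<r. \<Sum>k<r. cis (2 * pi * ((real j - real k) / l * z))) / of_real (l * real r)"
proof -
 have "cis (2 * pi * ((real j - real k) / l * z)) = cis (2 * pi * (real j / l * z)) * cnj (cis (2 * pi * (real k / l * z)))" for j k
  by (simp add: cis_cnj cis_mult algebra_simps diff_divide_distrib)
 then have "(\<Sum>j<r. \<Sum>k<r. cis (2 * pi * ((real j - real k) / l * z)))
  = (\<Sum>j<r. cis (2 * pi * (real j / l * z))) * cnj (\<Sum>k<r. cis (2 * pi * (real k / l * z)))"
  by (simp add: sum_product)
 also have "\<dots> = of_real ((norm (\<Sum>k<r. cis (2 * pi * (real k / l * z))))\<^sup>2)"
  by (rule complex_norm_square[symmetric])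
 finally show ?thesis by (simp add: fejer_kernel_def)
qed

lemma fejer_kernel_borel [measurable]: "fejer_kernel l r \<in> borel_measurable borel"
 unfolding fejer_kernel_def[abs_def] by measurable

lemma fejer_kernel_nonneg: "l > 0 ==> 0 \<le> fejer_kernel l r z"
 by (simp add: fejer_kernel_def)

lemma fejer_kernel_upper:
 assumes "l > 0" shows "fejer_kernel l r z \<le> real r / l"
proof (cases "r = 0")
 case False
 have "norm (\<Sum>k<r. cis (2 * pi * (real k / l * z))) \<le> real r"
  by (rule order_trans[OF norm_sum]) simp
 then have "(norm (\<Sum>k<r. cis (2 * pi * (real k / l * z))))\<^sup>2 \<le> (real r)\<^sup>2" by (intro power_mono) auto
 then show ?thesis using assms False by (simp add: fejer_kernel_def field_simps power2_eq_square)
qed (simp add: fejer_kernel_def)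

lemma integrable_fejer_bounded:
 assumes l: "l > 0" and [measurable]: "g \<in> borel_measurable borel" and g: "\<And>z. z \<in> {0..<l} ==> \<bar>g z\<bar> \<le> B"
 shows "integrable lborel (\<lambda>z. g z * (indicator {0..<l} z * fejer_kernel l r z))"
proof (rule Bochner_Integration.integrable_bound)
 show "integrable lborel (\<lambda>z. (B * (real r / l)) * indicator {0..<l} z)"
  using l by (intro integrable_mult_right integrable_real_indicator) auto
 show "AE z in lborel. norm (g z * (indicator {0..<l} z * fejer_kernel l r z)) \<le> norm ((B * (real r / l)) * indicator {0..<l} z)"
 proof (rule AE_I2)
  fix z
  show "norm (g z * (indicator {0..<l} z * fejer_kernel l r z)) \<le> norm ((B * (real r / l)) * indicator {0..<l} z)"
  proof (cases "z \<in> {0..<l}")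
   case True
   have "0 \<le> B" using g[OF True] by linarith
   then have "\<bar>g z\<bar> * fejer_kernel l r z \<le> B * (real r / l)"
    using g[OF True] fejer_kernel_upper[OF l] fejer_kernel_nonneg[OF l] by (intro mult_mono) auto
   then show ?thesis using True \<open>0 \<le> B\<close> l fejer_kernel_nonneg[OF l, of r z] by (simp add: abs_mult)
  qed simp
 qed
qed measurable

lemma integrable_fejer:
 assumes "l > 0" shows "integrable lborel (\<lambda>z. indicator {0..<l} z * fejer_kernel l r z)"
proof -
 have "integrable lborel (\<lambda>z. 1 * (indicator {0..<l} z * fejer_kernel l r z))"
  by (rule integrable_fejer_bounded[OF assms, where B = 1]) auto
 then show ?thesis by simp
qed

lemma integral_fejer_kernel:
 assumes l: "l > 0" and r: "r > 0"
 shows "(LBINT z. indicator {0..<l} z * fejer_kernel l r z) = 1"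
proof -
 let ?e = "\<lambda>j k z. complex_of_real (indicator {0..<l} z) * cis (2 * pi * ((real j - real k) / l * z))"
 have i: "integrable lborel (?e j k)" for j k
 proof (rule Bochner_Integration.integrable_bound)
  show "integrable lborel (indicator {0..<l} :: real => real)"
   using l by (intro integrable_real_indicator) auto
 qed (auto simp: norm_mult)
 have "complex_of_real (LBINT z. indicator {0..<l} z * fejer_kernel l r z)
   = (LBINT z. complex_of_real (indicator {0..<l} z * fejer_kernel l r z))"
  by (rule integral_complex_of_real[symmetric])
 also have "\<dots> = (LBINT z. (\<Sum>j<r. \<Sum>k<r. ?e j k z) / of_real (l * real r))"
  by (simp only: of_real_mult[of "indicator _ _"] fejer_kernel_expand sum_distrib_left times_divide_eq_right)
 also have "\<dots> = (\<Sum>j<r. \<Sum>k<r. \<integral>z. ?e j k z \<partial>lborel) / of_real (l * real r)"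
  using i by (simp add: Bochner_Integration.integral_sum Bochner_Integration.integrable_sum)
 also have "\<dots> = (\<Sum>j<r. \<Sum>k<r. if j = k then of_real l else 0) / of_real (l * real r)"
 proof -
  have "(LBINT z. ?e j k z) = (if j = k then of_real l else 0)" for j k
  proof -
   have "l * ((real j - real k) / l) \<in> \<int>" using l by simp
   from circle_orthogonality[OF l this] show ?thesis using l by simp
  qed
  then show ?thesis by simp
 qed
 also have "\<dots> = 1" using l r by simp
 finally show ?thesis by (simp only: of_real_eq_1_iff)
qed

definition circle_dist :: "real => real => real" where
 "circle_dist l z = min \<bar>z\<bar> \<bar>l - z\<bar>"

text \<open>The geometric sum \<open>\<Sum>k<r. z ^ k\<close> is at most \<open>2 / norm (1 - z)\<close>, and on the circle \<open>norm (1 - z)\<close> is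
 comparable to the distance from \<open>1\<close>.\<close>

lemma fejer_kernel_second_moment:
 assumes l: "l > 0" and z: "z \<in> {0..<l}" and r: "r > 0"
 shows "(circle_dist l z)\<^sup>2 * fejer_kernel l r z \<le> l / real r"
proof -
 let ?w = "cis (2 * pi * z / l)"
 have "(1 - ?w) * (\<Sum>k<r. ?w ^ k) = 1 - ?w ^ r" by (simp add: sum_gp_strict)
 then have "norm (1 - ?w) * norm (\<Sum>k<r. ?w ^ k) = norm (1 - ?w ^ r)" by (simp flip: norm_mult)
 also have "\<dots> \<le> 2" using norm_triangle_ineq4[of 1 "?w ^ r"] by (simp add: norm_power)
 finally have a: "norm (1 - ?w) * norm (\<Sum>k<r. ?w ^ k) \<le> 2" .
 have b: "norm (1 - ?w) = 2 * sin (pi * z / l)"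
 proof -
  have "norm (1 - ?w) = 2 * \<bar>sin (2 * pi * z / l / 2)\<bar>"
   using dist_exp_i_1[of "2 * pi * z / l"] by (simp add: cis_conv_exp norm_minus_commute)
  moreover have "sin (pi * z / l) \<ge> 0" using z l by (intro sin_ge_zero) (auto simp: field_simps mult_left_mono)
  ultimately show ?thesis by simp
 qed
 have c: "circle_dist l z / l \<le> sin (pi * z / l)"
 proof (cases "z \<le> l / 2")
  case True
  have "(pi * z / l) / 2 \<le> sin (pi * z / l)"
   using True z l by (intro half_le_sin) (auto simp: field_simps mult_left_mono)
  moreover have "z / l * 1 \<le> z / l * (pi / 2)" using z l pi_gt3 by (intro mult_left_mono) auto
  ultimately show ?thesis using True z l by (simp add: circle_dist_def min_def field_simps)
 next
  case False
  have "pi * (l - z) / l = pi - pi * z / l" using l by (simp add: field_simps)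
  then have s: "sin (pi * (l - z) / l) = sin (pi * z / l)" by (simp only: sin_pi_minus)
  have "(pi * (l - z) / l) / 2 \<le> sin (pi * (l - z) / l)"
   using False z l by (intro half_le_sin) (auto simp: field_simps mult_left_mono)
  moreover have "(l - z) / l * 1 \<le> (l - z) / l * (pi / 2)" using z l pi_gt3 by (intro mult_left_mono) auto
  moreover have "circle_dist l z / l = (l - z) / l * 1" "(l - z) / l * (pi / 2) = (pi * (l - z) / l) / 2"
   using False z by (auto simp: circle_dist_def min_def)
  ultimately show ?thesis unfolding s by linarith
 qed
 have d0: "0 \<le> circle_dist l z" by (simp add: circle_dist_def)
 have pw0: "cis (2 * pi * (real k / l * z)) = ?w ^ k" for k
 proof (induction k)
  case (Suc k)
  have "cis (2 * pi * (real (Suc k) / l * z)) = cis (2 * pi * z / l) * cis (2 * pi * (real k / l * z))"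
   by (simp add: cis_mult algebra_simps add_divide_distrib)
  then show ?case using Suc by simp
 qed simp
 have pw: "(\<Sum>k<r. cis (2 * pi * (real k / l * z))) = (\<Sum>k<r. ?w ^ k)"
  by (simp only: pw0)
 have "2 * (circle_dist l z / l) * norm (\<Sum>k<r. ?w ^ k) \<le> 2"
  using a b c by (intro order_trans[OF mult_right_mono[of _ "norm (1 - ?w)"] a]) auto
 then have "circle_dist l z * norm (\<Sum>k<r. ?w ^ k) \<le> l" using l by (simp add: field_simps)
 then have "(circle_dist l z * norm (\<Sum>k<r. ?w ^ k))\<^sup>2 \<le> l\<^sup>2" using d0 by (intro power_mono) auto
 then show ?thesis using l r unfolding fejer_kernel_def pw by (simp add: field_simps power2_eq_square)
qed

lemma circle_dist_bounds: "z \<in> {0..<l} ==> 0 \<le> circle_dist l z \<and> circle_dist l z \<le> l"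
 by (auto simp: circle_dist_def)

lemma circle_dist_borel [measurable]: "circle_dist l \<in> borel_measurable borel"
 unfolding circle_dist_def[abs_def] by measurable

text \<open>At distances below \<open>1 / sqrt r\<close> the integral of the kernel suffices, at larger distances the
 second moment does.\<close>

lemma fejer_kernel_first_moment:
 assumes l: "l > 0" and r: "r > 0"
 shows "(LBINT z. circle_dist l z * (indicator {0..<l} z * fejer_kernel l r z)) \<le> (1 + l\<^sup>2) / sqrt (real r)"
proof -
 let ?F = "\<lambda>z. indicator {0..<l} z * fejer_kernel l r z"
 let ?s = "sqrt (real r)"
 have s: "?s > 0" using r by simp
 have i: "integrable lborel ?F" using integrable_fejer[OF l] .
 have ind: "integrable lborel (indicator {0..<l} :: real => real)" using l by (intro integrable_real_indicator) auto
 have "(LBINT z. circle_dist l z * ?F z) \<le> (LBINT z. (1 / ?s) * ?F z + (l / ?s) * indicator {0..<l} z)"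
 proof (rule integral_mono)
  show "integrable lborel (\<lambda>z. circle_dist l z * ?F z)"
   using circle_dist_bounds by (intro integrable_fejer_bounded[OF l, of _ l]) auto
  show "integrable lborel (\<lambda>z. (1 / ?s) * ?F z + (l / ?s) * indicator {0..<l} z)"
   by (intro Bochner_Integration.integrable_add integrable_mult_right i ind)
  fix z
  show "circle_dist l z * ?F z \<le> (1 / ?s) * ?F z + (l / ?s) * indicator {0..<l} z"
  proof (cases "z \<in> {0..<l}")
   case True
   let ?d = "circle_dist l z"
   have "2 * ?d * ?s \<le> 1 + (?d * ?s)\<^sup>2" using sum_squares_bound[of "?d * ?s" 1] by simp
   moreover have "0 \<le> ?d * ?s" using circle_dist_bounds[OF True] by simp
   ultimately have "?d * ?s \<le> 1 + (?d * ?s)\<^sup>2" by linarith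
   then have "?d * ?s \<le> 1 + ?d\<^sup>2 * real r" by (simp add: power_mult_distrib)
   then have "?d \<le> (1 + ?d\<^sup>2 * real r) / ?s" using s by (simp only: pos_le_divide_eq)
   also have "\<dots> = 1 / ?s + ?d\<^sup>2 * (real r / ?s)" by (simp only: add_divide_distrib times_divide_eq_right)
   also have "real r / ?s = ?s" by (simp add: real_div_sqrt)
   finally have "?d \<le> 1 / ?s + ?d\<^sup>2 * ?s" .
   then have "?d * fejer_kernel l r z \<le> (1 / ?s + ?d\<^sup>2 * ?s) * fejer_kernel l r z"
    using fejer_kernel_nonneg[OF l] by (intro mult_right_mono)
   also have "\<dots> = (1 / ?s) * fejer_kernel l r z + ?s * (?d\<^sup>2 * fejer_kernel l r z)" by (simp add: algebra_simps)
   also have "\<dots> \<le> (1 / ?s) * fejer_kernel l r z + ?s * (l / real r)"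
    using fejer_kernel_second_moment[OF l True r] s by (intro add_left_mono mult_left_mono) auto
   also have "?s * (l / real r) = l / ?s" using s r by (simp add: field_simps flip: power2_eq_square)
   finally show ?thesis using True by simp
  qed simp
 qed
 also have "\<dots> = 1 / ?s + (l / ?s) * l"
  using integral_fejer_kernel[OF l r] i ind l
  by (subst Bochner_Integration.integral_add) (auto simp del: of_real_divide)
 also have "\<dots> = (1 + l\<^sup>2) / ?s" by (simp add: add_divide_distrib power2_eq_square)
 finally show ?thesis .
qed

section \<open>Density of the transforms of test functions in the Schwartz space\<close>

lemma has_bochner_integral_single:
 "a \<in> A ==> has_bochner_integral (count_space A) (\<lambda>t. indicator {a} t *\<^sub>R c) (c :: complex)"
 using has_bochner_integral_indicator[of "{a}" "count_space A" c] by (simp add: measure_count_space)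

lemma bump_int: "bump (of_int n) = (if n = 0 then 1 else 0)"
proof (cases "n = 0")
 case False
 then have "\<bar>real_of_int n\<bar> \<ge> 1" by linarith
 then show ?thesis using False by (simp add: bump_outside)
qed (simp add: bump_0)

context product_group begin

text \<open>Cut-offs of the frequencies.  On the lattice of a circle, the shifted bumps only serve to write
 the Fejer coefficients \<open>max 0 (1 - \<bar>n\<bar> / r)\<close> as the values of a smooth function.\<close>

definition multiplier :: "nat => 'n => real => real" where
 "multiplier r i t = (case \<Gamma> i of Line => bump (t / real r)
  | Circle l => (\<Sum>j<r. \<Sum>k<r. bump (l * t + (real k - real j))) / real r)"

definition coordinate_kernel :: "nat => 'n => real => complex" where
 "coordinate_kernel r i z = (case \<Gamma> i of Line => of_real (real r) * line_kernel (real r * z)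
  | Circle l => of_real (fejer_kernel l r z))"

definition group_kernel :: "nat => real ^ 'n => complex" where
 "group_kernel r z = (\<Prod>i\<in>UNIV. coordinate_kernel r i (z $ i))"

lemma smooth_multiplier: "smooth_real (multiplier r i)"
proof (cases "\<Gamma> i")
 case Line
 have "smooth_real (\<lambda>t. bump ((1 / real r) * t + 0))"
  by (rule smooth_real_compose[OF smooth_bump smooth_real_affine])
 then show ?thesis using Line by (simp add: multiplier_def[abs_def])
next
 case (Circle l)
 have "smooth_real (\<lambda>t. (1 / real r) * (\<Sum>j<r. \<Sum>k<r. bump (l * t + (real k - real j))))"
  by (intro smooth_real_mult smooth_real_const smooth_real_sum smooth_real_compose[OF smooth_bump smooth_real_affine]) auto
 then show ?thesis using Circle by (simp add: multiplier_def[abs_def])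
qed

lemma multiplier_vanishing: "r > 0 ==> \<exists>R. vanishing_outside R (multiplier r i)"
proof (cases "\<Gamma> i")
 case Line
 assume r: "r > 0"
 have "bump (t / real r) = 0" if "\<bar>t\<bar> \<ge> real r" for t
  using that r by (intro bump_outside) (simp add: abs_divide)
 then show ?thesis using Line by (auto simp: vanishing_outside_def multiplier_def)
next
 case (Circle l)
 note l = period_pos[OF Circle]
 have "bump (l * t + (real k - real j)) = 0" if t: "\<bar>t\<bar> \<ge> (real r + 1) / l" and jk: "j < r" "k < r" for t j k
 proof (rule bump_outside)
  have "\<bar>l * t\<bar> \<ge> real r + 1" using t l by (simp add: abs_mult field_simps)
  moreover have "\<bar>real j - real k\<bar> \<le> real r" using jk by linarith
  ultimately show "1 \<le> \<bar>l * t + (real k - real j)\<bar>" by linarith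
 qed
 then show ?thesis using Circle by (intro exI[of _ "(real r + 1) / l"]) (auto simp: vanishing_outside_def multiplier_def)
qed

lemma multiplier_test:
 assumes "r > 0" shows "prod_fun (multiplier r) \<in> tests"
proof -
 obtain R where R: "\<And>i. vanishing_outside (R i) (multiplier r i)"
  using multiplier_vanishing[OF assms] by metis
 have "vanishing_outside (\<Sum>i\<in>UNIV. \<bar>R i\<bar>) (multiplier r i)" for i
  using member_le_sum[of i UNIV "\<lambda>i. \<bar>R i\<bar>"] by (intro vanishing_outside_mono[OF R]) auto
 then show ?thesis by (rule prod_fun_test[OF smooth_multiplier])
qed

lemma multiplier_0: "r > 0 ==> multiplier r i 0 = 1"
proof (cases "\<Gamma> i")
 case (Circle l)
 assume r: "r > 0"
 have "bump (real k - real j) = (if k = j then 1 else 0)" for j k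
  using bump_int[of "int k - int j"] by (auto simp: of_nat_eq_iff)
 then show ?thesis using Circle r by (simp add: multiplier_def)
qed (simp add: multiplier_def bump_0)

lemma multiplier_transform:
 assumes r: "r > 0"
 shows "has_bochner_integral (dual_coords \<Gamma> i) (\<lambda>t. complex_of_real (multiplier r i t) * cis (2 * pi * (t * z)))
  ((case \<Gamma> i of Line => 1 | Circle l => of_real l) * coordinate_kernel r i z)"
proof (cases "\<Gamma> i")
 case Line
 let ?f = "\<lambda>t. complex_of_real (bump (t / real r)) * cis (2 * pi * (t * z))"
 have [measurable]: "bump \<in> borel_measurable borel"
  by (rule borel_measurable_continuous_onI[OF smooth_real_continuous[OF smooth_bump]])
 have "integrable lborel (\<lambda>u. complex_of_real (bump u) * cis (2 * pi * (u * (real r * z))))"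
  by (rule Bochner_Integration.integrable_bound[OF integrable_bump]) (auto simp: norm_mult)
 then have "has_bochner_integral lborel (\<lambda>u. complex_of_real (bump u) * cis (2 * pi * (u * (real r * z)))) (line_kernel (real r * z))"
  unfolding line_kernel_def by (rule has_bochner_integral_integrable)
 moreover have "(\<lambda>u. ?f (0 + real r * u)) = (\<lambda>u. complex_of_real (bump u) * cis (2 * pi * (u * (real r * z))))"
  using r by (simp add: mult_ac)
 moreover have "line_kernel (real r * z) = (of_real (real r) * line_kernel (real r * z)) /\<^sub>R \<bar>real r\<bar>"
  using r by (simp add: scaleR_conv_of_real)
 ultimately have "has_bochner_integral lborel (\<lambda>u. ?f (0 + real r * u)) ((of_real (real r) * line_kernel (real r * z)) /\<^sub>R \<bar>real r\<bar>)"
  by (simp only:)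
 then have "has_bochner_integral lborel ?f (of_real (real r) * line_kernel (real r * z))"
  using r by (subst lborel_has_bochner_integral_real_affine_iff[of "real r" _ _ 0]) auto
 then show ?thesis using Line by (simp add: multiplier_def coordinate_kernel_def)
next
 case (Circle l)
 note l = period_pos[OF Circle]
 let ?Z = "{t::real. l * t \<in> \<int>}"
 let ?g = "\<lambda>j k t. complex_of_real (bump (l * t + (real k - real j))) * cis (2 * pi * (t * z))"
 have "has_bochner_integral (count_space ?Z) (?g j k) (cis (2 * pi * ((real j - real k) / l * z)))" for j k
 proof -
  let ?a = "(real j - real k) / l"
  have a: "?a \<in> ?Z" using l by simp
  have "?g j k t = indicator {?a} t *\<^sub>R cis (2 * pi * (?a * z))" if t: "t \<in> ?Z" for t
  proof -
   obtain n where n: "l * t = of_int n" using t by (auto elim: Ints_cases)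
   have "l * t + (real k - real j) = of_int (n - (int j - int k))" by (simp add: n)
   then have "bump (l * t + (real k - real j)) = (if n - (int j - int k) = 0 then 1 else 0)" by (simp only: bump_int)
   moreover have "n - (int j - int k) = 0 \<longleftrightarrow> t = ?a"
   proof -
    have "n - (int j - int k) = 0 \<longleftrightarrow> real_of_int n = real j - real k" by linarith
    then show ?thesis using l unfolding n[symmetric] by (auto simp: field_simps)
   qed
   ultimately show ?thesis by (auto simp: indicator_def)
  qed
  then show ?thesis
   using has_bochner_integral_single[OF a, of "cis (2 * pi * (?a * z))"]
   by (subst has_bochner_integral_cong[OF refl _ refl]) auto
 qed
 then have "has_bochner_integral (count_space ?Z) (\<lambda>t. inverse (of_real (real r)) * (\<Sum>j<r. \<Sum>k<r. ?g j k t))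
   (inverse (of_real (real r)) * (\<Sum>j<r. \<Sum>k<r. cis (2 * pi * ((real j - real k) / l * z))))"
  by (intro has_bochner_integral_mult_right has_bochner_integral_sum)
 moreover have "(\<lambda>t. inverse (of_real (real r)) * (\<Sum>j<r. \<Sum>k<r. ?g j k t)) = (\<lambda>t. complex_of_real (multiplier r i t) * cis (2 * pi * (t * z)))"
  using Circle by (simp add: fun_eq_iff multiplier_def divide_inverse sum_distrib_left sum_distrib_right mult_ac)
 moreover have "inverse (of_real (real r)) * (\<Sum>j<r. \<Sum>k<r. cis (2 * pi * ((real j - real k) / l * z))) = of_real l * coordinate_kernel r i z"
  using Circle l r by (simp add: coordinate_kernel_def fejer_kernel_expand divide_inverse)
 ultimately show ?thesis using Circle by simp
qed

text \<open>The kernel is the transform of the multiplier, factor by factor.\<close>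

lemma multiplier_fourier:
 assumes r: "r > 0"
 shows "(fourier_const \<Gamma>)\<^sup>2 * fourier_integral m (2 * pi) (zero_ext (prod_fun (multiplier r))) x = group_kernel r x"
proof -
 let ?f = "\<lambda>i t. complex_of_real (multiplier r i t) * cis (2 * pi * (t * x $ i))"
 let ?l = "\<lambda>i. case \<Gamma> i of Line => 1 | Circle l => l"
 have [measurable]: "multiplier r i \<in> borel_measurable borel" for i
  by (rule borel_measurable_continuous_onI[OF smooth_real_continuous[OF smooth_multiplier]])
 have "fourier_integral m (2 * pi) (zero_ext (prod_fun (multiplier r))) x = (\<integral>\<xi>. (\<Prod>i\<in>UNIV. ?f i (\<xi> $ i)) \<partial>m)"
  unfolding fourier_integral_def
 proof (rule integral_cong_AE)
  show "AE \<xi> in m. zero_ext (prod_fun (multiplier r)) \<xi> * cis (2 * pi * (\<xi> \<bullet> x)) = (\<Prod>i\<in>UNIV. ?f i (\<xi> $ i))"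
   using AE_dual_group
   by eventually_elim (simp add: zero_ext_def prod_fun_def inner_vec_def sum_distrib_left cis_sum prod.distrib)
  have [measurable]: "zero_ext (prod_fun (multiplier r)) \<in> borel_measurable borel"
   using moments_test[OF multiplier_test[OF r]] by (simp add: moments_def)
  show "(\<lambda>\<xi>. zero_ext (prod_fun (multiplier r)) \<xi> * cis (2 * pi * (\<xi> \<bullet> x))) \<in> borel_measurable m" by measurable
  have [measurable]: "(\<lambda>\<xi>::real^'n. \<xi> $ i) \<in> borel_measurable borel" for i
   by (intro borel_measurable_continuous_onI continuous_intros)
  show "(\<lambda>\<xi>. \<Prod>i\<in>UNIV. ?f i (\<xi> $ i)) \<in> borel_measurable m" by measurable
 qed
 also have "\<dots> = (\<Prod>i\<in>UNIV. \<integral>t. ?f i t \<partial>dual_coords \<Gamma> i)"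
  unfolding dual_borel_def
  using multiplier_transform[OF r] by (intro dual.integral_vec_prod) (auto intro: integrable.intros)
 also have "\<dots> = (\<Prod>i\<in>UNIV. complex_of_real (?l i) * coordinate_kernel r i (x $ i))"
 proof (intro prod.cong refl)
  fix i
  show "(\<integral>t. ?f i t \<partial>dual_coords \<Gamma> i) = complex_of_real (?l i) * coordinate_kernel r i (x $ i)"
   using has_bochner_integral_integral_eq[OF multiplier_transform[OF r, of i "x $ i"]] by (cases "\<Gamma> i") auto
 qed
 also have "\<dots> = of_real (\<Prod>i\<in>UNIV. ?l i) * group_kernel r x"
  by (simp add: prod.distrib group_kernel_def)
 also have "(\<Prod>i\<in>UNIV. ?l i) = 1 / (fourier_const \<Gamma>)\<^sup>2"
  by (simp add: fourier_const_sq divide_inverse o_def flip: prod_inversef)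
 finally show ?thesis using fourier_const_pos by (simp add: less_imp_neq[symmetric])
qed

lemma group_kernel_cnj:
 assumes r: "r > 0"
 shows "group_kernel r x = cnj (fourier_const \<Gamma> * dual_fourier_integral \<Gamma> (prod_fun (multiplier r)) x)"
proof -
 let ?X = "zero_ext (prod_fun (multiplier r))"
 have "cnj (?X \<xi>) = ?X \<xi>" for \<xi> by (simp add: zero_ext_def prod_fun_def)
 then have "cnj (?X \<xi> * cis (- 2 * pi * (\<xi> \<bullet> x))) = ?X \<xi> * cis (2 * pi * (\<xi> \<bullet> x))" for \<xi>
  by (simp add: cis_cnj)
 then have "cnj (fourier_integral m (- 2 * pi) ?X x) = fourier_integral m (2 * pi) ?X x"
  unfolding fourier_integral_def by (simp only: Bochner_Integration.integral_cnj[symmetric])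
 then show ?thesis
  unfolding multiplier_fourier[OF r, symmetric] dual_fourier_integral_eq by (simp add: power2_eq_square)
qed

lemma group_kernel_schwartz:
 assumes r: "r > 0" shows "group_kernel r \<in> schwartz \<Gamma>"
 using schwartz_cnj[OF schwartz_cmult[OF dual_fourier_integral_schwartz[OF multiplier_test[OF r]], of "fourier_const \<Gamma>"]]
 by (simp add: group_kernel_cnj[OF r, abs_def])

lemma integral_group_kernel:
 assumes r: "r > 0"
 shows "(LBINT z. indicator (FD) z *\<^sub>R group_kernel r z) = 1"
proof -
 let ?X = "prod_fun (multiplier r)"
 have "(LBINT z. indicator (FD) z *\<^sub>R group_kernel r z)
   = (LBINT z. cnj (of_real (fourier_const \<Gamma>) * (indicator (FD) z *\<^sub>R (dual_fourier_integral \<Gamma> ?X z * cis (2 * pi * (0 \<bullet> z))))))"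
  unfolding group_kernel_cnj[OF r] by (intro Bochner_Integration.integral_cong refl) (simp add: indicator_def)
 also have "\<dots> = cnj (fourier_const \<Gamma> * (LBINT z. indicator (FD) z *\<^sub>R (dual_fourier_integral \<Gamma> ?X z * cis (2 * pi * (0 \<bullet> z)))))"
  by (simp only: Bochner_Integration.integral_cnj integral_mult_right_zero)
 also have "\<dots> = cnj (?X 0)"
  by (simp only: dual_fourier_inversion[OF multiplier_test[OF r] dual_group_zero])
 also have "\<dots> = 1" using multiplier_0[OF r] by (simp add: prod_fun_def)
 finally show ?thesis .
qed

text \<open>The distance to the identity in each factor.\<close>

definition coordinate_dist :: "'n => real => real" where
 "coordinate_dist i z = (case \<Gamma> i of Line => \<bar>z\<bar> | Circle l => circle_dist l z)"

text \<open>The absolute value of the kernel on a fundamental domain of the factor.\<close>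

definition kernel_mass :: "nat => 'n => real => real" where
 "kernel_mass r i z = (case \<Gamma> i of Line => 1 | Circle l => indicator {0..<l} z) * norm (coordinate_kernel r i z)"

lemma coordinate_dist_nonneg: "0 \<le> coordinate_dist i z"
 by (auto simp: coordinate_dist_def circle_dist_def split: factor.split)

lemma kernel_mass_nonneg: "0 \<le> kernel_mass r i z"
 by (auto simp: kernel_mass_def split: factor.split)

lemma coordinate_borel [measurable]:
 "coordinate_dist i \<in> borel_measurable borel" "kernel_mass r i \<in> borel_measurable borel"
proof -
 show "coordinate_dist i \<in> borel_measurable borel"
  by (cases "\<Gamma> i") (simp_all add: coordinate_dist_def[abs_def])
 show "kernel_mass r i \<in> borel_measurable borel"
  by (cases "\<Gamma> i") (simp_all add: kernel_mass_def[abs_def] coordinate_kernel_def)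
qed

text \<open>On a line, scaling by \<open>r\<close> makes the first moment \<open>O (1 / r)\<close>; on a circle, the Fejer kernel only
 gives \<open>O (1 / sqrt r)\<close>.\<close>

lemma kernel_mass_moments:
 "\<exists>A\<ge>1. \<forall>r>0. integrable lborel (\<lambda>z. (1 + coordinate_dist i z) ^ N * kernel_mass r i z)
  \<and> (LBINT z. (1 + coordinate_dist i z) ^ N * kernel_mass r i z) \<le> A
  \<and> integrable lborel (\<lambda>z. coordinate_dist i z * ((1 + coordinate_dist i z) ^ N * kernel_mass r i z))
  \<and> (LBINT z. coordinate_dist i z * ((1 + coordinate_dist i z) ^ N * kernel_mass r i z)) \<le> A / sqrt (real r)"
proof (cases "\<Gamma> i")
 case Line
 let ?M = "\<lambda>k. \<integral>u. (1 + \<bar>u\<bar>) ^ k * norm (line_kernel u) \<partial>lborel"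
 have M0: "0 \<le> ?M k" for k by (intro Bochner_Integration.integral_nonneg) auto
 have km: "kernel_mass r i z = real r * norm (line_kernel (real r * z))" for r z
  using Line by (simp add: kernel_mass_def coordinate_kernel_def norm_mult)
 have cd: "coordinate_dist i z = \<bar>z\<bar>" for z using Line by (simp add: coordinate_dist_def)
 have scale: "integrable lborel (\<lambda>z. \<bar>z\<bar> ^ p * ((1 + \<bar>z\<bar>) ^ N * kernel_mass r i z)) \<and>
  (LBINT z. \<bar>z\<bar> ^ p * ((1 + \<bar>z\<bar>) ^ N * kernel_mass r i z)) \<le> ?M (p + N) / real r ^ p" if r: "r > 0" for r p
 proof -
  let ?g = "\<lambda>u. (\<bar>u\<bar> / real r) ^ p * ((1 + \<bar>u\<bar> / real r) ^ N * norm (line_kernel u))"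
  let ?h = "\<lambda>u. (1 / real r ^ p) * ((1 + \<bar>u\<bar>) ^ (p + N) * norm (line_kernel u))"
  have h: "integrable lborel ?h" by (intro integrable_mult_right integrable_line_kernel_moment)
  have le: "0 \<le> ?g u \<and> ?g u \<le> ?h u" for u
  proof -
   have r1: "1 \<le> real r" using r by simp
   have "\<bar>u\<bar> * 1 \<le> \<bar>u\<bar> * real r" using r1 by (intro mult_left_mono) auto
   then have "\<bar>u\<bar> / real r \<le> \<bar>u\<bar>" using r by (simp add: divide_le_eq)
   then have "(1 + \<bar>u\<bar> / real r) ^ N \<le> (1 + \<bar>u\<bar>) ^ N" by (intro power_mono) auto
   moreover have "(\<bar>u\<bar> / real r) ^ p \<le> (1 / real r ^ p) * (1 + \<bar>u\<bar>) ^ p"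
    using power_mono[of "\<bar>u\<bar>" "1 + \<bar>u\<bar>" p] by (simp add: power_divide divide_right_mono)
   ultimately have "?g u \<le> ((1 / real r ^ p) * (1 + \<bar>u\<bar>) ^ p) * ((1 + \<bar>u\<bar>) ^ N * norm (line_kernel u))"
    by (intro mult_mono mult_right_mono) auto
   then show ?thesis by (simp add: power_add mult_ac)
  qed
  have g: "integrable lborel ?g"
   by (rule Bochner_Integration.integrable_bound[OF h]) (use le in \<open>auto intro!: AE_I2 simp del: times_divide_eq_left\<close>)
  have eq: "\<bar>z\<bar> ^ p * ((1 + \<bar>z\<bar>) ^ N * kernel_mass r i z) = real r * ?g (0 + real r * z)" for z
   using r by (simp add: km abs_mult mult_ac)
  have ig: "integrable lborel (\<lambda>z. ?g (0 + real r * z))"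
   using r g by (intro lborel_integrable_real_affine) auto
  have "(LBINT z. real r * ?g (0 + real r * z)) = (LBINT u. ?g u)"
   using r lborel_integral_real_affine[of "real r" ?g 0] by simp
  also have "\<dots> \<le> (LBINT u. ?h u)" using le by (intro integral_mono g h) blast
  also have "\<dots> = ?M (p + N) / real r ^ p" by (simp only: integral_mult_right_zero) simp
  finally show ?thesis unfolding eq using integrable_mult_right[OF ig, of "real r"] by simp
 qed
 let ?A = "1 + ?M N + ?M (Suc N)"
 show ?thesis
 proof (intro exI[of _ ?A] conjI allI impI)
  show "1 \<le> ?A" using M0[of N] M0[of "Suc N"] by linarith
  fix r :: nat assume r: "r > 0"
  show "integrable lborel (\<lambda>z. (1 + coordinate_dist i z) ^ N * kernel_mass r i z)"
   using scale[OF r, of 0] by (simp add: cd)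
  have "(LBINT z. (1 + coordinate_dist i z) ^ N * kernel_mass r i z) \<le> ?M N"
   using scale[OF r, of 0] by (simp add: cd)
  then show "(LBINT z. (1 + coordinate_dist i z) ^ N * kernel_mass r i z) \<le> ?A"
   using M0[of "Suc N"] by linarith
  show "integrable lborel (\<lambda>z. coordinate_dist i z * ((1 + coordinate_dist i z) ^ N * kernel_mass r i z))"
   using scale[OF r, of 1] by (simp add: cd)
  have "(LBINT z. coordinate_dist i z * ((1 + coordinate_dist i z) ^ N * kernel_mass r i z)) \<le> ?M (Suc N) / real r"
   using scale[OF r, of 1] by (simp add: cd)
  also have "\<dots> \<le> ?A / sqrt (real r)"
  proof (rule frac_le)
   show "sqrt (real r) \<le> real r" using r sqrt_le_D[of 1 "real r"] by (intro real_le_lsqrt) (auto simp: power2_eq_square)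
  qed (use M0[of N] M0[of "Suc N"] r in auto)
  finally show "(LBINT z. coordinate_dist i z * ((1 + coordinate_dist i z) ^ N * kernel_mass r i z)) \<le> ?A / sqrt (real r)" .
 qed
next
 case (Circle l)
 note l = period_pos[OF Circle]
 have km: "kernel_mass r i z = indicator {0..<l} z * fejer_kernel l r z" for r z
  using Circle fejer_kernel_nonneg[OF l] by (simp add: kernel_mass_def coordinate_kernel_def)
 have cd: "coordinate_dist i z = circle_dist l z" for z using Circle by (simp add: coordinate_dist_def)
 let ?L = "(1 + l) ^ N"
 have L: "\<bar>(1 + circle_dist l z) ^ N\<bar> \<le> ?L" if "z \<in> {0..<l}" for z
  using circle_dist_bounds[OF that] by (simp add: abs_of_nonneg power_mono)
 have L1: "1 \<le> ?L" using l by simp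
 have b1: "integrable lborel (\<lambda>z. (1 + circle_dist l z) ^ N * (indicator {0..<l} z * fejer_kernel l r z))" for r
  by (rule integrable_fejer_bounded[OF l, where B = ?L]) (use L in auto)
 have b2: "integrable lborel (\<lambda>z. (circle_dist l z * (1 + circle_dist l z) ^ N) * (indicator {0..<l} z * fejer_kernel l r z))" for r
 proof (rule integrable_fejer_bounded[OF l, where B = "l * ?L"])
  fix z assume z: "z \<in> {0..<l}"
  show "\<bar>circle_dist l z * (1 + circle_dist l z) ^ N\<bar> \<le> l * ?L"
   using circle_dist_bounds[OF z] L[OF z] unfolding abs_mult by (intro mult_mono) auto
 qed measurable
 have b3: "integrable lborel (\<lambda>z. circle_dist l z * (indicator {0..<l} z * fejer_kernel l r z))" for r
  by (rule integrable_fejer_bounded[OF l, where B = l]) (use circle_dist_bounds in auto)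
 have pw: "(1 + circle_dist l z) ^ N * (indicator {0..<l} z * fejer_kernel l r z) \<le> ?L * (indicator {0..<l} z * fejer_kernel l r z)" for z r
  using L[of z] fejer_kernel_nonneg[OF l, of r z] by (cases "z \<in> {0..<l}") (auto intro!: mult_right_mono)
 let ?A = "?L * (1 + l\<^sup>2)"
 have LA: "?L * 1 \<le> ?A" using L1 by (intro mult_left_mono) auto
 show ?thesis
 proof (intro exI[of _ ?A] conjI allI impI)
  show "1 \<le> ?A" using L1 LA by linarith
  fix r :: nat assume r: "r > 0"
  show "integrable lborel (\<lambda>z. (1 + coordinate_dist i z) ^ N * kernel_mass r i z)"
   unfolding cd km by (rule b1)
  have "(LBINT z. (1 + circle_dist l z) ^ N * (indicator {0..<l} z * fejer_kernel l r z))
    \<le> (LBINT z. ?L * (indicator {0..<l} z * fejer_kernel l r z))"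
   by (intro integral_mono b1 integrable_mult_right integrable_fejer l pw)
  also have "\<dots> = ?L" using integral_fejer_kernel[OF l r] by simp
  finally show "(LBINT z. (1 + coordinate_dist i z) ^ N * kernel_mass r i z) \<le> ?A"
   unfolding cd km using LA by linarith
  show "integrable lborel (\<lambda>z. coordinate_dist i z * ((1 + coordinate_dist i z) ^ N * kernel_mass r i z))"
   unfolding cd km using b2 by (simp only: mult.assoc)
  have "(LBINT z. circle_dist l z * ((1 + circle_dist l z) ^ N * (indicator {0..<l} z * fejer_kernel l r z)))
    \<le> (LBINT z. ?L * (circle_dist l z * (indicator {0..<l} z * fejer_kernel l r z)))"
  proof (intro integral_mono)
   show "integrable lborel (\<lambda>z. circle_dist l z * ((1 + circle_dist l z) ^ N * (indicator {0..<l} z * fejer_kernel l r z)))"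
    using b2 by (simp only: mult.assoc)
   show "integrable lborel (\<lambda>z. ?L * (circle_dist l z * (indicator {0..<l} z * fejer_kernel l r z)))"
    by (intro integrable_mult_right b3)
   fix z
   have "0 \<le> circle_dist l z" by (simp add: circle_dist_def)
   from mult_left_mono[OF pw[of z r] this]
   show "circle_dist l z * ((1 + circle_dist l z) ^ N * (indicator {0..<l} z * fejer_kernel l r z))
     \<le> ?L * (circle_dist l z * (indicator {0..<l} z * fejer_kernel l r z))" by (simp only: mult_ac)
  qed
  also have "\<dots> \<le> ?L * ((1 + l\<^sup>2) / sqrt (real r))"
   unfolding integral_mult_right_zero using L1 by (intro mult_left_mono fejer_kernel_first_moment l r) auto
  finally show "(LBINT z. coordinate_dist i z * ((1 + coordinate_dist i z) ^ N * kernel_mass r i z)) \<le> ?A / sqrt (real r)"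
   unfolding cd km by simp
 qed
qed

lemma group_kernel_moment:
 "\<exists>C. \<forall>r>0. integrable lborel (\<lambda>z. (\<Prod>i\<in>UNIV. (1 + coordinate_dist i (z $ i)) ^ N) * (\<Sum>i\<in>UNIV. coordinate_dist i (z $ i))
    * norm (indicator (FD) z *\<^sub>R group_kernel r z))
  \<and> (\<integral>z. (\<Prod>i\<in>UNIV. (1 + coordinate_dist i (z $ i)) ^ N) * (\<Sum>i\<in>UNIV. coordinate_dist i (z $ i))
    * norm (indicator (FD) z *\<^sub>R group_kernel r z) \<partial>lborel) \<le> C / sqrt (real r)"
proof -
 define Q where "Q i A \<longleftrightarrow> 1 \<le> A \<and> (\<forall>r>0. integrable lborel (\<lambda>z. (1 + coordinate_dist i z) ^ N * kernel_mass r i z)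
  \<and> (LBINT z. (1 + coordinate_dist i z) ^ N * kernel_mass r i z) \<le> A
  \<and> integrable lborel (\<lambda>z. coordinate_dist i z * ((1 + coordinate_dist i z) ^ N * kernel_mass r i z))
  \<and> (LBINT z. coordinate_dist i z * ((1 + coordinate_dist i z) ^ N * kernel_mass r i z)) \<le> A / sqrt (real r))" for i A
 have "\<forall>i. \<exists>A. Q i A" unfolding Q_def using kernel_mass_moments by simp
 from choice[OF this] obtain A where Q: "\<And>i. Q i (A i)" by blast
 have A: "1 \<le> A i"
  "r > 0 ==> integrable lborel (\<lambda>z. (1 + coordinate_dist i z) ^ N * kernel_mass r i z)"
  "r > 0 ==> (LBINT z. (1 + coordinate_dist i z) ^ N * kernel_mass r i z) \<le> A i"
  "r > 0 ==> integrable lborel (\<lambda>z. coordinate_dist i z * ((1 + coordinate_dist i z) ^ N * kernel_mass r i z))"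
  "r > 0 ==> (LBINT z. coordinate_dist i z * ((1 + coordinate_dist i z) ^ N * kernel_mass r i z)) \<le> A i / sqrt (real r)" for i r
  using Q[of i] unfolding Q_def by simp_all
 let ?a = "\<lambda>r i z. (1 + coordinate_dist i z) ^ N * kernel_mass r i z"
 let ?f = "\<lambda>r j i z. if i = j then coordinate_dist i z * ?a r i z else ?a r i z"
 let ?P = "\<Prod>i\<in>UNIV. A i"
 have mass: "norm (indicator (FD) z *\<^sub>R group_kernel r z) = (\<Prod>i\<in>UNIV. kernel_mass r i (z $ i))" for r z
 proof -
  have "(\<Prod>i\<in>UNIV. kernel_mass r i (z $ i)) = indicator (FD) z * norm (group_kernel r z)"
   unfolding kernel_mass_def prod.distrib group_kernel_def prod_norm indicator_fundamental_domain ..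
  then show ?thesis by simp
 qed
 have split: "(\<Prod>i\<in>UNIV. (1 + coordinate_dist i (z $ i)) ^ N) * (\<Sum>i\<in>UNIV. coordinate_dist i (z $ i))
    * norm (indicator (FD) z *\<^sub>R group_kernel r z) = (\<Sum>j\<in>UNIV. \<Prod>i\<in>UNIV. ?f r j i (z $ i))" for r z
 proof -
  have "(\<Prod>i\<in>UNIV. ?f r j i (z $ i)) = coordinate_dist j (z $ j) * (\<Prod>i\<in>UNIV. ?a r i (z $ i))" for j
   by (subst (1 2) prod.remove[of UNIV j]) (auto simp: mult.assoc intro!: prod.cong)
  then show ?thesis unfolding mass by (simp add: prod.distrib sum_distrib_right sum_distrib_left mult_ac)
 qed
 have f_meas: "?f r j i \<in> borel_measurable borel" for r j i by (cases "i = j") simp_all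
 have f_int: "integrable lborel (?f r j i)" if "r > 0" for r j i using A(2,4)[OF that] by (cases "i = j") simp_all
 have int: "integrable lborel (\<lambda>z::real^'n. \<Prod>i\<in>UNIV. ?f r j i (z $ i))" if "r > 0" for r j
  using lborel_coords.integrable_vec_prod[OF f_meas[where r = r and j = j] f_int[OF that, where j = j]] by (simp only: lborel_vec)
 have val: "(\<integral>z. (\<Prod>i\<in>UNIV. ?f r j i (z $ i)) \<partial>(lborel :: (real ^ 'n) measure)) \<le> ?P / sqrt (real r)" if r: "r > 0" for r j
 proof -
  have "(\<integral>z. (\<Prod>i\<in>UNIV. ?f r j i (z $ i)) \<partial>(lborel :: (real ^ 'n) measure)) = (\<Prod>i\<in>UNIV. \<integral>t. ?f r j i t \<partial>lborel)"
   using lborel_coords.integral_vec_prod[OF f_meas[where r = r and j = j] f_int[OF r, where j = j]] by (simp only: lborel_vec)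
  also have "\<dots> = (LBINT t. ?f r j j t) * (\<Prod>i\<in>UNIV - {j}. \<integral>t. ?f r j i t \<partial>lborel)"
   by (rule prod.remove) auto
  also have "\<dots> \<le> (A j / sqrt (real r)) * (\<Prod>i\<in>UNIV - {j}. A i)"
  proof (intro mult_mono prod_mono conjI)
   show "(LBINT t. ?f r j j t) \<le> A j / sqrt (real r)" using A(5)[OF r] by simp
   show "0 \<le> A j / sqrt (real r)" using A(1)[of j] by simp
   show "0 \<le> (\<Prod>i\<in>UNIV - {j}. \<integral>t. ?f r j i t \<partial>lborel)"
    by (intro prod_nonneg Bochner_Integration.integral_nonneg) (auto simp: coordinate_dist_nonneg kernel_mass_nonneg)
   fix i assume "i \<in> UNIV - {j}"
   then show "0 \<le> (LBINT t. ?f r j i t)" "(LBINT t. ?f r j i t) \<le> A i"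
    using A(3)[OF r, where i = i] by (auto intro!: Bochner_Integration.integral_nonneg simp: coordinate_dist_nonneg kernel_mass_nonneg)
  qed
  also have "\<dots> = ?P / sqrt (real r)" by (subst prod.remove[of UNIV j]) auto
  finally show ?thesis .
 qed
 show ?thesis
 proof (intro exI[of _ "real CARD('n) * ?P"] allI impI conjI)
  fix r :: nat assume r: "r > 0"
  show "integrable lborel (\<lambda>z. (\<Prod>i\<in>UNIV. (1 + coordinate_dist i (z $ i)) ^ N) * (\<Sum>i\<in>UNIV. coordinate_dist i (z $ i))
    * norm (indicator (FD) z *\<^sub>R group_kernel r z))"
   unfolding split by (intro Bochner_Integration.integrable_sum int r)
  have "(\<integral>z. (\<Sum>j\<in>UNIV. \<Prod>i\<in>UNIV. ?f r j i (z $ i)) \<partial>(lborel :: (real ^ 'n) measure)) = (\<Sum>j\<in>UNIV. \<integral>z. (\<Prod>i\<in>UNIV. ?f r j i (z $ i)) \<partial>(lborel :: (real ^ 'n) measure))"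
   by (intro Bochner_Integration.integral_sum int r)
  also have "\<dots> \<le> (\<Sum>j\<in>(UNIV::'n set). ?P / sqrt (real r))" by (intro sum_mono val r)
  finally show "(\<integral>z. (\<Prod>i\<in>UNIV. (1 + coordinate_dist i (z $ i)) ^ N) * (\<Sum>i\<in>UNIV. coordinate_dist i (z $ i))
    * norm (indicator (FD) z *\<^sub>R group_kernel r z) \<partial>lborel) \<le> real CARD('n) * ?P / sqrt (real r)"
   unfolding split by simp
 qed
qed

text \<open>Convolution with the reflection of \<open>k\<close>.  With \<open>x + z\<close> instead of \<open>x - z\<close> the integral runs over the
 fundamental domain itself, and derivatives in \<open>x\<close> fall on \<open>\<phi>\<close>.\<close>

definition group_conv :: "(real ^ 'n => complex) => (real ^ 'n => complex) => real ^ 'n => complex" where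
 "group_conv k \<phi> x = (LBINT z. indicator (FD) z *\<^sub>R (\<phi> (x + z) * k z))"

lemma schwartz_bounded:
 assumes "\<phi> \<in> schwartz \<Gamma>" obtains B where "B > 0" "\<And>x. norm (\<phi> x) \<le> B"
 using schwartz_bound[OF assms, where k = 0 and js = "[]"] by auto

lemma integrable_group_conv:
 assumes \<phi>: "\<phi> \<in> schwartz \<Gamma>" and k: "k \<in> schwartz \<Gamma>"
 shows "integrable lborel (\<lambda>z. indicator (FD) z *\<^sub>R (\<phi> (x + z) * k z))"
proof -
 obtain B where B: "B > 0" "\<And>x. norm (\<phi> x) \<le> B" using schwartz_bounded[OF \<phi>] by blast
 note [measurable] = schwartz_measurable[OF \<phi>] schwartz_measurable[OF k]
 show ?thesis
 proof (rule Bochner_Integration.integrable_bound)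
  show "integrable lborel (\<lambda>z. B * norm (indicator (FD) z *\<^sub>R k z))"
   by (intro integrable_mult_right integrable_norm integrable_schwartz k)
  show "AE z in lborel. norm (indicator (FD) z *\<^sub>R (\<phi> (x + z) * k z))
    \<le> norm (B * norm (indicator (FD) z *\<^sub>R k z))"
   using B by (intro AE_I2) (auto simp: norm_mult indicator_def abs_mult intro!: mult_right_mono)
 qed measurable
qed

lemma second_order_bound:
 assumes \<phi>: "\<phi> \<in> schwartz \<Gamma>" and B: "\<And>x. norm (partial_deriv j (partial_deriv j \<phi>) x) \<le> B"
 shows "norm (\<phi> (x + u *\<^sub>R axis j 1) - \<phi> x - u *\<^sub>R partial_deriv j \<phi> x) \<le> B * u\<^sup>2"
proof -
 note sm = schwartz_smooth[OF \<phi>]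
 let ?d = "partial_deriv j \<phi> x"
 let ?h = "\<lambda>y. \<phi> y + (- ?d) * complex_of_real (y $ j)"
 have h: "everywhere.smooth ?h"
  by (intro everywhere.smooth_add everywhere.smooth_mult everywhere.smooth_const everywhere.smooth_coordinate sm)
 have dh: "partial_deriv j ?h y = partial_deriv j \<phi> y - ?d" for y
 proof (rule partial_deriv_eqI)
  have 1: "((\<lambda>u. \<phi> (y + u *\<^sub>R axis j 1)) has_vector_derivative partial_deriv j \<phi> y) (at 0)"
   by (intro everywhere.partial_deriv_vector_derivative_0 everywhere.smooth_differentiable sm) auto
  have "((\<lambda>u. complex_of_real (y $ j) + of_real u) has_vector_derivative 1) (at 0)"
   by (auto intro!: derivative_eq_intros)
  then have 2: "((\<lambda>u. (- ?d) * complex_of_real ((y + u *\<^sub>R axis j 1) $ j)) has_vector_derivative (- ?d) * 1) (at 0)"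
   by (intro has_vector_derivative_mult_right) (simp add: axis_def)
  show "((\<lambda>u. \<phi> (y + u *\<^sub>R axis j 1) + (- ?d) * complex_of_real ((y + u *\<^sub>R axis j 1) $ j))
    has_vector_derivative partial_deriv j \<phi> y - ?d) (at 0)"
   using has_vector_derivative_add[OF 1 2] by simp
 qed
 have "norm (?h (x + u *\<^sub>R axis j 1) - ?h x) \<le> (B * \<bar>u\<bar>) * \<bar>u\<bar>"
 proof (rule everywhere.increment_one[OF everywhere.smooth_differentiable[OF h]])
  fix s assume s: "\<bar>s\<bar> \<le> \<bar>u\<bar>"
  have "norm (partial_deriv j \<phi> (x + s *\<^sub>R axis j 1) - ?d) \<le> B * \<bar>s\<bar>"
   by (rule everywhere.increment_one[OF everywhere.smooth_differentiable[OF everywhere.smooth_partial_deriv[OF sm]]]) (auto intro: B)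
  also have "\<dots> \<le> B * \<bar>u\<bar>"
   using s order_trans[OF norm_ge_zero B[of x]] by (intro mult_left_mono) auto
  finally show "norm (partial_deriv j ?h (x + s *\<^sub>R axis j 1)) \<le> B * \<bar>u\<bar>" unfolding dh .
 qed auto
 moreover have "?h (x + u *\<^sub>R axis j 1) - ?h x = \<phi> (x + u *\<^sub>R axis j 1) - \<phi> x - u *\<^sub>R ?d"
  by (simp add: axis_def scaleR_conv_of_real[where 'a = complex] algebra_simps)
 moreover have "(B * \<bar>u\<bar>) * \<bar>u\<bar> = B * u\<^sup>2" by (simp add: power2_eq_square mult.assoc)
 ultimately show ?thesis by (simp only:)
qed

text \<open>Differentiation under the integral sign: the second derivative of \<open>\<phi>\<close> bounds the remainder uniformly.\<close>

lemma partial_deriv_group_conv: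
 assumes \<phi>: "\<phi> \<in> schwartz \<Gamma>" and k: "k \<in> schwartz \<Gamma>"
 shows "partial_deriv j (group_conv k \<phi>) = group_conv k (partial_deriv j \<phi>)"
proof
 fix x
 let ?D = "FD"
 note d\<phi> = schwartz_partial_deriv[OF \<phi>]
 obtain B where B: "B > 0" "\<And>x. norm (partial_deriv j (partial_deriv j \<phi>) x) \<le> B"
  using schwartz_bounded[OF schwartz_partial_deriv[OF d\<phi>]] by blast
 let ?I = "\<integral>z. norm (indicator ?D z *\<^sub>R k z) \<partial>lborel"
 let ?F = "\<lambda>u. group_conv k \<phi> (x + u *\<^sub>R axis j 1)"
 let ?G = "group_conv k (partial_deriv j \<phi>) x"
 have rem: "norm (?F u - ?F 0 - u *\<^sub>R ?G) \<le> B * ?I * u\<^sup>2" for u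
 proof -
  let ?r = "\<lambda>z. indicator ?D z *\<^sub>R ((\<phi> (x + z + u *\<^sub>R axis j 1) - \<phi> (x + z) - u *\<^sub>R partial_deriv j \<phi> (x + z)) * k z)"
  have i1: "integrable lborel (\<lambda>z. indicator ?D z *\<^sub>R (\<phi> (x + u *\<^sub>R axis j 1 + z) * k z))"
   by (rule integrable_group_conv[OF \<phi> k])
  have i2: "integrable lborel (\<lambda>z. indicator ?D z *\<^sub>R (\<phi> (x + z) * k z))"
   by (rule integrable_group_conv[OF \<phi> k])
  have i3: "integrable lborel (\<lambda>z. u *\<^sub>R (indicator ?D z *\<^sub>R (partial_deriv j \<phi> (x + z) * k z)))"
   by (intro integrable_scaleR_right integrable_group_conv[OF d\<phi> k])
  have "?F u - ?F 0 - u *\<^sub>R ?G = (\<integral>z. indicator ?D z *\<^sub>R (\<phi> (x + u *\<^sub>R axis j 1 + z) * k z) - indicator ?D z *\<^sub>R (\<phi> (x + z) * k z)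
   - u *\<^sub>R (indicator ?D z *\<^sub>R (partial_deriv j \<phi> (x + z) * k z)) \<partial>lborel)"
   unfolding group_conv_def using i1 i2 i3
   by (simp only: Bochner_Integration.integral_diff Bochner_Integration.integrable_diff integral_scaleR_right) simp
  also have "\<dots> = (LBINT z. ?r z)"
   by (intro Bochner_Integration.integral_cong refl) (auto simp: indicator_def algebra_simps)
  also have "norm \<dots> \<le> (LBINT z. (B * u\<^sup>2) * norm (indicator ?D z *\<^sub>R k z))"
  proof (rule norm_integral_le)
   show "integrable lborel (\<lambda>z. (B * u\<^sup>2) * norm (indicator ?D z *\<^sub>R k z))"
    by (intro integrable_mult_right integrable_norm integrable_schwartz k)
   show "norm (?r z) \<le> (B * u\<^sup>2) * norm (indicator ?D z *\<^sub>R k z)" for z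
    using second_order_bound[OF \<phi> B(2), of "x + z" u] by (auto simp: indicator_def norm_mult intro!: mult_right_mono)
  qed
  also have "\<dots> = B * ?I * u\<^sup>2" unfolding integral_mult_right_zero by (simp only: mult_ac)
  finally show ?thesis .
 qed
 have "(?F has_derivative (\<lambda>u. u *\<^sub>R ?G)) (at 0)"
 proof (rule has_derivativeI_sandwich[of 1])
  show "((\<lambda>u. B * ?I * \<bar>u\<bar>) \<longlongrightarrow> 0) (at 0)" by (auto intro!: tendsto_eq_intros)
  fix u :: real assume "u \<noteq> 0"
  then show "norm (?F u - ?F 0 - (u - 0) *\<^sub>R ?G) / norm (u - 0) \<le> B * ?I * \<bar>u\<bar>"
   using rem[of u] by (simp add: divide_le_eq power2_eq_square mult.assoc)
 qed (auto intro: bounded_linear_scaleR_left)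
 then show "partial_deriv j (group_conv k \<phi>) x = ?G"
  by (intro partial_deriv_eqI) (simp add: has_vector_derivative_def)
qed

lemma partial_derivs_group_conv:
 assumes \<phi>: "\<phi> \<in> schwartz \<Gamma>" and k: "k \<in> schwartz \<Gamma>"
 shows "partial_derivs js (group_conv k \<phi>) = group_conv k (partial_derivs js \<phi>)"
 by (induction js) (simp_all add: partial_derivs_Cons partial_deriv_group_conv[OF schwartz_partial_derivs[OF \<phi>] k])

text \<open>The transform of the truncated Fourier transform of \<open>\<phi>\<close> is a convolution of \<open>\<phi>\<close>.\<close>

lemma truncated_transform:
 assumes \<phi>: "\<phi> \<in> schwartz \<Gamma>" and r: "r > 0"
 obtains \<psi> where "\<psi> \<in> tests" "dual_fourier_integral \<Gamma> \<psi> = group_conv (group_kernel r) \<phi>"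
proof
 let ?D = "FD"
 let ?X = "prod_fun (multiplier r)"
 let ?v = "\<lambda>y. indicator ?D y *\<^sub>R \<phi> y"
 let ?\<phi> = "\<lambda>\<xi>. of_real (fourier_const \<Gamma>) * fourier_integral lborel (2 * pi) ?v \<xi>"
 let ?\<psi> = "\<lambda>\<xi>. ?\<phi> \<xi> * ?X \<xi>"
 note X = multiplier_test[OF r]
 note K = group_kernel_schwartz[OF r]
 have sm: "everywhere.smooth ?\<phi>"
  by (intro everywhere.smooth_mult everywhere.smooth_const lborel_vec.smooth_fourier_integral moments_schwartz \<phi>)
 show "?\<psi> \<in> tests"
  by (intro test_mult X smooth_everywhere_along sm)
 note [measurable] = schwartz_measurable[OF \<phi>] schwartz_measurable[OF K] dual_borel.momentsD(1)[OF moments_test[OF X]]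
 show "dual_fourier_integral \<Gamma> ?\<psi> = group_conv (group_kernel r) \<phi>"
 proof
  fix x
  let ?u = "\<lambda>\<xi>. of_real ((fourier_const \<Gamma>)\<^sup>2) * (zero_ext ?X \<xi> * cis (- 2 * pi * (\<xi> \<bullet> x)))"
  have u: "integrable m ?u"
   by (intro integrable_mult_right dual_borel.integrable_cis dual_borel.momentsD(3)[OF moments_test[OF X]])
  have v: "integrable lborel ?v" by (rule integrable_schwartz[OF \<phi>])
  have "dual_fourier_integral \<Gamma> ?\<psi> x = (\<integral>\<xi>. of_real (fourier_const \<Gamma>) * (zero_ext ?\<psi> \<xi> * cis (- 2 * pi * (\<xi> \<bullet> x))) \<partial>m)"
   unfolding dual_fourier_integral_eq fourier_integral_def by (rule integral_mult_right_zero[symmetric])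
  also have "\<dots> = (\<integral>\<xi>. ?u \<xi> * (LBINT y. ?v y * cis (2 * pi * (\<xi> \<bullet> y))) \<partial>m)"
   by (intro Bochner_Integration.integral_cong refl)
    (simp add: zero_ext_def fourier_integral_def inner_commute power2_eq_square scaleR_conv_of_real[where 'a = complex] mult_ac)
  also have "\<dots> = (\<integral>y. ?v y * (\<integral>\<xi>. ?u \<xi> * cis (2 * pi * (\<xi> \<bullet> y)) \<partial>m) \<partial>lborel)"
   by (intro fubini_kernel sigma_finite_dual sigma_finite_lborel u v) auto
  also have "\<dots> = (LBINT y. indicator ?D y *\<^sub>R (\<phi> y * group_kernel r (y - x)))"
  proof (intro Bochner_Integration.integral_cong refl)
   fix y
   have "cis (- 2 * pi * (\<xi> \<bullet> x)) * cis (2 * pi * (\<xi> \<bullet> y)) = cis (2 * pi * (\<xi> \<bullet> (y - x)))" for \<xi>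
    by (simp add: cis_mult inner_diff_right algebra_simps)
   then have "(\<integral>\<xi>. ?u \<xi> * cis (2 * pi * (\<xi> \<bullet> y)) \<partial>m)
     = (\<integral>\<xi>. of_real ((fourier_const \<Gamma>)\<^sup>2) * (zero_ext ?X \<xi> * cis (2 * pi * (\<xi> \<bullet> (y - x)))) \<partial>m)"
    by (simp only: mult.assoc)
   also have "\<dots> = group_kernel r (y - x)"
    unfolding multiplier_fourier[OF r, symmetric] fourier_integral_def by (simp only: integral_mult_right_zero of_real_power)
   finally show "?v y * (\<integral>\<xi>. ?u \<xi> * cis (2 * pi * (\<xi> \<bullet> y)) \<partial>m) = indicator ?D y *\<^sub>R (\<phi> y * group_kernel r (y - x))"
    by simp
  qed
  also have "\<dots> = (LBINT z. indicator ?D z *\<^sub>R (\<phi> (z + x) * group_kernel r (z + x - x)))"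
  proof (rule fundamental_domain_translate[symmetric])
   have "periodic \<Gamma> (\<lambda>y. group_kernel r (y + (- x)))" by (rule periodic_translate[OF schwartz_periodic[OF K]])
   then show "periodic \<Gamma> (\<lambda>y. \<phi> y * group_kernel r (y - x))"
    using schwartz_periodic[OF \<phi>] by (simp add: periodic_def)
   show "(\<lambda>y. \<phi> y * group_kernel r (y - x)) \<in> borel_measurable borel" by measurable
   obtain B where B: "B > 0" "\<And>x. norm (group_kernel r x) \<le> B" using schwartz_bounded[OF K] by blast
   show "integrable lborel (\<lambda>y. indicator ?D y *\<^sub>R (\<phi> y * group_kernel r (y - x)))"
   proof (rule Bochner_Integration.integrable_bound)
    show "integrable lborel (\<lambda>y. B * norm (?v y))" by (intro integrable_mult_right integrable_norm v)
    show "AE y in lborel. norm (indicator ?D y *\<^sub>R (\<phi> y * group_kernel r (y - x))) \<le> norm (B * norm (?v y))"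
     using B by (intro AE_I2) (auto simp: norm_mult indicator_def abs_mult mult.commute[of B] intro!: mult_left_mono)
   qed measurable
  qed
  also have "\<dots> = group_conv (group_kernel r) \<phi> x" by (simp add: group_conv_def add.commute)
  finally show "dual_fourier_integral \<Gamma> ?\<psi> x = group_conv (group_kernel r) \<phi> x" .
 qed
qed

text \<open>
 Increments of Schwartz functions.  The increment is replaced by its shortest representative,
 whose coordinates have absolute value \<open>coordinate_dist\<close>.
\<close>

lemma periodic_sum:
 assumes "periodic \<Gamma> f" "finite J" "\<And>i. i \<in> J ==> \<Gamma> i = Circle (p i)"
 shows "f (x + (\<Sum>i\<in>J. p i *\<^sub>R axis i 1)) = f x"
 using assms(2,3)
proof (induction J rule: finite_induct)
 case (insert i J)
 have "x + (\<Sum>i\<in>insert i J. p i *\<^sub>R axis i 1) = (x + (\<Sum>i\<in>J. p i *\<^sub>R axis i 1)) + p i *\<^sub>R axis i 1"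
  using insert by (simp add: algebra_simps)
 moreover have "f (y + p i *\<^sub>R axis i 1) = f y" for y
  using assms(1) insert.prems[of i] unfolding periodic_def by simp
 moreover have "f (x + (\<Sum>i\<in>J. p i *\<^sub>R axis i 1)) = f x"
  by (rule insert.IH) (rule insert.prems, simp)
 ultimately show ?case by (simp only:)
qed simp

lemma schwartz_increment:
 assumes \<phi>: "\<phi> \<in> schwartz \<Gamma>"
 shows "\<exists>B. \<forall>x. \<forall>z\<in>FD. (1 + norm (line_part \<Gamma> x)) ^ N * norm (\<phi> (x + z) - \<phi> x)
  \<le> B * ((\<Prod>i\<in>UNIV. (1 + coordinate_dist i (z $ i)) ^ N) * (\<Sum>i\<in>UNIV. coordinate_dist i (z $ i)))"
proof -
 have "\<forall>i. \<exists>B. \<forall>x. (1 + norm (line_part \<Gamma> x)) ^ N * norm (partial_deriv i \<phi> x) \<le> B"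
 proof
  fix i
  obtain B where "\<And>x. (1 + norm (line_part \<Gamma> x)) ^ N * norm (partial_derivs [i] \<phi> x) \<le> B"
   using schwartz_bound[OF \<phi>] by blast
  then show "\<exists>B. \<forall>x. (1 + norm (line_part \<Gamma> x)) ^ N * norm (partial_deriv i \<phi> x) \<le> B"
   by (auto simp: partial_derivs_Cons)
 qed
 then obtain b where b: "\<And>i x. (1 + norm (line_part \<Gamma> x)) ^ N * norm (partial_deriv i \<phi> x) \<le> b i" by metis
 define B where "B = (\<Sum>i\<in>UNIV. \<bar>b i\<bar>)"
 have B: "(1 + norm (line_part \<Gamma> x)) ^ N * norm (partial_deriv i \<phi> x) \<le> B" for i x
  using b[of x i] member_le_sum[of i UNIV "\<lambda>i. \<bar>b i\<bar>"] by (auto simp: B_def)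
 have B0: "0 \<le> B" unfolding B_def by (intro sum_nonneg) auto
 show ?thesis
 proof (intro exI[of _ B] allI ballI)
  fix x z assume z: "z \<in> FD"
  define p where "p i = (case \<Gamma> i of Line => 0 | Circle l => l)" for i
  define J where "J = {i. \<Gamma> i \<noteq> Line \<and> \<bar>p i - z $ i\<bar> < \<bar>z $ i\<bar>}"
  define w where "w = z - (\<Sum>i\<in>J. p i *\<^sub>R axis i 1)"
  have circ: "\<Gamma> i = Circle (p i)" if "i \<in> J" for i
   using that by (cases "\<Gamma> i") (auto simp: J_def p_def)
  have wi: "w $ i = z $ i - (if i \<in> J then p i else 0)" for i
   unfolding w_def by (simp add: sum_component axis_def if_distrib cong: if_cong)
  have wd: "\<bar>w $ i\<bar> = coordinate_dist i (z $ i)" for i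
   unfolding wi by (cases "\<Gamma> i") (auto simp: coordinate_dist_def circle_dist_def J_def p_def abs_minus_commute)
  have "\<phi> (x + z) = \<phi> (x + w + (\<Sum>i\<in>J. p i *\<^sub>R axis i 1))" by (simp add: w_def)
  also have "\<dots> = \<phi> (x + w)" by (rule periodic_sum[OF schwartz_periodic[OF \<phi>] _ circ]) auto
  finally have per: "\<phi> (x + z) = \<phi> (x + w)" .
  let ?s = "\<Sum>i\<in>UNIV. \<bar>w $ i\<bar>"
  let ?X = "1 + norm (line_part \<Gamma> x)"
  have s0: "0 \<le> ?s" by (intro sum_nonneg) auto
  have X0: "?X > 0" by (simp add: add_pos_nonneg)
  have "norm (\<phi> (x + (\<Sum>i\<in>UNIV. w $ i *\<^sub>R axis i 1)) - \<phi> x) \<le> (B * (1 + ?s) ^ N / ?X ^ N) * ?s"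
  proof (rule everywhere.increment_bound[OF everywhere.smooth_differentiable[OF schwartz_smooth[OF \<phi>]]])
   fix i y assume y: "norm (y - x) \<le> ?s"
   have "line_part \<Gamma> x = line_part \<Gamma> y - line_part \<Gamma> (y - x)"
    by (auto simp: line_part_def vec_eq_iff)
   moreover have "norm (line_part \<Gamma> (y - x)) \<le> norm (y - x)"
    unfolding norm_vec_def by (intro L2_set_mono) (auto simp: line_part_def)
   ultimately have "norm (line_part \<Gamma> x) \<le> norm (line_part \<Gamma> y) + ?s"
    using y norm_triangle_ineq4[of "line_part \<Gamma> y" "line_part \<Gamma> (y - x)"] by simp
   also have "1 + (norm (line_part \<Gamma> y) + ?s) \<le> (1 + norm (line_part \<Gamma> y)) * (1 + ?s)"
    using s0 by (simp add: algebra_simps)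
   finally have "?X \<le> (1 + norm (line_part \<Gamma> y)) * (1 + ?s)" by simp
   then have "?X ^ N \<le> ((1 + norm (line_part \<Gamma> y)) * (1 + ?s)) ^ N" by (intro power_mono) auto
   then have "?X ^ N * norm (partial_deriv i \<phi> y) \<le> ((1 + norm (line_part \<Gamma> y)) * (1 + ?s)) ^ N * norm (partial_deriv i \<phi> y)"
    by (intro mult_right_mono) auto
   also have "\<dots> = (1 + ?s) ^ N * ((1 + norm (line_part \<Gamma> y)) ^ N * norm (partial_deriv i \<phi> y))"
    by (simp only: power_mult_distrib mult_ac)
   also have "\<dots> \<le> (1 + ?s) ^ N * B" using s0 by (intro mult_left_mono B) auto
   finally show "norm (partial_deriv i \<phi> y) \<le> B * (1 + ?s) ^ N / ?X ^ N"
    using X0 by (simp add: field_simps)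
  qed auto
  moreover have "(\<Sum>i\<in>UNIV. w $ i *\<^sub>R axis i 1) = w"
   by (auto simp: vec_eq_iff sum_component axis_def if_distrib cong: if_cong)
  ultimately have "?X ^ N * norm (\<phi> (x + w) - \<phi> x) \<le> ?X ^ N * ((B * (1 + ?s) ^ N / ?X ^ N) * ?s)"
   using X0 by (intro mult_left_mono) auto
  also have "\<dots> = B * ((1 + ?s) ^ N * ?s)" using X0 by simp
  also have "\<dots> \<le> B * ((\<Prod>i\<in>UNIV. (1 + \<bar>w $ i\<bar>)) ^ N * ?s)"
  proof (intro mult_left_mono mult_right_mono power_mono)
   have "1 + (\<Sum>i\<in>A. \<bar>w $ i\<bar>) \<le> (\<Prod>i\<in>A. 1 + \<bar>w $ i\<bar>)" if "finite A" for A
    using that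
   proof (induction A rule: finite_induct)
    case (insert i A)
    have "0 \<le> (\<Sum>i\<in>A. \<bar>w $ i\<bar>)" by (intro sum_nonneg) auto
    then have "1 + (\<Sum>i\<in>insert i A. \<bar>w $ i\<bar>) \<le> (1 + \<bar>w $ i\<bar>) * (1 + (\<Sum>i\<in>A. \<bar>w $ i\<bar>))"
     using insert by (simp add: algebra_simps)
    also have "\<dots> \<le> (1 + \<bar>w $ i\<bar>) * (\<Prod>i\<in>A. 1 + \<bar>w $ i\<bar>)" using insert by (intro mult_left_mono) auto
    finally show ?case using insert by simp
   qed simp
   then show "1 + ?s \<le> (\<Prod>i\<in>UNIV. (1 + \<bar>w $ i\<bar>))" by simp
  qed (use s0 B0 in auto)
  finally show "?X ^ N * norm (\<phi> (x + z) - \<phi> x)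
    \<le> B * ((\<Prod>i\<in>UNIV. (1 + coordinate_dist i (z $ i)) ^ N) * (\<Sum>i\<in>UNIV. coordinate_dist i (z $ i)))"
   unfolding per wd by (simp add: prod_power_distrib)
 qed
qed

text \<open>The kernel has integral one and a small first moment, and the increments of \<open>\<phi>\<close> are Lipschitz with
 constants that decay with \<open>x\<close>.\<close>

lemma group_conv_approximates:
 assumes \<phi>: "\<phi> \<in> schwartz \<Gamma>"
 shows "\<exists>C. \<forall>r>0. \<forall>x. (1 + norm (line_part \<Gamma> x)) ^ N * norm (\<phi> x - group_conv (group_kernel r) \<phi> x) \<le> C / sqrt (real r)"
proof -
 let ?D = "FD"
 let ?W = "\<lambda>z::real^'n. (\<Prod>i\<in>UNIV. (1 + coordinate_dist i (z $ i)) ^ N) * (\<Sum>i\<in>UNIV. coordinate_dist i (z $ i))"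
 obtain B where B: "\<And>x z. z \<in> ?D ==> (1 + norm (line_part \<Gamma> x)) ^ N * norm (\<phi> (x + z) - \<phi> x) \<le> B * ?W z"
  using schwartz_increment[OF \<phi>, of N] by blast
 obtain C where C: "\<And>r. r > 0 ==> integrable lborel (\<lambda>z. ?W z * norm (indicator ?D z *\<^sub>R group_kernel r z))"
  "\<And>r. r > 0 ==> (LBINT z. ?W z * norm (indicator ?D z *\<^sub>R group_kernel r z)) \<le> C / sqrt (real r)"
  using group_kernel_moment[of N] by blast
 have "(1 + norm (line_part \<Gamma> x)) ^ N * norm (\<phi> x - group_conv (group_kernel r) \<phi> x) \<le> (\<bar>B\<bar> * C) / sqrt (real r)"
  if r: "r > 0" for r x
 proof -
  let ?K = "group_kernel r"
  let ?X = "(1 + norm (line_part \<Gamma> x)) ^ N"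
  note K = group_kernel_schwartz[OF r]
  have i1: "integrable lborel (\<lambda>z. \<phi> x * (indicator ?D z *\<^sub>R ?K z))"
   by (intro integrable_mult_right integrable_schwartz K)
  have "\<phi> x = (LBINT z. \<phi> x * (indicator ?D z *\<^sub>R ?K z))"
   by (simp only: integral_mult_right_zero integral_group_kernel[OF r] mult_1_right)
  then have "\<phi> x - group_conv ?K \<phi> x = (LBINT z. \<phi> x * (indicator ?D z *\<^sub>R ?K z) - indicator ?D z *\<^sub>R (\<phi> (x + z) * ?K z))"
   unfolding group_conv_def using i1 integrable_group_conv[OF \<phi> K, of x]
   by (subst Bochner_Integration.integral_diff) auto
  then have "of_real ?X * (\<phi> x - group_conv ?K \<phi> x)
   = (LBINT z. of_real ?X * (\<phi> x * (indicator ?D z *\<^sub>R ?K z) - indicator ?D z *\<^sub>R (\<phi> (x + z) * ?K z)))"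
   by (simp only: integral_mult_right_zero)
  also have "norm \<dots> \<le> (LBINT z. \<bar>B\<bar> * (?W z * norm (indicator ?D z *\<^sub>R ?K z)))"
  proof (rule norm_integral_le)
   show "integrable lborel (\<lambda>z. \<bar>B\<bar> * (?W z * norm (indicator ?D z *\<^sub>R ?K z)))"
    by (intro integrable_mult_right C r)
   fix z
   show "norm (of_real ?X * (\<phi> x * (indicator ?D z *\<^sub>R ?K z) - indicator ?D z *\<^sub>R (\<phi> (x + z) * ?K z)))
     \<le> \<bar>B\<bar> * (?W z * norm (indicator ?D z *\<^sub>R ?K z))"
   proof (cases "z \<in> ?D")
    case True
    have W: "0 \<le> ?W z" by (intro mult_nonneg_nonneg prod_nonneg sum_nonneg) (auto simp: coordinate_dist_nonneg)
    have "?X * norm (\<phi> (x + z) - \<phi> x) \<le> \<bar>B\<bar> * ?W z"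
     by (rule order_trans[OF B[OF True] mult_right_mono[OF abs_ge_self W]])
    from mult_right_mono[OF this norm_ge_zero[of "?K z"]]
    have "?X * norm (\<phi> (x + z) - \<phi> x) * norm (?K z) \<le> \<bar>B\<bar> * ?W z * norm (?K z)" .
    moreover have "of_real ?X * (\<phi> x * (indicator ?D z *\<^sub>R ?K z) - indicator ?D z *\<^sub>R (\<phi> (x + z) * ?K z))
      = of_real ?X * ((\<phi> x - \<phi> (x + z)) * ?K z)"
     using True by (simp add: left_diff_distrib)
    moreover have "norm (of_real ?X :: complex) = ?X" by (simp only: norm_of_real) simp
    ultimately show ?thesis
     using True by (simp only: norm_mult norm_minus_commute[of "\<phi> x"]) (simp add: mult.assoc)
   qed simp
  qed
  also have "\<dots> \<le> \<bar>B\<bar> * (C / sqrt (real r))"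
   unfolding integral_mult_right_zero by (intro mult_left_mono C r) auto
  finally have "norm (complex_of_real ?X * (\<phi> x - group_conv ?K \<phi> x)) \<le> \<bar>B\<bar> * (C / sqrt (real r))" .
  moreover have "norm (of_real ?X :: complex) = ?X" by (simp only: norm_of_real) simp
  ultimately show ?thesis by (simp only: norm_mult times_divide_eq_right)
 qed
 then show ?thesis by blast
qed

text \<open>The approximation by \<open>group_conv\<close> commutes with derivatives, and only finitely many of them enter a
 seminorm.\<close>

theorem transforms_dense:
 assumes \<phi>: "\<phi> \<in> schwartz \<Gamma>" and \<epsilon>: "\<epsilon> > 0"
 obtains \<psi> where "\<psi> \<in> tests" "schwartz_seminorm \<Gamma> N (\<lambda>x. \<phi> x - dual_fourier_integral \<Gamma> \<psi> x) \<le> \<epsilon>"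
proof -
 have "\<forall>js. \<exists>C. \<forall>r>0. \<forall>x. (1 + norm (line_part \<Gamma> x)) ^ N *
   norm (partial_derivs js \<phi> x - group_conv (group_kernel r) (partial_derivs js \<phi>) x) \<le> C / sqrt (real r)"
  using group_conv_approximates[OF schwartz_partial_derivs[OF \<phi>]] by blast
 then obtain C where C: "\<And>js r x. r > 0 ==> (1 + norm (line_part \<Gamma> x)) ^ N *
   norm (partial_derivs js \<phi> x - group_conv (group_kernel r) (partial_derivs js \<phi>) x) \<le> C js / sqrt (real r)"
  by metis
 define c where "c = 1 + (\<Sum>js\<in>{js. length js \<le> N}. \<bar>C js\<bar>)"
 have c: "C js \<le> c" if "length js \<le> N" for js
 proof -
  have "\<bar>C js\<bar> \<le> (\<Sum>js\<in>{js. length js \<le> N}. \<bar>C js\<bar>)"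
   using that finite_short_lists[of N] by (intro member_le_sum) auto
  then show ?thesis unfolding c_def by linarith
 qed
 have c0: "c > 0" unfolding c_def by (intro add_pos_nonneg sum_nonneg) auto
 obtain r :: nat where r': "real r > (c / \<epsilon>)\<^sup>2" using reals_Archimedean2 by blast
 then have r: "r > 0" by (metis le_less_trans of_nat_0_less_iff zero_le_power2)
 have "c / \<epsilon> < sqrt (real r)" using r' by (rule real_less_rsqrt)
 then have ce: "c / sqrt (real r) \<le> \<epsilon>" using \<epsilon> r by (simp add: field_simps)
 obtain \<psi> where \<psi>: "\<psi> \<in> tests" and eq: "dual_fourier_integral \<Gamma> \<psi> = group_conv (group_kernel r) \<phi>"
  using truncated_transform[OF \<phi> r] by blast
 note K = group_kernel_schwartz[OF r]
 have sm: "everywhere.smooth (dual_fourier_integral \<Gamma> \<psi>)"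
  by (rule schwartz_smooth[OF dual_fourier_integral_schwartz[OF \<psi>]])
 have "partial_derivs js (\<lambda>x. \<phi> x - dual_fourier_integral \<Gamma> \<psi> x) x
   = partial_derivs js \<phi> x - group_conv (group_kernel r) (partial_derivs js \<phi>) x" for js x
 proof -
  have "partial_derivs js (\<lambda>x. \<phi> x + (-1) * dual_fourier_integral \<Gamma> \<psi> x) x
    = partial_derivs js \<phi> x + (-1) * partial_derivs js (dual_fourier_integral \<Gamma> \<psi>) x"
   using everywhere.partial_derivs_add[OF schwartz_smooth[OF \<phi>] everywhere.smooth_mult[OF everywhere.smooth_const sm, of "-1"], of js x]
    everywhere.partial_derivs_cmult[OF sm, of js x "-1"] by simp
  then show ?thesis by (simp add: eq partial_derivs_group_conv[OF \<phi> K])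
 qed
 then have "schwartz_seminorm \<Gamma> N (\<lambda>x. \<phi> x - dual_fourier_integral \<Gamma> \<psi> x) \<le> \<epsilon>"
 proof (intro schwartz_seminorm_least)
  fix js :: "'n list" and x assume js: "length js \<le> N"
  have "(1 + norm (line_part \<Gamma> x)) ^ N * norm (partial_derivs js \<phi> x - group_conv (group_kernel r) (partial_derivs js \<phi>) x)
    \<le> C js / sqrt (real r)" by (rule C[OF r])
  also have "\<dots> \<le> c / sqrt (real r)" using c[OF js] r by (intro divide_right_mono) auto
  also note ce
  finally show "(1 + norm (line_part \<Gamma> x)) ^ N * norm (partial_derivs js (\<lambda>x. \<phi> x - dual_fourier_integral \<Gamma> \<psi> x) x) \<le> \<epsilon>"
   by (simp add: \<open>\<And>x js. partial_derivs js (\<lambda>x. \<phi> x - dual_fourier_integral \<Gamma> \<psi> x) x = _ js x\<close>)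
 qed
 then show ?thesis using \<psi> that by blast
qed

text \<open>Two distributions that agree on a dense set and are continuous for a common seminorm are equal.\<close>

theorem tempered_determined:
 assumes f: "f \<in> tempered \<Gamma>" and g: "g \<in> tempered \<Gamma>"
  and eq: "\<And>\<psi>. \<psi> \<in> tests ==> f (dual_fourier_integral \<Gamma> \<psi>) = g (dual_fourier_integral \<Gamma> \<psi>)"
 shows "f = g"
proof (rule extensionalityI)
 show "f \<in> extensional (schwartz \<Gamma>)" "g \<in> extensional (schwartz \<Gamma>)" using f g by (auto simp: tempered_def)
 fix \<phi> assume \<phi>: "\<phi> \<in> schwartz \<Gamma>"
 have diff: "h (\<lambda>x. \<phi> x - \<psi> x) = h \<phi> - h \<psi>" if h: "h \<in> tempered \<Gamma>" and \<psi>: "\<psi> \<in> schwartz \<Gamma>" for h \<psi>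
 proof -
  have add: "\<forall>\<phi>\<in>schwartz \<Gamma>. \<forall>\<psi>\<in>schwartz \<Gamma>. h (\<lambda>x. \<phi> x + \<psi> x) = h \<phi> + h \<psi>"
   and cmult: "\<forall>c. \<forall>\<phi>\<in>schwartz \<Gamma>. h (\<lambda>x. c * \<phi> x) = c * h \<phi>"
   using h by (auto simp: tempered_def)
  show ?thesis
   using add[rule_format, OF \<phi> schwartz_cmult[OF \<psi>, of "-1"]] cmult[rule_format, OF \<psi>, of "-1"] by simp
 qed
 obtain C N where C: "\<And>\<phi>. \<phi> \<in> schwartz \<Gamma> ==> norm (f \<phi>) \<le> C * schwartz_seminorm \<Gamma> N \<phi>"
  using f unfolding tempered_def by blast
 obtain C' N' where C': "\<And>\<phi>. \<phi> \<in> schwartz \<Gamma> ==> norm (g \<phi>) \<le> C' * schwartz_seminorm \<Gamma> N' \<phi>"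
  using g unfolding tempered_def by blast
 have small: "schwartz_seminorm \<Gamma> n \<theta> \<le> schwartz_seminorm \<Gamma> n' \<theta>" "0 \<le> schwartz_seminorm \<Gamma> n \<theta>"
  if "n \<le> n'" "\<theta> \<in> schwartz \<Gamma>" for n n' \<theta>
 proof -
  show "schwartz_seminorm \<Gamma> n \<theta> \<le> schwartz_seminorm \<Gamma> n' \<theta>"
  proof (rule schwartz_seminorm_least)
   fix js :: "'n list" and x assume js: "length js \<le> n"
   have "(1 + norm (line_part \<Gamma> x)) ^ n * norm (partial_derivs js \<theta> x) \<le> (1 + norm (line_part \<Gamma> x)) ^ n' * norm (partial_derivs js \<theta> x)"
    using that(1) by (intro mult_right_mono power_increasing) auto
   also have "\<dots> \<le> schwartz_seminorm \<Gamma> n' \<theta>" using js that by (intro schwartz_seminorm_upper) auto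
   finally show "(1 + norm (line_part \<Gamma> x)) ^ n * norm (partial_derivs js \<theta> x) \<le> schwartz_seminorm \<Gamma> n' \<theta>" .
  qed
  have "0 \<le> (1 + norm (line_part \<Gamma> 0)) ^ n * norm (partial_derivs [] \<theta> 0)" by simp
  also have "\<dots> \<le> schwartz_seminorm \<Gamma> n \<theta>" using that by (intro schwartz_seminorm_upper) auto
  finally show "0 \<le> schwartz_seminorm \<Gamma> n \<theta>" .
 qed
 have "norm (f \<phi> - g \<phi>) \<le> \<epsilon>" if \<epsilon>: "\<epsilon> > 0" for \<epsilon>
 proof -
  let ?\<delta> = "\<epsilon> / (1 + \<bar>C\<bar> + \<bar>C'\<bar>)"
  have c: "1 + \<bar>C\<bar> + \<bar>C'\<bar> > 0" by (simp add: add_pos_nonneg)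
  obtain \<psi> where \<psi>: "\<psi> \<in> tests"
   and le: "schwartz_seminorm \<Gamma> (max N N') (\<lambda>x. \<phi> x - dual_fourier_integral \<Gamma> \<psi> x) \<le> ?\<delta>"
   using transforms_dense[OF \<phi>, of ?\<delta>] \<epsilon> c by (metis divide_pos_pos)
  let ?\<theta> = "\<lambda>x. \<phi> x - dual_fourier_integral \<Gamma> \<psi> x"
  have \<theta>: "?\<theta> \<in> schwartz \<Gamma>" by (rule schwartz_diff[OF \<phi> dual_fourier_integral_schwartz[OF \<psi>]])
  have sN: "0 \<le> schwartz_seminorm \<Gamma> N ?\<theta>" "schwartz_seminorm \<Gamma> N ?\<theta> \<le> ?\<delta>"
   "0 \<le> schwartz_seminorm \<Gamma> N' ?\<theta>" "schwartz_seminorm \<Gamma> N' ?\<theta> \<le> ?\<delta>"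
   using small(2)[OF order_refl \<theta>] small(1)[OF _ \<theta>, of N "max N N'"] small(1)[OF _ \<theta>, of N' "max N N'"] le by auto
  have "f \<phi> - g \<phi> = f ?\<theta> - g ?\<theta>"
   using diff[OF f dual_fourier_integral_schwartz[OF \<psi>]] diff[OF g dual_fourier_integral_schwartz[OF \<psi>]] eq[OF \<psi>] by simp
  also have "norm \<dots> \<le> C * schwartz_seminorm \<Gamma> N ?\<theta> + C' * schwartz_seminorm \<Gamma> N' ?\<theta>"
   using norm_triangle_ineq4[of "f ?\<theta>" "g ?\<theta>"] C[OF \<theta>] C'[OF \<theta>] by linarith
  also have "\<dots> \<le> \<bar>C\<bar> * ?\<delta> + \<bar>C'\<bar> * ?\<delta>"
   using sN by (intro add_mono mult_mono) auto
  also have "\<dots> = (\<bar>C\<bar> + \<bar>C'\<bar>) * ?\<delta>" by (simp only: distrib_right)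
  also have "\<dots> \<le> (1 + \<bar>C\<bar> + \<bar>C'\<bar>) * ?\<delta>" using \<epsilon> c by (intro mult_right_mono) auto
  also have "\<dots> = \<epsilon>" using c by simp
  finally show ?thesis .
 qed
 then have "norm (f \<phi> - g \<phi>) \<le> 0" by (meson dense_ge)
 then show "f \<phi> = g \<phi>" by simp
qed

end

section \<open>One-dimensional integrals\<close>

lemma nn_integral_interval:
 fixes f :: "real => real"
 assumes [measurable]: "f \<in> borel_measurable borel" and "\<And>x. 0 \<le> f x" and A [measurable]: "A \<in> sets borel"
  and I: "(f has_integral I) A"
 shows "(\<integral>\<^sup>+ t. ennreal (indicator A t * f t) \<partial>lborel) = ennreal I"
proof (rule nn_integral_has_integral_lborel)
 show "(\<lambda>t. indicator A t * f t) \<in> borel_measurable borel" by measurable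
 show "0 \<le> indicator A x * f x" for x using assms(2) by simp
 have "((\<lambda>x. if x \<in> A then f x else 0) has_integral I) UNIV" using I by (simp add: has_integral_restrict_UNIV)
 then show "((\<lambda>t. indicator A t * f t) has_integral I) UNIV"
  by (rule has_integral_eq_rhs[OF has_integral_eq[rotated]]) (auto simp: indicator_def)
qed

lemma ennreal_le_add_finite: "a \<le> b + c ==> b < \<infinity> ==> c < \<infinity> ==> a < (\<infinity> :: ennreal)"
 by (metis ennreal_add_less_top infinity_ennreal_def le_less_trans)

lemma nn_integral_reflect:
 assumes [measurable]: "f \<in> borel_measurable borel"
 shows "(\<integral>\<^sup>+ t. f (- t) \<partial>lborel) = (\<integral>\<^sup>+ t. f t \<partial>(lborel :: real measure))"
 using nn_integral_real_affine[of f "-1" 0] by simp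

lemma nn_integral_singular_power:
 assumes "a < 1"
 shows "(\<integral>\<^sup>+ t. ennreal (indicator {-1..1} t * \<bar>t\<bar> powr (- a)) \<partial>lborel) < \<infinity>"
proof -
 let ?f = "\<lambda>t::real. ennreal (indicator {0..1} t * \<bar>t\<bar> powr (- a))"
 have "((\<lambda>t. t powr (- a)) has_integral (1 powr (- a + 1) / (- a + 1))) {0..1}"
  using assms by (intro has_integral_powr_from_0) auto
 then have "((\<lambda>t. \<bar>t\<bar> powr (- a)) has_integral (1 powr (- a + 1) / (- a + 1))) {0..1}"
  by (rule has_integral_eq[rotated]) auto
 then have half: "(\<integral>\<^sup>+ t. ?f t \<partial>lborel) < \<infinity>"
  by (subst nn_integral_interval) auto
 have "(\<integral>\<^sup>+ t. ennreal (indicator {-1..1} t * \<bar>t\<bar> powr (- a)) \<partial>lborel) \<le> (\<integral>\<^sup>+ t. ?f t + ?f (- t) \<partial>lborel)"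
  by (intro nn_integral_mono) (auto simp: indicator_def simp flip: ennreal_plus)
 also have "\<dots> = (\<integral>\<^sup>+ t. ?f t \<partial>lborel) + (\<integral>\<^sup>+ t. ?f (- t) \<partial>lborel)" by (rule nn_integral_add) measurable
 also have "(\<integral>\<^sup>+ t. ?f (- t) \<partial>lborel) = (\<integral>\<^sup>+ t. ?f t \<partial>lborel)" by (rule nn_integral_reflect) measurable
 finally show ?thesis using half half by (rule ennreal_le_add_finite)
qed

lemma square_powr: "\<bar>t\<bar>\<^sup>2 powr q = \<bar>t\<bar> powr (2 * q)" for t q :: real
 using powr_powr[of "\<bar>t\<bar>" 2 q] by simp

lemma bracket_power_le:
 fixes t q :: real
 assumes "q > 0" "\<bar>t\<bar> > 0" shows "(1 + t\<^sup>2) powr (- q) \<le> \<bar>t\<bar> powr (- 2 * q)"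
proof -
 have "(1 + t\<^sup>2) powr (- q) \<le> (\<bar>t\<bar>\<^sup>2) powr (- q)"
  using assms by (intro powr_mono2') auto
 also have "\<dots> = \<bar>t\<bar> powr (- 2 * q)" by (simp only: square_powr) simp
 finally show ?thesis .
qed

lemma nn_integral_bracket_line:
 assumes "q > 1 / 2"
 shows "(\<integral>\<^sup>+ t. ennreal ((1 + t\<^sup>2) powr (- q)) \<partial>lborel) < \<infinity>"
proof -
 let ?f = "\<lambda>t::real. ennreal (indicator {1..} t * \<bar>t\<bar> powr (- 2 * q))"
 have "((\<lambda>t. t powr (- 2 * q)) has_integral -(1 powr (- 2 * q + 1)) / (- 2 * q + 1)) {1..}"
  using assms by (intro has_integral_powr_to_inf) auto
 then have "((\<lambda>t. \<bar>t\<bar> powr (- 2 * q)) has_integral -(1 powr (- 2 * q + 1)) / (- 2 * q + 1)) {1..}"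
  by (rule has_integral_eq[rotated]) auto
 then have tail: "(\<integral>\<^sup>+ t. ?f t \<partial>lborel) < \<infinity>"
  by (subst nn_integral_interval) auto
 have "(\<integral>\<^sup>+ t. ennreal ((1 + t\<^sup>2) powr (- q)) \<partial>lborel) \<le> (\<integral>\<^sup>+ t. indicator {-1..1} t + (?f t + ?f (- t)) \<partial>lborel)"
 proof (rule nn_integral_mono)
  fix t :: real
  show "ennreal ((1 + t\<^sup>2) powr (- q)) \<le> indicator {-1..1} t + (?f t + ?f (- t))"
  proof (cases "t \<in> {-1..1}")
   case True
   have "(1 + t\<^sup>2) powr (- q) \<le> 1 powr (- q)" using assms by (intro powr_mono2') auto
   then have "ennreal ((1 + t\<^sup>2) powr (- q)) \<le> 1" by simp
   then show ?thesis using True by (simp add: add_increasing2)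
  next
   case False
   then have "(1 + t\<^sup>2) powr (- q) \<le> indicator {1..} t * \<bar>t\<bar> powr (- 2 * q) + indicator {1..} (- t) * \<bar>- t\<bar> powr (- 2 * q)"
    using bracket_power_le[of q t] assms by (auto simp: indicator_def)
   from ennreal_leI[OF this] have "ennreal ((1 + t\<^sup>2) powr (- q)) \<le> ?f t + ?f (- t)" by (simp flip: ennreal_plus)
   then show ?thesis by (rule add_increasing[OF zero_le])
  qed
 qed
 also have "\<dots> = (\<integral>\<^sup>+ t. indicator {-1..1::real} t \<partial>lborel) + ((\<integral>\<^sup>+ t. ?f t \<partial>lborel) + (\<integral>\<^sup>+ t. ?f (- t) \<partial>lborel))"
  by (subst nn_integral_add, measurable)+
 also have "(\<integral>\<^sup>+ t. ?f (- t) \<partial>lborel) = (\<integral>\<^sup>+ t. ?f t \<partial>lborel)" by (rule nn_integral_reflect) measurable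
 finally show ?thesis
  by (rule ennreal_le_add_finite) (use tail in \<open>auto simp: ennreal_add_less_top\<close>)
qed

text \<open>The lattice points are enumerated by the integers, which are covered by the natural numbers and their negatives.\<close>

lemma nn_integral_bracket_lattice:
 assumes q: "q > 1 / 2" and l: "l > 0"
 shows "(\<integral>\<^sup>+ t. ennreal ((1 + t\<^sup>2) powr (- q)) \<partial>count_space {t. l * t \<in> \<int>}) < \<infinity>"
proof -
 let ?g = "\<lambda>x::real. ennreal ((1 + (x / l)\<^sup>2) powr (- q))"
 have bij: "bij_betw (\<lambda>n. of_int n / l) (UNIV :: int set) {t. l * t \<in> \<int>}"
  unfolding lattice_eq[OF l] using l by (intro inj_on_imp_bij_betw) (auto simp: inj_on_def)
 have sum: "(\<integral>\<^sup>+ n. ?g (real n) \<partial>count_space UNIV) < \<infinity>"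
 proof -
  have "summable (\<lambda>n::nat. l powr (2 * q) * real n powr (- 2 * q))"
   using q by (intro summable_mult) (simp add: summable_real_powr_iff)
  then have "summable (\<lambda>n::nat. (1 + (real n / l)\<^sup>2) powr (- q))"
  proof (rule summable_comparison_test'[where N = 1])
   fix n :: nat assume n: "1 \<le> n"
   have "(1 + (real n / l)\<^sup>2) powr (- q) \<le> \<bar>real n / l\<bar> powr (- 2 * q)"
    using q n l by (intro bracket_power_le) auto
   also have "\<dots> = l powr (2 * q) * real n powr (- 2 * q)"
    using l n by (simp add: powr_divide powr_minus divide_simps)
   finally show "norm ((1 + (real n / l)\<^sup>2) powr (- q)) \<le> l powr (2 * q) * real n powr (- 2 * q)" by simp
  qed
  then show ?thesis
   unfolding nn_integral_count_space_nat infinity_ennreal_def less_top[symmetric] by (rule ennreal_suminf_neq_top) simp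
 qed
 have "(\<integral>\<^sup>+ t. ennreal ((1 + t\<^sup>2) powr (- q)) \<partial>count_space {t. l * t \<in> \<int>}) = (\<integral>\<^sup>+ n. ?g (of_int n) \<partial>count_space (UNIV :: int set))"
  by (rule nn_integral_bij_count_space[OF bij, symmetric])
 also have "\<dots> \<le> (\<integral>\<^sup>+ n. ?g (of_int n) * indicator (range int) n + ?g (of_int n) * indicator (range (\<lambda>n. - int n)) n \<partial>count_space UNIV)"
 proof (rule nn_integral_mono)
  fix n :: int
  have "n \<in> range int \<or> n \<in> range (\<lambda>n. - int n)" by (cases n) (auto intro: range_eqI[of _ _ "Suc _"])
  then show "?g (of_int n) \<le> ?g (of_int n) * indicator (range int) n + ?g (of_int n) * indicator (range (\<lambda>n. - int n)) n"
   by (auto simp: indicator_def add_increasing add_increasing2)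
 qed
 also have "\<dots> = (\<integral>\<^sup>+ n. ?g (of_int n) * indicator (range int) n \<partial>count_space UNIV) + (\<integral>\<^sup>+ n. ?g (of_int n) * indicator (range (\<lambda>n. - int n)) n \<partial>count_space UNIV)"
  by (rule nn_integral_add) auto
 also have "(\<integral>\<^sup>+ n. ?g (of_int n) * indicator (range int) n \<partial>count_space UNIV) = (\<integral>\<^sup>+ n. ?g (real n) \<partial>count_space UNIV)"
  using nn_integral_bij_count_space[of int UNIV "range int" "\<lambda>n. ?g (of_int n)"]
  by (subst nn_integral_count_space_indicator[symmetric]) (auto simp: bij_betw_def)
 also have "(\<integral>\<^sup>+ n. ?g (of_int n) * indicator (range (\<lambda>n. - int n)) n \<partial>count_space UNIV) = (\<integral>\<^sup>+ n. ?g (real n) \<partial>count_space UNIV)"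
  using nn_integral_bij_count_space[of "\<lambda>n. - int n" UNIV "range (\<lambda>n. - int n)" "\<lambda>n. ?g (of_int n)"]
  by (subst nn_integral_count_space_indicator[symmetric]) (auto simp: bij_betw_def inj_on_def)
 finally show ?thesis using sum sum by (rule ennreal_le_add_finite)
qed

lemma nn_integral_cauchy:
 assumes "a > 0"
 shows "(\<integral>\<^sup>+ t. ennreal (a / (a\<^sup>2 + (t + c)\<^sup>2)) \<partial>lborel) = ennreal pi"
proof -
 have "(\<integral>t. inverse (1 + t\<^sup>2) \<partial>(lborel :: real measure)) = pi"
  using LBINT_inverse_1_plus_square by (simp add: interval_lebesgue_integral_def set_lebesgue_integral_def)
 then have std: "(\<integral>\<^sup>+ t. ennreal (inverse (1 + t\<^sup>2)) \<partial>(lborel :: real measure)) = ennreal pi"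
  using nn_integral_eq_integral[OF integrable_inverse_1_plus_square_UNIV] by simp
 have "(\<integral>\<^sup>+ t. ennreal (a / (a\<^sup>2 + (t + c)\<^sup>2)) \<partial>lborel)
   = ennreal \<bar>a\<bar> * (\<integral>\<^sup>+ x. ennreal (a / (a\<^sup>2 + (- c + a * x + c)\<^sup>2)) \<partial>lborel)"
  using assms by (intro nn_integral_real_affine) auto
 also have "\<dots> = (\<integral>\<^sup>+ x. ennreal \<bar>a\<bar> * ennreal (a / (a\<^sup>2 + (- c + a * x + c)\<^sup>2)) \<partial>lborel)"
  by (rule nn_integral_cmult[symmetric]) measurable
 also have "\<dots> = (\<integral>\<^sup>+ x. ennreal (inverse (1 + x\<^sup>2)) \<partial>lborel)"
 proof (rule nn_integral_cong)
  fix x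
  have "\<bar>a\<bar> * (a / (a\<^sup>2 + (- c + a * x + c)\<^sup>2)) = (a\<^sup>2) / (a\<^sup>2 * (1 + x\<^sup>2))"
   using assms by (simp add: power2_eq_square algebra_simps)
  also have "\<dots> = inverse (1 + x\<^sup>2)" using assms by (simp add: divide_inverse)
  finally show "ennreal \<bar>a\<bar> * ennreal (a / (a\<^sup>2 + (- c + a * x + c)\<^sup>2)) = ennreal (inverse (1 + x\<^sup>2))"
   using assms by (simp flip: ennreal_mult)
 qed
 finally show ?thesis by (simp only: std)
qed

section \<open>Square-integrability of the reciprocal weight\<close>

abbreviation mu :: "'n::finite => real ^ 'n => real" where "mu \<equiv> anisotropic_weight"
abbreviation bracket :: "real ^ 'n::finite => real" where "bracket \<equiv> japanese_bracket"

lemma bracket_ge_1: "1 \<le> bracket \<xi>" by (simp add: japanese_bracket_def)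
lemma bracket_pos: "0 < bracket \<xi>" using bracket_ge_1[of \<xi>] by linarith
lemma bracket_ge_norm: "norm \<xi> \<le> bracket \<xi>" unfolding japanese_bracket_def by (rule real_le_rsqrt) simp
lemma bracket_le: "bracket \<xi> \<le> 1 + norm \<xi>"
 unfolding japanese_bracket_def by (rule real_le_lsqrt) (auto simp: power2_sum)

lemma mu_nonzero: "\<xi> \<noteq> 0 ==> mu e \<xi> = \<bar>\<xi> $ e\<bar> / norm \<xi> + norm \<xi>"
 by (simp add: anisotropic_weight_def)

lemma mu_ge_norm: "norm \<xi> \<le> mu e \<xi>"
 by (simp add: anisotropic_weight_def)

lemma mu_pos: "0 < mu e \<xi>"
 by (simp add: anisotropic_weight_def add_nonneg_pos)

lemma mu_le: "mu e \<xi> \<le> 1 + norm \<xi>"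
proof (cases "\<xi> = 0")
 case False
 then have "\<bar>\<xi> $ e\<bar> / norm \<xi> \<le> 1" by (simp add: component_le_norm_cart)
 then show ?thesis using False by (simp add: mu_nonzero)
qed (simp add: anisotropic_weight_def)

lemma mu_ge_quotient: "\<bar>\<xi> $ e\<bar> / norm \<xi> \<le> mu e \<xi>"
 by (simp add: anisotropic_weight_def)

text \<open>The arithmetic-geometric mean inequality for the two summands of \<open>mu\<close>.\<close>

lemma mu_sq_ge: "4 * \<bar>\<xi> $ e\<bar> \<le> (mu e \<xi>)\<^sup>2"
proof (cases "\<xi> = 0")
 case False
 let ?a = "\<bar>\<xi> $ e\<bar> / norm \<xi>"
 have square: "4 * a * b \<le> (a + b)\<^sup>2" for a b :: real
  using zero_le_power2[of "a - b"] by (simp add: power2_eq_square algebra_simps)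
 have "4 * \<bar>\<xi> $ e\<bar> = 4 * ?a * norm \<xi>" using False by simp
 also have "\<dots> \<le> (?a + norm \<xi>)\<^sup>2" by (rule square)
 finally show ?thesis using False by (simp add: mu_nonzero)
qed simp

lemma mu_borel [measurable]: "mu (e :: 'n::finite) \<in> borel_measurable borel"
proof -
 have [measurable]: "(\<lambda>x::real^'n. x $ e) \<in> borel_measurable borel"
  by (intro borel_measurable_continuous_onI continuous_intros)
 show ?thesis unfolding anisotropic_weight_def[abs_def] by measurable
qed

lemma bracket_borel [measurable]: "bracket \<in> borel_measurable borel"
 unfolding japanese_bracket_def[abs_def] by measurable

locale anisotropic = product_group \<Gamma> for \<Gamma> :: "'n::finite => factor" +
 fixes e :: 'n and s :: real
 assumes line_or_torus: "\<Gamma> e = Line \<or> (\<forall>i. \<Gamma> i \<noteq> Line)"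
  and s_large: "s > real CARD('n) / 2"
begin

definition weight :: "real ^ 'n => real" where
 "weight \<xi> = mu e \<xi> * bracket \<xi> powr (s - 1)"

lemma s_pos: "s > 1 / 2"
proof -
 have "real CARD('n) \<ge> 1" by (simp add: Suc_leI)
 then show ?thesis using s_large by linarith
qed

lemma weight_pos: "0 < weight \<xi>"
 using mu_pos[of e \<xi>] bracket_pos[of \<xi>] by (simp add: weight_def)

lemma weight_borel [measurable]: "weight \<in> borel_measurable borel"
 unfolding weight_def[abs_def] by measurable

lemma bracket_powr_split: "bracket \<xi> powr s = bracket \<xi> * bracket \<xi> powr (s - 1)"
proof -
 have "bracket \<xi> powr s = bracket \<xi> powr (1 + (s - 1))" by simp
 also have "\<dots> = bracket \<xi> * bracket \<xi> powr (s - 1)" using bracket_pos[of \<xi>] by (simp only: powr_add) simp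
 finally show ?thesis .
qed

lemma weight_le: "weight \<xi> \<le> 2 * bracket \<xi> powr s"
proof -
 have "mu e \<xi> \<le> 2 * bracket \<xi>" using mu_le[of e \<xi>] bracket_ge_1[of \<xi>] bracket_ge_norm[of \<xi>] by linarith
 then have "weight \<xi> \<le> (2 * bracket \<xi>) * bracket \<xi> powr (s - 1)" unfolding weight_def by (intro mult_right_mono) auto
 then show ?thesis by (simp only: bracket_powr_split mult.assoc)
qed

text \<open>
 The weight is small compared with \<open>bracket \<xi> powr s\<close> only near the origin, and only if there is
 a line besides the distinguished one.
\<close>

definition low :: "real ^ 'n => bool" where
 "low \<xi> \<longleftrightarrow> (\<exists>j. j \<noteq> e \<and> \<Gamma> j = Line) \<and> norm \<xi> < 1 / 4"

text \<open>Away from the origin \<open>norm \<xi>\<close> is comparable to \<open>bracket \<xi>\<close>.  Near the origin, without a second line,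
 a point of the dual group either lies on the axis \<open>e\<close>, where \<open>\<bar>\<xi> $ e\<bar> / norm \<xi>\<close> is one, or has a
 nonzero lattice coordinate, which is bounded from below.\<close>

lemma weight_ge: "\<exists>c>0. \<forall>\<xi>\<in>S. \<not> low \<xi> \<longrightarrow> bracket \<xi> powr s \<le> c * weight \<xi>"
proof -
 let ?l = "\<lambda>i. case \<Gamma> i of Line => 0 | Circle l => l"
 define L where "L = 1 + (\<Sum>i\<in>UNIV. ?l i)"
 have l0: "0 \<le> ?l i" for i using period_pos[of i] by (cases "\<Gamma> i") (auto simp: less_imp_le)
 have L1: "L \<ge> 1" unfolding L_def using sum_nonneg[of UNIV ?l] l0 by simp
 have lL: "l \<le> L" if "\<Gamma> i = Circle l" for i l
  using member_le_sum[of i UNIV ?l] l0 that unfolding L_def by auto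
 have key: "bracket \<xi> \<le> (5 + L) * mu e \<xi>" if \<xi>: "\<xi> \<in> S" "\<not> low \<xi>" for \<xi>
 proof (cases "norm \<xi> \<ge> 1 / 4")
  case True
  then have "bracket \<xi> \<le> 5 * mu e \<xi>" using bracket_le[of \<xi>] mu_ge_norm[of \<xi> e] by linarith
  also have "\<dots> \<le> (5 + L) * mu e \<xi>" using L1 mu_pos[of e \<xi>] by (intro mult_right_mono) auto
  finally show ?thesis .
 next
  case False
  then have circ: "\<exists>l. \<Gamma> i = Circle l" if "i \<noteq> e" for i
   using \<xi> that by (cases "\<Gamma> i") (auto simp: low_def)
  show ?thesis
  proof (cases "\<forall>i. i \<noteq> e \<longrightarrow> \<xi> $ i = 0")
   case True
   then have \<xi>e: "\<xi> = axis e (\<xi> $ e)" by (auto simp: vec_eq_iff axis_def)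
   have "\<xi> = \<xi> $ e *\<^sub>R axis e 1" by (subst \<xi>e) (simp add: vec_eq_iff axis_def)
   then have "norm \<xi> = \<bar>\<xi> $ e\<bar>" by (metis norm_scaleR norm_axis_1 mult.right_neutral)
   then have "mu e \<xi> = 1 + norm \<xi>" by (cases "\<xi> = 0") (auto simp: anisotropic_weight_def)
   then have "bracket \<xi> \<le> 1 * mu e \<xi>" using bracket_le[of \<xi>] by simp
   also have "\<dots> \<le> (5 + L) * mu e \<xi>" using L1 mu_pos[of e \<xi>] by (intro mult_right_mono) auto
   finally show ?thesis .
  next
   case False
   then obtain i where i: "i \<noteq> e" "\<xi> $ i \<noteq> 0" by blast
   then obtain l where l: "\<Gamma> i = Circle l" using circ by blast
   have "l * \<xi> $ i \<in> \<int>" using \<xi> l by (simp add: dual_group_def)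
   moreover have "l * \<xi> $ i \<noteq> 0" using i period_pos[OF l] by simp
   ultimately have "1 \<le> \<bar>l * \<xi> $ i\<bar>" by (rule Ints_nonzero_abs_ge1)
   also have "\<dots> \<le> L * norm \<xi>"
    using lL[OF l] period_pos[OF l] component_le_norm_cart[of \<xi> i] by (simp add: abs_mult mult_mono)
   finally have "bracket \<xi> \<le> (5 + L) * norm \<xi>"
    using bracket_le[of \<xi>] norm_ge_zero[of \<xi>] unfolding distrib_right by linarith
   also have "\<dots> \<le> (5 + L) * mu e \<xi>" using L1 by (intro mult_left_mono mu_ge_norm) auto
   finally show ?thesis .
  qed
 qed
 show ?thesis
 proof (intro exI[of _ "5 + L"] conjI ballI impI)
  show "5 + L > 0" using L1 by simp
  fix \<xi> assume "\<xi> \<in> S" "\<not> low \<xi>"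
  from mult_right_mono[OF key[OF this], of "bracket \<xi> powr (s - 1)"]
  show "bracket \<xi> powr s \<le> (5 + L) * weight \<xi>" by (simp only: bracket_powr_split weight_def mult.assoc) simp
 qed
qed

lemma two_lines:
 assumes "j \<noteq> e" "\<Gamma> j = Line" shows "\<Gamma> e = Line" "s > 1"
proof -
 show "\<Gamma> e = Line" using line_or_torus assms by auto
 have "card {e, j} \<le> CARD('n)" by (intro card_mono) auto
 then show "s > 1" using s_large assms(1) by simp
qed

lemma low_weight:
 assumes "low \<xi>" shows "mu e \<xi> \<le> weight \<xi>"
proof -
 have "s > 1" using assms two_lines by (auto simp: low_def)
 then have "1 \<le> bracket \<xi> powr (s - 1)" using bracket_ge_1[of \<xi>] by (intro ge_one_powr_ge_zero) auto
 then show ?thesis unfolding weight_def using mult_left_mono[of 1 "bracket \<xi> powr (s - 1)" "mu e \<xi>"] mu_pos[of e \<xi>] by simp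
qed

text \<open>The product form gives each coordinate the exponent \<open>2 * s / d > 1\<close>, so that Fubini applies.\<close>

lemma bracket_powr_le_prod:
 fixes \<xi> :: "real ^ 'n"
 shows
 "bracket \<xi> powr (- 2 * s) \<le> (\<Prod>i\<in>UNIV. (1 + (\<xi> $ i)\<^sup>2) powr (- (s / real CARD('n))))"
proof -
 let ?q = "s / real CARD('n)"
 let ?b = "1 + (norm \<xi>)\<^sup>2"
 have b: "?b > 0" by (simp add: add_pos_nonneg)
 have "bracket \<xi> powr (- 2 * s) = ?b powr (- s)"
  using b by (simp add: japanese_bracket_def powr_half_sqrt[symmetric] powr_powr)
 also have "\<dots> = (?b powr (- ?q)) ^ CARD('n)"
  using b by (simp add: powr_powr flip: powr_realpow)
 also have "\<dots> = (\<Prod>i\<in>(UNIV::'n set). ?b powr (- ?q))" by simp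
 also have "\<dots> \<le> (\<Prod>i\<in>UNIV. (1 + (\<xi> $ i)\<^sup>2) powr (- ?q))"
 proof (intro prod_mono conjI)
  fix i
  have "(\<xi> $ i)\<^sup>2 \<le> (norm \<xi>)\<^sup>2"
   using power_mono[OF component_le_norm_cart[of \<xi> i], of 2] by simp
  then show "?b powr (- ?q) \<le> (1 + (\<xi> $ i)\<^sup>2) powr (- ?q)"
   using s_pos by (intro powr_mono2') (auto simp: add_pos_nonneg)
 qed simp
 finally show ?thesis .
qed

lemma nn_integral_bracket: "(\<integral>\<^sup>+ \<xi>. ennreal (bracket \<xi> powr (- 2 * s)) \<partial>m) < \<infinity>"
proof -
 let ?q = "s / real CARD('n)"
 have q: "?q > 1 / 2" using s_large by (simp add: field_simps)
 have "(\<integral>\<^sup>+ \<xi>. ennreal (bracket \<xi> powr (- 2 * s)) \<partial>m)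
   \<le> (\<integral>\<^sup>+ \<xi>. (\<Prod>i\<in>UNIV. ennreal ((1 + (\<xi> $ i)\<^sup>2) powr (- ?q))) \<partial>m)"
  using bracket_powr_le_prod by (intro nn_integral_mono) (simp add: prod_ennreal ennreal_leI)
 also have "\<dots> = (\<Prod>i\<in>UNIV. \<integral>\<^sup>+ t. ennreal ((1 + t\<^sup>2) powr (- ?q)) \<partial>dual_coords \<Gamma> i)"
  unfolding dual_borel_def by (rule dual.nn_integral_vec_prod) measurable
 also have "\<dots> < \<infinity>"
 proof -
  have "(\<integral>\<^sup>+ t. ennreal ((1 + t\<^sup>2) powr (- ?q)) \<partial>dual_coords \<Gamma> i) < \<infinity>" for i
   using nn_integral_bracket_line[OF q] nn_integral_bracket_lattice[OF q] period_pos by (cases "\<Gamma> i") auto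
  then show ?thesis by (auto simp: less_top[symmetric] ennreal_prod_eq_top less_imp_neq)
 qed
 finally show ?thesis .
qed

lemma dual_coords_bounded_finite: "(\<integral>\<^sup>+ t. indicator {- 1..1} t \<partial>dual_coords \<Gamma> i) < \<infinity>"
proof (cases "\<Gamma> i")
 case (Circle l)
 have "(\<integral>\<^sup>+ t. indicator {- 1..1} t \<partial>count_space {t. l * t \<in> \<int>}) = (\<Sum>t\<in>{t. l * t \<in> \<int>} \<inter> {- 1..1}. 1)"
  using lattice_bounded_finite[OF period_pos[OF Circle], of 1]
  by (subst nn_integral_count_space'[of "{t. l * t \<in> \<int>} \<inter> {- 1..1}"]) (auto simp: indicator_def)
 then show ?thesis using Circle by (simp add: of_nat_less_top)
qed simp

lemma AE_line_nonzero:
 assumes "\<Gamma> i = Line" shows "AE \<xi> in m. \<xi> $ i \<noteq> 0"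
proof -
 have "dual_coords \<Gamma> i = lborel" using assms by simp
 moreover have "AE t in lborel. t \<notin> {0::real}" using AE_lborel_singleton[of "0::real"] by auto
 ultimately have "AE t in dual_coords \<Gamma> i. t \<notin> {0}" by (simp only:)
 then have "AE \<xi> in m. \<xi> $ i \<notin> {0}" unfolding dual_borel_def by (rule dual.AE_vec_coordinate) simp
 then show ?thesis by eventually_elim simp
qed

text \<open>
 Near the origin, \<open>(mu e \<xi>)\<^sup>2\<close> dominates both \<open>\<bar>\<xi> $ e\<bar>\<close> and \<open>\<bar>\<xi> $ j\<bar>\<^sup>2\<close>; the geometric mean of
 the two bounds has an integrable reciprocal.
\<close>

lemma mu_powr_bound:
 assumes "\<xi> $ e \<noteq> 0" "\<xi> $ j \<noteq> 0"
 shows "inverse ((mu e \<xi>)\<^sup>2) \<le> \<bar>\<xi> $ e\<bar> powr (- (3 / 4)) * \<bar>\<xi> $ j\<bar> powr (- (1 / 2))"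
proof -
 let ?M = "(mu e \<xi>)\<^sup>2"
 have M: "?M > 0" using mu_pos[of e \<xi>] by simp
 have "\<bar>\<xi> $ j\<bar> \<le> mu e \<xi>" using component_le_norm_cart[of \<xi> j] mu_ge_norm[of \<xi> e] by linarith
 then have j: "\<bar>\<xi> $ j\<bar>\<^sup>2 \<le> ?M" by (intro power_mono) auto
 have e: "\<bar>\<xi> $ e\<bar> \<le> ?M" using mu_sq_ge[of \<xi> e] by linarith
 have "inverse ?M = ?M powr (- (3 / 4)) * ?M powr (- (1 / 4))" using M by (simp add: powr_minus_divide flip: powr_add)
   (simp add: divide_inverse)
 also have "\<dots> \<le> \<bar>\<xi> $ e\<bar> powr (- (3 / 4)) * (\<bar>\<xi> $ j\<bar>\<^sup>2) powr (- (1 / 4))"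
  using assms e j by (intro mult_mono powr_mono2') auto
 also have "(\<bar>\<xi> $ j\<bar>\<^sup>2) powr (- (1 / 4)) = \<bar>\<xi> $ j\<bar> powr (- (1 / 2))"
  by (simp only: square_powr) simp
 finally show ?thesis .
qed

text \<open>Where the weight is not low it is comparable to \<open>bracket \<xi> powr s\<close>.  The low part lies in the unit cube,
 and a product of integrable powers of two coordinates majorizes it.\<close>

theorem nn_integral_weight: "(\<integral>\<^sup>+ \<xi>. ennreal (inverse ((weight \<xi>)\<^sup>2)) \<partial>m) < \<infinity>"
proof -
 obtain c where c: "c > 0" "\<And>\<xi>. \<xi> \<in> S ==> \<not> low \<xi> ==> bracket \<xi> powr s \<le> c * weight \<xi>"
  using weight_ge by blast
 let ?H = "\<lambda>\<xi>. ennreal (c\<^sup>2 * bracket \<xi> powr (- 2 * s))"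
 have high: "ennreal (inverse ((weight \<xi>)\<^sup>2)) \<le> ?H \<xi>" if "\<xi> \<in> S" "\<not> low \<xi>" for \<xi>
 proof -
  have "(bracket \<xi> powr s)\<^sup>2 \<le> (c * weight \<xi>)\<^sup>2" using c(2)[OF that] by (intro power_mono) auto
  moreover have "(bracket \<xi> powr s)\<^sup>2 = inverse (bracket \<xi> powr (- 2 * s))"
   using bracket_pos[of \<xi>] by (simp add: power2_eq_square powr_minus flip: powr_add)
  ultimately have "inverse (bracket \<xi> powr (- 2 * s)) \<le> c\<^sup>2 * (weight \<xi>)\<^sup>2" by (simp add: power_mult_distrib)
  then have "inverse ((weight \<xi>)\<^sup>2) \<le> c\<^sup>2 * bracket \<xi> powr (- 2 * s)"
   using weight_pos[of \<xi>] bracket_pos[of \<xi>] by (simp add: field_simps)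
  then show ?thesis by (rule ennreal_leI)
 qed
 have Hfin: "(\<integral>\<^sup>+ \<xi>. ?H \<xi> \<partial>m) < \<infinity>"
  using nn_integral_bracket by (simp add: ennreal_mult nn_integral_cmult ennreal_mult_less_top)
 show ?thesis
 proof (cases "\<exists>j. j \<noteq> e \<and> \<Gamma> j = Line")
  case False
  have "AE \<xi> in m. ennreal (inverse ((weight \<xi>)\<^sup>2)) \<le> ?H \<xi>"
   using AE_dual_group
  proof eventually_elim
   case (elim \<xi>)
   have "\<not> low \<xi>" using False by (simp add: low_def)
   from high[OF elim this] show ?case .
  qed
  from nn_integral_mono_AE[OF this] Hfin show ?thesis by (rule le_less_trans)
 next
  case True
  then obtain j where j: "j \<noteq> e" "\<Gamma> j = Line" by blast
  note e = two_lines(1)[OF j]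
  let ?w = "\<lambda>i t. if i = e then indicator {-1..1} t * \<bar>t\<bar> powr (- (3 / 4)) else if i = j then indicator {-1..1} t * \<bar>t\<bar> powr (- (1 / 2)) else indicator {-1..1} t"
  let ?W = "\<lambda>\<xi>::real^'n. \<Prod>i\<in>UNIV. ennreal (?w i (\<xi> $ i))"
  have lowW: "ennreal (inverse ((weight \<xi>)\<^sup>2)) \<le> ?W \<xi>" if "low \<xi>" "\<xi> $ e \<noteq> 0" "\<xi> $ j \<noteq> 0" for \<xi>
  proof -
   have unit: "\<xi> $ i \<in> {-1..1}" for i
    using that(1) component_le_norm_cart[of \<xi> i] by (auto simp: low_def)
   have "inverse ((weight \<xi>)\<^sup>2) \<le> inverse ((mu e \<xi>)\<^sup>2)"
    using low_weight[OF that(1)] mu_pos[of e \<xi>] by (intro le_imp_inverse_le power_mono) auto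
   also have "\<dots> \<le> \<bar>\<xi> $ e\<bar> powr (- (3 / 4)) * \<bar>\<xi> $ j\<bar> powr (- (1 / 2))" by (rule mu_powr_bound[OF that(2,3)])
   also have "\<dots> = (\<Prod>i\<in>UNIV. ?w i (\<xi> $ i))"
   proof -
    have "(\<Prod>i\<in>UNIV. ?w i (\<xi> $ i)) = ?w e (\<xi> $ e) * (?w j (\<xi> $ j) * (\<Prod>i\<in>UNIV - {e} - {j}. ?w i (\<xi> $ i)))"
     using j by (subst prod.remove[of UNIV e], simp, simp, subst prod.remove[of "UNIV - {e}" j]) auto
    moreover have "(\<Prod>i\<in>UNIV - {e} - {j}. ?w i (\<xi> $ i)) = 1" using unit by (intro prod.neutral) auto
    ultimately show ?thesis using unit[of e] unit[of j] j by simp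
   qed
   finally have "ennreal (inverse ((weight \<xi>)\<^sup>2)) \<le> ennreal (\<Prod>i\<in>UNIV. ?w i (\<xi> $ i))" by (rule ennreal_leI)
   also have "\<dots> = ?W \<xi>" by (rule prod_ennreal[symmetric]) auto
   finally show ?thesis .
  qed
  have "AE \<xi> in m. ennreal (inverse ((weight \<xi>)\<^sup>2)) \<le> ?H \<xi> + ?W \<xi>"
   using AE_dual_group AE_line_nonzero[OF e] AE_line_nonzero[OF j(2)]
  proof eventually_elim
   case (elim \<xi>)
   show ?case
   proof (cases "low \<xi>")
    case True
    from lowW[OF True elim(2,3)] show ?thesis by (rule add_increasing[OF zero_le])
   next
    case False
    from high[OF elim(1) False] show ?thesis by (rule add_increasing2[OF zero_le])
   qed
  qed
  from nn_integral_mono_AE[OF this]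
  have "(\<integral>\<^sup>+ \<xi>. ennreal (inverse ((weight \<xi>)\<^sup>2)) \<partial>m) \<le> (\<integral>\<^sup>+ \<xi>. ?H \<xi> + ?W \<xi> \<partial>m)" .
  also have "\<dots> = (\<integral>\<^sup>+ \<xi>. ?H \<xi> \<partial>m) + (\<integral>\<^sup>+ \<xi>. ?W \<xi> \<partial>m)"
  proof (rule nn_integral_add)
   have [measurable]: "(\<lambda>\<xi>::real^'n. \<xi> $ i) \<in> borel_measurable borel" for i
    by (intro borel_measurable_continuous_onI continuous_intros)
   show "?W \<in> borel_measurable m" by measurable
  qed measurable
  finally have split: "(\<integral>\<^sup>+ \<xi>. ennreal (inverse ((weight \<xi>)\<^sup>2)) \<partial>m) \<le> (\<integral>\<^sup>+ \<xi>. ?H \<xi> \<partial>m) + (\<integral>\<^sup>+ \<xi>. ?W \<xi> \<partial>m)" .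
  have "(\<integral>\<^sup>+ \<xi>. ?W \<xi> \<partial>m) = (\<Prod>i\<in>UNIV. \<integral>\<^sup>+ t. ennreal (?w i t) \<partial>dual_coords \<Gamma> i)"
   unfolding dual_borel_def by (rule dual.nn_integral_vec_prod) measurable
  also have "\<dots> < \<infinity>"
  proof -
   have "(\<integral>\<^sup>+ t. ennreal (?w i t) \<partial>dual_coords \<Gamma> i) < \<infinity>" for i
   proof -
    consider "i = e" | "i \<noteq> e" "i = j" | "i \<noteq> e" "i \<noteq> j" by blast
    then show ?thesis
    proof cases
     case 1 then show ?thesis using nn_integral_singular_power[of "3 / 4"] e by simp
    next
     case 2 then show ?thesis using nn_integral_singular_power[of "1 / 2"] j by simp
    next
     case 3 then show ?thesis using dual_coords_bounded_finite[of i] by (simp add: ennreal_indicator)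
    qed
   qed
   then show ?thesis by (auto simp: less_top[symmetric] ennreal_prod_eq_top less_imp_neq)
  qed
  finally show ?thesis by (rule ennreal_le_add_finite[OF split Hfin])
 qed
qed

end

section \<open>The product kernel\<close>

lemma vec_nth_borel [measurable (raw)]:
 "f \<in> borel_measurable M ==> (\<lambda>x. f x $ i :: real) \<in> borel_measurable M"
 for f :: "'a => real ^ 'n::finite"
 by (rule measurable_compose[of f M borel]) (auto intro!: borel_measurable_continuous_onI continuous_intros)

lemma bracket_mono_double: "norm \<xi> \<le> 2 * norm \<zeta> ==> bracket \<xi> \<le> 2 * bracket \<zeta>"
proof -
 assume "norm \<xi> \<le> 2 * norm \<zeta>"
 then have "(norm \<xi>)\<^sup>2 \<le> (2 * norm \<zeta>)\<^sup>2" by (intro power_mono) auto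
 then have "1 + (norm \<xi>)\<^sup>2 \<le> 4 * (1 + (norm \<zeta>)\<^sup>2)" by (simp add: power_mult_distrib)
 then have "sqrt (1 + (norm \<xi>)\<^sup>2) \<le> sqrt (4 * (1 + (norm \<zeta>)\<^sup>2))" by (rule real_sqrt_le_mono)
 then show ?thesis by (simp only: japanese_bracket_def real_sqrt_mult real_sqrt_four)
qed

lemma sum_square_le: "(a + b)\<^sup>2 \<le> 2 * (a\<^sup>2 + b\<^sup>2)" for a b :: real
 using zero_le_power2[of "a - b"] by (simp add: power2_eq_square algebra_simps)

text \<open>
 The factor of the kernel in one coordinate: a Poisson kernel at \<open>e\<close>, and at \<open>j\<close> a Poisson kernel times
 its width \<open>2 * \<bar>\<zeta> $ e\<bar>\<close>.  The integral of a Poisson kernel does not depend on the width.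
\<close>

definition kernel_factor :: "'n => 'n => real ^ 'n::finite => 'n => real => real" where
 "kernel_factor e j \<zeta> i t =
  (if i = e then (norm \<zeta>)\<^sup>2 / (((norm \<zeta>)\<^sup>2)\<^sup>2 + t\<^sup>2)
  else if i = j then 2 * \<bar>\<zeta> $ e\<bar> * (2 * \<bar>\<zeta> $ e\<bar> / ((2 * \<bar>\<zeta> $ e\<bar>)\<^sup>2 + (t + \<zeta> $ j)\<^sup>2))
  else indicator {-1..1} t)"

text \<open>For fixed \<open>\<zeta>\<close>, the square of the part of the kernel that is needed near the origin, as a function of \<open>\<eta>\<close>.\<close>

definition low_kernel :: "'n => 'n => real ^ 'n::finite => real ^ 'n => real" where
 "low_kernel e j \<zeta> \<eta> = (\<Prod>i\<in>UNIV. kernel_factor e j \<zeta> i (\<eta> $ i)) / (mu e \<zeta>)\<^sup>2"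

lemma kernel_factor_nonneg: "0 \<le> kernel_factor e j \<zeta> i t"
 by (simp add: kernel_factor_def)

lemma low_kernel_nonneg: "0 \<le> low_kernel e j \<zeta> \<eta>"
 by (simp add: low_kernel_def prod_nonneg kernel_factor_nonneg)

lemma low_kernel_borel:
 assumes [measurable]: "f \<in> borel_measurable M" "g \<in> borel_measurable M"
 shows "(\<lambda>p. low_kernel e j (f p) (g p)) \<in> borel_measurable M"
proof -
 have [measurable]: "(\<lambda>p. kernel_factor e j (f p) i (g p $ i)) \<in> borel_measurable M" for i
  unfolding kernel_factor_def by measurable
 have [measurable]: "(\<lambda>p. mu e (f p)) \<in> borel_measurable M"
  by (rule measurable_compose[OF assms(1) mu_borel])
 show ?thesis unfolding low_kernel_def by measurable
qed

lemma low_kernel_eq: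
 assumes "j \<noteq> e" "norm \<eta> < 1"
 shows "low_kernel e j \<zeta> \<eta> = kernel_factor e j \<zeta> e (\<eta> $ e) * kernel_factor e j \<zeta> j (\<eta> $ j) / (mu e \<zeta>)\<^sup>2"
proof -
 have unit: "\<eta> $ i \<in> {-1..1}" for i
  using assms(2) component_le_norm_cart[of \<eta> i] by auto
 have "(\<Prod>i\<in>UNIV. kernel_factor e j \<zeta> i (\<eta> $ i))
   = kernel_factor e j \<zeta> e (\<eta> $ e) * (kernel_factor e j \<zeta> j (\<eta> $ j) * (\<Prod>i\<in>UNIV - {e} - {j}. kernel_factor e j \<zeta> i (\<eta> $ i)))"
  using assms(1) by (subst prod.remove[of UNIV e], simp, simp, subst prod.remove[of "UNIV - {e}" j]) auto
 moreover have "(\<Prod>i\<in>UNIV - {e} - {j}. kernel_factor e j \<zeta> i (\<eta> $ i)) = 1"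
  using unit by (intro prod.neutral) (auto simp: kernel_factor_def)
 ultimately show ?thesis by (simp add: low_kernel_def)
qed

text \<open>
 If the sum of two frequencies is much shorter than both, then its direction need not be controlled by
 the directions of the summands.  This is the case in which the kernel is needed: the
 \<open>j\<close>-coordinates must nearly cancel for the quotient \<open>\<bar>\<xi> $ e\<bar> / norm \<xi>\<close> to be large.
\<close>

lemma mu_sum_near_cancellation:
 assumes je: "j \<noteq> e" and small: "norm \<eta> < 1" and \<xi>: "\<xi> = \<eta> + \<zeta>" and le: "\<bar>\<eta> $ e\<bar> \<le> \<bar>\<zeta> $ e\<bar>"
  and steep: "norm \<xi> < \<bar>\<xi> $ e\<bar> / norm \<xi>" and short: "2 * norm \<xi> < norm \<zeta>"
 shows "(mu e \<xi>)\<^sup>2 \<le> 16 * ((mu e \<eta>)\<^sup>2 * (mu e \<zeta>)\<^sup>2 * low_kernel e j \<zeta> \<eta>)"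
proof -
 let ?q = "\<bar>\<xi> $ e\<bar> / norm \<xi>" and ?\<rho> = "norm \<zeta>" and ?t = "\<eta> $ e"
 have \<xi>0: "\<xi> \<noteq> 0" using steep by auto
 have \<xi>e: "\<xi> $ e \<noteq> 0" using steep norm_ge_zero[of \<xi>] by auto
 have \<rho>: "?\<rho> > 0" using short norm_ge_zero[of \<xi>] by linarith
 have \<xi>\<zeta>: "\<bar>\<xi> $ e\<bar> \<le> 2 * \<bar>\<zeta> $ e\<bar>" using le by (simp add: \<xi>)
 have \<zeta>e: "\<zeta> $ e \<noteq> 0" using \<xi>\<zeta> \<xi>e by auto
 have \<eta>1: "?\<rho> / 2 \<le> norm \<eta>" and \<eta>2: "norm \<eta> \<le> 2 * ?\<rho>"
  using short norm_triangle_ineq4[of \<xi> \<eta>] norm_triangle_ineq4[of \<xi> \<zeta>] by (auto simp: \<xi>)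
 have \<eta>0: "\<eta> \<noteq> 0" using \<eta>1 \<rho> by auto
 have "\<bar>?t\<bar> / (2 * ?\<rho>) \<le> \<bar>?t\<bar> / norm \<eta>" using \<eta>2 \<eta>0 \<rho> by (intro divide_left_mono mult_pos_pos) auto
 then have "(\<bar>?t\<bar> / ?\<rho> + ?\<rho>) / 2 \<le> mu e \<eta>" using \<eta>1 \<eta>0 by (simp add: mu_nonzero add_divide_distrib)
 then have "((\<bar>?t\<bar> / ?\<rho> + ?\<rho>) / 2)\<^sup>2 \<le> (mu e \<eta>)\<^sup>2" using \<rho> by (intro power_mono) auto
 moreover have "?t\<^sup>2 / ?\<rho>\<^sup>2 + ?\<rho>\<^sup>2 \<le> (\<bar>?t\<bar> / ?\<rho> + ?\<rho>)\<^sup>2"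
  using \<rho> by (simp add: power2_sum power_divide)
 ultimately have \<mu>\<eta>: "?t\<^sup>2 / ?\<rho>\<^sup>2 + ?\<rho>\<^sup>2 \<le> 4 * (mu e \<eta>)\<^sup>2" by (simp add: power_divide)
 have "(?t\<^sup>2 / ?\<rho>\<^sup>2 + ?\<rho>\<^sup>2) * kernel_factor e j \<zeta> e ?t = 1"
  using \<rho> by (simp add: kernel_factor_def field_simps power2_eq_square add_nonneg_eq_0_iff)
 then have we: "1 \<le> 4 * (mu e \<eta>)\<^sup>2 * kernel_factor e j \<zeta> e ?t"
  using mult_right_mono[OF \<mu>\<eta> kernel_factor_nonneg[of e j \<zeta> e ?t]] by simp
 have sq: "(\<xi> $ e)\<^sup>2 + (\<xi> $ j)\<^sup>2 \<le> (norm \<xi>)\<^sup>2"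
 proof -
  have "(\<xi> $ e)\<^sup>2 + (\<xi> $ j)\<^sup>2 = (\<Sum>i\<in>{e, j}. (\<xi> $ i)\<^sup>2)" using je by simp
  also have "\<dots> \<le> (\<Sum>i\<in>UNIV. (\<xi> $ i)\<^sup>2)" by (intro sum_mono2) auto
  also have "\<dots> = (norm \<xi>)\<^sup>2" by (simp add: norm_vec_def L2_set_def sum_nonneg)
  finally show ?thesis .
 qed
 have "?q\<^sup>2 = (\<xi> $ e)\<^sup>2 / (norm \<xi>)\<^sup>2" by (simp add: power_divide)
 also have "\<dots> \<le> (\<xi> $ e)\<^sup>2 / ((\<xi> $ e)\<^sup>2 + (\<xi> $ j)\<^sup>2)"
  using sq \<xi>e \<xi>0 by (intro divide_left_mono) (auto simp: add_pos_nonneg)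
 also have "\<dots> \<le> (2 * \<bar>\<zeta> $ e\<bar>)\<^sup>2 / ((2 * \<bar>\<zeta> $ e\<bar>)\<^sup>2 + (\<xi> $ j)\<^sup>2)"
 proof -
  have mono: "a / (a + c) \<le> b / (b + c)" if "0 < a" "a \<le> b" "0 \<le> c" for a b c :: real
   using that mult_right_mono[of a b c] by (simp add: divide_simps algebra_simps)
  have "(\<xi> $ e)\<^sup>2 \<le> (2 * \<bar>\<zeta> $ e\<bar>)\<^sup>2" using power_mono[OF \<xi>\<zeta>, of 2] by simp
  then show ?thesis using \<xi>e by (intro mono) auto
 qed
 also have "\<dots> = kernel_factor e j \<zeta> j (\<eta> $ j)"
  using je by (simp add: kernel_factor_def \<xi> power2_eq_square)
 finally have wj: "?q\<^sup>2 \<le> kernel_factor e j \<zeta> j (\<eta> $ j)" .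
 have "(mu e \<xi>)\<^sup>2 \<le> (2 * ?q)\<^sup>2" using steep \<xi>0 by (intro power_mono) (auto simp: mu_nonzero)
 also have "\<dots> = 4 * ?q\<^sup>2" by (simp add: power_mult_distrib power_divide)
 also have "\<dots> \<le> 4 * (kernel_factor e j \<zeta> j (\<eta> $ j) * 1)" using wj by simp
 also have "\<dots> \<le> 4 * (kernel_factor e j \<zeta> j (\<eta> $ j) * (4 * (mu e \<eta>)\<^sup>2 * kernel_factor e j \<zeta> e ?t))"
  using we kernel_factor_nonneg by (intro mult_left_mono) auto
 also have "\<dots> = 16 * ((mu e \<eta>)\<^sup>2 * (mu e \<zeta>)\<^sup>2 * low_kernel e j \<zeta> \<eta>)"
  using mu_pos[of e \<zeta>] by (simp add: low_kernel_eq[OF je small])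
 finally show ?thesis .
qed

text \<open>Unless the sum is steep and much shorter than \<open>\<zeta>\<close>, the summands control it: if it is not steep,
 then \<open>mu\<close> is comparable to the norm, and if it is not short, then \<open>\<bar>\<xi> $ e\<bar> / norm \<xi>\<close> is at most four times
 \<open>\<bar>\<zeta> $ e\<bar> / norm \<zeta>\<close>.\<close>

lemma mu_sum_ordered:
 assumes je: "j \<noteq> e" and small: "norm \<eta> < 1" and \<xi>: "\<xi> = \<eta> + \<zeta>" "\<xi> \<noteq> 0" and le: "\<bar>\<eta> $ e\<bar> \<le> \<bar>\<zeta> $ e\<bar>"
 shows "(mu e \<xi>)\<^sup>2 \<le> 50 * ((mu e \<eta>)\<^sup>2 + (mu e \<zeta>)\<^sup>2 + (mu e \<eta>)\<^sup>2 * (mu e \<zeta>)\<^sup>2 * low_kernel e j \<zeta> \<eta>)"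
proof -
 let ?q = "\<bar>\<xi> $ e\<bar> / norm \<xi>" and ?P = "(mu e \<eta>)\<^sup>2 * (mu e \<zeta>)\<^sup>2 * low_kernel e j \<zeta> \<eta>"
 have P: "0 \<le> ?P" by (simp add: low_kernel_nonneg)
 have n: "norm \<xi> \<le> mu e \<eta> + mu e \<zeta>"
  using norm_triangle_ineq[of \<eta> \<zeta>] mu_ge_norm[of \<eta> e] mu_ge_norm[of \<zeta> e] by (simp add: \<xi>)
 have pos: "mu e \<eta> > 0" "mu e \<zeta> > 0" "mu e \<xi> > 0" by (auto simp: mu_pos)
 have split: "mu e \<xi> = ?q + norm \<xi>" using \<xi>(2) by (rule mu_nonzero)
 have sum_bound: "m \<le> 5 * (a + b)" if "m = q + n" "n \<le> a + b" "q \<le> n \<or> q \<le> 4 * b" "0 < a" "0 < b" for m q n a b :: real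
  using that(3)
 proof
  assume "q \<le> n" then show ?thesis using that unfolding distrib_left by linarith
 next
  assume "q \<le> 4 * b" then show ?thesis using that unfolding distrib_left by linarith
 qed
 have flat_case: ?thesis if "mu e \<xi> \<le> 5 * (mu e \<eta> + mu e \<zeta>)"
 proof -
  have "(mu e \<xi>)\<^sup>2 \<le> (5 * (mu e \<eta> + mu e \<zeta>))\<^sup>2" using that pos by (intro power_mono) auto
  also have "\<dots> = 25 * (mu e \<eta> + mu e \<zeta>)\<^sup>2" by (simp only: power_mult_distrib) simp
  also have "\<dots> \<le> 25 * (2 * ((mu e \<eta>)\<^sup>2 + (mu e \<zeta>)\<^sup>2))" by (intro mult_left_mono sum_square_le) auto
  finally have le: "(mu e \<xi>)\<^sup>2 \<le> 25 * (2 * ((mu e \<eta>)\<^sup>2 + (mu e \<zeta>)\<^sup>2))" .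
  have "x \<le> 50 * (a + b + p)" if "x \<le> 25 * (2 * (a + b))" "0 \<le> p" for x a b p :: real using that by simp
  from this[OF le P] show ?thesis .
 qed
 show ?thesis
 proof (cases "?q \<le> norm \<xi>")
  case True
  then show ?thesis by (intro flat_case sum_bound[OF split n _ pos(1,2)]) simp
 next
  case steep: False
  show ?thesis
  proof (cases "norm \<zeta> \<le> 2 * norm \<xi>")
   case True
   have "\<bar>\<xi> $ e\<bar> \<le> 2 * \<bar>\<zeta> $ e\<bar>" using le by (simp add: \<xi>)
   have "?q \<le> 4 * mu e \<zeta>"
   proof (cases "\<zeta> = 0")
    case True
    then show ?thesis using le \<xi> pos by simp
   next
    case False
    have "?q \<le> (2 * \<bar>\<zeta> $ e\<bar>) / (norm \<zeta> / 2)"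
     using \<open>\<bar>\<xi> $ e\<bar> \<le> 2 * \<bar>\<zeta> $ e\<bar>\<close> True False by (intro frac_le) auto
    also have "\<dots> \<le> 4 * mu e \<zeta>" using mu_ge_quotient[of \<zeta> e] by simp
    finally show ?thesis .
   qed
   then show ?thesis by (intro flat_case sum_bound[OF split n _ pos(1,2)]) simp
  next
   case False
   have "(mu e \<xi>)\<^sup>2 \<le> 16 * ?P"
    using je small \<xi>(1) le steep False by (intro mu_sum_near_cancellation) auto
   then show ?thesis using P pos by (smt (verit) zero_le_power2)
  qed
 qed
qed

lemma mu_sum:
 assumes je: "j \<noteq> e" and small: "norm \<eta> < 1" "norm \<zeta> < 1" and \<xi>: "\<eta> + \<zeta> \<noteq> 0"
 shows "(mu e (\<eta> + \<zeta>))\<^sup>2 \<le> 50 * ((mu e \<eta>)\<^sup>2 + (mu e \<zeta>)\<^sup>2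
  + (mu e \<eta>)\<^sup>2 * (mu e \<zeta>)\<^sup>2 * (low_kernel e j \<zeta> \<eta> + low_kernel e j \<eta> \<zeta>))"
proof (cases "\<bar>\<eta> $ e\<bar> \<le> \<bar>\<zeta> $ e\<bar>")
 case True
 from mu_sum_ordered[OF je small(1) refl \<xi> True]
 have "(mu e (\<eta> + \<zeta>))\<^sup>2 \<le> 50 * ((mu e \<eta>)\<^sup>2 + (mu e \<zeta>)\<^sup>2 + (mu e \<eta>)\<^sup>2 * (mu e \<zeta>)\<^sup>2 * low_kernel e j \<zeta> \<eta>)" .
 also have "\<dots> \<le> 50 * ((mu e \<eta>)\<^sup>2 + (mu e \<zeta>)\<^sup>2
  + (mu e \<eta>)\<^sup>2 * (mu e \<zeta>)\<^sup>2 * (low_kernel e j \<zeta> \<eta> + low_kernel e j \<eta> \<zeta>))"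
  using low_kernel_nonneg[of e j] by (intro mult_left_mono add_left_mono) auto
 finally show ?thesis .
next
 case False
 then have le: "\<bar>\<zeta> $ e\<bar> \<le> \<bar>\<eta> $ e\<bar>" by simp
 have comm: "\<eta> + \<zeta> = \<zeta> + \<eta>" by simp
 from mu_sum_ordered[OF je small(2) comm \<xi> le]
 have "(mu e (\<eta> + \<zeta>))\<^sup>2 \<le> 50 * ((mu e \<eta>)\<^sup>2 + (mu e \<zeta>)\<^sup>2 + (mu e \<eta>)\<^sup>2 * (mu e \<zeta>)\<^sup>2 * low_kernel e j \<eta> \<zeta>)"
  by (simp add: ac_simps)
 also have "\<dots> \<le> 50 * ((mu e \<eta>)\<^sup>2 + (mu e \<zeta>)\<^sup>2
  + (mu e \<eta>)\<^sup>2 * (mu e \<zeta>)\<^sup>2 * (low_kernel e j \<zeta> \<eta> + low_kernel e j \<eta> \<zeta>))"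
  using low_kernel_nonneg[of e j] by (intro mult_left_mono add_left_mono) auto
 finally show ?thesis .
qed

context anisotropic
begin

text \<open>The bound is uniform in \<open>\<zeta>\<close> because of \<open>4 * \<bar>\<zeta> $ e\<bar> \<le> (mu e \<zeta>)\<^sup>2\<close>.\<close>

lemma nn_integral_low_kernel:
 assumes j: "j \<noteq> e" "\<Gamma> j = Line"
 shows "\<exists>C<\<infinity>. \<forall>\<zeta>. (\<integral>\<^sup>+ \<eta>. ennreal (low_kernel e j \<zeta> \<eta>) \<partial>m) \<le> C"
proof -
 note e = two_lines(1)[OF j]
 define K where "K = (\<Prod>i\<in>UNIV - {e} - {j}. \<integral>\<^sup>+ t. indicator {-1..1} t \<partial>dual_coords \<Gamma> i)"
 have K: "K < \<infinity>" unfolding K_def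
  using dual_coords_bounded_finite by (auto simp: less_top[symmetric] ennreal_prod_eq_top less_imp_neq)
 have "(\<integral>\<^sup>+ \<eta>. ennreal (low_kernel e j \<zeta> \<eta>) \<partial>m) \<le> ennreal (pi\<^sup>2) * K" for \<zeta>
 proof (cases "\<zeta> $ e = 0")
  case True
  have "low_kernel e j \<zeta> \<eta> = 0" for \<eta>
  proof -
   have "kernel_factor e j \<zeta> j (\<eta> $ j) = 0" using True j(1) by (simp add: kernel_factor_def)
   then have "(\<Prod>i\<in>UNIV. kernel_factor e j \<zeta> i (\<eta> $ i)) = 0" by (intro prod_zero) auto
   then show ?thesis by (simp add: low_kernel_def)
  qed
  then show ?thesis by simp
 next
  case False
  then have \<zeta>: "\<zeta> \<noteq> 0" by auto
  let ?M = "inverse ((mu e \<zeta>)\<^sup>2)"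
  have [measurable]: "kernel_factor e j \<zeta> i \<in> borel_measurable borel" for i
   unfolding kernel_factor_def[abs_def] by measurable
  have fe: "(\<integral>\<^sup>+ t. ennreal (kernel_factor e j \<zeta> e t) \<partial>dual_coords \<Gamma> e) = ennreal pi"
   using nn_integral_cauchy[of "(norm \<zeta>)\<^sup>2" 0] \<zeta> e by (simp add: kernel_factor_def)
  have fj: "(\<integral>\<^sup>+ t. ennreal (kernel_factor e j \<zeta> j t) \<partial>dual_coords \<Gamma> j) = ennreal (2 * \<bar>\<zeta> $ e\<bar> * pi)"
  proof -
   let ?b = "2 * \<bar>\<zeta> $ e\<bar>"
   have "(\<integral>\<^sup>+ t. ennreal (kernel_factor e j \<zeta> j t) \<partial>dual_coords \<Gamma> j)
     = (\<integral>\<^sup>+ t. ennreal ?b * ennreal (?b / (?b\<^sup>2 + (t + \<zeta> $ j)\<^sup>2)) \<partial>lborel)"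
    using j by (simp add: kernel_factor_def flip: ennreal_mult)
   also have "\<dots> = ennreal ?b * (\<integral>\<^sup>+ t. ennreal (?b / (?b\<^sup>2 + (t + \<zeta> $ j)\<^sup>2)) \<partial>lborel)"
    by (rule nn_integral_cmult) measurable
   also have "\<dots> = ennreal (?b * pi)" using False by (subst nn_integral_cauchy) (auto simp: ennreal_mult)
   finally show ?thesis .
  qed
  have fr: "(\<Prod>i\<in>UNIV - {e} - {j}. \<integral>\<^sup>+ t. ennreal (kernel_factor e j \<zeta> i t) \<partial>dual_coords \<Gamma> i) = K"
   unfolding K_def by (intro prod.cong refl nn_integral_cong) (auto simp: kernel_factor_def ennreal_indicator)
  have "(\<integral>\<^sup>+ \<eta>. ennreal (low_kernel e j \<zeta> \<eta>) \<partial>m)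
    = (\<integral>\<^sup>+ \<eta>. ennreal ?M * (\<Prod>i\<in>UNIV. ennreal (kernel_factor e j \<zeta> i (\<eta> $ i))) \<partial>m)"
   by (intro nn_integral_cong)
    (simp add: low_kernel_def divide_inverse mult.commute prod_ennreal kernel_factor_nonneg prod_nonneg flip: ennreal_mult)
  also have "\<dots> = ennreal ?M * (\<integral>\<^sup>+ \<eta>. (\<Prod>i\<in>UNIV. ennreal (kernel_factor e j \<zeta> i (\<eta> $ i))) \<partial>m)"
   by (rule nn_integral_cmult) measurable
  also have "(\<integral>\<^sup>+ \<eta>. (\<Prod>i\<in>UNIV. ennreal (kernel_factor e j \<zeta> i (\<eta> $ i))) \<partial>m)
    = (\<Prod>i\<in>UNIV. \<integral>\<^sup>+ t. ennreal (kernel_factor e j \<zeta> i t) \<partial>dual_coords \<Gamma> i)"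
   unfolding dual_borel_def by (rule dual.nn_integral_vec_prod) measurable
  also have "\<dots> = ennreal pi * (ennreal (2 * \<bar>\<zeta> $ e\<bar> * pi) * K)"
   using j(1) unfolding fr[symmetric] fe[symmetric] fj[symmetric]
   by (subst prod.remove[of UNIV e], simp, simp, subst prod.remove[of "UNIV - {e}" j]) auto
  also have "ennreal ?M * (ennreal pi * (ennreal (2 * \<bar>\<zeta> $ e\<bar> * pi) * K)) = ennreal (?M * (2 * \<bar>\<zeta> $ e\<bar>) * pi\<^sup>2) * K"
  proof -
   have "ennreal (?M * (2 * \<bar>\<zeta> $ e\<bar>) * pi\<^sup>2) = ennreal (?M * (pi * (2 * \<bar>\<zeta> $ e\<bar> * pi)))"
    by (simp add: power2_eq_square mult.assoc mult.left_commute)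
   also have "\<dots> = ennreal ?M * (ennreal pi * ennreal (2 * \<bar>\<zeta> $ e\<bar> * pi))"
    by (subst ennreal_mult, simp, simp, subst ennreal_mult) auto
   finally show ?thesis by (simp only: mult.assoc)
  qed
  also have "\<dots> \<le> ennreal (pi\<^sup>2) * K"
  proof (intro mult_right_mono ennreal_leI)
   have "?M * (2 * \<bar>\<zeta> $ e\<bar>) \<le> 1" using mu_sq_ge[of \<zeta> e] mu_pos[of e \<zeta>] by (simp add: field_simps)
   then show "?M * (2 * \<bar>\<zeta> $ e\<bar>) * pi\<^sup>2 \<le> pi\<^sup>2" by (intro mult_left_le_one_le) auto
  qed simp
  finally show ?thesis .
 qed
 moreover have "ennreal (pi\<^sup>2) * K < \<infinity>" using K by (simp add: ennreal_mult_less_top)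
 ultimately show ?thesis by blast
qed

text \<open>The sum is at most twice as long as the longer summand, whose weight is comparable to \<open>bracket powr s\<close>.\<close>

lemma weight_sum_high:
 "\<exists>K>0. \<forall>\<eta>\<in>S. \<forall>\<zeta>\<in>S. norm \<eta> \<le> norm \<zeta> \<longrightarrow> \<not> low \<zeta> \<longrightarrow> weight (\<eta> + \<zeta>) \<le> K * weight \<zeta>"
proof -
 obtain c where c: "c > 0" "\<And>\<xi>. \<xi> \<in> S ==> \<not> low \<xi> ==> bracket \<xi> powr s \<le> c * weight \<xi>"
  using weight_ge by blast
 have "weight (\<eta> + \<zeta>) \<le> (2 * 2 powr s * c) * weight \<zeta>"
  if "\<zeta> \<in> S" "norm \<eta> \<le> norm \<zeta>" "\<not> low \<zeta>" for \<eta> \<zeta>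
 proof -
  have "norm (\<eta> + \<zeta>) \<le> 2 * norm \<zeta>" using norm_triangle_ineq[of \<eta> \<zeta>] that(2) by linarith
  then have "bracket (\<eta> + \<zeta>) powr s \<le> (2 * bracket \<zeta>) powr s"
   using s_pos bracket_pos[of "\<eta> + \<zeta>"] by (intro powr_mono2 bracket_mono_double) auto
  also have "\<dots> = 2 powr s * bracket \<zeta> powr s" using bracket_pos[of \<zeta>] by (simp add: powr_mult)
  also have "\<dots> \<le> 2 powr s * (c * weight \<zeta>)" using c(2)[OF that(1,3)] by (intro mult_left_mono) auto
  finally show ?thesis using weight_le[of "\<eta> + \<zeta>"] by simp
 qed
 then show ?thesis using c(1) by (intro exI[of _ "2 * 2 powr s * c"]) auto
qed

text \<open>
 A multiple of \<open>1 / weight \<eta>\<close> is a kernel for sums of frequencies that are not both low, and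
 \<open>low_kernel\<close> is added for the others.  If there are two lines, then \<open>\<xi> = 0\<close> has to be excluded:
 there \<open>mu e \<xi>\<close> is one by definition, while it may be arbitrarily small at \<open>\<eta>\<close> and \<open>\<zeta> = - \<eta>\<close>.
\<close>

theorem weight_sum_kernel:
 obtains k :: "real ^ 'n => real ^ 'n => real" and C :: ennreal where
  "C < \<infinity>" "\<And>\<zeta> \<eta>. 0 \<le> k \<zeta> \<eta>"
  "\<And>\<zeta>. (\<integral>\<^sup>+ \<eta>. ennreal ((k \<zeta> \<eta>)\<^sup>2) \<partial>m) \<le> C"
  "(\<lambda>(\<zeta>, \<eta>). k \<zeta> \<eta>) \<in> borel_measurable (m \<Otimes>\<^sub>M m)"
  "AE \<xi> in m. \<forall>\<eta>\<in>S. \<forall>\<zeta>\<in>S. \<xi> = \<eta> + \<zeta> \<longrightarrow> weight \<xi> \<le> weight \<eta> * weight \<zeta> * (k \<zeta> \<eta> + k \<eta> \<zeta>)"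
proof -
 define two where "two \<longleftrightarrow> (\<exists>j. j \<noteq> e \<and> \<Gamma> j = Line)"
 define j where "j = (SOME j. j \<noteq> e \<and> \<Gamma> j = Line)"
 have j: "j \<noteq> e" "\<Gamma> j = Line" if two
  using someI_ex[of "\<lambda>j. j \<noteq> e \<and> \<Gamma> j = Line"] that by (auto simp: two_def j_def)
 define P where "P \<zeta> \<eta> = (if two then low_kernel e j \<zeta> \<eta> else 0)" for \<zeta> \<eta>
 have P0: "0 \<le> P \<zeta> \<eta>" for \<zeta> \<eta> by (simp add: P_def low_kernel_nonneg)
 obtain CP where CP: "CP < \<infinity>" "\<And>\<zeta>. (\<integral>\<^sup>+ \<eta>. ennreal (P \<zeta> \<eta>) \<partial>m) \<le> CP"
 proof (cases two)
  case True
  from nn_integral_low_kernel[OF j[OF True]] show ?thesis using that True by (auto simp: P_def)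
 next
  case False
  then show ?thesis using that[of 0] by (simp add: P_def)
 qed
 obtain K where K: "K > 0" "\<And>\<eta> \<zeta>. \<eta> \<in> S ==> \<zeta> \<in> S ==> norm \<eta> \<le> norm \<zeta> ==> \<not> low \<zeta> ==> weight (\<eta> + \<zeta>) \<le> K * weight \<zeta>"
  using weight_sum_high by blast
 \<comment> \<open>large enough for the estimate away from the origin and for the one near it\<close>
 define A where "A = K\<^sup>2 + 50 * (2 powr s)\<^sup>2"
 have A: "A > 0" "K\<^sup>2 \<le> A" "50 * (2 powr s)\<^sup>2 \<le> A" using K(1) by (auto simp: A_def add_pos_nonneg)
 define \<Phi> where "\<Phi> \<zeta> \<eta> = A * (inverse ((weight \<eta>)\<^sup>2) + P \<zeta> \<eta>)" for \<zeta> \<eta>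
 have \<Phi>0: "0 \<le> \<Phi> \<zeta> \<eta>" for \<zeta> \<eta> using A P0 by (simp add: \<Phi>_def)
 have key: "(weight (\<eta> + \<zeta>))\<^sup>2 \<le> (weight \<eta>)\<^sup>2 * (weight \<zeta>)\<^sup>2 * (\<Phi> \<zeta> \<eta> + \<Phi> \<eta> \<zeta>)"
  if S: "\<eta> \<in> S" "\<zeta> \<in> S" and nz: "two \<longrightarrow> \<eta> + \<zeta> \<noteq> 0" for \<eta> \<zeta>
 proof -
  let ?a = "(weight \<eta>)\<^sup>2" and ?b = "(weight \<zeta>)\<^sup>2"
  have ab: "0 < ?a" "0 < ?b" using weight_pos[of \<eta>] weight_pos[of \<zeta>] by auto
  have rhs: "?a * ?b * (\<Phi> \<zeta> \<eta> + \<Phi> \<eta> \<zeta>) = A * (?a + ?b + ?a * ?b * (P \<zeta> \<eta> + P \<eta> \<zeta>))"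
   using ab by (simp add: \<Phi>_def algebra_simps)
  have PP: "0 \<le> ?a * ?b * (P \<zeta> \<eta> + P \<eta> \<zeta>)" using P0 by simp
  have high: ?thesis if "weight (\<eta> + \<zeta>) \<le> K * w" "w\<^sup>2 \<le> ?a + ?b" for w
  proof -
   have "(weight (\<eta> + \<zeta>))\<^sup>2 \<le> (K * w)\<^sup>2" using that(1) weight_pos[of "\<eta> + \<zeta>"] by (intro power_mono) auto
   also have "\<dots> = K\<^sup>2 * w\<^sup>2" by (simp add: power_mult_distrib)
   also have "\<dots> \<le> A * (?a + ?b)" using that(2) A by (intro mult_mono) auto
   also have "\<dots> \<le> A * (?a + ?b + ?a * ?b * (P \<zeta> \<eta> + P \<eta> \<zeta>))" using A PP by (intro mult_left_mono) auto
   finally show ?thesis by (simp only: rhs)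
  qed
  show ?thesis
  proof (cases "low \<eta> \<and> low \<zeta>")
   case False
   show ?thesis
   proof (cases "norm \<eta> \<le> norm \<zeta>")
    case True
    then have "\<not> low \<zeta>" using False by (auto simp: low_def)
    from K(2)[OF S True this] ab show ?thesis by (intro high) auto
   next
    case le: False
    then have "\<not> low \<eta>" using False by (auto simp: low_def)
    from K(2)[OF S(2,1) _ this] le ab show ?thesis by (intro high[of "weight \<eta>"]) (auto simp: add.commute)
   qed
  next
   case True
   then have two and small: "norm \<eta> < 1 / 4" "norm \<zeta> < 1 / 4" by (auto simp: low_def two_def)
   let ?P = "low_kernel e j \<zeta> \<eta> + low_kernel e j \<eta> \<zeta>"
   have LK: "0 \<le> ?P" using low_kernel_nonneg[of e j] by simp
   have s1: "s > 1" using two_lines j \<open>two\<close> by blast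
   have "bracket (\<eta> + \<zeta>) \<le> 2"
    using bracket_le[of "\<eta> + \<zeta>"] norm_triangle_ineq[of \<eta> \<zeta>] small by linarith
   then have "bracket (\<eta> + \<zeta>) powr (s - 1) \<le> 2 powr (s - 1)"
    using s1 bracket_pos[of "\<eta> + \<zeta>"] by (intro powr_mono2) auto
   also have "\<dots> \<le> 2 powr s" by simp
   finally have "weight (\<eta> + \<zeta>) \<le> mu e (\<eta> + \<zeta>) * 2 powr s"
    unfolding weight_def using mu_pos[of e "\<eta> + \<zeta>"] by (intro mult_left_mono) auto
   then have "(weight (\<eta> + \<zeta>))\<^sup>2 \<le> (mu e (\<eta> + \<zeta>) * 2 powr s)\<^sup>2"
    using weight_pos[of "\<eta> + \<zeta>"] by (intro power_mono) auto
   also have "\<dots> = (2 powr s)\<^sup>2 * (mu e (\<eta> + \<zeta>))\<^sup>2" by (simp add: power_mult_distrib mult.commute)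
   also have "\<dots> \<le> (2 powr s)\<^sup>2 * (50 * ((mu e \<eta>)\<^sup>2 + (mu e \<zeta>)\<^sup>2 + (mu e \<eta>)\<^sup>2 * (mu e \<zeta>)\<^sup>2 * ?P))"
    using small nz \<open>two\<close> j by (intro mult_left_mono mu_sum) auto
   also have "\<dots> \<le> (2 powr s)\<^sup>2 * (50 * (?a + ?b + ?a * ?b * ?P))"
   proof -
    have \<mu>: "(mu e \<eta>)\<^sup>2 \<le> ?a" "(mu e \<zeta>)\<^sup>2 \<le> ?b"
     using low_weight True mu_pos[of e \<eta>] mu_pos[of e \<zeta>] by (auto intro!: power_mono)
    have "(mu e \<eta>)\<^sup>2 * (mu e \<zeta>)\<^sup>2 * ?P \<le> ?a * ?b * ?P"
     using \<mu> LK by (intro mult_right_mono mult_mono) auto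
    then show ?thesis using \<mu> by (intro mult_left_mono) auto
   qed
   also have "\<dots> = (50 * (2 powr s)\<^sup>2) * (?a + ?b + ?a * ?b * ?P)" by simp
   also have "\<dots> \<le> A * (?a + ?b + ?a * ?b * ?P)" using A(3) ab LK by (intro mult_right_mono) auto
   also have "?P = P \<zeta> \<eta> + P \<eta> \<zeta>" using \<open>two\<close> by (simp add: P_def)
   finally show ?thesis by (simp only: rhs)
  qed
 qed
 let ?I = "\<integral>\<^sup>+ \<eta>. ennreal (inverse ((weight \<eta>)\<^sup>2)) \<partial>m"
 show ?thesis
 proof (rule that[of "ennreal A * (?I + CP)" "\<lambda>\<zeta> \<eta>. sqrt (\<Phi> \<zeta> \<eta>)"])
  show "ennreal A * (?I + CP) < \<infinity>" using nn_integral_weight CP(1) by (simp add: ennreal_mult_less_top)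
  show "0 \<le> sqrt (\<Phi> \<zeta> \<eta>)" for \<zeta> \<eta> using \<Phi>0 by simp
  show "(\<integral>\<^sup>+ \<eta>. ennreal ((sqrt (\<Phi> \<zeta> \<eta>))\<^sup>2) \<partial>m) \<le> ennreal A * (?I + CP)" for \<zeta>
  proof -
   have [measurable]: "(\<lambda>\<eta>. P \<zeta> \<eta>) \<in> borel_measurable borel"
   proof -
    have "(\<lambda>\<eta>. low_kernel e j \<zeta> \<eta>) \<in> borel_measurable borel" by (rule low_kernel_borel) auto
    then show ?thesis by (cases two) (simp_all add: P_def)
   qed
   have "(\<integral>\<^sup>+ \<eta>. ennreal ((sqrt (\<Phi> \<zeta> \<eta>))\<^sup>2) \<partial>m)
     = (\<integral>\<^sup>+ \<eta>. ennreal A * (ennreal (inverse ((weight \<eta>)\<^sup>2)) + ennreal (P \<zeta> \<eta>)) \<partial>m)"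
   proof (rule nn_integral_cong)
    fix \<eta>
    have "(sqrt (\<Phi> \<zeta> \<eta>))\<^sup>2 = A * (inverse ((weight \<eta>)\<^sup>2) + P \<zeta> \<eta>)" using \<Phi>0[of \<zeta> \<eta>] by (simp add: \<Phi>_def)
    moreover have "ennreal (A * (inverse ((weight \<eta>)\<^sup>2) + P \<zeta> \<eta>)) = ennreal A * ennreal (inverse ((weight \<eta>)\<^sup>2) + P \<zeta> \<eta>)"
     using A(1) P0[of \<zeta> \<eta>] by (intro ennreal_mult) auto
    moreover have "ennreal (inverse ((weight \<eta>)\<^sup>2) + P \<zeta> \<eta>) = ennreal (inverse ((weight \<eta>)\<^sup>2)) + ennreal (P \<zeta> \<eta>)"
     using P0[of \<zeta> \<eta>] by (intro ennreal_plus) auto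
    ultimately show "ennreal ((sqrt (\<Phi> \<zeta> \<eta>))\<^sup>2) = ennreal A * (ennreal (inverse ((weight \<eta>)\<^sup>2)) + ennreal (P \<zeta> \<eta>))"
     by (simp only:)
   qed
   also have "\<dots> = ennreal A * (?I + (\<integral>\<^sup>+ \<eta>. ennreal (P \<zeta> \<eta>) \<partial>m))"
    by (subst nn_integral_cmult, measurable, subst nn_integral_add) auto
   also have "\<dots> \<le> ennreal A * (?I + CP)" by (intro mult_left_mono add_left_mono CP) auto
   finally show ?thesis .
  qed
  show "(\<lambda>(\<zeta>, \<eta>). sqrt (\<Phi> \<zeta> \<eta>)) \<in> borel_measurable (m \<Otimes>\<^sub>M m)"
  proof -
   have [measurable]: "(\<lambda>p. P (fst p) (snd p)) \<in> borel_measurable (m \<Otimes>\<^sub>M m)"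
   proof -
    have "(\<lambda>p. low_kernel e j (fst p) (snd p)) \<in> borel_measurable (m \<Otimes>\<^sub>M m)"
     by (rule low_kernel_borel) measurable
    then show ?thesis by (cases two) (simp_all add: P_def)
   qed
   have [measurable]: "(\<lambda>p. weight (snd p)) \<in> borel_measurable (m \<Otimes>\<^sub>M m)"
    by (rule measurable_compose[OF _ weight_borel]) measurable
   show ?thesis unfolding \<Phi>_def case_prod_beta by measurable
  qed
  have "AE \<xi> in m. two \<longrightarrow> \<xi> \<noteq> 0"
  proof (cases two)
   case True
   from AE_line_nonzero[OF j(2)[OF True]] show ?thesis by eventually_elim auto
  qed simp
  then show "AE \<xi> in m. \<forall>\<eta>\<in>S. \<forall>\<zeta>\<in>S. \<xi> = \<eta> + \<zeta> \<longrightarrow> weight \<xi> \<le> weight \<eta> * weight \<zeta> * (sqrt (\<Phi> \<zeta> \<eta>) + sqrt (\<Phi> \<eta> \<zeta>))"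
  proof (eventually_elim, intro ballI impI)
   fix \<xi> \<eta> \<zeta> assume nz: "two \<longrightarrow> \<xi> \<noteq> 0" and S: "\<eta> \<in> S" "\<zeta> \<in> S" and \<xi>: "\<xi> = \<eta> + \<zeta>"
   have "weight \<xi> = sqrt ((weight (\<eta> + \<zeta>))\<^sup>2)" using weight_pos[of \<xi>] by (simp add: \<xi>)
   also have "\<dots> \<le> sqrt ((weight \<eta>)\<^sup>2 * (weight \<zeta>)\<^sup>2 * (\<Phi> \<zeta> \<eta> + \<Phi> \<eta> \<zeta>))"
    using key[OF S] nz \<xi> by (intro real_sqrt_le_mono) auto
   also have "\<dots> = weight \<eta> * weight \<zeta> * sqrt (\<Phi> \<zeta> \<eta> + \<Phi> \<eta> \<zeta>)"
    using weight_pos[of \<eta>] weight_pos[of \<zeta>] by (simp add: real_sqrt_mult)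
   also have "\<dots> \<le> weight \<eta> * weight \<zeta> * (sqrt (\<Phi> \<zeta> \<eta>) + sqrt (\<Phi> \<eta> \<zeta>))"
    using weight_pos[of \<eta>] weight_pos[of \<zeta>] \<Phi>0 by (intro mult_left_mono sqrt_add_le_add_sqrt) auto
   finally show "weight \<xi> \<le> weight \<eta> * weight \<zeta> * (sqrt (\<Phi> \<zeta> \<eta>) + sqrt (\<Phi> \<eta> \<zeta>))" .
  qed
 qed
qed

end

section \<open>The bilinear estimate\<close>

context anisotropic
begin

text \<open>The reciprocal weight is square-integrable, so the transforms of elements of the space are integrable.\<close>

lemma nn_integral_by_weight:
 assumes [measurable]: "F \<in> borel_measurable borel"
 shows "(\<integral>\<^sup>+ \<xi>. F \<xi> \<partial>m)\<^sup>2
  \<le> (\<integral>\<^sup>+ \<xi>. ennreal (inverse ((weight \<xi>)\<^sup>2)) \<partial>m) * (\<integral>\<^sup>+ \<xi>. (ennreal (weight \<xi>) * F \<xi>)\<^sup>2 \<partial>m)"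
proof -
 have one: "ennreal (inverse (weight \<xi>)) * (ennreal (weight \<xi>) * F \<xi>) = F \<xi>" for \<xi>
 proof -
  have "ennreal (inverse (weight \<xi>)) * ennreal (weight \<xi>) = 1"
   using weight_pos[of \<xi>] by (simp flip: ennreal_mult)
  then show ?thesis by (simp flip: mult.assoc)
 qed
 have "(\<integral>\<^sup>+ \<xi>. ennreal (inverse (weight \<xi>)) * (ennreal (weight \<xi>) * F \<xi>) \<partial>m)\<^sup>2
  \<le> (\<integral>\<^sup>+ \<xi>. (ennreal (inverse (weight \<xi>)))\<^sup>2 \<partial>m) * (\<integral>\<^sup>+ \<xi>. (ennreal (weight \<xi>) * F \<xi>)\<^sup>2 \<partial>m)"
  by (rule Cauchy_Schwarz_nn_integral) measurable
 moreover have "(ennreal (inverse (weight \<xi>)))\<^sup>2 = ennreal (inverse ((weight \<xi>)\<^sup>2))" for \<xi>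
  using weight_pos[of \<xi>] by (simp add: power2_eq_square flip: ennreal_mult)
 ultimately show ?thesis by (simp only: one)
qed

lemma pair_sigma_finite_dual: "pair_sigma_finite m m"
 by (intro pair_sigma_finite.intro sigma_finite_dual)

text \<open>
 Cauchy--Schwarz on the product: the kernel is grouped with the function of \<open>\<zeta>\<close>, and the test function
 \<open>H\<close> with the function of \<open>\<eta>\<close>, so that each factor can be integrated first in the variable in
 which it is uniformly square-integrable.
\<close>

lemma kernel_trilinear:
 fixes k :: "real ^ 'n => real ^ 'n => ennreal"
 assumes k [measurable]: "(\<lambda>p. k (fst p) (snd p)) \<in> borel_measurable (m \<Otimes>\<^sub>M m)"
  and C: "\<And>\<zeta>. (\<integral>\<^sup>+ \<eta>. (k \<zeta> \<eta>)\<^sup>2 \<partial>m) \<le> C"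
  and [measurable]: "f \<in> borel_measurable borel" "g \<in> borel_measurable borel" "H \<in> borel_measurable borel"
 shows "(\<integral>\<^sup>+ \<zeta>. \<integral>\<^sup>+ \<eta>. (g \<zeta> * k \<zeta> \<eta>) * (f \<eta> * H (\<zeta> + \<eta>)) \<partial>m \<partial>m)\<^sup>2
  \<le> C * ((\<integral>\<^sup>+ \<eta>. (f \<eta>)\<^sup>2 \<partial>m) * (\<integral>\<^sup>+ \<zeta>. (g \<zeta>)\<^sup>2 \<partial>m)) * (\<integral>\<^sup>+ \<xi>. (H \<xi>)\<^sup>2 \<partial>m)"
proof -
 interpret P: pair_sigma_finite m m by (rule pair_sigma_finite_dual)
 let ?u = "\<lambda>p. g (fst p) * k (fst p) (snd p)" and ?v = "\<lambda>p. f (snd p) * H (fst p + snd p)"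
 have [measurable]: "?u \<in> borel_measurable (m \<Otimes>\<^sub>M m)" "?v \<in> borel_measurable (m \<Otimes>\<^sub>M m)" by measurable
 have [measurable]: "k \<zeta> \<in> borel_measurable borel" for \<zeta>
  using measurable_compose[OF measurable_Pair[OF measurable_const[of \<zeta> m m] measurable_ident] k] by simp
 have "(\<integral>\<^sup>+ \<zeta>. \<integral>\<^sup>+ \<eta>. (g \<zeta> * k \<zeta> \<eta>) * (f \<eta> * H (\<zeta> + \<eta>)) \<partial>m \<partial>m) = (\<integral>\<^sup>+ p. ?u p * ?v p \<partial>(m \<Otimes>\<^sub>M m))"
  using P.M1.nn_integral_fst[of "\<lambda>p. ?u p * ?v p" m] by simp
 also have "\<dots>\<^sup>2 \<le> (\<integral>\<^sup>+ p. (?u p)\<^sup>2 \<partial>(m \<Otimes>\<^sub>M m)) * (\<integral>\<^sup>+ p. (?v p)\<^sup>2 \<partial>(m \<Otimes>\<^sub>M m))"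
  by (rule Cauchy_Schwarz_nn_integral) measurable
 also have "(\<integral>\<^sup>+ p. (?u p)\<^sup>2 \<partial>(m \<Otimes>\<^sub>M m)) \<le> C * (\<integral>\<^sup>+ \<zeta>. (g \<zeta>)\<^sup>2 \<partial>m)"
 proof -
  have "(\<integral>\<^sup>+ p. (?u p)\<^sup>2 \<partial>(m \<Otimes>\<^sub>M m)) = (\<integral>\<^sup>+ \<zeta>. \<integral>\<^sup>+ \<eta>. (g \<zeta> * k \<zeta> \<eta>)\<^sup>2 \<partial>m \<partial>m)"
   using P.M1.nn_integral_fst[of "\<lambda>p. (?u p)\<^sup>2" m] by simp
  also have "\<dots> = (\<integral>\<^sup>+ \<zeta>. (g \<zeta>)\<^sup>2 * (\<integral>\<^sup>+ \<eta>. (k \<zeta> \<eta>)\<^sup>2 \<partial>m) \<partial>m)"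
   unfolding power_mult_distrib by (intro nn_integral_cong nn_integral_cmult) measurable
  also have "\<dots> \<le> (\<integral>\<^sup>+ \<zeta>. (g \<zeta>)\<^sup>2 * C \<partial>m)" by (intro nn_integral_mono mult_left_mono C) auto
  also have "\<dots> = C * (\<integral>\<^sup>+ \<zeta>. (g \<zeta>)\<^sup>2 \<partial>m)" by (subst nn_integral_multc) (auto simp: mult.commute)
  finally show ?thesis .
 qed
 also have "(\<integral>\<^sup>+ p. (?v p)\<^sup>2 \<partial>(m \<Otimes>\<^sub>M m)) = (\<integral>\<^sup>+ \<eta>. (f \<eta>)\<^sup>2 \<partial>m) * (\<integral>\<^sup>+ \<xi>. (H \<xi>)\<^sup>2 \<partial>m)"
 proof -
  have "(\<integral>\<^sup>+ p. (?v p)\<^sup>2 \<partial>(m \<Otimes>\<^sub>M m)) = (\<integral>\<^sup>+ \<eta>. \<integral>\<^sup>+ \<zeta>. (f \<eta> * H (\<zeta> + \<eta>))\<^sup>2 \<partial>m \<partial>m)"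
   using P.nn_integral_snd[of "\<lambda>p. (?v p)\<^sup>2"] by simp
  also have "\<dots> = (\<integral>\<^sup>+ \<eta>. (f \<eta>)\<^sup>2 * (\<integral>\<^sup>+ \<zeta>. (H (\<zeta> + \<eta>))\<^sup>2 \<partial>m) \<partial>m)"
   unfolding power_mult_distrib by (intro nn_integral_cong nn_integral_cmult) measurable
  also have "\<dots> = (\<integral>\<^sup>+ \<eta>. (f \<eta>)\<^sup>2 * (\<integral>\<^sup>+ \<xi>. (H \<xi>)\<^sup>2 \<partial>m) \<partial>m)"
  proof (rule nn_integral_cong_AE)
   show "AE \<eta> in m. (f \<eta>)\<^sup>2 * (\<integral>\<^sup>+ \<zeta>. (H (\<zeta> + \<eta>))\<^sup>2 \<partial>m) = (f \<eta>)\<^sup>2 * (\<integral>\<^sup>+ \<xi>. (H \<xi>)\<^sup>2 \<partial>m)"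
    using AE_dual_group
   proof eventually_elim
    case (elim \<eta>)
    have "(\<integral>\<^sup>+ \<zeta>. (H (\<zeta> + \<eta>))\<^sup>2 \<partial>m) = (\<integral>\<^sup>+ \<xi>. (H \<xi>)\<^sup>2 \<partial>m)"
     by (rule nn_integral_dual_translate[OF elim, of "\<lambda>\<xi>. (H \<xi>)\<^sup>2"]) measurable
    then show ?case by simp
   qed
  qed
  also have "\<dots> = (\<integral>\<^sup>+ \<eta>. (f \<eta>)\<^sup>2 \<partial>m) * (\<integral>\<^sup>+ \<xi>. (H \<xi>)\<^sup>2 \<partial>m)" by (rule nn_integral_multc) measurable
  finally show ?thesis .
 qed
 finally show ?thesis by (simp only: ac_simps) (simp add: mult_right_mono)
qed

definition convolution :: "(real ^ 'n => ennreal) => (real ^ 'n => ennreal) => real ^ 'n => ennreal" where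
 "convolution F G \<xi> = (\<integral>\<^sup>+ \<eta>. F \<eta> * G (\<xi> - \<eta>) \<partial>m)"

lemma convolution_borel:
 assumes [measurable]: "F \<in> borel_measurable borel" "G \<in> borel_measurable borel"
 shows "convolution F G \<in> borel_measurable borel"
proof -
 interpret m: sigma_finite_measure m by (rule sigma_finite_dual)
 have "(\<lambda>\<xi>. \<integral>\<^sup>+ \<eta>. F \<eta> * G (\<xi> - \<eta>) \<partial>m) \<in> borel_measurable borel"
  by (rule m.borel_measurable_nn_integral) measurable
 then show ?thesis by (simp add: convolution_def[abs_def])
qed

text \<open>Fubini, and the invariance of the dual measure under the translation of the inner variable.\<close>

lemma nn_integral_convolution:
 fixes R :: "real ^ 'n => real ^ 'n => real ^ 'n => ennreal"
 assumes R [measurable]: "(\<lambda>p. R (fst p) (snd p) (fst p - snd p)) \<in> borel_measurable (m \<Otimes>\<^sub>M m)"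
  and R' [measurable]: "\<And>\<eta>. (\<lambda>\<xi>. R \<xi> \<eta> (\<xi> - \<eta>)) \<in> borel_measurable borel"
 shows "(\<integral>\<^sup>+ \<xi>. \<integral>\<^sup>+ \<eta>. R \<xi> \<eta> (\<xi> - \<eta>) \<partial>m \<partial>m) = (\<integral>\<^sup>+ \<eta>. \<integral>\<^sup>+ \<zeta>. R (\<zeta> + \<eta>) \<eta> \<zeta> \<partial>m \<partial>m)"
proof -
 interpret P: pair_sigma_finite m m by (rule pair_sigma_finite_dual)
 have "(\<integral>\<^sup>+ \<xi>. \<integral>\<^sup>+ \<eta>. R \<xi> \<eta> (\<xi> - \<eta>) \<partial>m \<partial>m) = (\<integral>\<^sup>+ \<eta>. \<integral>\<^sup>+ \<xi>. R \<xi> \<eta> (\<xi> - \<eta>) \<partial>m \<partial>m)"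
  using P.Fubini'[of "\<lambda>\<xi> \<eta>. R \<xi> \<eta> (\<xi> - \<eta>)"] by (simp add: case_prod_beta)
 also have "\<dots> = (\<integral>\<^sup>+ \<eta>. \<integral>\<^sup>+ \<zeta>. R (\<zeta> + \<eta>) \<eta> \<zeta> \<partial>m \<partial>m)"
 proof (rule nn_integral_cong_AE)
  show "AE \<eta> in m. (\<integral>\<^sup>+ \<xi>. R \<xi> \<eta> (\<xi> - \<eta>) \<partial>m) = (\<integral>\<^sup>+ \<zeta>. R (\<zeta> + \<eta>) \<eta> \<zeta> \<partial>m)"
   using AE_dual_group
  proof eventually_elim
   case (elim \<eta>)
   from nn_integral_dual_translate[OF elim R'[of \<eta>]] show ?case by simp
  qed
 qed
 finally show ?thesis .
qed

lemma le_of_square_le: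
 fixes X B :: ennreal
 assumes "X\<^sup>2 \<le> B * X" "X < \<infinity>" shows "X \<le> B"
proof (rule ccontr)
 assume "\<not> X \<le> B"
 then have "B < X" by simp
 then have "X \<noteq> 0" by auto
 from \<open>B < X\<close> have "B * X < X * X" using \<open>X \<noteq> 0\<close> \<open>X < \<infinity>\<close>
  by (metis ennreal_mult_strict_right_mono infinity_ennreal_def less_top not_gr_zero)
 then show False using assms(1) by (simp add: power2_eq_square)
qed

text \<open>
 By duality: the weighted convolution is tested against its own truncations, which have finite norm.
\<close>

theorem weighted_convolution:
 "\<exists>C<\<infinity>. \<forall>F\<in>borel_measurable borel. \<forall>G\<in>borel_measurable borel.
  (\<integral>\<^sup>+ \<xi>. (ennreal (weight \<xi>) * convolution F G \<xi>)\<^sup>2 \<partial>m)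
   \<le> C * ((\<integral>\<^sup>+ \<xi>. (ennreal (weight \<xi>) * F \<xi>)\<^sup>2 \<partial>m) * (\<integral>\<^sup>+ \<xi>. (ennreal (weight \<xi>) * G \<xi>)\<^sup>2 \<partial>m))"
proof -
 obtain k :: "real ^ 'n => real ^ 'n => real" and C :: ennreal where C: "C < \<infinity>" and k0: "\<And>\<zeta> \<eta>. 0 \<le> k \<zeta> \<eta>"
  and kC: "\<And>\<zeta>. (\<integral>\<^sup>+ \<eta>. ennreal ((k \<zeta> \<eta>)\<^sup>2) \<partial>m) \<le> C"
  and kb: "(\<lambda>(\<zeta>, \<eta>). k \<zeta> \<eta>) \<in> borel_measurable (m \<Otimes>\<^sub>M m)"
  and kw: "AE \<xi> in m. \<forall>\<eta>\<in>S. \<forall>\<zeta>\<in>S. \<xi> = \<eta> + \<zeta> \<longrightarrow> weight \<xi> \<le> weight \<eta> * weight \<zeta> * (k \<zeta> \<eta> + k \<eta> \<zeta>)"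
  by (rule weight_sum_kernel) (rule that; assumption)
 let ?k = "\<lambda>\<zeta> \<eta>. ennreal (k \<zeta> \<eta>)"
 have kC': "(\<integral>\<^sup>+ \<eta>. (?k \<zeta> \<eta>)\<^sup>2 \<partial>m) \<le> C" for \<zeta>
  using kC[of \<zeta>] k0 by (simp add: ennreal_power)
 have [measurable]: "(\<lambda>p. k (f p) (g p)) \<in> borel_measurable M"
  if "f \<in> M \<rightarrow>\<^sub>M borel" "g \<in> M \<rightarrow>\<^sub>M borel" for f g and M :: "(real ^ 'n) measure"
 proof -
  have "(\<lambda>p. (f p, g p)) \<in> M \<rightarrow>\<^sub>M m \<Otimes>\<^sub>M m" using that by measurable
  from measurable_compose[OF this kb] show ?thesis by simp
 qed
 have [measurable]: "(\<lambda>p. k (f p) (g p)) \<in> borel_measurable M"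
  if "f \<in> M \<rightarrow>\<^sub>M borel" "g \<in> M \<rightarrow>\<^sub>M borel" for f g and M :: "((real ^ 'n) \<times> (real ^ 'n)) measure"
 proof -
  have "(\<lambda>p. (f p, g p)) \<in> M \<rightarrow>\<^sub>M m \<Otimes>\<^sub>M m" using that by measurable
  from measurable_compose[OF this kb] show ?thesis by simp
 qed
 have "(\<integral>\<^sup>+ \<xi>. (ennreal (weight \<xi>) * convolution F G \<xi>)\<^sup>2 \<partial>m)
   \<le> (4 * C) * ((\<integral>\<^sup>+ \<xi>. (ennreal (weight \<xi>) * F \<xi>)\<^sup>2 \<partial>m) * (\<integral>\<^sup>+ \<xi>. (ennreal (weight \<xi>) * G \<xi>)\<^sup>2 \<partial>m))"
  if F [measurable]: "F \<in> borel_measurable borel" and G [measurable]: "G \<in> borel_measurable borel" for F G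
 proof -
  let ?f = "\<lambda>\<eta>. ennreal (weight \<eta>) * F \<eta>" and ?g = "\<lambda>\<zeta>. ennreal (weight \<zeta>) * G \<zeta>"
  let ?N = "(\<integral>\<^sup>+ \<xi>. (?f \<xi>)\<^sup>2 \<partial>m) * (\<integral>\<^sup>+ \<xi>. (?g \<xi>)\<^sup>2 \<partial>m)"
  let ?U = "\<lambda>\<xi>. ennreal (weight \<xi>) * convolution F G \<xi>"
  note convolution_borel[OF F G, measurable]
  have dual_bound: "(\<integral>\<^sup>+ \<xi>. H \<xi> * ?U \<xi> \<partial>m)\<^sup>2 \<le> (4 * C) * ?N * (\<integral>\<^sup>+ \<xi>. (H \<xi>)\<^sup>2 \<partial>m)"
   if H [measurable]: "H \<in> borel_measurable borel" for H
  proof -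
   interpret P: pair_sigma_finite m m by (rule pair_sigma_finite_dual)
   define R where "R \<xi> \<eta> \<zeta> = (?g \<zeta> * ?k \<zeta> \<eta>) * (?f \<eta> * H \<xi>) + (?f \<eta> * ?k \<eta> \<zeta>) * (?g \<zeta> * H \<xi>)" for \<xi> \<eta> \<zeta>
   let ?J = "\<lambda>f g. \<integral>\<^sup>+ \<zeta>. \<integral>\<^sup>+ \<eta>. (g \<zeta> * ?k \<zeta> \<eta>) * (f \<eta> * H (\<zeta> + \<eta>)) \<partial>m \<partial>m"
   have "(\<integral>\<^sup>+ \<xi>. H \<xi> * ?U \<xi> \<partial>m) \<le> (\<integral>\<^sup>+ \<xi>. \<integral>\<^sup>+ \<eta>. R \<xi> \<eta> (\<xi> - \<eta>) \<partial>m \<partial>m)"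
   proof (rule nn_integral_mono_AE)
    show "AE \<xi> in m. H \<xi> * ?U \<xi> \<le> (\<integral>\<^sup>+ \<eta>. R \<xi> \<eta> (\<xi> - \<eta>) \<partial>m)"
     using kw AE_dual_group
    proof eventually_elim
     case (elim \<xi>)
     have "H \<xi> * ?U \<xi> = (\<integral>\<^sup>+ \<eta>. (H \<xi> * ennreal (weight \<xi>)) * (F \<eta> * G (\<xi> - \<eta>)) \<partial>m)"
      unfolding convolution_def mult.assoc[symmetric, of "H \<xi>"] by (rule nn_integral_cmult[symmetric]) measurable
     also have "\<dots> \<le> (\<integral>\<^sup>+ \<eta>. R \<xi> \<eta> (\<xi> - \<eta>) \<partial>m)"
     proof (rule nn_integral_mono_AE)
      show "AE \<eta> in m. (H \<xi> * ennreal (weight \<xi>)) * (F \<eta> * G (\<xi> - \<eta>)) \<le> R \<xi> \<eta> (\<xi> - \<eta>)"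
       using AE_dual_group
      proof eventually_elim
       fix \<eta> assume \<eta>: "\<eta> \<in> S"
       let ?\<zeta> = "\<xi> - \<eta>"
       have "weight \<xi> \<le> weight \<eta> * weight ?\<zeta> * (k ?\<zeta> \<eta> + k \<eta> ?\<zeta>)"
        using elim(1)[rule_format, OF \<eta> dual_group_diff[OF elim(2) \<eta>]] by simp
       then have "ennreal (weight \<xi>) \<le> ennreal (weight \<eta> * weight ?\<zeta> * (k ?\<zeta> \<eta> + k \<eta> ?\<zeta>))" by (rule ennreal_leI)
       also have "\<dots> = ennreal (weight \<eta>) * ennreal (weight ?\<zeta>) * (?k ?\<zeta> \<eta> + ?k \<eta> ?\<zeta>)"
        using weight_pos[of \<eta>] weight_pos[of ?\<zeta>] k0 by (simp add: ennreal_mult ennreal_plus less_imp_le)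
       finally have "(H \<xi> * ennreal (weight \<xi>)) * (F \<eta> * G ?\<zeta>)
        \<le> (H \<xi> * (ennreal (weight \<eta>) * ennreal (weight ?\<zeta>) * (?k ?\<zeta> \<eta> + ?k \<eta> ?\<zeta>))) * (F \<eta> * G ?\<zeta>)"
        by (intro mult_right_mono mult_left_mono) auto
       also have "\<dots> = R \<xi> \<eta> ?\<zeta>" by (simp only: R_def distrib_left distrib_right ac_simps)
       finally show "(H \<xi> * ennreal (weight \<xi>)) * (F \<eta> * G (\<xi> - \<eta>)) \<le> R \<xi> \<eta> (\<xi> - \<eta>)" .
      qed
     qed
     finally show ?case .
    qed
   qed
   also have "\<dots> = (\<integral>\<^sup>+ \<eta>. \<integral>\<^sup>+ \<zeta>. R (\<zeta> + \<eta>) \<eta> \<zeta> \<partial>m \<partial>m)"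
    by (rule nn_integral_convolution) (unfold R_def, measurable)
   also have "\<dots> = (\<integral>\<^sup>+ \<eta>. (\<integral>\<^sup>+ \<zeta>. (?g \<zeta> * ?k \<zeta> \<eta>) * (?f \<eta> * H (\<zeta> + \<eta>)) \<partial>m)
     + (\<integral>\<^sup>+ \<zeta>. (?f \<eta> * ?k \<eta> \<zeta>) * (?g \<zeta> * H (\<zeta> + \<eta>)) \<partial>m) \<partial>m)"
    unfolding R_def by (intro nn_integral_cong nn_integral_add) measurable
   also have "\<dots> = (\<integral>\<^sup>+ \<eta>. \<integral>\<^sup>+ \<zeta>. (?g \<zeta> * ?k \<zeta> \<eta>) * (?f \<eta> * H (\<zeta> + \<eta>)) \<partial>m \<partial>m)
     + (\<integral>\<^sup>+ \<eta>. \<integral>\<^sup>+ \<zeta>. (?f \<eta> * ?k \<eta> \<zeta>) * (?g \<zeta> * H (\<zeta> + \<eta>)) \<partial>m \<partial>m)"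
    by (rule nn_integral_add) measurable
   also have "(\<integral>\<^sup>+ \<eta>. \<integral>\<^sup>+ \<zeta>. (?g \<zeta> * ?k \<zeta> \<eta>) * (?f \<eta> * H (\<zeta> + \<eta>)) \<partial>m \<partial>m) = ?J ?f ?g"
    by (rule P.Fubini') measurable
   also have "(\<integral>\<^sup>+ \<eta>. \<integral>\<^sup>+ \<zeta>. (?f \<eta> * ?k \<eta> \<zeta>) * (?g \<zeta> * H (\<zeta> + \<eta>)) \<partial>m \<partial>m) = ?J ?g ?f"
    by (simp only: add.commute)
   finally have le: "(\<integral>\<^sup>+ \<xi>. H \<xi> * ?U \<xi> \<partial>m) \<le> ?J ?f ?g + ?J ?g ?f" .
   let ?B = "C * ?N * (\<integral>\<^sup>+ \<xi>. (H \<xi>)\<^sup>2 \<partial>m)"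
   have J1: "(?J ?f ?g)\<^sup>2 \<le> ?B" by (rule kernel_trilinear[OF _ kC']) measurable
   have J2: "(?J ?g ?f)\<^sup>2 \<le> ?B"
    unfolding mult.commute[of "\<integral>\<^sup>+ \<xi>. (?f \<xi>)\<^sup>2 \<partial>m"] by (rule kernel_trilinear[OF _ kC']) measurable
   have "(\<integral>\<^sup>+ \<xi>. H \<xi> * ?U \<xi> \<partial>m) \<le> 2 * max (?J ?f ?g) (?J ?g ?f)"
    using le by (rule order_trans) (auto simp: mult_2 intro!: add_mono)
   then have "(\<integral>\<^sup>+ \<xi>. H \<xi> * ?U \<xi> \<partial>m)\<^sup>2 \<le> (2 * max (?J ?f ?g) (?J ?g ?f))\<^sup>2" by (rule power_mono) simp
   also have "\<dots> = 4 * (max (?J ?f ?g) (?J ?g ?f))\<^sup>2" by (simp add: power_mult_distrib)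
   also have "\<dots> \<le> 4 * ?B" using J1 J2 by (intro mult_left_mono) (auto simp: max_def)
   finally show ?thesis by (simp only: mult.assoc)
  qed
  \<comment> \<open>a function of finite norm, which may be cancelled in an inequality between its norms\<close>
  define H where "H n \<xi> = min (?U \<xi>) (of_nat n) * indicator (cball 0 (real n)) \<xi>" for n :: nat and \<xi>
  have [measurable]: "cball (0 :: real ^ 'n) (real n) \<in> sets borel" for n by simp
  have [measurable]: "H n \<in> borel_measurable borel" for n unfolding H_def by measurable
  have trunc: "(\<integral>\<^sup>+ \<xi>. (H n \<xi>)\<^sup>2 \<partial>m) \<le> (4 * C) * ?N" for n
  proof (rule le_of_square_le)
   have "(\<integral>\<^sup>+ \<xi>. (H n \<xi>)\<^sup>2 \<partial>m) \<le> (\<integral>\<^sup>+ \<xi>. H n \<xi> * ?U \<xi> \<partial>m)"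
    unfolding power2_eq_square by (intro nn_integral_mono mult_left_mono) (auto simp: H_def indicator_def)
   then have "(\<integral>\<^sup>+ \<xi>. (H n \<xi>)\<^sup>2 \<partial>m)\<^sup>2 \<le> (\<integral>\<^sup>+ \<xi>. H n \<xi> * ?U \<xi> \<partial>m)\<^sup>2" by (rule power_mono) simp
   also have "\<dots> \<le> (4 * C) * ?N * (\<integral>\<^sup>+ \<xi>. (H n \<xi>)\<^sup>2 \<partial>m)" by (rule dual_bound) measurable
   finally show "(\<integral>\<^sup>+ \<xi>. (H n \<xi>)\<^sup>2 \<partial>m)\<^sup>2 \<le> (4 * C) * ?N * (\<integral>\<^sup>+ \<xi>. (H n \<xi>)\<^sup>2 \<partial>m)" .
   have "(\<integral>\<^sup>+ \<xi>. (H n \<xi>)\<^sup>2 \<partial>m) \<le> (\<integral>\<^sup>+ \<xi>. (of_nat n)\<^sup>2 * indicator (cball 0 (real n)) \<xi> \<partial>m)"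
    by (intro nn_integral_mono) (auto simp: H_def indicator_def intro!: power_mono)
   also have "\<dots> = (of_nat n)\<^sup>2 * emeasure m (cball 0 (real n))"
    by (rule nn_integral_cmult_indicator) simp
   also have "\<dots> < \<infinity>" using emeasure_dual_bounded[of "cball 0 (real n)"]
    by (simp add: ennreal_mult_less_top power2_eq_square of_nat_less_top)
   finally show "(\<integral>\<^sup>+ \<xi>. (H n \<xi>)\<^sup>2 \<partial>m) < \<infinity>" .
  qed
  have lim: "(\<lambda>n. (H n \<xi>)\<^sup>2) \<longlonglongrightarrow> (?U \<xi>)\<^sup>2" for \<xi>
  proof -
   have "(\<lambda>n. min (?U \<xi>) (of_nat n)) \<longlonglongrightarrow> min (?U \<xi>) top"
    by (intro tendsto_min tendsto_const of_nat_tendsto_top_ennreal)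
   moreover have "eventually (\<lambda>n. min (?U \<xi>) (of_nat n) = H n \<xi>) sequentially"
    using eventually_ge_at_top[of "nat \<lceil>norm \<xi>\<rceil>"]
    by eventually_elim (auto simp: H_def indicator_def nat_ceiling_le_eq)
   ultimately have "(\<lambda>n. H n \<xi>) \<longlonglongrightarrow> ?U \<xi>" by (auto simp: tendsto_cong)
   then show ?thesis unfolding power2_eq_square by (intro tendsto_mult_ennreal) auto
  qed
  have "(\<integral>\<^sup>+ \<xi>. (?U \<xi>)\<^sup>2 \<partial>m) = (\<integral>\<^sup>+ \<xi>. liminf (\<lambda>n. (H n \<xi>)\<^sup>2) \<partial>m)"
  proof -
   have "liminf (\<lambda>n. (H n \<xi>)\<^sup>2) = (?U \<xi>)\<^sup>2" for \<xi> by (rule lim_imp_Liminf[OF _ lim]) simp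
   then show ?thesis by (simp only:)
  qed
  also have "\<dots> \<le> liminf (\<lambda>n. \<integral>\<^sup>+ \<xi>. (H n \<xi>)\<^sup>2 \<partial>m)" by (rule nn_integral_liminf) measurable
  also have "\<dots> \<le> limsup (\<lambda>n. \<integral>\<^sup>+ \<xi>. (H n \<xi>)\<^sup>2 \<partial>m)" by (rule Liminf_le_Limsup) simp
  also have "\<dots> \<le> (4 * C) * ?N" by (rule Limsup_bounded) (simp add: trunc)
  finally show ?thesis .
 qed
 moreover have "4 * C < \<infinity>" using C by (simp add: ennreal_mult_less_top)
 ultimately show ?thesis by blast
qed

end

section \<open>Functions as distributions\<close>

lemma cnj_borel [measurable]: "cnj \<in> borel_measurable borel"
 by (intro borel_measurable_continuous_onI continuous_on_cnj continuous_on_id)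

context product_group
begin

definition function_dist :: "(real ^ 'n => complex) => 'n distribution" where
 "function_dist u = (\<lambda>\<phi>\<in>schwartz \<Gamma>. LINT x:FD|lborel. u x * \<phi> x)"

lemma
 assumes [measurable]: "u \<in> borel_measurable borel" and B: "\<And>x. norm (u x) \<le> B" and \<phi>: "\<phi> \<in> schwartz \<Gamma>"
 shows integrable_bounded_function: "set_integrable lborel FD (\<lambda>x. u x * \<phi> x)"
  and bounded_function_seminorm: "norm (LINT x:FD|lborel. u x * \<phi> x)
   \<le> (B * (LBINT x. group_weight \<Gamma> x)) * schwartz_seminorm \<Gamma> (2 * CARD('n)) \<phi>"
proof -
 note schwartz_measurable[OF \<phi>, measurable]
 let ?s = "schwartz_seminorm \<Gamma> (2 * CARD('n)) \<phi>"
 have decay: "(1 + norm (line_part \<Gamma> x)) ^ (2 * CARD('n)) * norm (u x * \<phi> x) \<le> B * ?s" for x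
 proof -
  have "(1 + norm (line_part \<Gamma> x)) ^ (2 * CARD('n)) * norm (\<phi> x) \<le> ?s"
   using schwartz_seminorm_upper[OF \<phi>, of "[]" "2 * CARD('n)" x] by (simp add: partial_derivs_def)
  from mult_mono[OF B[of x] this order_trans[OF norm_ge_zero B[of x]]]
  show ?thesis by (simp add: norm_mult ac_simps)
 qed
 show "set_integrable lborel FD (\<lambda>x. u x * \<phi> x)"
  unfolding set_integrable_def by (rule integrable_decay[OF _ decay]) measurable
 have "norm (LINT x:FD|lborel. u x * \<phi> x) \<le> (LBINT x. norm (indicator FD x *\<^sub>R (u x * \<phi> x)))"
  unfolding set_lebesgue_integral_def by (rule integral_norm_bound)
 also have "\<dots> \<le> (B * ?s) * (LBINT x. group_weight \<Gamma> x)" by (rule integral_decay[OF _ decay]) measurable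
 finally show "norm (LINT x:FD|lborel. u x * \<phi> x) \<le> (B * (LBINT x. group_weight \<Gamma> x)) * ?s"
  by (simp only: ac_simps)
qed

text \<open>A Schwartz function is at most a seminorm times the integrable group weight on the fundamental domain.\<close>

lemma function_dist_tempered:
 assumes u: "u \<in> borel_measurable borel" and B: "\<And>x. norm (u x) \<le> B"
 shows "function_dist u \<in> tempered \<Gamma>"
 unfolding tempered_def
proof (intro CollectI conjI ballI allI)
 show "function_dist u \<in> extensional (schwartz \<Gamma>)" by (simp add: function_dist_def)
 fix \<phi> assume \<phi>: "\<phi> \<in> schwartz \<Gamma>"
 show "function_dist u (\<lambda>x. \<phi> x + \<psi> x) = function_dist u \<phi> + function_dist u \<psi>" if "\<psi> \<in> schwartz \<Gamma>" for \<psi>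
  using \<phi> that schwartz_add[OF \<phi> that] set_integral_add(2)[OF integrable_bounded_function[OF u B \<phi>] integrable_bounded_function[OF u B that]]
  by (simp add: function_dist_def distrib_left)
 show "function_dist u (\<lambda>x. c * \<phi> x) = c * function_dist u \<phi>" for c
  using \<phi> schwartz_cmult[OF \<phi>, of c] by (simp add: function_dist_def mult.left_commute)
next
 show "\<exists>C N. \<forall>\<phi>\<in>schwartz \<Gamma>. norm (function_dist u \<phi>) \<le> C * schwartz_seminorm \<Gamma> N \<phi>"
  using bounded_function_seminorm[OF u B] by (auto simp: function_dist_def)
qed

lemma represents_bounded:
 assumes "u \<in> borel_measurable borel" "\<And>x. norm (u x) \<le> B" "periodic \<Gamma> u"
 shows "represents \<Gamma> (function_dist u) u"
 using assms integrable_bounded_function[OF assms(1,2)] by (simp add: represents_def function_dist_def)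

lemma represents_function_dist: "represents \<Gamma> f u ==> f = function_dist u"
 unfolding represents_def function_dist_def by blast

lemma represents_unique:
 assumes "represents \<Gamma> f u" "represents \<Gamma> f v"
 shows "AE x in lborel. x \<in> FD \<longrightarrow> u x = v x"
proof -
 have [measurable]: "u \<in> borel_measurable borel" "v \<in> borel_measurable borel"
  using assms by (auto simp: represents_def)
 have int: "integrable lborel (\<lambda>x. indicator FD x *\<^sub>R (u x * \<phi> x))" "integrable lborel (\<lambda>x. indicator FD x *\<^sub>R (v x * \<phi> x))"
  and eq: "(LBINT x. indicator FD x *\<^sub>R (u x * \<phi> x)) = (LBINT x. indicator FD x *\<^sub>R (v x * \<phi> x))"
  if "\<phi> \<in> schwartz \<Gamma>" for \<phi>
 proof -
  show "integrable lborel (\<lambda>x. indicator FD x *\<^sub>R (u x * \<phi> x))" "integrable lborel (\<lambda>x. indicator FD x *\<^sub>R (v x * \<phi> x))"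
   using assms that by (auto simp: represents_def set_integrable_def)
  have "function_dist u = function_dist v" using assms[THEN represents_function_dist] by simp
  then have "function_dist u \<phi> = function_dist v \<phi>" by (rule fun_cong)
  then show "(LBINT x. indicator FD x *\<^sub>R (u x * \<phi> x)) = (LBINT x. indicator FD x *\<^sub>R (v x * \<phi> x))"
   using that by (simp add: function_dist_def set_lebesgue_integral_def)
 qed
 have "AE x in lborel. x \<in> FD \<longrightarrow> u x - v x = 0"
 proof (rule group_uniqueness)
  fix \<phi> assume \<phi>: "\<phi> \<in> schwartz \<Gamma>"
  have split: "(\<lambda>x. indicator FD x *\<^sub>R ((u x - v x) * \<phi> x))
   = (\<lambda>x. indicator FD x *\<^sub>R (u x * \<phi> x) - indicator FD x *\<^sub>R (v x * \<phi> x))"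
   by (simp add: left_diff_distrib scaleR_diff_right)
  show "integrable lborel (\<lambda>x. indicator FD x *\<^sub>R ((u x - v x) * \<phi> x))"
   unfolding split by (intro Bochner_Integration.integrable_diff int[OF \<phi>])
  show "(LBINT x. indicator FD x *\<^sub>R ((u x - v x) * \<phi> x)) = 0"
   unfolding split by (subst Bochner_Integration.integral_diff[OF int[OF \<phi>]]) (simp add: eq[OF \<phi>])
 qed measurable
 then show ?thesis by simp
qed

lemma function_dist_cong_AE:
 assumes "AE x in lborel. x \<in> FD \<longrightarrow> u x = v x"
  and [measurable]: "u \<in> borel_measurable borel" "v \<in> borel_measurable borel"
 shows "function_dist u = function_dist v"
 unfolding function_dist_def
proof (rule restrict_ext)
 fix \<phi> assume "\<phi> \<in> schwartz \<Gamma>"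
 note schwartz_measurable[OF this, measurable]
 show "(LINT x:FD|lborel. u x * \<phi> x) = (LINT x:FD|lborel. v x * \<phi> x)"
  unfolding set_lebesgue_integral_def
 proof (rule integral_cong_AE)
  show "AE x in lborel. indicator FD x *\<^sub>R (u x * \<phi> x) = indicator FD x *\<^sub>R (v x * \<phi> x)"
   using assms(1) by eventually_elim (auto simp: indicator_def)
 qed measurable
qed

text \<open>The representing functions are unique almost everywhere, so their product is unique as a distribution.\<close>

lemma is_product_unique:
 assumes u: "represents \<Gamma> f u" and v: "represents \<Gamma> g v" and uv: "represents \<Gamma> h (\<lambda>x. u x * v x)"
 shows "\<exists>!h. is_product \<Gamma> f g h" "dist_mult \<Gamma> f g = h"
proof -
 have "is_product \<Gamma> f g h" using assms by (auto simp: is_product_def)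
 moreover have "h' = h" if "is_product \<Gamma> f g h'" for h'
 proof -
  obtain u' v' where u': "represents \<Gamma> f u'" and v': "represents \<Gamma> g v'" and uv': "represents \<Gamma> h' (\<lambda>x. u' x * v' x)"
   using \<open>is_product \<Gamma> f g h'\<close> by (auto simp: is_product_def)
  have [measurable]: "u \<in> borel_measurable borel" "v \<in> borel_measurable borel" "u' \<in> borel_measurable borel" "v' \<in> borel_measurable borel"
   using u v u' v' by (auto simp: represents_def)
  have "AE x in lborel. x \<in> FD \<longrightarrow> u' x * v' x = u x * v x"
   using represents_unique[OF u' u] represents_unique[OF v' v] by eventually_elim auto
  then have "function_dist (\<lambda>x. u' x * v' x) = function_dist (\<lambda>x. u x * v x)" by (rule function_dist_cong_AE) measurable
  then show ?thesis using uv uv' by (simp add: represents_def function_dist_def)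
 qed
 ultimately show "\<exists>!h. is_product \<Gamma> f g h" by auto
 then show "dist_mult \<Gamma> f g = h" unfolding dist_mult_def using \<open>is_product \<Gamma> f g h\<close> the1_equality[of "is_product \<Gamma> f g" h] by simp
qed

lemma conj_function_dist:
 assumes "u \<in> borel_measurable borel"
 shows "conj_distribution \<Gamma> (function_dist u) = function_dist (\<lambda>x. cnj (u x))"
 unfolding conj_distribution_def function_dist_def[of "\<lambda>x. cnj (u x)"]
proof (rule restrict_ext)
 fix \<phi> assume "\<phi> \<in> schwartz \<Gamma>"
 from schwartz_cnj[OF this]
 have "cnj (function_dist u (\<lambda>x. cnj (\<phi> x))) = cnj (LBINT x. indicator FD x *\<^sub>R (u x * cnj (\<phi> x)))"
  by (simp add: function_dist_def set_lebesgue_integral_def)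
 also have "\<dots> = (LBINT x. cnj (indicator FD x *\<^sub>R (u x * cnj (\<phi> x))))" by (rule Bochner_Integration.integral_cnj[symmetric])
 finally show "cnj (function_dist u (\<lambda>x. cnj (\<phi> x))) = (LINT x:FD|lborel. cnj (u x) * \<phi> x)"
  by (simp add: set_lebesgue_integral_def)
qed

section \<open>The inverse transform of an integrable function\<close>

lemma inverse_fourier_borel:
 assumes [measurable]: "k \<in> borel_measurable borel" shows "inverse_fourier k \<in> borel_measurable borel"
proof -
 interpret sigma_finite_measure m by (rule sigma_finite_dual)
 have "(\<lambda>x. \<integral>\<xi>. k \<xi> * cis (2 * pi * (\<xi> \<bullet> x)) \<partial>m) \<in> borel_measurable borel"
  by (rule borel_measurable_lebesgue_integral) measurable
 then show ?thesis by (simp add: inverse_fourier_def[abs_def] fourier_integral_def)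
qed

lemma inverse_fourier_bound:
 assumes "integrable m k" shows "norm (inverse_fourier k x) \<le> fourier_const \<Gamma> * (\<integral>\<xi>. norm (k \<xi>) \<partial>m)"
 using dual_borel.fourier_integral_bound[OF assms, of "2 * pi" x] fourier_const_pos
 by (simp add: inverse_fourier_def norm_mult mult_left_mono)

lemma inverse_fourier_periodic: "periodic \<Gamma> (inverse_fourier (zero_ext h))"
 using fourier_integral_periodic[of "2 * pi" h] by (simp add: inverse_fourier_def periodic_def)

lemma integrable_imp_L1_loc:
 assumes "integrable m (zero_ext h)" shows "h \<in> dual_L1_loc \<Gamma>"
proof -
 have "set_integrable (dual_measure \<Gamma>) K h" if "compact K" for K
 proof -
  have "zero_ext (\<lambda>\<xi>. indicator K \<xi> *\<^sub>R h \<xi>) = (\<lambda>\<xi>. indicator K \<xi> *\<^sub>R zero_ext h \<xi>)"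
   by (auto simp: zero_ext_def)
  moreover have "integrable m (\<lambda>\<xi>. indicator K \<xi> *\<^sub>R zero_ext h \<xi>)"
   using that by (intro integrable_mult_indicator assms) (auto intro: borel_compact)
  ultimately show ?thesis by (simp add: set_integrable_def integrable_dual_measure)
 qed
 moreover have "h \<in> borel_measurable (dual_measure \<Gamma>)"
  using borel_measurable_integrable[OF assms] by (simp add: borel_measurable_dual_measure)
 ultimately show ?thesis by (simp add: dual_L1_loc_def)
qed

lemma inverse_fourier_represents:
 assumes h: "integrable m (zero_ext h)"
 shows "represents \<Gamma> (function_dist (inverse_fourier (zero_ext h))) (inverse_fourier (zero_ext h))"
  and "function_dist (inverse_fourier (zero_ext h)) \<in> tempered \<Gamma>"
  and "fourier_represents \<Gamma> (function_dist (inverse_fourier (zero_ext h))) h"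
proof -
 have u: "inverse_fourier (zero_ext h) \<in> borel_measurable borel"
  using borel_measurable_integrable[OF h] by (intro inverse_fourier_borel) simp
 note bound = inverse_fourier_bound[OF h]
 show "represents \<Gamma> (function_dist (inverse_fourier (zero_ext h))) (inverse_fourier (zero_ext h))"
  by (rule represents_bounded[OF u bound inverse_fourier_periodic])
 show "function_dist (inverse_fourier (zero_ext h)) \<in> tempered \<Gamma>"
  by (rule function_dist_tempered[OF u bound])
 show "fourier_represents \<Gamma> (function_dist (inverse_fourier (zero_ext h))) h"
  unfolding fourier_represents_def
 proof (intro conjI ballI integrable_imp_L1_loc h)
  fix \<psi> assume \<psi>: "\<psi> \<in> tests"
  have "fourier_transform \<Gamma> (function_dist (inverse_fourier (zero_ext h))) \<psi> = (\<integral>\<xi>. zero_ext h \<xi> * zero_ext \<psi> \<xi> \<partial>m)"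
   using inverse_fourier_pairing[OF h \<psi>] dual_fourier_integral_schwartz[OF \<psi>]
   by (simp add: fourier_transform_def function_dist_def set_lebesgue_integral_def)
  then show "fourier_transform \<Gamma> (function_dist (inverse_fourier (zero_ext h))) \<psi> = (LINT \<xi>|dual_measure \<Gamma>. h \<xi> * \<psi> \<xi>)"
   by (simp add: zero_ext_mult integral_dual_measure)
 qed
qed

lemma fourier_represents_fourier_fun:
 "fourier_represents \<Gamma> f h ==> fourier_represents \<Gamma> f (fourier_fun \<Gamma> f)"
 unfolding fourier_fun_def by (rule someI[of "fourier_represents \<Gamma> f"])

lemma fourier_represents_unique:
 assumes "fourier_represents \<Gamma> f h" "fourier_represents \<Gamma> f h'"
 shows "AE \<xi> in m. zero_ext h \<xi> = zero_ext h' \<xi>"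
proof (rule dual_uniqueness)
 show "h \<in> dual_L1_loc \<Gamma>" "h' \<in> dual_L1_loc \<Gamma>" using assms by (auto simp: fourier_represents_def)
 show "(\<integral>\<xi>. h \<xi> * \<psi> \<xi> \<partial>dual_measure \<Gamma>) = (\<integral>\<xi>. h' \<xi> * \<psi> \<xi> \<partial>dual_measure \<Gamma>)" if "\<psi> \<in> tests" for \<psi>
  using assms that unfolding fourier_represents_def by metis
qed

text \<open>Fourier inversion for distributions: both sides have the transform \<open>h\<close>.\<close>

lemma distribution_of_integrable_transform:
 assumes f: "f \<in> tempered \<Gamma>" and h: "fourier_represents \<Gamma> f h" and int: "integrable m (zero_ext h)"
 shows "f = function_dist (inverse_fourier (zero_ext h))"
proof (rule tempered_determined[OF f inverse_fourier_represents(2)[OF int]])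
 fix \<psi> assume "\<psi> \<in> tests"
 then show "f (dual_fourier_integral \<Gamma> \<psi>) = function_dist (inverse_fourier (zero_ext h)) (dual_fourier_integral \<Gamma> \<psi>)"
  using h inverse_fourier_represents(3)[OF int] by (simp add: fourier_represents_def fourier_transform_def)
qed

end

section \<open>The transform of a product\<close>

context anisotropic
begin

definition complex_convolution :: "(real ^ 'n => complex) => (real ^ 'n => complex) => real ^ 'n => complex" where
 "complex_convolution a b \<xi> = (\<integral>\<eta>. a \<eta> * b (\<xi> - \<eta>) \<partial>m)"

lemma complex_convolution_borel:
 assumes [measurable]: "a \<in> borel_measurable borel" "b \<in> borel_measurable borel"
 shows "complex_convolution a b \<in> borel_measurable borel"
proof -
 interpret sigma_finite_measure m by (rule sigma_finite_dual)
 have "(\<lambda>\<xi>. \<integral>\<eta>. a \<eta> * b (\<xi> - \<eta>) \<partial>m) \<in> borel_measurable borel"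
  by (rule borel_measurable_lebesgue_integral) measurable
 then show ?thesis by (simp add: complex_convolution_def[abs_def])
qed

lemma complex_convolution_bound:
 "ennreal (norm (complex_convolution a b \<xi>)) \<le> convolution (\<lambda>\<eta>. ennreal (norm (a \<eta>))) (\<lambda>\<eta>. ennreal (norm (b \<eta>))) \<xi>"
proof (cases "integrable m (\<lambda>\<eta>. a \<eta> * b (\<xi> - \<eta>))")
 case True
 from integral_norm_bound_ennreal[OF this] show ?thesis
  by (simp add: complex_convolution_def convolution_def norm_mult ennreal_mult)
qed (simp add: complex_convolution_def not_integrable_integral_eq)

lemma nn_integral_convolution_product:
 assumes [measurable]: "F \<in> borel_measurable borel" "G \<in> borel_measurable borel"
 shows "(\<integral>\<^sup>+ \<xi>. convolution F G \<xi> \<partial>m) = (\<integral>\<^sup>+ \<eta>. F \<eta> \<partial>m) * (\<integral>\<^sup>+ \<zeta>. G \<zeta> \<partial>m)"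
proof -
 have "(\<integral>\<^sup>+ \<xi>. convolution F G \<xi> \<partial>m) = (\<integral>\<^sup>+ \<eta>. \<integral>\<^sup>+ \<zeta>. F \<eta> * G \<zeta> \<partial>m \<partial>m)"
  unfolding convolution_def by (rule nn_integral_convolution[of "\<lambda>\<xi> \<eta> \<zeta>. F \<eta> * G \<zeta>"]) measurable
 also have "\<dots> = (\<integral>\<^sup>+ \<eta>. F \<eta> * (\<integral>\<^sup>+ \<zeta>. G \<zeta> \<partial>m) \<partial>m)"
  by (intro nn_integral_cong nn_integral_cmult) measurable
 also have "\<dots> = (\<integral>\<^sup>+ \<eta>. F \<eta> \<partial>m) * (\<integral>\<^sup>+ \<zeta>. G \<zeta> \<partial>m)" by (rule nn_integral_multc) measurable
 finally show ?thesis .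
qed

lemma
 assumes a: "integrable m a" and b: "integrable m b"
 shows integrable_complex_convolution: "integrable m (complex_convolution a b)"
  and fourier_integral_convolution:
   "fourier_integral m t (complex_convolution a b) x = fourier_integral m t a x * fourier_integral m t b x"
proof -
 interpret P: pair_sigma_finite m m by (rule pair_sigma_finite_dual)
 have [measurable]: "a \<in> borel_measurable borel" "b \<in> borel_measurable borel"
  using borel_measurable_integrable[OF a] borel_measurable_integrable[OF b] by simp_all
 let ?F = "\<lambda>\<eta>. ennreal (norm (a \<eta>))" and ?G = "\<lambda>\<eta>. ennreal (norm (b \<eta>))"
 have fin: "(\<integral>\<^sup>+ \<xi>. convolution ?F ?G \<xi> \<partial>m) < \<infinity>"
  using a b by (subst nn_integral_convolution_product) (auto simp: integrable_iff_bounded ennreal_mult_less_top)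
 show "integrable m (complex_convolution a b)"
 proof (rule integrableI_bounded)
  show "complex_convolution a b \<in> borel_measurable m" using complex_convolution_borel[of a b] by simp
  have "(\<integral>\<^sup>+ \<xi>. ennreal (norm (complex_convolution a b \<xi>)) \<partial>m) \<le> (\<integral>\<^sup>+ \<xi>. convolution ?F ?G \<xi> \<partial>m)"
   by (intro nn_integral_mono complex_convolution_bound)
  then show "(\<integral>\<^sup>+ \<xi>. ennreal (norm (complex_convolution a b \<xi>)) \<partial>m) < \<infinity>" using fin by (rule le_less_trans)
 qed
 let ?f = "\<lambda>\<xi> \<eta>. a \<eta> * b (\<xi> - \<eta>) * cis (t * (\<xi> \<bullet> x))"
 have pair: "integrable (m \<Otimes>\<^sub>M m) (case_prod ?f)"
 proof (rule integrableI_bounded)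
  show "case_prod ?f \<in> borel_measurable (m \<Otimes>\<^sub>M m)" by measurable
  have "(\<integral>\<^sup>+ p. ennreal (norm (case_prod ?f p)) \<partial>(m \<Otimes>\<^sub>M m)) = (\<integral>\<^sup>+ \<xi>. \<integral>\<^sup>+ \<eta>. ennreal (norm (?f \<xi> \<eta>)) \<partial>m \<partial>m)"
   using P.M1.nn_integral_fst[of "\<lambda>p. ennreal (norm (case_prod ?f p))" m] by simp
  also have "\<dots> = (\<integral>\<^sup>+ \<xi>. convolution ?F ?G \<xi> \<partial>m)"
   by (simp add: convolution_def norm_mult ennreal_mult)
  finally show "(\<integral>\<^sup>+ p. ennreal (norm (case_prod ?f p)) \<partial>(m \<Otimes>\<^sub>M m)) < \<infinity>" using fin by simp
 qed
 have "fourier_integral m t (complex_convolution a b) x = (\<integral>\<xi>. \<integral>\<eta>. ?f \<xi> \<eta> \<partial>m \<partial>m)"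
  by (simp add: fourier_integral_def complex_convolution_def)
 also have "\<dots> = (\<integral>\<eta>. \<integral>\<xi>. ?f \<xi> \<eta> \<partial>m \<partial>m)" by (rule P.Fubini_integral[OF pair, symmetric])
 also have "\<dots> = (\<integral>\<eta>. a \<eta> * cis (t * (\<eta> \<bullet> x)) * fourier_integral m t b x \<partial>m)"
 proof (rule integral_cong_AE)
  have "case_prod ?f \<in> borel_measurable (m \<Otimes>\<^sub>M m)" by measurable
  show "(\<lambda>\<eta>. \<integral>\<xi>. ?f \<xi> \<eta> \<partial>m) \<in> borel_measurable m"
   by (rule P.M1.borel_measurable_lebesgue_integral) measurable
  show "AE \<eta> in m. (\<integral>\<xi>. ?f \<xi> \<eta> \<partial>m) = a \<eta> * cis (t * (\<eta> \<bullet> x)) * fourier_integral m t b x"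
   using AE_dual_group
  proof eventually_elim
   case (elim \<eta>)
   have "(\<integral>\<xi>. ?f \<xi> \<eta> \<partial>m) = (\<integral>\<zeta>. ?f (\<zeta> + \<eta>) \<eta> \<partial>m)"
    by (rule integral_dual_translate[OF elim, symmetric]) measurable
   also have "\<dots> = (\<integral>\<zeta>. (a \<eta> * cis (t * (\<eta> \<bullet> x))) * (b \<zeta> * cis (t * (\<zeta> \<bullet> x))) \<partial>m)"
    by (intro Bochner_Integration.integral_cong) (auto simp: inner_add_left distrib_left cis_mult[symmetric] ac_simps)
   finally show ?case by (simp add: fourier_integral_def)
  qed
 qed measurable
 also have "\<dots> = fourier_integral m t a x * fourier_integral m t b x" by (simp add: fourier_integral_def)
 finally show "fourier_integral m t (complex_convolution a b) x = fourier_integral m t a x * fourier_integral m t b x" .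
qed

text \<open>The dual group is closed under addition, so the convolution of functions carried by it is carried by it.\<close>

lemma zero_ext_convolution:
 "zero_ext (complex_convolution (zero_ext a) (zero_ext b)) = complex_convolution (zero_ext a) (zero_ext b)"
proof
 fix \<xi>
 show "zero_ext (complex_convolution (zero_ext a) (zero_ext b)) \<xi> = complex_convolution (zero_ext a) (zero_ext b) \<xi>"
 proof (cases "\<xi> \<in> S")
  case False
  have "zero_ext a \<eta> * zero_ext b (\<xi> - \<eta>) = 0" for \<eta>
   using False dual_group_add[of \<eta> "\<xi> - \<eta>"] by (auto simp: zero_ext_def indicator_def)
  then have "complex_convolution (zero_ext a) (zero_ext b) \<xi> = 0" unfolding complex_convolution_def by (simp only:) simp
  then show ?thesis using False by (simp add: zero_ext_def[of "complex_convolution (zero_ext a) (zero_ext b)"])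
 qed (simp add: zero_ext_def)
qed

section \<open>The anisotropic space is an algebra\<close>

text \<open>The squared norm of a function of frequency, as an element of the extended half-line.\<close>

definition weighted_square :: "(real ^ 'n => complex) => ennreal" where
 "weighted_square h = (\<integral>\<^sup>+ \<xi>. (ennreal (weight \<xi>) * ennreal (norm (h \<xi>)))\<^sup>2 \<partial>m)"

lemma nn_integral_X_density:
 "(\<integral>\<^sup>+ \<xi>. ennreal (X_density \<Gamma> e s f \<xi>) \<partial>dual_measure \<Gamma>) = weighted_square (zero_ext (fourier_fun \<Gamma> f))"
proof -
 have "(\<integral>\<^sup>+ \<xi>. ennreal (X_density \<Gamma> e s f \<xi>) \<partial>dual_measure \<Gamma>) = (\<integral>\<^sup>+ \<xi>. ennreal (X_density \<Gamma> e s f \<xi>) * indicator S \<xi> \<partial>m)"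
  unfolding dual_measure_eq by (rule nn_integral_restrict_space) (simp add: dual_group_borel)
 also have "\<dots> = weighted_square (zero_ext (fourier_fun \<Gamma> f))"
  unfolding weighted_square_def
 proof (rule nn_integral_cong)
  fix \<xi>
  have "X_density \<Gamma> e s f \<xi> = (weight \<xi> * norm (fourier_fun \<Gamma> f \<xi>))\<^sup>2"
   using mu_pos[of e \<xi>] by (simp add: X_density_def weight_def norm_mult abs_mult)
  moreover have "ennreal ((weight \<xi> * y)\<^sup>2) = (ennreal (weight \<xi>) * ennreal y)\<^sup>2" if "y \<ge> 0" for y
   using weight_pos[of \<xi>] that by (simp add: ennreal_mult[symmetric] ennreal_power)
  ultimately show "ennreal (X_density \<Gamma> e s f \<xi>) * indicator S \<xi> = (ennreal (weight \<xi>) * ennreal (norm (zero_ext (fourier_fun \<Gamma> f) \<xi>)))\<^sup>2"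
   by (auto simp: zero_ext_def indicator_def)
 qed
 finally show ?thesis .
qed

lemma X_density_borel:
 assumes "fourier_represents \<Gamma> f h" shows "X_density \<Gamma> e s f \<in> borel_measurable (dual_measure \<Gamma>)"
proof -
 have [measurable]: "fourier_fun \<Gamma> f \<in> borel_measurable (dual_measure \<Gamma>)"
  using fourier_represents_fourier_fun[OF assms] by (simp add: fourier_represents_def dual_L1_loc_def)
 have [measurable]: "weight \<in> borel_measurable (dual_measure \<Gamma>)"
  unfolding dual_measure_eq by (rule measurable_restrict_space1) measurable
 have "(\<lambda>\<xi>. (weight \<xi> * norm (fourier_fun \<Gamma> f \<xi>))\<^sup>2) \<in> borel_measurable (dual_measure \<Gamma>)" by measurable
 moreover have "X_density \<Gamma> e s f = (\<lambda>\<xi>. (weight \<xi> * norm (fourier_fun \<Gamma> f \<xi>))\<^sup>2)"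
  using abs_of_pos[OF mu_pos[of e]] by (simp add: X_density_def[abs_def] weight_def norm_mult abs_mult fun_eq_iff)
 ultimately show ?thesis by simp
qed

lemma X_complex_iff:
 "f \<in> X_complex \<Gamma> e s \<longleftrightarrow> f \<in> tempered \<Gamma> \<and> (\<exists>h. fourier_represents \<Gamma> f h) \<and> weighted_square (zero_ext (fourier_fun \<Gamma> f)) < \<infinity>"
 using X_density_borel[of f] nn_integral_X_density[of f]
 by (auto simp: X_complex_def integrable_iff_bounded X_density_def)

lemma X_norm_square:
 assumes "f \<in> X_complex \<Gamma> e s"
 shows "ennreal ((X_norm \<Gamma> e s f)\<^sup>2) = weighted_square (zero_ext (fourier_fun \<Gamma> f))"
proof -
 have int: "integrable (dual_measure \<Gamma>) (X_density \<Gamma> e s f)" using assms by (simp add: X_complex_def)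
 have nonneg: "0 \<le> X_density \<Gamma> e s f \<xi>" for \<xi> by (simp add: X_density_def)
 then have "(X_norm \<Gamma> e s f)\<^sup>2 = (\<integral>\<xi>. X_density \<Gamma> e s f \<xi> \<partial>dual_measure \<Gamma>)"
  by (simp add: X_norm_def Bochner_Integration.integral_nonneg)
 then show ?thesis using nn_integral_eq_integral[OF int] nonneg by (simp add: nn_integral_X_density)
qed

lemma X_norm_nonneg: "0 \<le> X_norm \<Gamma> e s f"
 by (simp add: X_norm_def X_density_def Bochner_Integration.integral_nonneg)

text \<open>Cauchy--Schwarz with \<open>1 / weight\<close>, which is square-integrable.\<close>

lemma X_integrable_transform:
 assumes "f \<in> X_complex \<Gamma> e s"
 shows "fourier_represents \<Gamma> f (fourier_fun \<Gamma> f)" and "integrable m (zero_ext (fourier_fun \<Gamma> f))"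
proof -
 let ?h = "zero_ext (fourier_fun \<Gamma> f)"
 show rep: "fourier_represents \<Gamma> f (fourier_fun \<Gamma> f)"
  using assms fourier_represents_fourier_fun by (auto simp: X_complex_def)
 then have [measurable]: "?h \<in> borel_measurable borel"
  by (simp add: fourier_represents_def dual_L1_loc_def borel_measurable_dual_measure)
 show "integrable m ?h"
 proof (rule integrableI_bounded)
  have "(\<integral>\<^sup>+ \<xi>. ennreal (norm (?h \<xi>)) \<partial>m)\<^sup>2 \<le> (\<integral>\<^sup>+ \<xi>. ennreal (inverse ((weight \<xi>)\<^sup>2)) \<partial>m) * weighted_square ?h"
   unfolding weighted_square_def by (rule nn_integral_by_weight) measurable
  also have "\<dots> < \<infinity>" using assms nn_integral_weight by (simp add: X_complex_iff ennreal_mult_less_top)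
  finally show "(\<integral>\<^sup>+ \<xi>. ennreal (norm (?h \<xi>)) \<partial>m) < \<infinity>" by (simp add: power_less_top_ennreal)
 qed simp
qed

lemma weighted_square_cong_AE:
 assumes "AE \<xi> in m. h \<xi> = h' \<xi>" shows "weighted_square h = weighted_square h'"
 unfolding weighted_square_def using assms by (intro nn_integral_cong_AE) (auto elim: eventually_mono)

lemma weighted_square_cmult:
 assumes [measurable]: "h \<in> borel_measurable borel"
 shows "weighted_square (\<lambda>\<xi>. c * h \<xi>) = ennreal ((norm c)\<^sup>2) * weighted_square h"
proof -
 have "weighted_square (\<lambda>\<xi>. c * h \<xi>) = (\<integral>\<^sup>+ \<xi>. ennreal ((norm c)\<^sup>2) * (ennreal (weight \<xi>) * ennreal (norm (h \<xi>)))\<^sup>2 \<partial>m)"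
  unfolding weighted_square_def
  by (intro nn_integral_cong) (simp add: norm_mult ennreal_mult power_mult_distrib ennreal_power mult.left_commute)
 then show ?thesis unfolding weighted_square_def by (simp add: nn_integral_cmult)
qed

text \<open>The candidate for the product: each factor is the function with the given integrable transform.\<close>

definition product_dist :: "'n distribution => 'n distribution => 'n distribution" where
 "product_dist f g = function_dist
  (\<lambda>x. inverse_fourier (zero_ext (fourier_fun \<Gamma> f)) x * inverse_fourier (zero_ext (fourier_fun \<Gamma> g)) x)"

definition product_transform :: "'n distribution => 'n distribution => real ^ 'n => complex" where
 "product_transform f g \<xi> =
  fourier_const \<Gamma> * complex_convolution (zero_ext (fourier_fun \<Gamma> f)) (zero_ext (fourier_fun \<Gamma> g)) \<xi>"

lemma
 assumes f: "f \<in> X_complex \<Gamma> e s" and g: "g \<in> X_complex \<Gamma> e s"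
 shows product_represents:
   "represents \<Gamma> f (inverse_fourier (zero_ext (fourier_fun \<Gamma> f)))"
   "represents \<Gamma> g (inverse_fourier (zero_ext (fourier_fun \<Gamma> g)))"
   "represents \<Gamma> (product_dist f g)
    (\<lambda>x. inverse_fourier (zero_ext (fourier_fun \<Gamma> f)) x * inverse_fourier (zero_ext (fourier_fun \<Gamma> g)) x)"
  and product_tempered: "product_dist f g \<in> tempered \<Gamma>"
  and product_fourier: "fourier_represents \<Gamma> (product_dist f g) (product_transform f g)"
  and product_zero_ext: "zero_ext (product_transform f g) = product_transform f g"
proof -
 let ?a = "zero_ext (fourier_fun \<Gamma> f)" and ?b = "zero_ext (fourier_fun \<Gamma> g)"
 let ?k = "product_transform f g"
 note a = X_integrable_transform[OF f] and b = X_integrable_transform[OF g]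
 have "f = function_dist (inverse_fourier ?a)" "g = function_dist (inverse_fourier ?b)"
  using f g by (auto intro!: distribution_of_integrable_transform a b simp: X_complex_def)
 then show "represents \<Gamma> f (inverse_fourier ?a)" "represents \<Gamma> g (inverse_fourier ?b)"
  using inverse_fourier_represents(1)[OF a(2)] inverse_fourier_represents(1)[OF b(2)] by simp_all
 show zk: "zero_ext ?k = ?k"
 proof
  fix \<xi>
  have "zero_ext ?k \<xi> = fourier_const \<Gamma> * zero_ext (complex_convolution ?a ?b) \<xi>"
   by (simp add: zero_ext_def product_transform_def)
  then show "zero_ext ?k \<xi> = ?k \<xi>" by (simp add: zero_ext_convolution product_transform_def)
 qed
 have "integrable m ?k"
  unfolding product_transform_def[abs_def] by (intro integrable_mult_right integrable_complex_convolution a b)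
 then have k: "integrable m (zero_ext ?k)" by (simp only: zk)
 have "inverse_fourier ?k x = inverse_fourier ?a x * inverse_fourier ?b x" for x
 proof -
  have "fourier_integral m (2 * pi) ?k x = fourier_const \<Gamma> * fourier_integral m (2 * pi) (complex_convolution ?a ?b) x"
   by (simp add: fourier_integral_def product_transform_def mult.assoc)
  then show ?thesis by (simp add: inverse_fourier_def fourier_integral_convolution[OF a(2) b(2)])
 qed
 then have eq: "(\<lambda>x. inverse_fourier ?a x * inverse_fourier ?b x) = inverse_fourier (zero_ext ?k)"
  by (simp add: zk fun_eq_iff)
 note rep = inverse_fourier_represents[OF k]
 show "represents \<Gamma> (product_dist f g) (\<lambda>x. inverse_fourier ?a x * inverse_fourier ?b x)"
  "product_dist f g \<in> tempered \<Gamma>" "fourier_represents \<Gamma> (product_dist f g) ?k"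
  unfolding product_dist_def eq by (fact rep)+
qed

text \<open>The transform of the product is a multiple of the convolution of the transforms, so the norm is
 bounded by the bilinear estimate for the absolute values.\<close>

theorem X_complex_product:
 "\<exists>C>0. \<forall>f\<in>X_complex \<Gamma> e s. \<forall>g\<in>X_complex \<Gamma> e s. product_dist f g \<in> X_complex \<Gamma> e s \<and>
  X_norm \<Gamma> e s (product_dist f g) \<le> C * X_norm \<Gamma> e s f * X_norm \<Gamma> e s g"
proof -
 obtain C where C: "C < \<infinity>" and conv: "\<And>F G. F \<in> borel_measurable borel ==> G \<in> borel_measurable borel ==>
   (\<integral>\<^sup>+ \<xi>. (ennreal (weight \<xi>) * convolution F G \<xi>)\<^sup>2 \<partial>m)
   \<le> C * ((\<integral>\<^sup>+ \<xi>. (ennreal (weight \<xi>) * F \<xi>)\<^sup>2 \<partial>m) * (\<integral>\<^sup>+ \<xi>. (ennreal (weight \<xi>) * G \<xi>)\<^sup>2 \<partial>m))"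
  using weighted_convolution by blast
 define D where "D = fourier_const \<Gamma> * sqrt (enn2real C) + 1"
 have D: "D > 0" using fourier_const_pos by (simp add: D_def add_nonneg_pos)
 have CD: "ennreal ((fourier_const \<Gamma>)\<^sup>2) * C \<le> ennreal (D\<^sup>2)"
 proof -
  have "(fourier_const \<Gamma>)\<^sup>2 * enn2real C = (fourier_const \<Gamma> * sqrt (enn2real C))\<^sup>2" by (simp add: power_mult_distrib)
  also have "\<dots> \<le> D\<^sup>2" unfolding D_def using fourier_const_pos by (intro power_mono) auto
  finally have "ennreal ((fourier_const \<Gamma>)\<^sup>2 * enn2real C) \<le> ennreal (D\<^sup>2)" by (rule ennreal_leI)
  then show ?thesis using C by (simp add: ennreal_mult)
 qed
 have "product_dist f g \<in> X_complex \<Gamma> e s \<and> X_norm \<Gamma> e s (product_dist f g) \<le> D * X_norm \<Gamma> e s f * X_norm \<Gamma> e s g"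
  if f: "f \<in> X_complex \<Gamma> e s" and g: "g \<in> X_complex \<Gamma> e s" for f g
 proof -
  let ?a = "zero_ext (fourier_fun \<Gamma> f)" and ?b = "zero_ext (fourier_fun \<Gamma> g)"
  let ?p = "product_dist f g"
  have [measurable]: "?a \<in> borel_measurable borel" "?b \<in> borel_measurable borel"
   using borel_measurable_integrable[OF X_integrable_transform(2)] f g by auto
  have rep: "fourier_represents \<Gamma> ?p (fourier_fun \<Gamma> ?p)"
   by (rule fourier_represents_fourier_fun[OF product_fourier[OF f g]])
  have "weighted_square (zero_ext (fourier_fun \<Gamma> ?p)) = weighted_square (product_transform f g)"
   using fourier_represents_unique[OF rep product_fourier[OF f g]]
   by (intro weighted_square_cong_AE) (simp add: product_zero_ext[OF f g])
  also have "\<dots> = ennreal ((fourier_const \<Gamma>)\<^sup>2) * weighted_square (complex_convolution ?a ?b)"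
   using fourier_const_pos unfolding product_transform_def[abs_def]
   by (subst weighted_square_cmult) (auto intro: complex_convolution_borel)
  also have "\<dots> \<le> ennreal ((fourier_const \<Gamma>)\<^sup>2) * (C * (weighted_square ?a * weighted_square ?b))"
  proof (rule mult_left_mono)
   have "weighted_square (complex_convolution ?a ?b)
     \<le> (\<integral>\<^sup>+ \<xi>. (ennreal (weight \<xi>) * convolution (\<lambda>\<eta>. ennreal (norm (?a \<eta>))) (\<lambda>\<eta>. ennreal (norm (?b \<eta>))) \<xi>)\<^sup>2 \<partial>m)"
    unfolding weighted_square_def
    by (intro nn_integral_mono power_mono mult_left_mono complex_convolution_bound) auto
   also have "\<dots> \<le> C * (weighted_square ?a * weighted_square ?b)"
    unfolding weighted_square_def by (rule conv) measurable
   finally show "weighted_square (complex_convolution ?a ?b) \<le> C * (weighted_square ?a * weighted_square ?b)" .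
  qed simp
  also have "\<dots> \<le> ennreal (D\<^sup>2) * (weighted_square ?a * weighted_square ?b)"
   unfolding mult.assoc[symmetric, of _ C] by (rule mult_right_mono[OF CD]) simp
  finally have le: "weighted_square (zero_ext (fourier_fun \<Gamma> ?p)) \<le> ennreal (D\<^sup>2) * (weighted_square ?a * weighted_square ?b)" .
  also have "\<dots> = ennreal (D\<^sup>2 * ((X_norm \<Gamma> e s f)\<^sup>2 * (X_norm \<Gamma> e s g)\<^sup>2))"
   using X_norm_square[OF f] X_norm_square[OF g] by (simp add: ennreal_mult)
  finally have le: "weighted_square (zero_ext (fourier_fun \<Gamma> ?p)) \<le> ennreal (D\<^sup>2 * ((X_norm \<Gamma> e s f)\<^sup>2 * (X_norm \<Gamma> e s g)\<^sup>2))" .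
  then have "weighted_square (zero_ext (fourier_fun \<Gamma> ?p)) < \<infinity>" by (rule le_less_trans) simp
  then have p: "?p \<in> X_complex \<Gamma> e s" using product_tempered[OF f g] rep by (auto simp: X_complex_iff)
  have "(X_norm \<Gamma> e s ?p)\<^sup>2 \<le> D\<^sup>2 * ((X_norm \<Gamma> e s f)\<^sup>2 * (X_norm \<Gamma> e s g)\<^sup>2)"
   using le unfolding X_norm_square[OF p, symmetric] by (subst (asm) ennreal_le_iff) auto
  then have "(X_norm \<Gamma> e s ?p)\<^sup>2 \<le> (D * X_norm \<Gamma> e s f * X_norm \<Gamma> e s g)\<^sup>2" by (simp only: power_mult_distrib mult.assoc)
  then have "X_norm \<Gamma> e s ?p \<le> D * X_norm \<Gamma> e s f * X_norm \<Gamma> e s g"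
   by (rule power2_le_imp_le) (use D X_norm_nonneg in simp)
  with p show ?thesis by blast
 qed
 with D show ?thesis by blast
qed

text \<open>The functions representing distributions that are equal to their conjugates are real almost everywhere.\<close>

lemma product_real:
 assumes f: "f \<in> X_real \<Gamma> e s" and g: "g \<in> X_real \<Gamma> e s"
 shows "product_dist f g = conj_distribution \<Gamma> (product_dist f g)"
proof -
 let ?u = "inverse_fourier (zero_ext (fourier_fun \<Gamma> f))" and ?v = "inverse_fourier (zero_ext (fourier_fun \<Gamma> g))"
 have X: "f \<in> X_complex \<Gamma> e s" "g \<in> X_complex \<Gamma> e s" using f g by (auto simp: X_real_def)
 note rep = product_represents[OF X]
 have real: "AE x in lborel. x \<in> FD \<longrightarrow> cnj (w x) = w x"
  if d: "represents \<Gamma> d w" and c: "d = conj_distribution \<Gamma> d" for d w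
 proof (rule represents_unique[OF _ d])
  have w: "w \<in> borel_measurable borel" and per: "periodic \<Gamma> w" and d': "d = function_dist w"
   and int: "\<And>\<phi>. \<phi> \<in> schwartz \<Gamma> ==> set_integrable lborel FD (\<lambda>x. w x * \<phi> x)"
   using d by (auto simp: represents_def function_dist_def)
  have "set_integrable lborel FD (\<lambda>x. cnj (w x) * \<phi> x)" if "\<phi> \<in> schwartz \<Gamma>" for \<phi>
   using integrable_cnj[OF int[OF schwartz_cnj[OF that], unfolded set_integrable_def]]
   by (simp add: set_integrable_def)
  moreover have "d = function_dist (\<lambda>x. cnj (w x))" using c conj_function_dist[OF w] by (simp only: d')
  moreover have "(\<lambda>x. cnj (w x)) \<in> borel_measurable borel" by (rule measurable_compose[OF w cnj_borel])
  ultimately show "represents \<Gamma> d (\<lambda>x. cnj (w x))"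
   using w per by (simp add: represents_def function_dist_def periodic_def)
 qed
 have [measurable]: "?u \<in> borel_measurable borel" "?v \<in> borel_measurable borel"
  using rep by (auto simp: represents_def)
 have "AE x in lborel. x \<in> FD \<longrightarrow> cnj (?u x * ?v x) = ?u x * ?v x"
  using real[OF rep(1)] real[OF rep(2)] f g by (auto simp: X_real_def elim: eventually_elim2)
 then have "function_dist (\<lambda>x. cnj (?u x * ?v x)) = product_dist f g"
  unfolding product_dist_def by (rule function_dist_cong_AE) measurable
 then show ?thesis unfolding product_dist_def by (subst conj_function_dist) auto
qed

end

theorem theorem1p1:
  fixes \<Sigma> :: "'n::finite \<Rightarrow> factor" and e :: 'n and F :: scalars and s :: real
  assumes "\<And>i l. \<Sigma> i = Circle l \<Longrightarrow> l > 0"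
    and "\<Sigma> e = Line \<or> (\<forall>i. \<Sigma> i \<noteq> Line)"
    and "s > real CARD('n) / 2"
  shows "\<exists>C>0. \<forall>f\<in>X_space F \<Sigma> e s. \<forall>g\<in>X_space F \<Sigma> e s.
           (\<exists>!h. is_product \<Sigma> f g h) \<and>
           dist_mult \<Sigma> f g \<in> X_space F \<Sigma> e s \<and>
           X_norm \<Sigma> e s (dist_mult \<Sigma> f g) \<le> C * X_norm \<Sigma> e s f * X_norm \<Sigma> e s g"
proof -
 interpret anisotropic \<Sigma> e s by unfold_locales (use assms in auto)
 obtain C where "C > 0" and C: "\<And>f g. f \<in> X_complex \<Sigma> e s ==> g \<in> X_complex \<Sigma> e s ==>
   product_dist f g \<in> X_complex \<Sigma> e s \<and> X_norm \<Sigma> e s (product_dist f g) \<le> C * X_norm \<Sigma> e s f * X_norm \<Sigma> e s g"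
  using X_complex_product by blast
 have "(\<exists>!h. is_product \<Sigma> f g h) \<and> dist_mult \<Sigma> f g \<in> X_space F \<Sigma> e s \<and>
   X_norm \<Sigma> e s (dist_mult \<Sigma> f g) \<le> C * X_norm \<Sigma> e s f * X_norm \<Sigma> e s g"
  if f: "f \<in> X_space F \<Sigma> e s" and g: "g \<in> X_space F \<Sigma> e s" for f g
 proof -
  have X: "f \<in> X_complex \<Sigma> e s" "g \<in> X_complex \<Sigma> e s" using f g by (cases F; simp add: X_real_def)+
  note product = is_product_unique[OF product_represents[OF X]]
  have "product_dist f g \<in> X_space F \<Sigma> e s"
   using C[OF X] f g product_real[of f g] by (cases F) (auto simp: X_real_def)
  then show ?thesis using product C[OF X] by simp
 qed
 with \<open>C > 0\<close> show ?thesis by blast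
qed

end
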